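(* Let $1<p<\infty$ and let $g$ be an analytic function in the unit disc $\mathbb{D}$. Then: (i) If the generalized Hilbert operator $\mathcal{H}_g:H^p\to H^p$ is compact, then $g\in\lambda\left(p,\frac1p\right)$. (ii) If $1<p\le2$ and $g\in\lambda\left(p,\frac1p\right)$, then $\mathcal{H}_g:H^p\to H^p$ is compact. (iii) If $2<p<\infty$ and $g\in\lambda\left(q,\frac1q\right)$ for some $1<q<p$, then $\mathcal{H}_g:H^p\to H^p$ is compact.
   Context: For analytic $f$ in $\mathbb{D}$, $M_p(r,f)=\left(\frac1{2\pi}\int_0^{2\pi}|f(re^{it})|^p\,dt\right)^{1/p}$; $H^p$ is the Hardy space of analytic $f$ with $\|f\|_{H^p}=\sup_{0<r<1}M_p(r,f)<\infty$. Given $g$ analytic in $\mathbb{D}$, the generalized Hilbert operator is $\mathcal{H}_g(f)(z)=\int_0^1 f(t)g'(tz)\,dt$, $z\in\mathbb{D}$; it is well defined, with $\mathcal{H}_g(f)$ analytic in $\mathbb{D}$, for every $f\in H^1$. Little-oh mean Lipschitz spaces: for $1\le p<\infty$ and $0<\alpha<1$, $\lambda(p,\alpha)$ is the set of $g\in H^p$ whose boundary function satisfies $\omega_p(g,t)=o(t^\alpha)$ as $t\to0$, where $\omega_p(g,t)=\sup_{0<h\le t}\left(\int_0^{2\pi}|g(e^{i(\theta+h)})-g(e^{i\theta})|^p\frac{d\theta}{2\pi}\right)^{1/p}$; equivalently, $g\in H^p$ and $M_p(r,g')=o((1-r)^{\alpha-1})$ as $r\to1^-$. *)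

theory Defs
  imports "HOL-Complex_Analysis.Complex_Analysis" "HOL-Library.Landau_Symbols"
begin

definition integral_mean :: "real \<Rightarrow> real \<Rightarrow> (complex \<Rightarrow> complex) \<Rightarrow> real" where
  "integral_mean p r f =
     ((LINT t:{0..2*pi}|lebesgue. norm (f (of_real r * cis t)) powr p) / (2*pi)) powr (1/p)"

text \<open>
  Elements of the Hardy space are total functions on the complex numbers of which only the
  values on the open unit disc matter.
\<close>

definition Hardy :: "real \<Rightarrow> (complex \<Rightarrow> complex) set" where
  "Hardy p = {f. f holomorphic_on ball 0 1 \<and>
                 bdd_above ((\<lambda>r. integral_mean p r f) ` {0<..<1})}"

definition Hardy_norm :: "real \<Rightarrow> (complex \<Rightarrow> complex) \<Rightarrow> real" where
  "Hardy_norm p f = (SUP r\<in>{0<..<1}. integral_mean p r f)"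

definition gen_Hilbert :: "(complex \<Rightarrow> complex) \<Rightarrow> (complex \<Rightarrow> complex) \<Rightarrow> complex \<Rightarrow> complex" where
  "gen_Hilbert g f z = (LINT t:{0..1}|lebesgue. f (of_real t) * deriv g (of_real t * z))"

text \<open>
  Compactness of an operator from the Hardy space to itself: every norm-bounded sequence is
  mapped to a sequence in the space with a norm-convergent subsequence.
  Linearity is not part of the definition; it is automatic for the operators considered here.
\<close>

definition compact_on_Hardy ::
    "real \<Rightarrow> ((complex \<Rightarrow> complex) \<Rightarrow> complex \<Rightarrow> complex) \<Rightarrow> bool" where
  "compact_on_Hardy p T \<longleftrightarrow>
     (\<forall>f\<in>Hardy p. T f \<in> Hardy p) \<and>
     (\<forall>(f :: nat \<Rightarrow> complex \<Rightarrow> complex) C.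
        (\<forall>n. f n \<in> Hardy p \<and> Hardy_norm p (f n) \<le> C) \<longrightarrow>
        (\<exists>k F. strict_mono (k :: nat \<Rightarrow> nat) \<and> F \<in> Hardy p \<and>
           (\<lambda>n. Hardy_norm p (\<lambda>z. T (f (k n)) z - F z)) \<longlonglongrightarrow> 0))"

text \<open>
  Radial limits. For a function in a Hardy space the limit exists for almost every angle;
  on the remaining null set the value is arbitrary.
\<close>

definition boundary_fun :: "(complex \<Rightarrow> complex) \<Rightarrow> real \<Rightarrow> complex" where
  "boundary_fun g \<theta> = Lim (at_left 1) (\<lambda>r. g (of_real r * cis \<theta>))"

definition mean_modulus :: "real \<Rightarrow> (complex \<Rightarrow> complex) \<Rightarrow> real \<Rightarrow> real" where
  "mean_modulus p g t =
     (SUP h\<in>{0<..t}.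
        ((LINT \<theta>:{0..2*pi}|lebesgue.
            norm (boundary_fun g (\<theta> + h) - boundary_fun g \<theta>) powr p) / (2*pi)) powr (1/p))"

definition little_mean_Lipschitz :: "real \<Rightarrow> real \<Rightarrow> (complex \<Rightarrow> complex) set" where
  "little_mean_Lipschitz p \<alpha> =
     {g \<in> Hardy p. (\<lambda>t. mean_modulus p g t) \<in> o[at_right 0](\<lambda>t. t powr \<alpha>)}"

end

theory Submission
  imports Defs
begin

text \<open>
  Let \<open>F = H\<^sub>g f\<close>, so that \<open>F'(z)\<close> is the integral of \<open>t f(t) g''(t z)\<close> over \<open>[0, 1]\<close>.
  If \<open>g\<close> is in the little-oh space of exponent \<open>q\<close>, then for every \<open>\<epsilon>\<close> the \<open>q\<close>-mean of \<open>g''\<close> on the circle of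
  radius \<open>1 - \<tau>\<close> is at most \<open>\<epsilon> \<tau> powr (1/q - 2) + B\<close>, and Minkowski's inequality bounds the \<open>q\<close>-mean of \<open>F'\<close> there by
  the integral of \<open>(\<epsilon> max \<tau> u powr (1/q - 2) + B) |f(1 - u)|\<close>. The \<open>p\<close>-norm of \<open>F\<close> is recovered from these
  means: for \<open>q = p \<le> 2\<close> by summing dyadic increments, using
  \<open>|a + b|\<^sup>p \<le> |a|\<^sup>p + p |a| powr (p - 2) Re(cnj a b) + C |b|\<^sup>p\<close> under a Poisson kernel that annihilates the linear term;
  for \<open>q < p\<close> by interpolating with the pointwise bound of \<open>F'\<close>. The Schur test and the Fejer--Riesz inequality
  then give \<open>\<parallel>F\<parallel> \<le> K \<epsilon> \<parallel>f\<parallel> + B' \<integral> |f|\<close>, where the last integral over \<open>[0, 1]\<close> tends to 0 along bounded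
  sequences that converge to 0 locally uniformly; with Montel's theorem this is compactness.

  Conversely, \<open>f(z) = (1 - a) powr (2 - 1/p) / (1 - a z)\<^sup>2\<close> is bounded in the Hardy space and tends to 0 locally
  uniformly as \<open>a \<rightarrow> 1\<close>, and integrating the derivative of \<open>t f(t) g'(t z)\<close> expresses \<open>f(1) g'(z)\<close> through the
  images of \<open>f\<close> and of \<open>z f'\<close>, whose norms compactness makes small.
\<close>

section \<open>Means on the circle\<close>

text \<open>The split of cases has an analytic reason: for p > 2 and |b| small against |a|, the
  second-order term |a|^(p-2) |b|^2 of |a + b|^p is not dominated by |b|^p, so means of order p of
  F' alone no longer control the norm of F. With q < p there is a pointwise bound besides the
  q-means, and the gap between 1/p and 1/q is exactly what the Schur test for the q-means consumes.
  The little-oh condition gives smallness only near the boundary. The remainder costs a large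
  constant B, but it is of lower order, so it can be charged to the integral of |f| over the radius
  instead of to the norm; no approximation of g by polynomials or of the operator by finite rank
  enters. The space is defined through boundary functions. Their existence and their approximation
  by dilates must therefore be established before anything about g' or g'' can be said; both rest on
  uniform convexity, and the almost everywhere existence also on a weak-type maximal
  estimate.\<close>

abbreviation polar :: "real \<Rightarrow> real \<Rightarrow> complex" where
  "polar r \<theta> \<equiv> of_real r * cis \<theta>"

text \<open>This is \<open>x \<le> x powr p / p + (1 - 1 / p)\<close> at
  \<open>x = a / (m * w)\<close>, multiplied by \<open>m * w\<close>. The parameter \<open>m\<close>
  is kept free so that it can later be tuned to a ratio of integrals.\<close>

lemma Young_scaled:
  fixes a w m p :: real
  assumes "1 \<le> p" "0 \<le> a" "0 < w" "0 < m"
  shows "a \<le> m powr (1 - p) / p * (a powr p * w powr (1 - p)) + (1 - 1 / p) * m * w"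
proof (cases "a = 0")
  case True
  with assms show ?thesis by simp
next
  case False
  define x where "x = a / (m * w)"
  have x: "x > 0" "a = x * (m * w)" using assms False by (auto simp: x_def)
  have "(x powr p) powr (1/p) * 1 powr (1 - 1/p) \<le> (1/p) * x powr p + (1 - 1/p) * 1"
    using assms x by (intro Youngs_inequality_0) auto
  then have *: "x \<le> x powr p / p + (1 - 1/p)"
    using assms x by (simp add: powr_powr)
  have "m * w * x \<le> m * w * (x powr p / p + (1 - 1/p))"
    using * assms by (intro mult_left_mono) auto
  moreover have "m * w * (x powr p / p) = m powr (1 - p) / p * (a powr p * w powr (1 - p))"
  proof -
    have "a powr p = x powr p * (m powr p * w powr p)"
      using assms x(1) unfolding x(2) by (subst powr_mult; simp add: powr_mult)+
    then show ?thesis using assms by (simp add: powr_diff)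
  qed
  ultimately show ?thesis using x(2) by (metis (no_types, opaque_lifting) distrib_left mult.assoc mult.commute)
qed

text \<open>Integrating the scaled Young inequality with \<open>m = \<Phi> / B\<close> and absorbing
  \<open>(1 - 1 / p) * \<Phi>\<close> on the left gives Hoelder's inequality with weight
  \<open>W\<close>. A number \<open>\<Phi>\<close> below the integral of \<open>A\<close> and a
  number \<open>B\<close> above that of \<open>W\<close> keep all manipulations real. Minkowski's
  inequality, the Schur test and the pointwise bounds all come from this one inequality.\<close>

lemma Jensen_weighted:
  fixes A W :: "'a \<Rightarrow> real" and p B \<Phi> :: real
  assumes p: "1 \<le> p"
    and [measurable]: "A \<in> borel_measurable M" "W \<in> borel_measurable M"
    and A0: "\<And>s. 0 \<le> A s" and W0: "\<And>s. 0 \<le> W s" and AW: "\<And>s. W s = 0 \<Longrightarrow> A s = 0"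
    and B: "0 \<le> B" "(\<integral>\<^sup>+s. W s \<partial>M) \<le> ennreal B"
    and \<Phi>: "0 \<le> \<Phi>" "ennreal \<Phi> \<le> (\<integral>\<^sup>+s. A s \<partial>M)"
  shows "ennreal (\<Phi> powr p) \<le> ennreal (B powr (p - 1)) * (\<integral>\<^sup>+s. ennreal (A s powr p * W s powr (1 - p)) \<partial>M)"
proof (cases "\<Phi> = 0")
  case True
  then show ?thesis using p by simp
next
  case False
  then have \<Phi>0: "\<Phi> > 0" using \<Phi> by simp
  have B0: "B > 0"
  proof (rule ccontr)
    assume "\<not> B > 0"
    then have "(\<integral>\<^sup>+s. W s \<partial>M) = 0" using B by simp
    then have "AE s in M. W s = 0"
      by (subst (asm) nn_integral_0_iff_AE) (use W0 in \<open>auto simp: antisym_conv\<close>)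
    then have "AE s in M. ennreal (A s) = 0" by eventually_elim (simp add: AW)
    then have "(\<integral>\<^sup>+s. A s \<partial>M) = 0" by (subst nn_integral_0_iff_AE) auto
    then show False using \<Phi> \<Phi>0 by simp
  qed
  define m where "m = \<Phi> / B"
  have m0: "m > 0" using \<Phi>0 B0 by (simp add: m_def)
  define J where "J = (\<integral>\<^sup>+s. ennreal (A s powr p * W s powr (1 - p)) \<partial>M)"
  have "ennreal \<Phi> \<le> (\<integral>\<^sup>+s. ennreal (m powr (1 - p) / p) * ennreal (A s powr p * W s powr (1 - p))
        + ennreal ((1 - 1 / p) * m) * ennreal (W s) \<partial>M)"
  proof (rule order_trans[OF \<Phi>(2)], rule nn_integral_mono)
    fix s
    have "A s \<le> m powr (1 - p) / p * (A s powr p * W s powr (1 - p)) + (1 - 1 / p) * m * W s"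
    proof (cases "W s = 0")
      case True
      then show ?thesis using AW[of s] p by simp
    next
      case False
      then show ?thesis using Young_scaled[OF p A0[of s] _ m0, of "W s"] W0[of s] by simp
    qed
    then show "ennreal (A s) \<le> ennreal (m powr (1 - p) / p) * ennreal (A s powr p * W s powr (1 - p))
        + ennreal ((1 - 1 / p) * m) * ennreal (W s)"
      using p m0 W0[of s] by (simp flip: ennreal_mult ennreal_plus add: ennreal_leI)
  qed
  also have "\<dots> = ennreal (m powr (1 - p) / p) * J + ennreal ((1 - 1 / p) * m) * (\<integral>\<^sup>+s. W s \<partial>M)"
    unfolding J_def by (subst nn_integral_add) (auto simp: nn_integral_cmult)
  also have "\<dots> \<le> ennreal (m powr (1 - p) / p) * J + ennreal ((1 - 1 / p) * m) * ennreal B"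
    using B by (intro add_left_mono mult_left_mono) auto
  also have "ennreal ((1 - 1 / p) * m) * ennreal B = ennreal ((1 - 1 / p) * \<Phi>)"
    using p m0 B0 by (subst ennreal_mult[symmetric]) (auto simp: m_def field_simps)
  finally have main: "ennreal \<Phi> \<le> ennreal (m powr (1 - p) / p) * J + ennreal ((1 - 1 / p) * \<Phi>)" .
  show ?thesis
  proof (cases J)
    case top
    then show ?thesis using B0 unfolding J_def[symmetric] by (simp add: ennreal_mult_top)
  next
    case (real j)
    then have "ennreal \<Phi> \<le> ennreal (m powr (1 - p) / p * j + (1 - 1 / p) * \<Phi>)"
    proof -
      have "ennreal (m powr (1 - p) / p * j + (1 - 1 / p) * \<Phi>)
          = ennreal (m powr (1 - p) / p) * ennreal j + ennreal ((1 - 1 / p) * \<Phi>)"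
        using real p \<Phi> by (subst ennreal_plus) (auto intro!: ennreal_mult simp del: times_divide_eq_left)
      then show ?thesis using main real by simp
    qed
    then have "\<Phi> \<le> m powr (1 - p) / p * j + (1 - 1 / p) * \<Phi>"
      using p \<Phi> real by (subst (asm) ennreal_le_iff) auto
    then have "\<Phi> / p \<le> m powr (1 - p) * j / p" by (simp add: algebra_simps)
    then have "\<Phi> \<le> m powr (1 - p) * j" using p by (simp add: divide_le_cancel)
    also have "m powr (1 - p) = \<Phi> powr (1 - p) * B powr (p - 1)"
      using \<Phi>0 B0 by (simp add: m_def powr_divide powr_diff)
    finally have "\<Phi> powr (p - 1) * \<Phi> \<le> \<Phi> powr (p - 1) * (\<Phi> powr (1 - p) * B powr (p - 1) * j)"
      by (intro mult_left_mono) auto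
    also have "\<Phi> powr (p - 1) * (\<Phi> powr (1 - p) * B powr (p - 1) * j) = B powr (p - 1) * j"
      using \<Phi>0 by (simp add: powr_diff)
    also have "\<Phi> powr (p - 1) * \<Phi> = \<Phi> powr p" using \<Phi>0 by (simp add: powr_diff)
    finally show ?thesis unfolding J_def[symmetric] using real
      by (simp add: ennreal_leI flip: ennreal_mult)
  qed
qed

text \<open>The interval is symmetric about 0, so that \<open>\<bar>s\<bar> \<le> pi\<close> holds
  almost everywhere and kernel bounds in \<open>\<bar>s\<bar>\<close> apply directly. Functions on
  the circle remain functions of a real angle, with periodicity assumed where a rotation takes
  place.\<close>

definition circle :: "real measure" where
  "circle = uniform_measure lborel {-pi..pi}"

lemma space_circle [simp]: "space circle = UNIV"
  by (simp add: circle_def)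

lemma sets_circle [simp, measurable_cong]: "sets circle = sets borel"
  by (simp add: circle_def)

lemma emeasure_lborel_period [simp]: "emeasure lborel {-pi..pi} = ennreal (2 * pi)"
  by simp

lemma emeasure_circle_UNIV [simp]: "emeasure circle UNIV = 1"
  unfolding circle_def by (subst emeasure_uniform_measure) (auto simp: divide_ennreal)

interpretation circle: finite_measure circle
  by standard simp

lemma nn_integral_circle:
  assumes [measurable]: "f \<in> borel_measurable borel"
  shows "(\<integral>\<^sup>+x. f x \<partial>circle) = (\<integral>\<^sup>+x. f x * indicator {-pi..pi} x \<partial>lborel) / ennreal (2 * pi)"
  unfolding circle_def by (subst nn_integral_uniform_measure) auto

lemma AE_circleI:
  assumes "AE x in lborel. P x"
  shows "AE x in circle. P x"
  unfolding circle_def by (rule AE_uniform_measureI) (use assms in auto)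

lemma AE_circle_range: "AE x in circle. x \<in> {-pi..pi}"
  unfolding circle_def by (rule AE_uniform_measureI) auto

section \<open>Periodic integrands: change of starting point and rotation\<close>

lemma nn_integral_period_start:
  fixes f :: "real \<Rightarrow> ennreal"
  assumes [measurable]: "f \<in> borel_measurable borel" and per: "\<And>x. f (x + 2 * pi) = f x"
    and s: "0 \<le> s" "s \<le> 2 * pi"
  shows "(\<integral>\<^sup>+x. f x * indicator {a + s..<a + s + 2 * pi} x \<partial>lborel)
       = (\<integral>\<^sup>+x. f x * indicator {a..<a + 2 * pi} x \<partial>lborel)"
proof -
  have "(\<integral>\<^sup>+x. f x * indicator {a + s..<a + s + 2 * pi} x \<partial>lborel)
      = (\<integral>\<^sup>+x. f x * indicator {a + s..<a + 2 * pi} x + f x * indicator {a + 2 * pi..<a + s + 2 * pi} x \<partial>lborel)"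
    using s by (intro nn_integral_cong) (auto simp: indicator_def)
  also have "\<dots> = (\<integral>\<^sup>+x. f x * indicator {a + s..<a + 2 * pi} x \<partial>lborel)
      + (\<integral>\<^sup>+x. f x * indicator {a + 2 * pi..<a + s + 2 * pi} x \<partial>lborel)"
    by (subst nn_integral_add) auto
  also have "(\<integral>\<^sup>+x. f x * indicator {a + 2 * pi..<a + s + 2 * pi} x \<partial>lborel)
      = (\<integral>\<^sup>+x. f (2 * pi + x) * indicator {a + 2 * pi..<a + s + 2 * pi} (2 * pi + x) \<partial>lborel)"
    by (subst nn_integral_real_affine[where c=1 and t="2*pi"]) auto
  also have "\<dots> = (\<integral>\<^sup>+x. f x * indicator {a..<a + s} x \<partial>lborel)"
    using per by (intro nn_integral_cong) (auto simp: indicator_def add.commute)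
  also have "(\<integral>\<^sup>+x. f x * indicator {a + s..<a + 2 * pi} x \<partial>lborel) + \<dots>
      = (\<integral>\<^sup>+x. f x * indicator {a + s..<a + 2 * pi} x + f x * indicator {a..<a + s} x \<partial>lborel)"
    by (subst nn_integral_add) auto
  also have "\<dots> = (\<integral>\<^sup>+x. f x * indicator {a..<a + 2 * pi} x \<partial>lborel)"
    using s by (intro nn_integral_cong) (auto simp: indicator_def)
  finally show ?thesis .
qed

lemma nn_integral_circle_interval:
  fixes f :: "real \<Rightarrow> ennreal"
  assumes [measurable]: "f \<in> borel_measurable borel" and per: "\<And>x. f (x + 2 * pi) = f x"
    and a: "-pi \<le> a" "a \<le> pi"
  shows "(\<integral>\<^sup>+x. f x \<partial>circle) = (\<integral>\<^sup>+x. f x * indicator {a..a + 2 * pi} x \<partial>lborel) / ennreal (2 * pi)"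
proof -
  have closed: "(\<integral>\<^sup>+x. f x * indicator {b..b + 2 * pi} x \<partial>lborel)
      = (\<integral>\<^sup>+x. f x * indicator {b..<b + 2 * pi} x \<partial>lborel)" for b
    by (rule nn_integral_cong_AE, rule AE_I'[of "{b + 2 * pi}"]) (auto simp: indicator_def null_sets_def)
  have "(\<integral>\<^sup>+x. f x * indicator {a..a + 2 * pi} x \<partial>lborel) = (\<integral>\<^sup>+x. f x * indicator {-pi..-pi+2*pi} x \<partial>lborel)"
    unfolding closed using nn_integral_period_start[OF assms(1,2), of "a + pi" "-pi"] a by simp
  then show ?thesis by (simp add: nn_integral_circle)
qed

lemma nn_integral_circle_shift:
  fixes f :: "real \<Rightarrow> ennreal"
  assumes [measurable]: "f \<in> borel_measurable borel" and per: "\<And>x. f (x + 2 * pi) = f x"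
  shows "(\<integral>\<^sup>+x. f (x + s) \<partial>circle) = (\<integral>\<^sup>+x. f x \<partial>circle)"
proof -
  have per_int: "f (x + 2 * pi * of_int k) = f x" for x and k :: int
  proof (induction k rule: int_induct[where k=0])
    case base then show ?case by simp
  next
    case (step1 i)
    then show ?case using per[of "x + 2 * pi * of_int i"] by (simp add: algebra_simps)
  next
    case (step2 i)
    then show ?case using per[of "x + 2 * pi * (of_int i - 1)"] by (simp add: algebra_simps)
  qed
  \<comment> \<open>Removing whole periods leaves a shift \<open>t\<close> between 0 and
    \<open>2 * pi\<close>, the range covered by the change of starting point.\<close>
  define k where "k = \<lfloor>s / (2 * pi)\<rfloor>"
  define t where "t = s - 2 * pi * of_int k"
  have "of_int k \<le> s / (2 * pi)" "s / (2 * pi) < of_int k + 1"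
    unfolding k_def by linarith+
  then have t: "0 \<le> t" "t \<le> 2 * pi"
    by (auto simp: t_def field_simps)
  have "f (x + s) = f (x + t)" for x
    using per_int[of "x + t" k] by (simp add: t_def algebra_simps)
  then have "(\<integral>\<^sup>+x. f (x + s) \<partial>circle) = (\<integral>\<^sup>+x. f (x + t) \<partial>circle)" by simp
  also have "\<dots> = (\<integral>\<^sup>+x. f (x + t) * indicator {-pi..pi} x \<partial>lborel) / ennreal (2 * pi)"
    by (rule nn_integral_circle) simp
  also have "(\<integral>\<^sup>+x. f (x + t) * indicator {-pi..pi} x \<partial>lborel)
      = (\<integral>\<^sup>+x. f x * indicator {-pi + t..-pi + t + 2 * pi} x \<partial>lborel)"
    by (subst nn_integral_real_affine[where c=1 and t="-t"]) (auto intro!: nn_integral_cong simp: indicator_def)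
  also have "\<dots> / ennreal (2 * pi) = (\<integral>\<^sup>+x. f x \<partial>circle)"
    using nn_integral_circle_interval[OF assms, of "-pi + t"] t by simp
  finally show ?thesis .
qed

text \<open>A norm bound is a relation rather than a comparison of numbers, so an infinite integral
  simply fails to satisfy it and no default value intervenes. The sign condition is built in so that
  \<open>W\<close> can be recovered from \<open>W powr p\<close>.\<close>

definition Lp_le :: "real \<Rightarrow> (real \<Rightarrow> complex) \<Rightarrow> real \<Rightarrow> bool" where
  "Lp_le p \<phi> W \<longleftrightarrow> 0 \<le> W \<and> (\<integral>\<^sup>+\<theta>. ennreal (norm (\<phi> \<theta>) powr p) \<partial>circle) \<le> ennreal (W powr p)"

section \<open>Rules for L^p bounds on the circle\<close>

lemma Lp_le_nonneg: "Lp_le p \<phi> W \<Longrightarrow> 0 \<le> W"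
  by (simp add: Lp_le_def)

lemma Lp_le_mono:
  assumes "Lp_le p \<phi> W" "W \<le> W'" "0 \<le> p"
  shows "Lp_le p \<phi> W'"
  using assms unfolding Lp_le_def
  by (auto intro!: order_trans[of _ "ennreal (W powr p)" "ennreal (W' powr p)"] ennreal_leI powr_mono2)

text \<open>Lets an estimate be proved with an arbitrarily small loss, as when weights have to be
  made positive or a boundary function has to be replaced by a dilate.\<close>

lemma Lp_le_limit:
  assumes p: "0 < p" and W: "0 \<le> W" and le: "\<And>\<eta>. 0 < \<eta> \<Longrightarrow> Lp_le p \<phi> (W + \<eta>)"
  shows "Lp_le p \<phi> W"
proof -
  have "(\<lambda>n. (W + inverse (real (Suc n))) powr p) \<longlonglongrightarrow> (W + 0) powr p"
    using p W by (intro tendsto_powr' tendsto_add tendsto_const LIMSEQ_inverse_real_of_nat) (auto intro!: always_eventually)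
  then have "(\<lambda>n. ennreal ((W + inverse (real (Suc n))) powr p)) \<longlonglongrightarrow> ennreal (W powr p)"
    by (intro tendsto_ennrealI) simp
  then have "(\<integral>\<^sup>+\<theta>. ennreal (norm (\<phi> \<theta>) powr p) \<partial>circle) \<le> ennreal (W powr p)"
    by (rule LIMSEQ_le_const) (use le in \<open>auto simp: Lp_le_def\<close>)
  then show ?thesis using W by (simp add: Lp_le_def)
qed

lemma Lp_le_dominated:
  assumes "Lp_le p \<psi> W" "\<And>\<theta>. norm (\<phi> \<theta>) \<le> norm (\<psi> \<theta>)" "0 \<le> p"
  shows "Lp_le p \<phi> W"
proof -
  have "(\<integral>\<^sup>+\<theta>. ennreal (norm (\<phi> \<theta>) powr p) \<partial>circle) \<le> (\<integral>\<^sup>+\<theta>. ennreal (norm (\<psi> \<theta>) powr p) \<partial>circle)"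
    using assms by (intro nn_integral_mono ennreal_leI powr_mono2) auto
  then show ?thesis using assms(1) by (auto simp: Lp_le_def)
qed

lemma Lp_le_cmult:
  assumes "Lp_le p \<phi> W" and p: "0 < p" and [measurable]: "\<phi> \<in> borel_measurable borel"
  shows "Lp_le p (\<lambda>\<theta>. c * \<phi> \<theta>) (norm c * W)"
proof -
  have "(\<integral>\<^sup>+\<theta>. ennreal (norm (c * \<phi> \<theta>) powr p) \<partial>circle)
      = (\<integral>\<^sup>+\<theta>. ennreal (norm c powr p) * ennreal (norm (\<phi> \<theta>) powr p) \<partial>circle)"
    by (simp add: norm_mult powr_mult ennreal_mult)
  also have "\<dots> = ennreal (norm c powr p) * (\<integral>\<^sup>+\<theta>. ennreal (norm (\<phi> \<theta>) powr p) \<partial>circle)"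
    by (rule nn_integral_cmult) auto
  also have "\<dots> \<le> ennreal (norm c powr p) * ennreal (W powr p)"
    using assms by (intro mult_left_mono) (auto simp: Lp_le_def)
  also have "\<dots> = ennreal ((norm c * W) powr p)"
    using assms by (simp add: Lp_le_def powr_mult ennreal_mult)
  finally show ?thesis using assms by (auto simp: Lp_le_def)
qed

lemma Lp_le_sup:
  assumes "\<And>\<theta>. norm (\<phi> \<theta>) \<le> W" "0 < p"
  shows "Lp_le p \<phi> W"
proof -
  have "0 \<le> W" using assms(1)[of 0] norm_ge_zero order_trans by blast
  moreover have "(\<integral>\<^sup>+\<theta>. ennreal (norm (\<phi> \<theta>) powr p) \<partial>circle) \<le> (\<integral>\<^sup>+\<theta>. ennreal (W powr p) \<partial>circle)"
    using assms by (intro nn_integral_mono ennreal_leI powr_mono2) auto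
  ultimately show ?thesis by (simp add: Lp_le_def)
qed

lemma Lp_le_shift:
  assumes [measurable]: "\<phi> \<in> borel_measurable borel" and per: "\<And>x. \<phi> (x + 2 * pi) = \<phi> x"
  shows "Lp_le p (\<lambda>\<theta>. \<phi> (\<theta> + s)) W \<longleftrightarrow> Lp_le p \<phi> W"
  unfolding Lp_le_def using nn_integral_circle_shift[of "\<lambda>x. ennreal (norm (\<phi> x) powr p)" s] per by simp

text \<open>Minkowski's integral inequality follows from the weighted Jensen inequality with the
  norm bounds \<open>W\<close> themselves as weights.\<close>

lemma Minkowski_integral:
  fixes A :: "'a \<Rightarrow> real \<Rightarrow> complex"
  assumes p: "1 \<le> p" and fin: "finite_measure M"
    and [measurable]: "(\<lambda>(s, \<theta>). A s \<theta>) \<in> borel_measurable (M \<Otimes>\<^sub>M borel)" "W \<in> borel_measurable M"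
    and A: "\<And>s. s \<in> space M \<Longrightarrow> Lp_le p (A s) (W s)"
    and B: "0 \<le> B" "(\<integral>\<^sup>+s. W s \<partial>M) \<le> ennreal B"
    and \<Phi>: "\<And>\<theta>. ennreal (norm (\<Phi> \<theta>)) \<le> (\<integral>\<^sup>+s. norm (A s \<theta>) \<partial>M)"
  shows "Lp_le p \<Phi> B"
proof (rule Lp_le_limit[OF _ B(1)])
  interpret M: finite_measure M by fact
  interpret pair_sigma_finite M circle ..
  fix \<eta> :: real assume \<eta>: "0 < \<eta>"
  define e where "e = \<eta> / (measure M (space M) + 1)"
  have mM: "measure M (space M) + 1 > 0" using measure_nonneg[of M "space M"] by linarith
  have e0: "e > 0" using \<eta> mM by (simp add: e_def)
  have eM: "e * measure M (space M) \<le> \<eta>"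
    using \<eta> mM by (simp add: e_def divide_simps)
  \<comment> \<open>The weighted Jensen inequality wants \<open>A s \<theta> = 0\<close> wherever
    the weight vanishes, but \<open>W s = 0\<close> forces this only for almost every
    \<open>\<theta>\<close>. Adding a constant of total mass at most \<open>\<eta>\<close> makes the
    weight positive everywhere.\<close>
  define V where "V = (\<lambda>s. max 0 (W s) + e)"
  have [measurable]: "V \<in> borel_measurable M" by (simp add: V_def)
  have V0: "V s > 0" for s using e0 by (simp add: V_def add_nonneg_pos)
  have W0: "s \<in> space M \<Longrightarrow> 0 \<le> W s" for s using A by (auto dest: Lp_le_nonneg)
  have "(\<integral>\<^sup>+s. V s \<partial>M) = (\<integral>\<^sup>+s. ennreal (W s) + ennreal e \<partial>M)"
    using e0 W0 by (intro nn_integral_cong) (auto simp: V_def)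
  also have "\<dots> = (\<integral>\<^sup>+s. W s \<partial>M) + ennreal e * emeasure M (space M)"
    using e0 by (subst nn_integral_add) auto
  also have "\<dots> \<le> ennreal B + ennreal (e * measure M (space M))"
    using B e0 by (intro add_mono) (auto simp: M.emeasure_eq_measure ennreal_mult)
  also have "\<dots> \<le> ennreal (B + \<eta>)"
    using B eM \<eta> e0 by (simp flip: ennreal_plus add: ennreal_leI)
  finally have V: "(\<integral>\<^sup>+s. V s \<partial>M) \<le> ennreal (B + \<eta>)" .
  have "ennreal (norm (\<Phi> \<theta>) powr p) \<le> ennreal ((B + \<eta>) powr (p - 1)) *
      (\<integral>\<^sup>+s. ennreal (norm (A s \<theta>) powr p * V s powr (1 - p)) \<partial>M)" for \<theta>
  proof (rule Jensen_weighted[OF p _ _ _ _ _ _ V _ \<Phi>])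
    show "(\<lambda>s. norm (A s \<theta>)) \<in> borel_measurable M" by measurable
  qed (use B \<eta> V0 less_imp_le in \<open>auto simp: less_le\<close>)
  then have "(\<integral>\<^sup>+\<theta>. ennreal (norm (\<Phi> \<theta>) powr p) \<partial>circle) \<le> (\<integral>\<^sup>+\<theta>. ennreal ((B + \<eta>) powr (p - 1)) *
      (\<integral>\<^sup>+s. ennreal (norm (A s \<theta>) powr p * V s powr (1 - p)) \<partial>M) \<partial>circle)"
    by (rule nn_integral_mono)
  also have "\<dots> = ennreal ((B + \<eta>) powr (p - 1)) * (\<integral>\<^sup>+\<theta>.
      (\<integral>\<^sup>+s. ennreal (norm (A s \<theta>) powr p * V s powr (1 - p)) \<partial>M) \<partial>circle)"
    by (rule nn_integral_cmult) measurable
  also have "(\<integral>\<^sup>+\<theta>. (\<integral>\<^sup>+s. ennreal (norm (A s \<theta>) powr p * V s powr (1 - p)) \<partial>M) \<partial>circle)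
      = (\<integral>\<^sup>+s. (\<integral>\<^sup>+\<theta>. ennreal (norm (A s \<theta>) powr p * V s powr (1 - p)) \<partial>circle) \<partial>M)"
    by (rule Fubini') measurable
  also have "\<dots> = (\<integral>\<^sup>+s. (\<integral>\<^sup>+\<theta>. ennreal (norm (A s \<theta>) powr p) \<partial>circle) * ennreal (V s powr (1 - p)) \<partial>M)"
  proof (intro nn_integral_cong)
    fix s assume [simp]: "s \<in> space M"
    have [measurable]: "A s \<in> borel_measurable borel" 
      using measurable_compose[OF measurable_Pair1'[of s M borel] assms(3)] by simp
    show "(\<integral>\<^sup>+\<theta>. ennreal (norm (A s \<theta>) powr p * V s powr (1 - p)) \<partial>circle)
       = (\<integral>\<^sup>+\<theta>. ennreal (norm (A s \<theta>) powr p) \<partial>circle) * ennreal (V s powr (1 - p))"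
      by (simp add: ennreal_mult nn_integral_multc)
  qed
  also have "\<dots> \<le> (\<integral>\<^sup>+s. V s \<partial>M)"
  proof (intro nn_integral_mono)
    fix s assume s: "s \<in> space M"
    have "Lp_le p (A s) (V s)"
      using A[OF s] W0[OF s] e0 p by (rule_tac Lp_le_mono) (auto simp: V_def)
    then have "(\<integral>\<^sup>+\<theta>. ennreal (norm (A s \<theta>) powr p) \<partial>circle) * ennreal (V s powr (1 - p))
       \<le> ennreal (V s powr p) * ennreal (V s powr (1 - p))"
      by (intro mult_right_mono) (auto simp: Lp_le_def)
    also have "\<dots> = ennreal (V s)"
      using V0[of s] by (simp flip: ennreal_mult powr_add)
    finally show "(\<integral>\<^sup>+\<theta>. ennreal (norm (A s \<theta>) powr p) \<partial>circle) * ennreal (V s powr (1 - p)) \<le> ennreal (V s)" .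
  qed
  also note V
  also have "ennreal ((B + \<eta>) powr (p - 1)) * ennreal (B + \<eta>) = ennreal ((B + \<eta>) powr p)"
    using B \<eta> by (subst ennreal_mult[symmetric]) (auto simp: powr_diff)
  finally show "Lp_le p \<Phi> (B + \<eta>)"
    using B \<eta> by (simp add: Lp_le_def mult_left_mono)
qed (use p in simp)

text \<open>The triangle inequality in L^p is the integral version over the counting measure of a
  two-point set.\<close>

lemma Lp_le_add:
  assumes p: "1 \<le> p" and [measurable]: "\<phi> \<in> borel_measurable borel" "\<psi> \<in> borel_measurable borel"
    and "Lp_le p \<phi> a" "Lp_le p \<psi> b"
  shows "Lp_le p (\<lambda>\<theta>. \<phi> \<theta> + \<psi> \<theta>) (a + b)"
proof (rule Minkowski_integral[where M="count_space UNIV" and A="\<lambda>s. if s then \<phi> else \<psi>" and W="\<lambda>s. if s then a else b"])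
  show "finite_measure (count_space (UNIV :: bool set))" by (rule finite_measure_count_space) simp
  show "(\<lambda>(s, \<theta>). (if s then \<phi> else \<psi>) \<theta>) \<in> borel_measurable (count_space UNIV \<Otimes>\<^sub>M borel)"
    by (rule measurable_pair_measure_countable1) auto
qed (use assms Lp_le_nonneg[of p \<phi> a] Lp_le_nonneg[of p \<psi> b] in
   \<open>auto simp: nn_integral_count_space_finite UNIV_bool norm_triangle_ineq add.commute[of "norm (\<psi> _)"] simp flip: ennreal_plus intro!: ennreal_leI\<close>)

lemma Lp_le_diff:
  assumes p: "1 \<le> p" and [measurable]: "\<phi> \<in> borel_measurable borel" "\<psi> \<in> borel_measurable borel"
    and "Lp_le p \<phi> a" "Lp_le p \<psi> b"
  shows "Lp_le p (\<lambda>\<theta>. \<phi> \<theta> - \<psi> \<theta>) (a + b)"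
  using Lp_le_add[of p \<phi> "\<lambda>\<theta>. - \<psi> \<theta>" a b] assms by (simp add: Lp_le_def)

text \<open>Fatou's lemma: L^p bounds are lower semicontinuous under almost everywhere convergence.
  The bound is asked for eventually only, which suits radii that tend to 1.\<close>

lemma Lp_le_AE_lim:
  fixes \<phi>n :: "nat \<Rightarrow> real \<Rightarrow> complex"
  assumes p: "0 < p" and [measurable]: "\<And>n. \<phi>n n \<in> borel_measurable borel"
    and lim: "AE \<theta> in circle. (\<lambda>n. \<phi>n n \<theta>) \<longlonglongrightarrow> \<phi> \<theta>" and W: "0 \<le> W"
    and ev: "eventually (\<lambda>n. Lp_le p (\<phi>n n) W) sequentially"
  shows "Lp_le p \<phi> W"
proof -
  have "(\<integral>\<^sup>+\<theta>. ennreal (norm (\<phi> \<theta>) powr p) \<partial>circle)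
      = (\<integral>\<^sup>+\<theta>. liminf (\<lambda>n. ennreal (norm (\<phi>n n \<theta>) powr p)) \<partial>circle)"
  proof (rule nn_integral_cong_AE, use lim in eventually_elim)
    fix \<theta> assume "(\<lambda>n. \<phi>n n \<theta>) \<longlonglongrightarrow> \<phi> \<theta>"
    then have "(\<lambda>n. ennreal (norm (\<phi>n n \<theta>) powr p)) \<longlonglongrightarrow> ennreal (norm (\<phi> \<theta>) powr p)"
      using p by (intro tendsto_ennrealI tendsto_powr' tendsto_norm tendsto_const) auto
    then show "ennreal (norm (\<phi> \<theta>) powr p) = liminf (\<lambda>n. ennreal (norm (\<phi>n n \<theta>) powr p))"
      using lim_imp_Liminf[OF sequentially_bot] by metis
  qed
  also have "\<dots> \<le> liminf (\<lambda>n. \<integral>\<^sup>+\<theta>. ennreal (norm (\<phi>n n \<theta>) powr p) \<partial>circle)"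
    by (rule nn_integral_liminf) measurable
  also have "\<dots> \<le> liminf (\<lambda>n. ennreal (W powr p))"
    by (rule Liminf_mono) (use ev in eventually_elim, auto simp: Lp_le_def)
  also have "\<dots> = ennreal (W powr p)" by (simp add: Liminf_const)
  finally show ?thesis using W by (simp add: Lp_le_def)
qed

section \<open>Poisson integrals\<close>

text \<open>Functions on the disc are total and arbitrary outside it, so measurability of a trace
  goes through the restriction of the Borel sets to the ball.\<close>

lemma continuous_trace_measurable:
  fixes F :: "complex \<Rightarrow> 'b::topological_space"
  assumes F: "continuous_on (ball 0 1) F" and [measurable]: "u \<in> borel_measurable N"
    and u: "\<And>x. x \<in> space N \<Longrightarrow> norm (u x) < 1"
  shows "(\<lambda>x. F (u x)) \<in> borel_measurable N"
proof -
  have "u \<in> measurable N (restrict_space borel (ball 0 1))"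
    using u by (intro measurable_restrict_space2) auto
  from measurable_compose[OF this borel_measurable_continuous_on_restrict[OF F]] show ?thesis .
qed

lemma trace_measurable:
  assumes "F holomorphic_on ball 0 1" "0 \<le> r" "r < 1"
  shows "(\<lambda>\<theta>. F (polar r (\<theta> + s))) \<in> borel_measurable borel"
    and "(\<lambda>\<theta>. F (polar r \<theta>)) \<in> borel_measurable borel"
proof -
  show *: "(\<lambda>\<theta>. F (polar r (\<theta> + s))) \<in> borel_measurable borel" for s
    using assms by (intro continuous_trace_measurable[of F] holomorphic_on_imp_continuous_on
        borel_measurable_continuous_onI continuous_intros) (auto simp: norm_mult)
  show "(\<lambda>\<theta>. F (polar r \<theta>)) \<in> borel_measurable borel"
    using *[of 0] by simp
qed

lemma cis_period [simp]: "cis (x + 2 * pi) = cis x"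
  by (simp add: cis.ctr)

lemma trace_shift:
  assumes "F holomorphic_on ball 0 1" "0 \<le> r" "r < 1"
  shows "Lp_le p (\<lambda>\<theta>. F (polar r (\<theta> + s))) W \<longleftrightarrow> Lp_le p (\<lambda>\<theta>. F (polar r \<theta>)) W"
  by (rule Lp_le_shift) (use assms trace_measurable in auto)

section \<open>Cauchy's formula for the normalised measure\<close>

lemma integrable_circle:
  fixes f :: "real \<Rightarrow> complex"
  assumes "continuous_on UNIV f"
  shows "integrable circle f"
proof -
  have [measurable]: "f \<in> borel_measurable borel"
    using assms by (rule borel_measurable_continuous_onI)
  have "compact (f ` {-pi..pi})"
    using assms by (intro compact_continuous_image continuous_on_subset[OF assms]) auto
  then obtain B where "\<And>x. x \<in> {-pi..pi} \<Longrightarrow> norm (f x) \<le> B"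
    by (meson bounded_iff compact_imp_bounded image_eqI)
  then show ?thesis
    using eventually_mono[OF AE_circle_range, of "\<lambda>x. norm (f x) \<le> B"]
    by (intro circle.integrable_const_bound[where B=B]) auto
qed

lemma integral_circle_eq:
  fixes f :: "real \<Rightarrow> complex"
  assumes f: "continuous_on UNIV f"
  shows "(LINT x|circle. f x) = integral {-pi..pi} f / (2 * pi)"
proof -
  have [measurable]: "f \<in> borel_measurable borel"
    using f by (rule borel_measurable_continuous_onI)
  have int: "set_integrable lborel {-pi..pi} f"
    using f by (intro borel_integrable_atLeastAtMost' continuous_on_subset[OF f]) auto
  have c: "circle = density lborel (\<lambda>x. ennreal (indicator {-pi..pi} x / (2 * pi)))"
    unfolding circle_def uniform_measure_def
    by (intro density_cong) (auto simp: divide_ennreal indicator_def divide_ennreal[of 1, simplified])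
  have "(LINT x|circle. f x) = (LINT x|lborel. (indicator {-pi..pi} x / (2 * pi)) *\<^sub>R f x)"
    unfolding c by (subst integral_density) auto
  also have "\<dots> = (LINT x|lborel. (1 / (2 * pi)) *\<^sub>R (indicator {-pi..pi} x *\<^sub>R f x))"
    by (intro Bochner_Integration.integral_cong) auto
  also have "\<dots> = (1 / (2 * pi)) *\<^sub>R (LINT x|lborel. indicator {-pi..pi} x *\<^sub>R f x)"
    by (rule integral_scaleR_right)
  also have "(LINT x|lborel. indicator {-pi..pi} x *\<^sub>R f x) = integral {-pi..pi} f"
    using set_borel_integral_eq_integral(2)[OF int] by (simp add: set_lebesgue_integral_def)
  finally show ?thesis by (simp add: scaleR_conv_of_real)
qed

lemma integral_periodic_interval:
  fixes f :: "real \<Rightarrow> complex"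
  assumes f: "continuous_on UNIV f" and per: "\<And>x. f (x + 2 * pi) = f x"
  shows "integral {-pi..pi} f = integral {0..2 * pi} f"
proof -
  have int: "f integrable_on {a..b}" for a b
    using f by (intro integrable_continuous_real continuous_on_subset[OF f]) auto
  have "integral {-pi..0} f = integral {-pi..0} (f \<circ> (\<lambda>x. x + 2 * pi))"
    using per by (intro Henstock_Kurzweil_Integration.integral_cong) auto
  also have "\<dots> = integral {pi..2 * pi} f"
    using integral_shift[of "-pi" "2*pi" 0 f] continuous_on_subset[OF f] by simp
  finally have "integral {-pi..0} f = integral {pi..2 * pi} f" .
  moreover have "integral {-pi..0} f + integral {0..pi} f = integral {-pi..pi} f"
    by (rule Henstock_Kurzweil_Integration.integral_combine) (auto intro: int)
  moreover have "integral {0..pi} f + integral {pi..2*pi} f = integral {0..2 * pi} f"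
    by (rule Henstock_Kurzweil_Integration.integral_combine) (auto intro: int)
  ultimately show ?thesis by (metis add.commute)
qed

lemma continuous_on_circle_trace:
  assumes "continuous_on (cball 0 1) V"
  shows "continuous_on UNIV (\<lambda>s. V (cis s))"
  by (rule continuous_on_compose2[OF assms]) (auto intro!: continuous_intros)

lemma cis_ne: "norm z < 1 \<Longrightarrow> cis s \<noteq> z"
  by auto

text \<open>The contour integral over the unit circle in terms of the normalised measure; the factor
  \<open>cis s\<close> is the derivative of the parametrisation up to the imaginary unit. It serves
  for \<open>k = 0\<close> (Poisson formula), \<open>k = 1\<close> (derivative estimate) and
  \<open>k = 2\<close> (second derivative from boundary increments).\<close>

lemma Cauchy_circle:
  assumes contf: "continuous_on (cball 0 1) V" and holf: "V holomorphic_on ball 0 1" and z: "norm z < 1"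
  shows "(LINT s|circle. V (cis s) * cis s / (cis s - z) ^ Suc k) = (deriv ^^ k) V z / fact k"
proof -
  let ?h = "\<lambda>s. V (cis s) * cis s / (cis s - z) ^ Suc k"
  have cont: "continuous_on UNIV ?h"
    using cis_ne[OF z] by (intro continuous_intros continuous_on_circle_trace[OF contf]) auto
  have "((\<lambda>u. V u / (u - z) ^ Suc k) has_contour_integral (2 * pi * \<i>) / fact k * (deriv ^^ k) V z)
      (part_circlepath 0 1 0 (2 * pi))"
    using Cauchy_has_contour_integral_higher_derivative_circlepath[OF contf holf, of z k] z
    by (simp add: circlepath_def)
  then have "((\<lambda>t. V (cis t) / (cis t - z) ^ Suc k * \<i> * cis t) has_integral (2 * pi * \<i>) / fact k * (deriv ^^ k) V z) {0..2*pi}"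
    by (subst (asm) has_contour_integral_part_circlepath_iff) simp_all
  from has_integral_mult_right[OF this, of "-\<i>"]
  have "(?h has_integral 2 * pi / fact k * (deriv ^^ k) V z) {0..2*pi}"
    by (simp add: mult_ac)
  then have "integral {0..2*pi} ?h = 2 * pi / fact k * (deriv ^^ k) V z"
    by (rule integral_unique)
  then show ?thesis
    using integral_circle_eq[OF cont] integral_periodic_interval[OF cont] by simp
qed

section \<open>The Poisson kernel and its size\<close>

definition poisson :: "real \<Rightarrow> real \<Rightarrow> real" where
  "poisson r s = (1 - r\<^sup>2) / (norm (cis s - of_real r))\<^sup>2"

lemma poisson_nonneg: "0 \<le> r \<Longrightarrow> r < 1 \<Longrightarrow> 0 \<le> poisson r s"
  by (simp add: poisson_def power_le_one)

lemma poisson_measurable [measurable]: "poisson r \<in> borel_measurable borel"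
  unfolding poisson_def by (intro borel_measurable_divide borel_measurable_power borel_measurable_norm
    borel_measurable_const borel_measurable_continuous_onI continuous_intros)

lemma continuous_poisson: "0 \<le> r \<Longrightarrow> r < 1 \<Longrightarrow> continuous_on UNIV (\<lambda>s. complex_of_real (poisson r s))"
  unfolding poisson_def using cis_ne[of "of_real r"] by (intro continuous_intros) auto

text \<open>Cauchy's formula for \<open>w \<mapsto> V w (1 - r\<^sup>2) / (1 - r w)\<close> at the point \<open>r\<close>.\<close>

lemma poisson_formula:
  assumes contf: "continuous_on (cball 0 1) V" and holf: "V holomorphic_on ball 0 1"
    and r: "0 \<le> r" "r < 1"
  shows "V (of_real r) = (LINT s|circle. of_real (poisson r s) * V (cis s))"
proof -
  have ne: "1 - of_real r * w \<noteq> 0" if "w \<in> cball 0 1" for w :: complex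
  proof
    assume "1 - of_real r * w = 0"
    then have "norm (of_real r * w) = 1" by (simp add: eq_iff_diff_eq_0[symmetric] flip: norm_one)
    then have "r * norm w = 1" using r by (simp add: norm_mult)
    moreover have "r * norm w \<le> r * 1" using that r by (intro mult_left_mono) auto
    ultimately show False using r by simp
  qed
  have rr: "1 - (complex_of_real r)\<^sup>2 \<noteq> 0"
    using ne[of "of_real r"] r by (simp add: power2_eq_square)
  let ?U = "\<lambda>w. V w * (1 - of_real r ^ 2) / (1 - of_real r * w)"
  have "continuous_on (cball 0 1) ?U" using ne by (intro continuous_intros contf) auto
  moreover have "?U holomorphic_on ball 0 1" using ne by (intro holomorphic_intros holf) auto
  ultimately have "(LINT s|circle. ?U (cis s) * cis s / (cis s - of_real r) ^ Suc 0) = ?U (of_real r)"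
    using Cauchy_circle[of ?U "of_real r" 0] r by simp
  moreover have "?U (cis s) * cis s / (cis s - of_real r) = of_real (poisson r s) * V (cis s)" for s
  proof -
    \<comment> \<open>On the unit circle \<open>1 - r w\<close> equals \<open>w\<close> times the
      conjugate of \<open>w - r\<close>. This turns the Cauchy kernel with its correction factor
      into the Poisson kernel.\<close>
    have "(1 - of_real r * cis s) * (cis s - of_real r) = cis s * (cnj (cis s - of_real r) * (cis s - of_real r))"
    proof -
      have "cis s * cnj (cis s) = 1" by (simp add: cis_cnj cis_mult)
      then have "1 - of_real r * cis s = cis s * cnj (cis s - of_real r)" by (simp add: algebra_simps)
      then show ?thesis by simp
    qed
    also have "cnj (cis s - of_real r) * (cis s - of_real r) = of_real ((norm (cis s - of_real r))\<^sup>2)"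
      using complex_norm_square[of "cis s - of_real r"] by (simp add: mult.commute)
    finally have "(1 - of_real r * cis s) * (cis s - of_real r) = cis s * of_real ((norm (cis s - of_real r))\<^sup>2)" .
    then have "?U (cis s) * cis s / (cis s - of_real r)
       = V (cis s) * (1 - of_real r ^ 2) * cis s / (cis s * of_real ((norm (cis s - of_real r))\<^sup>2))"
      by (simp add: divide_divide_eq_left)
    also have "\<dots> = of_real (poisson r s) * V (cis s)"
      by (simp add: poisson_def)
    finally show ?thesis .
  qed
  ultimately show ?thesis
    using rr by (simp add: power2_eq_square)
qed

lemma poisson_integral_1:
  assumes r: "0 \<le> r" "r < 1"
  shows "(LINT s|circle. complex_of_real (poisson r s)) = 1" "(\<integral>\<^sup>+s. poisson r s \<partial>circle) = 1"
proof -
  show 1: "(LINT s|circle. complex_of_real (poisson r s)) = 1"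
    using poisson_formula[of "\<lambda>_. 1" r] r by simp
  have "integrable circle (\<lambda>s. complex_of_real (poisson r s))"
    using r by (intro integrable_circle continuous_poisson)
  then have int: "integrable circle (poisson r)"
    using complex_of_real_integrable_eq by blast
  have "(LINT s|circle. poisson r s) = 1"
    using 1 integral_complex_of_real[of circle "poisson r"] of_real_eq_1_iff by metis
  then show "(\<integral>\<^sup>+s. poisson r s \<partial>circle) = 1"
    using nn_integral_eq_integral[OF int] poisson_nonneg[OF r] by simp
qed

text \<open>For \<open>\<bar>x\<bar> \<le> 2\<close> the cubic Taylor remainder is at most
  \<open>4 / 6\<close> of \<open>\<bar>x\<bar>\<close>, which leaves one third. The range is chosen
  to contain \<open>pi / 2\<close>.\<close>

lemma abs_sin_ge:
  assumes "\<bar>x\<bar> \<le> 2"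
  shows "\<bar>x\<bar> / 3 \<le> \<bar>sin (x::real)\<bar>"
proof -
  have "\<bar>sin x - x\<bar> \<le> inverse (fact 3) * \<bar>x\<bar> ^ 3"
    using Maclaurin_sin_bound[of x 3] by (simp add: numeral_eq_Suc sin_coeff_def)
  also have "\<dots> = \<bar>x\<bar> * (\<bar>x\<bar>\<^sup>2 / 6)" by (simp add: fact_numeral power3_eq_cube power2_eq_square)
  also have "\<dots> \<le> \<bar>x\<bar> * (2\<^sup>2 / 6)"
    using assms by (intro mult_left_mono divide_right_mono power_mono) auto
  finally have "\<bar>sin x - x\<bar> \<le> 2 / 3 * \<bar>x\<bar>" by simp
  then show ?thesis by arith
qed

text \<open>Where \<open>cos s \<le> 0\<close> the distance is at least 1 while
  \<open>\<bar>s\<bar> \<le> pi < 4\<close>; where \<open>cos s > 0\<close> the imaginary part alone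
  already gives a third of \<open>\<bar>s\<bar>\<close>.\<close>

lemma norm_cis_diff_ge:
  assumes r: "0 \<le> r" "r \<le> 1" and s: "\<bar>s\<bar> \<le> pi"
  shows "max (1 - r) \<bar>s\<bar> \<le> 4 * norm (cis s - of_real r)"
proof -
  have "1 - r \<le> norm (cis s - of_real r)"
    using norm_triangle_ineq2[of "cis s" "of_real r"] r by simp
  moreover have "\<bar>s\<bar> \<le> 4 * norm (cis s - of_real r)"
  proof (cases "cos s \<le> 0")
    case True
    have "1 = (cos s)\<^sup>2 + (sin s)\<^sup>2" by simp
    also have "\<dots> \<le> (cos s - r)\<^sup>2 + (sin s)\<^sup>2"
    proof -
      have "(cos s - r)\<^sup>2 = (cos s)\<^sup>2 + (r\<^sup>2 - 2 * (r * cos s))" by (simp add: power2_eq_square algebra_simps)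
      moreover have "0 \<le> r\<^sup>2 - 2 * (r * cos s)"
        using mult_nonneg_nonpos[OF r(1) True] zero_le_power2[of r] by linarith
      ultimately show ?thesis by linarith
    qed
    also have "\<dots> = (norm (cis s - of_real r))\<^sup>2" by (simp add: cmod_power2)
    finally have "1 \<le> norm (cis s - of_real r)" by (simp add: power2_nonneg_ge_1_iff abs_le_square_iff[of 1, simplified])
    then show ?thesis using s pi_less_4 by linarith
  next
    case False
    have "\<bar>s\<bar> \<le> pi / 2"
    proof (rule ccontr)
      assume "\<not> \<bar>s\<bar> \<le> pi / 2"
      then have "cos \<bar>s\<bar> \<le> cos (pi / 2)" using s by (intro cos_monotone_0_pi_le) auto
      then show False using False by simp
    qed
    then have "\<bar>s\<bar> / 3 \<le> \<bar>sin s\<bar>" using pi_less_4 by (intro abs_sin_ge) linarith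
    also have "\<dots> \<le> norm (cis s - of_real r)" using abs_Im_le_cmod[of "cis s - of_real r"] by simp
    finally show ?thesis by (simp add: field_simps) 
  qed
  ultimately show ?thesis using norm_ge_zero[of "cis s - of_real r"] by auto
qed

text \<open>Both bounds use \<open>1 - r\<^sup>2 = (1 - r) * (1 + r)\<close>. The constant 32 is 2
  from \<open>1 + r\<close>, times the square of the 4 in the distance estimate. The first bound
  serves for pointwise values, the second exhibits the kernel at scale \<open>1 - r\<close>.\<close>

lemma poisson_le:
  assumes r: "0 \<le> r" "r < 1"
  shows "poisson r s \<le> 2 / (1 - r)"
    and "\<bar>s\<bar> \<le> pi \<Longrightarrow> poisson r s \<le> 32 * (1 - r) / (max (1 - r) \<bar>s\<bar>)\<^sup>2"
proof -
  have f: "1 - r\<^sup>2 = (1 - r) * (1 + r)" by (simp add: power2_eq_square algebra_simps)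
  have pos: "norm (cis s - of_real r) > 0" using cis_ne[of "of_real r" s] r by simp
  have "1 - r \<le> norm (cis s - of_real r)"
    using norm_triangle_ineq2[of "cis s" "of_real r"] r by simp
  then have "poisson r s \<le> (1 - r) * (1 + r) / (1 - r)\<^sup>2"
    unfolding poisson_def f using r pos by (intro divide_left_mono power_mono mult_pos_pos mult_nonneg_nonneg zero_less_power) auto
  also have "\<dots> = (1 + r) / (1 - r)" using r by (simp add: power2_eq_square)
  also have "\<dots> \<le> 2 / (1 - r)" using r by (intro divide_right_mono) auto
  finally show "poisson r s \<le> 2 / (1 - r)" .
  assume s: "\<bar>s\<bar> \<le> pi"
  have m: "max (1 - r) \<bar>s\<bar> > 0" using r by auto
  have "max (1 - r) \<bar>s\<bar> / 4 \<le> norm (cis s - of_real r)"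
    using norm_cis_diff_ge[of r s] r s by auto
  then have "poisson r s \<le> (1 - r) * (1 + r) / (max (1 - r) \<bar>s\<bar> / 4)\<^sup>2"
    unfolding poisson_def f using r pos m by (intro divide_left_mono power_mono mult_pos_pos mult_nonneg_nonneg zero_less_power) auto
  also have "\<dots> \<le> (1 - r) * 2 / (max (1 - r) \<bar>s\<bar> / 4)\<^sup>2"
    using r by (intro divide_right_mono mult_left_mono) auto
  finally show "poisson r s \<le> 32 * (1 - r) / (max (1 - r) \<bar>s\<bar>)\<^sup>2"
    by (simp add: power_divide)
qed

section \<open>Poisson averages on interior circles, monotone means, point evaluation\<close>

lemma holomorphic_rotate_dilate:
  assumes F: "F holomorphic_on ball 0 1" and c: "norm c < 1"
  shows "(\<lambda>w. F (c * w)) holomorphic_on ball 0 1" "continuous_on (cball 0 1) (\<lambda>w. F (c * w))"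
proof -
  have in_ball: "c * w \<in> ball 0 1" if "norm w \<le> 1" for w
    using mult_left_mono[OF that, of "norm c"] c by (simp add: norm_mult)
  show "(\<lambda>w. F (c * w)) holomorphic_on ball 0 1"
    by (rule holomorphic_on_compose_gen[OF _ F, unfolded o_def]) (use in_ball in \<open>auto intro!: holomorphic_intros\<close>)
  show "continuous_on (cball 0 1) (\<lambda>w. F (c * w))"
    by (rule continuous_on_compose2[OF holomorphic_on_imp_continuous_on[OF F]]) (use in_ball in \<open>auto intro!: continuous_intros\<close>)
qed

text \<open>The formula at real points is applied to the function w -> F(R
  cis(\<open>\<theta>\<close>) w), which is continuous on the closed disc whatever the boundary
  behaviour of \<open>F\<close>.\<close>

lemma poisson_dilate:
  assumes F: "F holomorphic_on ball 0 1" and r: "0 \<le> r" "r < R" "R < 1"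
  shows "F (polar r \<theta>) = (LINT s|circle. of_real (poisson (r / R) s) * F (polar R (\<theta> + s)))"
    and "integrable circle (\<lambda>s. of_real (poisson (r / R) s) * F (polar R (\<theta> + s)))"
proof -
  let ?c = "of_real R * cis \<theta>"
  have c: "norm ?c < 1" using r by (simp add: norm_mult)
  have q: "0 \<le> r / R" "r / R < 1" using r by auto
  show "F (polar r \<theta>) = (LINT s|circle. of_real (poisson (r / R) s) * F (polar R (\<theta> + s)))"
    using poisson_formula[OF holomorphic_rotate_dilate(2,1)[OF F c] q] r
    by (simp add: mult.assoc cis_mult) (simp add: mult.commute)
  have "continuous_on UNIV (\<lambda>s. of_real (poisson (r / R) s) * F (?c * cis s))"
    using continuous_on_circle_trace[OF holomorphic_rotate_dilate(2)[OF F c]]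
    by (intro continuous_intros continuous_poisson q)
  then show "integrable circle (\<lambda>s. of_real (poisson (r / R) s) * F (polar R (\<theta> + s)))"
    by (intro integrable_circle) (simp add: mult.assoc cis_mult)
qed

lemma poisson_dilate_norm:
  assumes F: "F holomorphic_on ball 0 1" and r: "0 \<le> r" "r < R" "R < 1"
  shows "ennreal (norm (F (polar r \<theta>)))
    \<le> (\<integral>\<^sup>+s. poisson (r / R) s * norm (F (polar R (\<theta> + s))) \<partial>circle)"
  using integral_norm_bound_ennreal[OF poisson_dilate(2)[OF assms, of \<theta>]] r
  by (simp add: poisson_dilate(1)[OF assms, of \<theta>, symmetric] norm_mult poisson_nonneg)

lemma pair_trace_measurable:
  assumes F: "F holomorphic_on ball 0 1" and r: "0 \<le> r" "r < 1"
  shows "(\<lambda>(s, \<theta>). F (polar r (\<theta> + s))) \<in> borel_measurable (borel \<Otimes>\<^sub>M borel)"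
proof -
  have "(\<lambda>(s, \<theta>). F (polar r (\<theta> + s))) = (\<lambda>x. F (polar r (snd x + fst x)))"
    by auto
  also have "\<dots> \<in> borel_measurable borel"
    using assms by (intro continuous_trace_measurable[of F] holomorphic_on_imp_continuous_on
        borel_measurable_continuous_onI continuous_intros) (auto simp: norm_mult)
  finally show ?thesis by (simp add: borel_prod)
qed

text \<open>The trace at radius \<open>r\<close> is an average of rotated traces at radius
  \<open>R\<close> against a kernel of total mass 1, and rotations preserve the norm; Minkowski's
  inequality does the rest.\<close>

lemma Lp_le_radius_mono:
  assumes p: "1 \<le> p" and F: "F holomorphic_on ball 0 1" and r: "0 \<le> r" "r \<le> R" "R < 1"
    and W: "Lp_le p (\<lambda>\<theta>. F (polar R \<theta>)) W"
  shows "Lp_le p (\<lambda>\<theta>. F (polar r \<theta>)) W"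
proof (cases "r = R")
  case False
  then have r: "0 \<le> r" "r < R" "R < 1" using r by auto
  have q: "0 \<le> r / R" "r / R < 1" using r by auto
  have W0: "0 \<le> W" using W by (rule Lp_le_nonneg)
  have [measurable]: "(\<lambda>(s, \<theta>). F (polar R (\<theta> + s))) \<in> borel_measurable (borel \<Otimes>\<^sub>M borel)"
    using r by (intro pair_trace_measurable F) auto
  show ?thesis
  proof (rule Minkowski_integral[OF p circle.finite_measure_axioms,
      where A="\<lambda>s \<theta>. of_real (poisson (r / R) s) * F (polar R (\<theta> + s))"
        and W="\<lambda>s. poisson (r / R) s * W"])
    show "Lp_le p (\<lambda>\<theta>. of_real (poisson (r / R) s) * F (polar R (\<theta> + s))) (poisson (r / R) s * W)" for s
      using Lp_le_cmult[of p "\<lambda>\<theta>. F (polar R (\<theta> + s))" W "of_real (poisson (r / R) s)"] W p F r q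
        trace_shift[OF F, of R] trace_measurable(1)[OF F, of R s] poisson_nonneg[of "r / R" s] by simp
    have "(\<integral>\<^sup>+s. ennreal (poisson (r / R) s * W) \<partial>circle) = (\<integral>\<^sup>+s. poisson (r / R) s \<partial>circle) * ennreal W"
      using W0 poisson_nonneg[OF q] by (subst nn_integral_multc[symmetric]) (auto simp: ennreal_mult)
    also have "\<dots> = ennreal W" by (simp add: poisson_integral_1[OF q])
    finally show "(\<integral>\<^sup>+s. ennreal (poisson (r / R) s * W) \<partial>circle) \<le> ennreal W" by simp
    show "ennreal (norm (F (polar r \<theta>)))
      \<le> (\<integral>\<^sup>+s. norm (of_real (poisson (r / R) s) * F (polar R (\<theta> + s))) \<partial>circle)" for \<theta>
      using poisson_dilate_norm[OF F r, of \<theta>] poisson_nonneg[OF q] by (simp add: norm_mult)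
  qed (use W0 in auto)
qed (use W in simp)

text \<open>Jensen's inequality with the Poisson kernel as weight bounds the p-th power by a Poisson
  average, and the kernel is at most \<open>2 / (1 - r / R)\<close>.\<close>

lemma Lp_le_point_bound:
  assumes p: "1 \<le> p" and F: "F holomorphic_on ball 0 1" and r: "0 \<le> r" "r < R" "R < 1"
    and W: "Lp_le p (\<lambda>\<theta>. F (polar R \<theta>)) W"
  shows "norm (F (polar r \<theta>)) \<le> (2 * R / (R - r)) powr (1 / p) * W"
proof -
  have q: "0 \<le> r / R" "r / R < 1" using r by auto
  have W0: "0 \<le> W" using W by (rule Lp_le_nonneg)
  have [measurable]: "(\<lambda>s. F (polar R (\<theta> + s))) \<in> borel_measurable borel"
    using trace_measurable(1)[OF F, of R \<theta>] r by (simp add: add.commute)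
  have "ennreal (norm (F (polar r \<theta>)) powr p) \<le> ennreal (1 powr (p - 1)) *
     (\<integral>\<^sup>+s. ennreal ((poisson (r / R) s * norm (F (polar R (\<theta> + s)))) powr p * poisson (r / R) s powr (1 - p)) \<partial>circle)"
    by (rule Jensen_weighted[OF p _ _ _ _ _ _ _ _ poisson_dilate_norm[OF F r]])
      (use q poisson_nonneg[OF q] poisson_integral_1[OF q] in auto)
  also have "\<dots> \<le> (\<integral>\<^sup>+s. ennreal (2 * R / (R - r)) * ennreal (norm (F (polar R (\<theta> + s))) powr p) \<partial>circle)"
    unfolding powr_one_eq_one ennreal_1 mult_1
  proof (rule nn_integral_mono)
    fix s
    have "(poisson (r / R) s * norm (F (polar R (\<theta> + s)))) powr p * poisson (r / R) s powr (1 - p)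
       = (poisson (r / R) s powr p * poisson (r / R) s powr (1 - p)) * norm (F (polar R (\<theta> + s))) powr p"
      using poisson_nonneg[OF q, of s] by (simp add: powr_mult)
    also have "poisson (r / R) s powr p * poisson (r / R) s powr (1 - p) = poisson (r / R) s"
      using poisson_nonneg[OF q, of s] by (simp flip: powr_add)
    also have "\<dots> \<le> 2 * R / (R - r)"
      using poisson_le(1)[OF q, of s] r by (simp add: field_simps)
    finally show "ennreal ((poisson (r / R) s * norm (F (polar R (\<theta> + s)))) powr p * poisson (r / R) s powr (1 - p))
      \<le> ennreal (2 * R / (R - r)) * ennreal (norm (F (polar R (\<theta> + s))) powr p)"
      using r by (simp add: mult_right_mono ennreal_leI flip: ennreal_mult)
  qed
  also have "\<dots> = ennreal (2 * R / (R - r)) * (\<integral>\<^sup>+s. ennreal (norm (F (polar R (\<theta> + s))) powr p) \<partial>circle)"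
    by (rule nn_integral_cmult) measurable
  also have "(\<integral>\<^sup>+s. ennreal (norm (F (polar R (\<theta> + s))) powr p) \<partial>circle) \<le> ennreal (W powr p)"
    using trace_shift[OF F, of R p \<theta> W] W r by (simp add: Lp_le_def add.commute)
  finally have "ennreal (norm (F (polar r \<theta>)) powr p) \<le> ennreal (2 * R / (R - r) * W powr p)"
    using r by (simp add: mult_left_mono ennreal_mult del: times_divide_eq_left)
  then have "norm (F (polar r \<theta>)) powr p \<le> 2 * R / (R - r) * W powr p"
    using r by (subst (asm) ennreal_le_iff) auto
  then have "(norm (F (polar r \<theta>)) powr p) powr (1 / p) \<le> (2 * R / (R - r) * W powr p) powr (1 / p)"
    using p by (intro powr_mono2) auto
  also have "(2 * R / (R - r) * W powr p) powr (1 / p) = (2 * R / (R - r)) powr (1 / p) * W"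
    using p r W0 by (subst powr_mult) (auto simp: powr_powr)
  finally show ?thesis using p by (simp add: powr_powr)
qed

section \<open>Increments along radii and circles\<close>

lemma norm_FTC_le:
  fixes f :: "real \<Rightarrow> complex"
  assumes "a \<le> b" and f: "\<And>x. x \<in> {a..b} \<Longrightarrow> (f has_vector_derivative f' x) (at x within {a..b})"
    and c: "continuous_on {a..b} f'"
  shows "ennreal (norm (f b - f a)) \<le> (\<integral>\<^sup>+x. norm (f' x) \<partial>restrict_space lborel {a..b})"
proof -
  have int: "integrable lborel (\<lambda>x. indicator {a..b} x *\<^sub>R f' x)"
    using borel_integrable_atLeastAtMost'[OF c] by (simp add: set_integrable_def)
  have "f b - f a = (LINT x|lborel. indicator {a..b} x *\<^sub>R f' x)"
    using integral_FTC_Icc[OF assms(1) f c] by simp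
  also have "ennreal (norm \<dots>) \<le> (\<integral>\<^sup>+x. norm (indicator {a..b} x *\<^sub>R f' x) \<partial>lborel)"
    by (rule integral_norm_bound_ennreal[OF int])
  also have "\<dots> = (\<integral>\<^sup>+x. norm (f' x) \<partial>restrict_space lborel {a..b})"
    by (subst nn_integral_restrict_space) (auto intro!: nn_integral_cong simp: indicator_def)
  finally show ?thesis .
qed

text \<open>Minkowski's inequality is stated for finite measures, so derivatives are integrated over
  a restriction of Lebesgue measure to a bounded interval.\<close>

lemma finite_measure_restrict_interval: "finite_measure (restrict_space lborel {a..b::real})"
  by (rule finite_measureI) (auto simp: emeasure_restrict_space emeasure_lborel_Icc_eq)

lemma radial_vector_derivative:
  assumes F: "F holomorphic_on ball 0 1" and x: "0 \<le> x" "x < 1"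
  shows "((\<lambda>x. F (polar x \<theta>)) has_vector_derivative cis \<theta> * deriv F (polar x \<theta>)) (at x within S)"
proof -
  have "of_real x * cis \<theta> \<in> ball 0 1" using x by (simp add: norm_mult)
  then have "(F has_field_derivative deriv F (polar x \<theta>)) (at (polar x \<theta>))"
    using F holomorphic_derivI by blast
  moreover have "((\<lambda>x. of_real x * cis \<theta>) has_vector_derivative cis \<theta>) (at x within S)"
    by (auto intro!: derivative_eq_intros)
  ultimately have "((F \<circ> (\<lambda>x. of_real x * cis \<theta>)) has_vector_derivative cis \<theta> * deriv F (polar x \<theta>)) (at x within S)"
    using field_vector_diff_chain_within has_field_derivative_at_within by blast
  then show ?thesis by (simp add: o_def)
qed

lemma angular_vector_derivative:
  assumes F: "F holomorphic_on ball 0 1" and r: "0 \<le> r" "r < 1"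
  shows "((\<lambda>s. F (polar r (\<theta> + s))) has_vector_derivative
     of_real r * \<i> * cis (\<theta> + s) * deriv F (polar r (\<theta> + s))) (at s within S)"
proof -
  have "of_real r * cis (\<theta> + s) \<in> ball 0 1" using r by (simp add: norm_mult)
  then have "(F has_field_derivative deriv F (polar r (\<theta> + s))) (at (polar r (\<theta> + s)))"
    using F holomorphic_derivI by blast
  moreover have "((\<lambda>s. of_real r * cis (\<theta> + s)) has_vector_derivative of_real r * \<i> * cis (\<theta> + s)) (at s within S)"
  proof -
    have "((\<lambda>s. \<i> * of_real (\<theta> + s)) has_vector_derivative \<i>) (at s within S)"
      by (auto intro!: derivative_eq_intros)
    moreover have "((\<lambda>z. of_real r * exp z) has_field_derivative of_real r * exp (\<i> * of_real (\<theta> + s)))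
        (at (\<i> * of_real (\<theta> + s)) within (\<lambda>s. \<i> * of_real (\<theta> + s)) ` S)"
      by (auto intro!: derivative_eq_intros)
    ultimately have "(((\<lambda>z. of_real r * exp z) \<circ> (\<lambda>s. \<i> * of_real (\<theta> + s))) has_vector_derivative
        \<i> * (of_real r * exp (\<i> * of_real (\<theta> + s)))) (at s within S)"
      by (rule field_vector_diff_chain_within)
    then show ?thesis by (simp add: o_def cis_conv_exp mult_ac)
  qed
  ultimately have "((F \<circ> (\<lambda>s. of_real r * cis (\<theta> + s))) has_vector_derivative
      of_real r * \<i> * cis (\<theta> + s) * deriv F (polar r (\<theta> + s))) (at s within S)"
    using field_vector_diff_chain_within has_field_derivative_at_within by blast
  then show ?thesis by (simp add: o_def)
qed

lemma continuous_pair_measurable: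
  fixes h :: "real \<times> real \<Rightarrow> complex"
  assumes "continuous_on UNIV h"
  shows "h \<in> borel_measurable (restrict_space lborel S \<Otimes>\<^sub>M borel)"
proof -
  have "(\<lambda>x. (fst x, snd x)) \<in> restrict_space lborel S \<Otimes>\<^sub>M borel \<rightarrow>\<^sub>M borel \<Otimes>\<^sub>M (borel :: real measure)"
    by (intro measurable_Pair measurable_snd measurable_compose[OF measurable_fst measurable_restrict_space1]) simp
  then have "(\<lambda>x. x) \<in> restrict_space lborel S \<Otimes>\<^sub>M borel \<rightarrow>\<^sub>M (borel :: (real \<times> real) measure)"
    by (simp add: borel_prod)
  from measurable_compose[OF this borel_measurable_continuous_onI[OF assms]] show ?thesis .
qed

lemma Lp_le_radial_increment:
  assumes p: "1 \<le> p" and F: "F holomorphic_on ball 0 1" and r: "0 \<le> r" "r \<le> R" "R < 1"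
    and W: "\<And>x. x \<in> {r..R} \<Longrightarrow> Lp_le p (\<lambda>\<theta>. deriv F (polar x \<theta>)) (W x)"
    and [measurable]: "W \<in> borel_measurable borel"
    and B: "0 \<le> B" "(\<integral>\<^sup>+x. ennreal (W x) * indicator {r..R} x \<partial>lborel) \<le> ennreal B"
  shows "Lp_le p (\<lambda>\<theta>. F (polar R \<theta>) - F (polar r \<theta>)) B"
proof (rule Minkowski_integral[OF p finite_measure_restrict_interval[of r R],
      where A="\<lambda>x \<theta>. cis \<theta> * deriv F (polar x \<theta>)" and W=W])
  have F': "deriv F holomorphic_on ball 0 1" using F by (intro holomorphic_intros) auto
  have "(\<lambda>x. of_real (fst x) * cis (snd x)) \<in> borel_measurable (restrict_space lborel {r..R} \<Otimes>\<^sub>M borel)"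
    by (intro continuous_pair_measurable continuous_intros)
  then have m: "(\<lambda>x. deriv F (polar (fst x) (snd x))) \<in> borel_measurable (restrict_space lborel {r..R} \<Otimes>\<^sub>M borel)"
    by (rule continuous_trace_measurable[OF holomorphic_on_imp_continuous_on[OF F']])
      (use r in \<open>auto simp: norm_mult space_pair_measure space_restrict_space\<close>)
  have [measurable]: "cis \<in> borel_measurable borel"
    by (intro borel_measurable_continuous_onI continuous_intros)
  show "(\<lambda>(x, \<theta>). cis \<theta> * deriv F (polar x \<theta>)) \<in> borel_measurable (restrict_space lborel {r..R} \<Otimes>\<^sub>M borel)"
    using m by (simp add: case_prod_beta')
  show "W \<in> borel_measurable (restrict_space lborel {r..R})" by (intro measurable_restrict_space1) simp
  show "Lp_le p (\<lambda>\<theta>. cis \<theta> * deriv F (polar x \<theta>)) (W x)" if "x \<in> space (restrict_space lborel {r..R})" for x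
    using W[of x] that by (simp add: Lp_le_def norm_mult space_restrict_space)
  show "(\<integral>\<^sup>+x. ennreal (W x) \<partial>restrict_space lborel {r..R}) \<le> ennreal B"
    using B by (simp add: nn_integral_restrict_space)
  show "ennreal (norm (F (polar R \<theta>) - F (polar r \<theta>)))
      \<le> (\<integral>\<^sup>+x. norm (cis \<theta> * deriv F (polar x \<theta>)) \<partial>restrict_space lborel {r..R})" for \<theta>
  proof (rule norm_FTC_le[where f="\<lambda>x. F (polar x \<theta>)"])
    show "continuous_on {r..R} (\<lambda>x. cis \<theta> * deriv F (polar x \<theta>))"
      using r by (intro continuous_intros continuous_on_compose2[OF holomorphic_on_imp_continuous_on[OF F']])
        (auto simp: norm_mult)
    show "((\<lambda>x. F (polar x \<theta>)) has_vector_derivative cis \<theta> * deriv F (polar x \<theta>)) (at x within {r..R})"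
      if "x \<in> {r..R}" for x
      using that r by (intro radial_vector_derivative[OF F]) auto
  qed (use r in simp)
qed (use B in simp)

text \<open>The derivative in the angle has modulus \<open>r\<close> times that of
  \<open>F'\<close>, and its mean is the same at every intermediate angle, so Minkowski's inequality
  yields the length \<open>\<bar>u\<bar>\<close> as a factor.\<close>

lemma Lp_le_rotation_increment:
  assumes p: "1 \<le> p" and F: "F holomorphic_on ball 0 1" and r: "0 \<le> r" "r < 1"
    and W: "Lp_le p (\<lambda>\<theta>. deriv F (polar r \<theta>)) W"
  shows "Lp_le p (\<lambda>\<theta>. F (polar r (\<theta> + u)) - F (polar r \<theta>)) (\<bar>u\<bar> * (r * W))"
proof -
  have W0: "0 \<le> W" using W by (rule Lp_le_nonneg)
  have F': "deriv F holomorphic_on ball 0 1" using F by (intro holomorphic_intros) auto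
  have [measurable]: "cis \<in> borel_measurable borel"
    by (intro borel_measurable_continuous_onI continuous_intros)
  have pos: "Lp_le p (\<lambda>\<theta>. F (polar r (\<theta> + u)) - F (polar r \<theta>)) (u * (r * W))" if u: "0 \<le> u" for u
  proof (rule Minkowski_integral[OF p finite_measure_restrict_interval[of 0 u],
      where A="\<lambda>s \<theta>. of_real r * \<i> * cis (\<theta> + s) * deriv F (polar r (\<theta> + s))" and W="\<lambda>_. r * W"])
    have "continuous_on UNIV (\<lambda>x::real \<times> real. of_real r * \<i> * cis (snd x + fst x) * deriv F (polar r (snd x + fst x)))"
      using r by (intro continuous_intros continuous_on_compose2[OF holomorphic_on_imp_continuous_on[OF F']])
        (auto simp: norm_mult)
    from continuous_pair_measurable[OF this]
    show "(\<lambda>(s, \<theta>). of_real r * \<i> * cis (\<theta> + s) * deriv F (polar r (\<theta> + s)))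
        \<in> borel_measurable (restrict_space lborel {0..u} \<Otimes>\<^sub>M borel)"
      by (simp add: case_prod_beta')
    show "Lp_le p (\<lambda>\<theta>. of_real r * \<i> * cis (\<theta> + s) * deriv F (polar r (\<theta> + s))) (r * W)" for s
    proof -
      have "Lp_le p (\<lambda>\<theta>. of_real r * deriv F (polar r (\<theta> + s))) (norm (complex_of_real r) * W)"
        by (rule Lp_le_cmult) (use p r W trace_shift[OF F' r, of p s W] trace_measurable(1)[OF F' r] in auto)
      then show ?thesis using r by (simp add: Lp_le_def norm_mult)
    qed
    show "(\<integral>\<^sup>+s. ennreal (r * W) \<partial>restrict_space lborel {0..u}) \<le> ennreal (u * (r * W))"
      using u r W0 by (simp add: emeasure_restrict_space space_restrict_space mult.commute flip: ennreal_mult)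
    show "ennreal (norm (F (polar r (\<theta> + u)) - F (polar r \<theta>)))
      \<le> (\<integral>\<^sup>+s. norm (of_real r * \<i> * cis (\<theta> + s) * deriv F (polar r (\<theta> + s))) \<partial>restrict_space lborel {0..u})" for \<theta>
    proof -
      have "ennreal (norm (F (polar r (\<theta> + u)) - F (polar r (\<theta> + 0))))
        \<le> (\<integral>\<^sup>+s. norm (of_real r * \<i> * cis (\<theta> + s) * deriv F (polar r (\<theta> + s))) \<partial>restrict_space lborel {0..u})"
      proof (rule norm_FTC_le[OF u])
        show "continuous_on {0..u} (\<lambda>s. of_real r * \<i> * cis (\<theta> + s) * deriv F (polar r (\<theta> + s)))"
          using r by (intro continuous_intros continuous_on_compose2[OF holomorphic_on_imp_continuous_on[OF F']])
            (auto simp: norm_mult)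
      qed (rule angular_vector_derivative[OF F r])
      then show ?thesis by simp
    qed
  qed (use u r W0 in auto)
  show ?thesis
  proof (cases "0 \<le> u")
    case True
    then show ?thesis using pos[of u] by simp
  next
    case False
    \<comment> \<open>A negative angle is a positive one seen from the rotated starting point; the
      shift by \<open>u\<close> and the symmetry of the norm exchange the two ends.\<close>
    have "Lp_le p (\<lambda>\<theta>. F (polar r (\<theta> + - u)) - F (polar r \<theta>)) (\<bar>u\<bar> * (r * W))"
      using pos[of "-u"] False by simp
    then have "Lp_le p (\<lambda>\<theta>. F (polar r (\<theta> + u + - u)) - F (polar r (\<theta> + u))) (\<bar>u\<bar> * (r * W))"
    proof (subst Lp_le_shift[where s=u and \<phi>="\<lambda>\<theta>. F (polar r (\<theta> + - u)) - F (polar r \<theta>)"])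
      show "F (polar r (x + 2 * pi + - u)) - F (polar r (x + 2 * pi))
          = F (polar r (x + - u)) - F (polar r x)" for x
        using cis_period[of "x - u"] cis_period[of x] by (simp add: algebra_simps)
    qed (intro borel_measurable_diff trace_measurable F r)
    then show ?thesis by (simp add: Lp_le_def norm_minus_commute)
  qed
qed

section \<open>Hardy spaces\<close>

text \<open>Passes from the Lebesgue integrals of the definitions to the measure
  \<open>circle\<close>. When the integral diverges, both sides take the default value 0.\<close>

lemma set_LINT_period:
  fixes \<psi> :: "real \<Rightarrow> real"
  assumes [measurable]: "\<psi> \<in> borel_measurable borel" and pos: "\<And>x. 0 \<le> \<psi> x"
    and per: "\<And>x. \<psi> (x + 2 * pi) = \<psi> x"
  shows "(LINT \<theta>:{0..2*pi}|lebesgue. \<psi> \<theta>) / (2 * pi) = enn2real (\<integral>\<^sup>+\<theta>. \<psi> \<theta> \<partial>circle)"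
proof -
  define X where "X = (\<integral>\<^sup>+\<theta>. ennreal (\<psi> \<theta>) * indicator {0..2*pi} \<theta> \<partial>lborel)"
  have "(LINT \<theta>:{0..2*pi}|lebesgue. \<psi> \<theta>) = (LINT \<theta>|lborel. indicator {0..2*pi} \<theta> *\<^sub>R \<psi> \<theta>)"
    unfolding set_lebesgue_integral_def by (rule integral_completion) auto
  also have "\<dots> = enn2real (\<integral>\<^sup>+\<theta>. ennreal (indicator {0..2*pi} \<theta> *\<^sub>R \<psi> \<theta>) \<partial>lborel)"
    using pos by (intro integral_eq_nn_integral) auto
  also have "(\<integral>\<^sup>+\<theta>. ennreal (indicator {0..2*pi} \<theta> *\<^sub>R \<psi> \<theta>) \<partial>lborel) = X"
    unfolding X_def by (intro nn_integral_cong) (auto simp: indicator_def)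
  finally have 1: "(LINT \<theta>:{0..2*pi}|lebesgue. \<psi> \<theta>) = enn2real X" .
  have 2: "(\<integral>\<^sup>+\<theta>. \<psi> \<theta> \<partial>circle) = X / ennreal (2 * pi)"
    using nn_integral_circle_interval[of "\<lambda>x. ennreal (\<psi> x)" 0] per by (simp add: X_def)
  show ?thesis unfolding 1 2
    by (cases X) (auto simp: divide_ennreal ennreal_top_divide)
qed

text \<open>The hypothesis \<open>fin\<close> guards against the default value: a divergent integral
  would make the left-hand mean 0 while the relation on the right fails.\<close>

lemma mean_le_iff_Lp_le:
  assumes [measurable]: "\<phi> \<in> borel_measurable borel" and per: "\<And>x. \<phi> (x + 2 * pi) = \<phi> x"
    and p: "0 < p" and fin: "Lp_le p \<phi> C"
  shows "((LINT \<theta>:{0..2*pi}|lebesgue. norm (\<phi> \<theta>) powr p) / (2 * pi)) powr (1 / p) \<le> W \<longleftrightarrow> Lp_le p \<phi> W"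
proof -
  define Y where "Y = (\<integral>\<^sup>+\<theta>. ennreal (norm (\<phi> \<theta>) powr p) \<partial>circle)"
  have "Y \<noteq> top" using fin by (auto simp: Lp_le_def Y_def[symmetric] top_unique)
  then obtain y where y: "0 \<le> y" "Y = ennreal y" by (cases Y) auto
  have *: "(LINT \<theta>:{0..2*pi}|lebesgue. norm (\<phi> \<theta>) powr p) / (2 * pi) = y"
    using set_LINT_period[of "\<lambda>\<theta>. norm (\<phi> \<theta>) powr p"] per y by (simp add: Y_def)
  show ?thesis unfolding * Lp_le_def Y_def[symmetric] y(2)
  proof safe
    assume le: "y powr (1 / p) \<le> W"
    then show W: "0 \<le> W" using powr_ge_zero order_trans by blast
    from le have "(y powr (1 / p)) powr p \<le> W powr p" using p by (intro powr_mono2) auto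
    then show "ennreal y \<le> ennreal (W powr p)" using p y by (simp add: powr_powr ennreal_leI)
  next
    assume "0 \<le> W" "ennreal y \<le> ennreal (W powr p)"
    then have "y powr (1 / p) \<le> (W powr p) powr (1 / p)" using p y by (intro powr_mono2) auto
    then show "y powr (1 / p) \<le> W" using p \<open>0 \<le> W\<close> by (simp add: powr_powr)
  qed
qed

lemma trace_bounded:
  assumes F: "F holomorphic_on ball 0 1" and r: "0 \<le> r" "r < 1"
  obtains C where "\<And>\<theta>. norm (F (polar r \<theta>)) \<le> C"
proof -
  have "compact (F ` sphere 0 r)"
    using r by (intro compact_continuous_image holomorphic_on_imp_continuous_on holomorphic_on_subset[OF F]) auto
  then obtain C where "\<And>z. z \<in> sphere 0 r \<Longrightarrow> norm (F z) \<le> C"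
    by (meson bounded_iff compact_imp_bounded image_eqI)
  then have "norm (F (polar r \<theta>)) \<le> C" for \<theta> using r by (simp add: norm_mult)
  then show ?thesis by (rule that)
qed

lemma integral_mean_le_iff:
  assumes F: "F holomorphic_on ball 0 1" and r: "0 \<le> r" "r < 1" and p: "0 < p"
  shows "integral_mean p r F \<le> W \<longleftrightarrow> Lp_le p (\<lambda>\<theta>. F (polar r \<theta>)) W"
proof -
  obtain C where "\<And>\<theta>. norm (F (polar r \<theta>)) \<le> C" using trace_bounded[OF F r] by metis
  then have "Lp_le p (\<lambda>\<theta>. F (polar r \<theta>)) C" using p by (rule Lp_le_sup)
  then show ?thesis unfolding integral_mean_def
    by (intro mean_le_iff_Lp_le) (use trace_measurable[OF F r] p in auto)
qed

lemma integral_mean_nonneg: "0 \<le> integral_mean p r F"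
  by (simp add: integral_mean_def)

lemma Lp_le_integral_mean:
  assumes "F holomorphic_on ball 0 1" "0 \<le> r" "r < 1" "0 < p"
  shows "Lp_le p (\<lambda>\<theta>. F (polar r \<theta>)) (integral_mean p r F)"
  using integral_mean_le_iff[OF assms, of "integral_mean p r F"] by simp

section \<open>Hardy spaces through bounds on circles\<close>

lemma Hardy_holomorphic: "F \<in> Hardy p \<Longrightarrow> F holomorphic_on ball 0 1"
  by (simp add: Hardy_def)

lemma HardyI:
  assumes F: "F holomorphic_on ball 0 1" and p: "0 < p"
    and C: "\<And>r. 0 < r \<Longrightarrow> r < 1 \<Longrightarrow> Lp_le p (\<lambda>\<theta>. F (polar r \<theta>)) C"
  shows "F \<in> Hardy p" "Hardy_norm p F \<le> C"
proof -
  have le: "integral_mean p r F \<le> C" if "r \<in> {0<..<1}" for r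
    using that C[of r] integral_mean_le_iff[OF F, of r p] p by auto
  then have "bdd_above ((\<lambda>r. integral_mean p r F) ` {0<..<1})" by (rule bdd_aboveI2)
  then show "F \<in> Hardy p" using F by (simp add: Hardy_def)
  show "Hardy_norm p F \<le> C" unfolding Hardy_norm_def
    by (rule cSUP_least) (use le in auto)
qed

lemma Hardy_Lp_le:
  assumes F: "F \<in> Hardy p" and p: "1 \<le> p" and r: "0 \<le> r" "r < 1"
  shows "Lp_le p (\<lambda>\<theta>. F (polar r \<theta>)) (Hardy_norm p F)"
proof -
  have hol: "F holomorphic_on ball 0 1" using F by (rule Hardy_holomorphic)
  \<comment> \<open>The supremum in the norm ranges over \<open>0 < r < 1\<close>; moving to a
    larger radius makes the bound available at \<open>r = 0\<close> too.\<close>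
  define R where "R = (r + 1) / 2"
  have R: "0 < R" "r \<le> R" "R < 1" using r by (auto simp: R_def)
  have "integral_mean p R F \<le> Hardy_norm p F"
    unfolding Hardy_norm_def using F R by (intro cSUP_upper) (auto simp: Hardy_def)
  then have "Lp_le p (\<lambda>\<theta>. F (polar R \<theta>)) (Hardy_norm p F)"
    using integral_mean_le_iff[OF hol, of R p] R p by simp
  then show ?thesis using Lp_le_radius_mono[OF p hol, of r R] r R by blast
qed

lemma Hardy_norm_nonneg:
  assumes "F \<in> Hardy p" "1 \<le> p"
  shows "0 \<le> Hardy_norm p F"
  using Hardy_Lp_le[OF assms, of 0] by (auto dest: Lp_le_nonneg)

section \<open>Uniform convexity for exponents above 1\<close>

lemma powr_midpoint_strict:
  fixes x y p :: real
  assumes p: "1 < p" and xy: "0 \<le> x" "x < y"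
  shows "((x + y) / 2) powr p < (x powr p + y powr p) / 2"
proof -
  let ?m = "(x + y) / 2"
  have cont: "continuous_on {a..b} (\<lambda>x. x powr p)" if "0 \<le> a" for a b :: real
    using that p by (intro continuous_on_powr' continuous_intros) auto
  have der: "((\<lambda>x. x powr p) has_derivative (\<lambda>h. h * (p * z powr (p - 1)))) (at z)" if "0 < z" for z :: real
    using has_real_derivative_powr[OF that, of p] by (simp add: has_field_derivative_def mult_commute_abs)
  have mv: "\<exists>\<xi>. a < \<xi> \<and> \<xi> < b \<and> b powr p - a powr p = (b - a) * (p * \<xi> powr (p - 1))" if ab: "0 \<le> a" "a < b" for a b :: real
  proof -
    obtain \<xi> where "a < \<xi>" "\<xi> < b" "b powr p - a powr p = (b - a) * (p * \<xi> powr (p - 1))"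
      by (rule mvt[OF ab(2) cont[OF ab(1)] der]) (use ab in auto)
    then show ?thesis by blast
  qed
  obtain \<xi> where \<xi>: "x < \<xi>" "\<xi> < ?m" "?m powr p - x powr p = (?m - x) * (p * \<xi> powr (p - 1))"
    using mv[of x ?m] xy by auto
  obtain \<zeta> where \<zeta>: "?m < \<zeta>" "\<zeta> < y" "y powr p - ?m powr p = (y - ?m) * (p * \<zeta> powr (p - 1))"
    using mv[of ?m y] xy by auto
  have "\<xi> powr (p - 1) < \<zeta> powr (p - 1)"
    using \<xi> \<zeta> xy p by (intro powr_less_mono2) auto
  then have "(y - x) / 2 * (p * \<xi> powr (p - 1)) < (y - x) / 2 * (p * \<zeta> powr (p - 1))"
    using p xy by (intro mult_strict_left_mono) auto
  moreover have "?m - x = (y - x) / 2" by (simp add: field_simps)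
  moreover have "y - ?m = (y - x) / 2" by (simp add: field_simps)
  ultimately have "?m powr p - x powr p < y powr p - ?m powr p"
    unfolding \<xi>(3) \<zeta>(3) by presburger
  then show ?thesis by simp
qed

text \<open>Strictness has two sources: for different moduli the power function is strictly convex,
  and for equal moduli the parallelogram law makes the midpoint shorter.\<close>

lemma norm_midpoint_powr:
  fixes a b :: complex
  assumes p: "1 < p"
  shows "norm ((a + b) / 2) powr p \<le> (norm a powr p + norm b powr p) / 2"
    and "a \<noteq> b \<Longrightarrow> norm ((a + b) / 2) powr p < (norm a powr p + norm b powr p) / 2"
proof -
  have tri: "norm ((a + b) / 2) \<le> (norm a + norm b) / 2"
    using norm_triangle_ineq[of a b] by (simp add: norm_divide)
  then have 1: "norm ((a + b) / 2) powr p \<le> ((norm a + norm b) / 2) powr p"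
    using p by (intro powr_mono2) auto
  have 2: "((norm a + norm b) / 2) powr p < (norm a powr p + norm b powr p) / 2" if "norm a \<noteq> norm b"
    using powr_midpoint_strict[OF p, of "norm a" "norm b"] powr_midpoint_strict[OF p, of "norm b" "norm a"] that
    by (cases "norm a < norm b") (auto simp: add.commute)
  show "norm ((a + b) / 2) powr p \<le> (norm a powr p + norm b powr p) / 2"
    using 1 2 by (cases "norm a = norm b") auto
  assume ab: "a \<noteq> b"
  show "norm ((a + b) / 2) powr p < (norm a powr p + norm b powr p) / 2"
  proof (cases "norm a = norm b")
    case True
    have "(norm (a + b))\<^sup>2 + (norm (a - b))\<^sup>2 = 2 * (norm a)\<^sup>2 + 2 * (norm b)\<^sup>2"
      unfolding cmod_power2 by (simp add: power2_eq_square algebra_simps)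
    moreover have "(norm (a - b))\<^sup>2 > 0" using ab by simp
    moreover have "(2 * norm a)\<^sup>2 = 2 * (norm a)\<^sup>2 + 2 * (norm b)\<^sup>2" using True by (simp add: power_mult_distrib)
    ultimately have "(norm (a + b))\<^sup>2 < (2 * norm a)\<^sup>2" by linarith
    then have "norm (a + b) < 2 * norm a" by (rule power2_less_imp_less) simp
    then have "norm ((a + b) / 2) powr p < norm a powr p"
      using p by (intro powr_less_mono2) (auto simp: norm_divide)
    then show ?thesis using True by simp
  qed (use 1 2 in auto)
qed

text \<open>By homogeneity it suffices to treat \<open>|a|\<^sup>p + |b|\<^sup>p = 1\<close>, where compactness applies.\<close>

lemma uniform_convexity_pointwise:
  fixes p \<epsilon> :: real
  assumes p: "1 < p" and \<epsilon>: "0 < \<epsilon>"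
  obtains C where "0 \<le> C" "\<And>a b :: complex. norm (a - b) powr p \<le> \<epsilon> * (norm a powr p + norm b powr p)
     + C * ((norm a powr p + norm b powr p) / 2 - norm ((a + b) / 2) powr p)"
proof -
  define S where "S = {z :: complex \<times> complex. norm (fst z) powr p + norm (snd z) powr p = 1 \<and> \<epsilon> \<le> norm (fst z - snd z) powr p}"
  define D where "D = (\<lambda>z :: complex \<times> complex. 1 / 2 - norm ((fst z + snd z) / 2) powr p)"
  have contp: "continuous_on UNIV (\<lambda>z :: complex \<times> complex. norm (f z) powr p)" if "continuous_on UNIV f" for f :: "_ \<Rightarrow> complex"
    using that p by (intro continuous_on_powr' continuous_intros) auto
  have contD: "continuous_on UNIV D" unfolding D_def by (intro continuous_on_diff continuous_on_const contp continuous_intros) auto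
  have le1: "norm x \<le> 1" if "norm x powr p \<le> 1" for x :: complex
  proof (rule ccontr)
    assume "\<not> norm x \<le> 1"
    then have "1 powr p < norm x powr p" using p by (intro powr_less_mono2) auto
    then show False using that by simp
  qed
  have bd: "S \<subseteq> cball 0 1 \<times> cball 0 1"
  proof
    fix z assume "z \<in> S"
    then have "norm (fst z) powr p + norm (snd z) powr p = 1" by (simp add: S_def)
    then have "norm (fst z) powr p \<le> 1" "norm (snd z) powr p \<le> 1"
      using powr_ge_zero[of "norm (fst z)" p] powr_ge_zero[of "norm (snd z)" p] by linarith+
    then show "z \<in> cball 0 1 \<times> cball 0 1" using le1 by (simp add: mem_Times_iff)
  qed
  have "closed S" unfolding S_def
    by (intro closed_Collect_conj closed_Collect_eq closed_Collect_le continuous_on_add continuous_on_const contp continuous_intros)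
  moreover have "bounded S" using bd by (rule bounded_subset[rotated]) (intro bounded_Times bounded_cball)
  ultimately have "compact S" by (simp add: compact_eq_bounded_closed)
  have Dpos: "0 < D z" if "z \<in> S" for z
  proof -
    have "fst z \<noteq> snd z" using that \<epsilon> by (auto simp: S_def)
    then show ?thesis using norm_midpoint_powr(2)[OF p, of "fst z" "snd z"] that by (simp add: D_def S_def)
  qed
  obtain d where d: "0 < d" "\<And>z. z \<in> S \<Longrightarrow> d \<le> D z"
  proof (cases "S = {}")
    case False
    then obtain z where "z \<in> S" "\<And>y. y \<in> S \<Longrightarrow> D z \<le> D y"
      using continuous_attains_inf[OF \<open>compact S\<close> False continuous_on_subset[OF contD]] by auto
    then show ?thesis using Dpos by (intro that[of "D z"]) auto
  qed (use that[of 1] in auto)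
  \<comment> \<open>On \<open>S\<close> the midpoint defect is at least \<open>d\<close> while
    \<open>norm (a - b) powr p\<close> is at most \<open>2 powr p = C * d\<close>; off
    \<open>S\<close> the term with \<open>\<epsilon>\<close> suffices because the defect is
    nonnegative.\<close>
  define C where "C = 2 powr p / d"
  have C0: "0 \<le> C" using d by (simp add: C_def)
  show thesis
  proof (rule that[OF C0])
    fix a b :: complex
    define N where "N = norm a powr p + norm b powr p"
    show "norm (a - b) powr p \<le> \<epsilon> * (norm a powr p + norm b powr p)
       + C * ((norm a powr p + norm b powr p) / 2 - norm ((a + b) / 2) powr p)"
    proof (cases "N = 0")
      case True
      then have "norm a powr p = 0" "norm b powr p = 0"
        unfolding N_def using add_nonneg_eq_0_iff[OF powr_ge_zero powr_ge_zero] by blast+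
      then show ?thesis using p by simp
    next
      case False
      then have N: "0 < N" unfolding N_def using powr_ge_zero[of "norm a" p] powr_ge_zero[of "norm b" p] by linarith
      define c where "c = N powr (1 / p)"
      have c: "0 < c" "c powr p = N" using N p by (auto simp: c_def powr_powr)
      define a' b' where "a' = a / of_real c" and "b' = b / of_real c"
      have sc: "norm (x / of_real c) powr p = norm x powr p / N" for x :: complex
        using c by (simp add: norm_divide powr_divide)
      have s1: "norm a' powr p + norm b' powr p = 1"
        unfolding a'_def b'_def sc using N by (simp add: N_def add_divide_distrib[symmetric])
      have s2: "norm (a' - b') powr p = norm (a - b) powr p / N"
        using sc[of "a - b"] by (simp add: a'_def b'_def diff_divide_distrib)
      have s3: "norm ((a' + b') / 2) powr p = norm ((a + b) / 2) powr p / N"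
        using sc[of "(a + b) / 2"] by (simp add: a'_def b'_def add_divide_distrib mult.commute)
      have "norm (a' - b') powr p \<le> \<epsilon> + C * (1 / 2 - norm ((a' + b') / 2) powr p)"
      proof (cases "\<epsilon> \<le> norm (a' - b') powr p")
        case True
        then have "(a', b') \<in> S" using s1 by (simp add: S_def)
        then have dD: "d \<le> 1 / 2 - norm ((a' + b') / 2) powr p" and "(a', b') \<in> cball 0 1 \<times> cball 0 1"
          using d(2)[of "(a', b')"] bd by (auto simp: D_def)
        then have "norm (a' - b') \<le> 2"
          using norm_triangle_ineq4[of a' b'] by auto
        then have "norm (a' - b') powr p \<le> 2 powr p" using p by (intro powr_mono2) auto
        also have "\<dots> = C * d" using d by (simp add: C_def)
        also have "\<dots> \<le> C * (1 / 2 - norm ((a' + b') / 2) powr p)" using dD C0 by (rule mult_left_mono)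
        finally show ?thesis using \<epsilon> by simp
      next
        case False
        have "0 \<le> C * (1 / 2 - norm ((a' + b') / 2) powr p)"
          using C0 norm_midpoint_powr(1)[OF p, of a' b'] s1 by simp
        then show ?thesis using False by simp
      qed
      then have "N * (norm (a - b) powr p / N) \<le> N * (\<epsilon> + C * (1 / 2 - norm ((a + b) / 2) powr p / N))"
        unfolding s2 s3 using N by (intro mult_left_mono) auto
      then show ?thesis using N unfolding N_def[symmetric] by (simp add: algebra_simps)
    qed
  qed
qed

text \<open>Uniform convexity makes the dilates of \<open>g\<close> Cauchy: their midpoints are almost as large as the
  norm of \<open>g\<close>, since dilating further only decreases the norm.\<close>

lemma Hardy_dilates_Cauchy:
  assumes g: "g \<in> Hardy p" and p: "1 < p" and \<epsilon>: "0 < \<epsilon>"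
  obtains r0 where "0 < r0" "r0 < 1"
    "\<And>r s. r0 \<le> r \<Longrightarrow> r < 1 \<Longrightarrow> r0 \<le> s \<Longrightarrow> s < 1 \<Longrightarrow>
       Lp_le p (\<lambda>\<theta>. g (polar r \<theta>) - g (polar s \<theta>)) \<epsilon>"
proof -
  have hol: "g holomorphic_on ball 0 1" using g by (rule Hardy_holomorphic)
  define M where "M = Hardy_norm p g"
  have M0: "0 \<le> M" using Hardy_norm_nonneg[OF g] p by (simp add: M_def)
  \<comment> \<open>The convexity inequality with this \<open>e\<close> spends half of
    \<open>\<epsilon> powr p\<close> on the norms; the other half is kept for the midpoint defect.
    Adding 1 covers \<open>M = 0\<close>.\<close>
  define e where "e = \<epsilon> powr p / (4 * (M powr p + 1))"
  have Mp: "0 < M powr p + 1" using powr_ge_zero[of M p] by linarith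
  have e0: "0 < e" using \<epsilon> Mp by (simp add: e_def)
  have e1: "e * (2 * M powr p) \<le> \<epsilon> powr p / 2"
  proof -
    have "e * (2 * M powr p) \<le> e * (2 * (M powr p + 1))" using e0 by (intro mult_left_mono) auto
    also have "\<dots> = \<epsilon> powr p / 2" using Mp by (simp add: e_def field_simps)
    finally show ?thesis .
  qed
  obtain C where C: "0 \<le> C" "\<And>a b :: complex. norm (a - b) powr p \<le> e * (norm a powr p + norm b powr p)
     + C * ((norm a powr p + norm b powr p) / 2 - norm ((a + b) / 2) powr p)"
    using uniform_convexity_pointwise[OF p e0] by blast
  have "((\<lambda>\<delta>. C * (M powr p - max 0 (M - 2 * \<delta>) powr p)) \<longlongrightarrow> C * (M powr p - max 0 (M - 2 * 0) powr p)) (at_right 0)"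
    using p by (intro tendsto_intros tendsto_powr') auto
  then have "((\<lambda>\<delta>. C * (M powr p - max 0 (M - 2 * \<delta>) powr p)) \<longlongrightarrow> 0) (at_right 0)"
    using M0 by simp
  then have "eventually (\<lambda>\<delta>. C * (M powr p - max 0 (M - 2 * \<delta>) powr p) < \<epsilon> powr p / 2) (at_right 0)"
    by (rule order_tendstoD) (use \<epsilon> in simp)
  then have "eventually (\<lambda>\<delta>. 0 < \<delta> \<and> C * (M powr p - max 0 (M - 2 * \<delta>) powr p) < \<epsilon> powr p / 2) (at_right 0)"
    using eventually_at_right_less by (rule eventually_elim2) auto
  then obtain \<delta> where \<delta>: "0 < \<delta>" "C * (M powr p - max 0 (M - 2 * \<delta>) powr p) < \<epsilon> powr p / 2"
    using eventually_happens'[OF trivial_limit_at_right_real] by blast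
  \<comment> \<open>At radius \<open>t\<close> the mean nearly attains the norm. Uniform continuity
    on \<open>cball 0 t\<close> then makes a further dilation by a factor close to 1 change
    \<open>g\<close> by at most \<open>\<delta>\<close> there.\<close>
  obtain t where t: "0 < t" "t < 1" "M - \<delta> < integral_mean p t g"
  proof -
    have "M - \<delta> < (SUP r\<in>{0<..<1}. integral_mean p r g)" using \<delta> by (simp add: M_def Hardy_norm_def)
    then show ?thesis using g that by (subst (asm) less_cSUP_iff) (auto simp: Hardy_def)
  qed
  have "uniformly_continuous_on (cball 0 t) g"
    using t by (intro compact_uniformly_continuous holomorphic_on_imp_continuous_on holomorphic_on_subset[OF hol]) auto
  then obtain d where d: "0 < d" "\<And>x y. x \<in> cball 0 t \<Longrightarrow> y \<in> cball 0 t \<Longrightarrow> dist y x < d \<Longrightarrow> dist (g y) (g x) < \<delta>"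
    using \<delta>(1) unfolding uniformly_continuous_on_def by metis
  define r0 where "r0 = max (1 / 2) (1 - d / 2)"
  have r0: "0 < r0" "r0 < 1" "1 - r0 < d" using d by (auto simp: r0_def)
  have close: "norm (g (polar (t * r) \<theta>) - g (polar t \<theta>)) \<le> \<delta>" if "r0 \<le> r" "r < 1" for r \<theta>
  proof -
    have "of_real (t * r) * cis \<theta> - of_real t * cis \<theta> = of_real (t * (r - 1)) * cis \<theta>" by (simp add: algebra_simps)
    then have "dist (polar (t * r) \<theta>) (polar t \<theta>) = t * (1 - r)"
      using t that r0 by (simp only: dist_norm norm_mult norm_of_real norm_cis) (simp add: abs_mult)
    also have "\<dots> \<le> 1 * (1 - r)" using t that by (intro mult_right_mono) auto
    also have "\<dots> < d" using that r0 by simp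
    finally have "dist (polar (t * r) \<theta>) (polar t \<theta>) < d" .
    moreover have "t * r \<le> t" using t that by (simp add: mult_left_le)
    ultimately show ?thesis using d(2)[of "of_real t * cis \<theta>" "of_real (t * r) * cis \<theta>"] t that r0
      by (auto simp: dist_norm norm_mult abs_mult)
  qed
  have main: "Lp_le p (\<lambda>\<theta>. g (polar r \<theta>) - g (polar s \<theta>)) \<epsilon>"
    if rs: "r0 \<le> s" "s \<le> r" "r < 1" for r s
  proof -
    have s: "0 < s" "s < 1" "0 < r" using rs r0 by auto
    \<comment> \<open>At radius \<open>r\<close> this is the midpoint of the dilates with radii
      \<open>r\<close> and \<open>s\<close>. Its mean at \<open>r\<close> dominates its mean at
      \<open>t * r\<close>, where both dilates are within \<open>\<delta>\<close> of
      \<open>g\<close> at radius \<open>t\<close>; hence \<open>X\<close> is at least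
      \<open>M - 2 * \<delta>\<close>.\<close>
    define mid where "mid = (\<lambda>z. (g z + g (of_real (s / r) * z)) / 2)"
    have srz: "of_real (s / r) * z \<in> ball 0 1" if "z \<in> ball 0 1" for z :: complex
    proof -
      have "norm (of_real (s / r) * z) \<le> 1 * norm z" unfolding norm_mult norm_of_real using s rs by (intro mult_right_mono) auto
      then show ?thesis using that by simp
    qed
    have midhol: "mid holomorphic_on ball 0 1"
      unfolding mid_def using srz by (intro holomorphic_intros hol holomorphic_on_compose_gen[OF _ hol, unfolded o_def]) auto
    define X where "X = integral_mean p r mid"
    have X0: "0 \<le> X" by (simp add: X_def integral_mean_nonneg)
    have LX: "Lp_le p (\<lambda>\<theta>. mid (polar r \<theta>)) X"
      unfolding X_def using s rs p by (intro Lp_le_integral_mean midhol) auto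
    have midr: "mid (polar (t * r) \<theta>) = (g (polar (t * r) \<theta>) + g (polar (t * s) \<theta>)) / 2" for t \<theta>
    proof -
      have "of_real (s / r) * (polar (t * r) \<theta>) = of_real (s / r * (t * r)) * cis \<theta>" by simp
      also have "s / r * (t * r) = t * s" using s by simp
      finally show ?thesis by (simp add: mid_def)
    qed
    have tr: "0 \<le> t * r" "t * r \<le> r" "t * r < 1" using s rs t by (auto simp: mult_le_cancel_right1 intro: le_less_trans[of _ r])
    have "Lp_le p (\<lambda>\<theta>. mid (polar (t * r) \<theta>)) X"
      using LX Lp_le_radius_mono[of p mid "t * r" r X] midhol p tr rs by auto
    moreover have "Lp_le p (\<lambda>\<theta>. g (polar t \<theta>) - mid (polar (t * r) \<theta>)) \<delta>"
    proof (rule Lp_le_sup)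
      fix \<theta>
      have "g (polar t \<theta>) - mid (polar (t * r) \<theta>)
          = - ((g (polar (t * r) \<theta>) - g (polar t \<theta>)) + (g (polar (t * s) \<theta>) - g (polar t \<theta>))) / 2"
        unfolding midr by (simp add: field_simps)
      also have "norm \<dots> = norm ((g (polar (t * r) \<theta>) - g (polar t \<theta>)) + (g (polar (t * s) \<theta>) - g (polar t \<theta>))) / 2"
        by (simp only: norm_divide norm_minus_cancel norm_numeral)
      also have "\<dots> \<le> (\<delta> + \<delta>) / 2"
        by (intro divide_right_mono order_trans[OF norm_triangle_ineq] add_mono close) (use rs in auto)
      finally show "norm (g (polar t \<theta>) - mid (polar (t * r) \<theta>)) \<le> \<delta>" by simp
    qed (use p in simp)
    ultimately have "Lp_le p (\<lambda>\<theta>. mid (polar (t * r) \<theta>) + (g (polar t \<theta>) - mid (polar (t * r) \<theta>))) (X + \<delta>)"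
      using p by (intro Lp_le_add borel_measurable_diff trace_measurable hol midhol) (use tr t in auto)
    then have "integral_mean p t g \<le> X + \<delta>"
      using integral_mean_le_iff[OF hol, of t p] t p by simp
    then have "max 0 (M - 2 * \<delta>) \<le> X" using t X0 by simp
    then have Xp: "max 0 (M - 2 * \<delta>) powr p \<le> X powr p" using p by (intro powr_mono2) auto
    have [measurable]: "(\<lambda>\<theta>. g (polar r \<theta>)) \<in> borel_measurable borel" "(\<lambda>\<theta>. g (polar s \<theta>)) \<in> borel_measurable borel"
       "(\<lambda>\<theta>. mid (polar r \<theta>)) \<in> borel_measurable borel"
      using trace_measurable(2)[OF hol] trace_measurable(2)[OF midhol] s rs by auto
    have Mle: "(\<integral>\<^sup>+\<theta>. ennreal (norm (g (polar x \<theta>)) powr p) \<partial>circle) \<le> ennreal (M powr p)" if "0 \<le> x" "x < 1" for x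
      using Hardy_Lp_le[OF g, of x] p that by (simp add: Lp_le_def M_def)
    let ?a = "\<lambda>\<theta>. norm (g (polar r \<theta>)) powr p" and ?b = "\<lambda>\<theta>. norm (g (polar s \<theta>)) powr p"
    let ?m = "\<lambda>\<theta>. norm (mid (polar r \<theta>)) powr p"
    let ?d = "\<lambda>\<theta>. norm (g (polar r \<theta>) - g (polar s \<theta>)) powr p"
    have Xeq: "(\<integral>\<^sup>+\<theta>. ennreal (?m \<theta>) \<partial>circle) = ennreal (X powr p)"
    proof -
      have "(\<integral>\<^sup>+\<theta>. ennreal (?m \<theta>) \<partial>circle) \<noteq> top"
        using LX by (auto simp: Lp_le_def top_unique)
      then have "(\<integral>\<^sup>+\<theta>. ennreal (?m \<theta>) \<partial>circle) = ennreal (enn2real (\<integral>\<^sup>+\<theta>. ennreal (?m \<theta>) \<partial>circle))"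
        by (simp add: less_top)
      also have "enn2real (\<integral>\<^sup>+\<theta>. ennreal (?m \<theta>) \<partial>circle) = (LINT \<theta>:{0..2*pi}|lebesgue. ?m \<theta>) / (2 * pi)"
        by (rule set_LINT_period[symmetric]) auto
      also have "\<dots> = X powr p"
      proof -
        have nn: "0 \<le> (LINT \<theta>:{0..2*pi}|lebesgue. ?m \<theta>)"
          by (auto simp: set_lebesgue_integral_def intro!: integral_nonneg)
        then show ?thesis using p by (simp add: X_def integral_mean_def powr_powr)
      qed
      finally show ?thesis .
    qed
    have "(\<integral>\<^sup>+\<theta>. ennreal (?d \<theta>) \<partial>circle) + ennreal C * (\<integral>\<^sup>+\<theta>. ennreal (?m \<theta>) \<partial>circle)
      = (\<integral>\<^sup>+\<theta>. ennreal (?d \<theta> + C * ?m \<theta>) \<partial>circle)"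
      using C by (simp add: nn_integral_add nn_integral_cmult ennreal_mult)
    also have "\<dots> \<le> (\<integral>\<^sup>+\<theta>. ennreal ((e + C / 2) * (?a \<theta> + ?b \<theta>)) \<partial>circle)"
    proof (intro nn_integral_mono ennreal_leI)
      fix \<theta>
      have midr1: "mid (polar r \<theta>) = (g (polar r \<theta>) + g (polar s \<theta>)) / 2"
        using midr[of 1 \<theta>] by simp
      have "?d \<theta> \<le> e * (?a \<theta> + ?b \<theta>) + C * ((?a \<theta> + ?b \<theta>) / 2 - ?m \<theta>)"
        unfolding midr1 by (rule C(2))
      moreover have "D \<le> e * A + C * (A / 2 - m) \<Longrightarrow> D + C * m \<le> (e + C / 2) * A" for A D m :: real
        by (simp add: field_simps)
      ultimately show "?d \<theta> + C * ?m \<theta> \<le> (e + C / 2) * (?a \<theta> + ?b \<theta>)" by blast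
    qed
    also have "\<dots> = ennreal (e + C / 2) * ((\<integral>\<^sup>+\<theta>. ?a \<theta> \<partial>circle) + (\<integral>\<^sup>+\<theta>. ?b \<theta> \<partial>circle))"
      using C e0 by (simp add: nn_integral_add nn_integral_cmult ennreal_mult)
    also have "\<dots> \<le> ennreal (e + C / 2) * (ennreal (M powr p) + ennreal (M powr p))"
      using s rs by (intro mult_left_mono add_mono Mle) auto
    also have "\<dots> = ennreal (e * (2 * M powr p) + C * M powr p)"
      using C e0 by (simp add: algebra_simps flip: ennreal_plus ennreal_mult)
    also have "\<dots> \<le> ennreal (\<epsilon> powr p / 2 + C * M powr p)"
      using e1 by (intro ennreal_leI) auto
    finally have fin: "(\<integral>\<^sup>+\<theta>. ennreal (?d \<theta>) \<partial>circle) + ennreal (C * X powr p) \<le> ennreal (\<epsilon> powr p / 2 + C * M powr p)"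
      using C by (simp add: Xeq ennreal_mult)
    then have "(\<integral>\<^sup>+\<theta>. ennreal (?d \<theta>) \<partial>circle) \<noteq> top" by (auto simp: top_unique)
    then obtain y where y: "0 \<le> y" "(\<integral>\<^sup>+\<theta>. ennreal (?d \<theta>) \<partial>circle) = ennreal y" by (cases "(\<integral>\<^sup>+\<theta>. ennreal (?d \<theta>) \<partial>circle)") auto
    have "y + C * X powr p \<le> \<epsilon> powr p / 2 + C * M powr p"
      using fin y C by (simp flip: ennreal_plus)
    moreover have "C * max 0 (M - 2 * \<delta>) powr p \<le> C * X powr p" using Xp C by (intro mult_left_mono)
    ultimately have "y \<le> \<epsilon> powr p" using \<delta>(2) by (simp add: algebra_simps)
    then show ?thesis using y \<epsilon> by (simp add: Lp_le_def ennreal_leI)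
  qed
  show thesis
  proof (rule that[OF r0(1,2)])
    fix r s assume rs: "r0 \<le> r" "r < 1" "r0 \<le> s" "s < 1"
    show "Lp_le p (\<lambda>\<theta>. g (polar r \<theta>) - g (polar s \<theta>)) \<epsilon>"
    proof (cases "s \<le> r")
      case True
      then show ?thesis using main rs by blast
    next
      case False
      then have "Lp_le p (\<lambda>\<theta>. g (polar s \<theta>) - g (polar r \<theta>)) \<epsilon>" using main rs by auto
      then show ?thesis by (simp add: Lp_le_def norm_minus_commute)
    qed
  qed
qed

section \<open>Radial limits\<close>

lemma nn_integral_inverse_powers:
  assumes "0 < (m::real)" "0 \<le> x"
  shows "(\<integral>\<^sup>+h. ennreal (2 * x / h ^ 3) * indicator {m..} h \<partial>lborel) = ennreal (x / m\<^sup>2)"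
    and "(\<integral>\<^sup>+h. ennreal (x / h\<^sup>2) * indicator {m..} h \<partial>lborel) = ennreal (x / m)"
proof -
  have "(\<integral>\<^sup>+h. ennreal (2 * x / h ^ 3) * indicator {m..} h \<partial>lborel) = ennreal (0 - (- x / m\<^sup>2))"
  proof (rule nn_integral_FTC_atLeast)
    show "((\<lambda>h. - x / h\<^sup>2) has_real_derivative 2 * x / h ^ 3) (at h)" if "m \<le> h" for h
      using that assms by (auto intro!: derivative_eq_intros simp: power2_eq_square power3_eq_cube field_simps)
    show "((\<lambda>h. - x / h\<^sup>2) \<longlongrightarrow> 0) at_top"
      by (intro tendsto_divide_0[OF tendsto_const] filterlim_at_top_imp_at_infinity filterlim_pow_at_top filterlim_ident) auto
  qed (use assms in auto)
  then show "(\<integral>\<^sup>+h. ennreal (2 * x / h ^ 3) * indicator {m..} h \<partial>lborel) = ennreal (x / m\<^sup>2)" by simp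
  have "(\<integral>\<^sup>+h. ennreal (x / h\<^sup>2) * indicator {m..} h \<partial>lborel) = ennreal (0 - (- x / m))"
  proof (rule nn_integral_FTC_atLeast)
    show "((\<lambda>h. - x / h) has_real_derivative x / h\<^sup>2) (at h)" if "m \<le> h" for h
      using that assms by (auto intro!: derivative_eq_intros simp: power2_eq_square field_simps)
    show "((\<lambda>h. - x / h) \<longlongrightarrow> 0) at_top"
      by (intro tendsto_divide_0[OF tendsto_const] filterlim_at_top_imp_at_infinity filterlim_ident)
  qed (use assms in auto)
  then show "(\<integral>\<^sup>+h. ennreal (x / h\<^sup>2) * indicator {m..} h \<partial>lborel) = ennreal (x / m)" by simp
qed

text \<open>The kernel is a superposition of normalised indicators of symmetric intervals:
  \<open>x / max(x, |s|)\<^sup>2\<close> is the integral of \<open>2 x / h\<^sup>3\<close> over \<open>h \<ge> max(x, |s|)\<close>.\<close>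

lemma kernel_le_averages:
  fixes w :: "real \<Rightarrow> ennreal"
  assumes [measurable]: "w \<in> borel_measurable borel" and x: "0 < x" and \<mu>: "0 \<le> \<mu>"
    and avg: "\<And>h. 0 < h \<Longrightarrow> (\<integral>\<^sup>+s. w s * indicator {-h..h} s \<partial>lborel) \<le> ennreal (2 * h * \<mu>)"
  shows "(\<integral>\<^sup>+s. ennreal (x / (max x \<bar>s\<bar>)\<^sup>2) * w s \<partial>lborel) \<le> ennreal (4 * \<mu>)"
proof -
  define K where "K = (\<lambda>h s. (if max x \<bar>s\<bar> \<le> h then 1 else 0) :: ennreal)"
  have K: "indicator {max x \<bar>s\<bar>..} h = K h s" for h s by (simp add: K_def indicator_def)
  have [measurable]: "(\<lambda>(h, s). K h s) \<in> borel_measurable (borel \<Otimes>\<^sub>M borel)"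
    unfolding K_def by measurable
  have "(\<integral>\<^sup>+s. ennreal (x / (max x \<bar>s\<bar>)\<^sup>2) * w s \<partial>lborel)
      = (\<integral>\<^sup>+s. (\<integral>\<^sup>+h. ennreal (2 * x / h ^ 3) * K h s * w s \<partial>lborel) \<partial>lborel)"
  proof (intro nn_integral_cong)
    fix s
    have "ennreal (x / (max x \<bar>s\<bar>)\<^sup>2) = (\<integral>\<^sup>+h. ennreal (2 * x / h ^ 3) * K h s \<partial>lborel)"
      using nn_integral_inverse_powers(1)[of "max x \<bar>s\<bar>" x] x by (simp add: K)
    then show "ennreal (x / (max x \<bar>s\<bar>)\<^sup>2) * w s = (\<integral>\<^sup>+h. ennreal (2 * x / h ^ 3) * K h s * w s \<partial>lborel)"
      by (subst nn_integral_multc) auto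
  qed
  also have "\<dots> = (\<integral>\<^sup>+h. (\<integral>\<^sup>+s. ennreal (2 * x / h ^ 3) * K h s * w s \<partial>lborel) \<partial>lborel)"
    by (rule lborel_pair.Fubini') measurable
  also have "\<dots> = (\<integral>\<^sup>+h. ennreal (2 * x / h ^ 3) * indicator {x..} h * (\<integral>\<^sup>+s. w s * indicator {-h..h} s \<partial>lborel) \<partial>lborel)"
  proof (intro nn_integral_cong)
    fix h :: real
    have "(\<integral>\<^sup>+s. ennreal (2 * x / h ^ 3) * K h s * w s \<partial>lborel)
       = (\<integral>\<^sup>+s. ennreal (2 * x / h ^ 3) * indicator {x..} h * (w s * indicator {-h..h} s) \<partial>lborel)"
      by (intro nn_integral_cong) (auto simp: indicator_def K_def)
    then show "(\<integral>\<^sup>+s. ennreal (2 * x / h ^ 3) * K h s * w s \<partial>lborel)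
       = ennreal (2 * x / h ^ 3) * indicator {x..} h * (\<integral>\<^sup>+s. w s * indicator {-h..h} s \<partial>lborel)"
      by (simp add: nn_integral_cmult)
  qed
  also have "\<dots> \<le> (\<integral>\<^sup>+h. ennreal (4 * x * \<mu> / h\<^sup>2) * indicator {x..} h \<partial>lborel)"
  proof (intro nn_integral_mono)
    fix h :: real
    show "ennreal (2 * x / h ^ 3) * indicator {x..} h * (\<integral>\<^sup>+s. w s * indicator {-h..h} s \<partial>lborel)
      \<le> ennreal (4 * x * \<mu> / h\<^sup>2) * indicator {x..} h"
    proof (cases "x \<le> h")
      case True
      then have h: "0 < h" using x by simp
      have "ennreal (2 * x / h ^ 3) * (\<integral>\<^sup>+s. w s * indicator {-h..h} s \<partial>lborel) \<le> ennreal (2 * x / h ^ 3) * ennreal (2 * h * \<mu>)"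
        using avg[OF h] by (rule mult_left_mono) simp
      also have "\<dots> = ennreal (2 * x / h ^ 3 * (2 * h * \<mu>))"
        using h x \<mu> by (subst ennreal_mult) auto
      also have "2 * x / h ^ 3 * (2 * h * \<mu>) = 4 * x * \<mu> / h\<^sup>2"
        using h by (simp add: power2_eq_square power3_eq_cube)
      finally show ?thesis using True by simp
    qed simp
  qed
  also have "\<dots> = ennreal (4 * \<mu>)"
    using nn_integral_inverse_powers(2)[of x "4 * x * \<mu>"] x \<mu> by simp
  finally show ?thesis .
qed

text \<open>Vitali's lemma picks disjoint intervals whose fivefold enlargements cover
  \<open>E\<close>. Each carries mass at least \<open>\<mu>\<close> times its own length, and being
  disjoint they share the mass of \<open>w\<close> on \<open>S\<close>; the enlargement accounts for
  the factor 5.\<close>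

lemma Vitali_measure_bound:
  fixes E :: "real set" and w :: "real \<Rightarrow> ennreal"
  assumes [measurable]: "w \<in> borel_measurable borel" "E \<in> sets borel" and \<mu>: "0 < \<mu>"
    and E: "\<And>x. x \<in> E \<Longrightarrow> \<exists>h. 0 < h \<and> h \<le> B \<and> ennreal (2 * h * \<mu>) \<le> (\<integral>\<^sup>+y. w y * indicator (cball x h) y \<partial>lborel)
       \<and> cball x h \<subseteq> S" and [measurable]: "S \<in> sets borel"
  shows "ennreal \<mu> * emeasure lborel E \<le> 5 * (\<integral>\<^sup>+y. w y * indicator S y \<partial>lborel)"
proof -
  obtain h where h: "\<And>x. x \<in> E \<Longrightarrow> 0 < h x \<and> h x \<le> B" "\<And>x. x \<in> E \<Longrightarrow> cball x (h x) \<subseteq> S"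
     "\<And>x. x \<in> E \<Longrightarrow> ennreal (2 * h x * \<mu>) \<le> (\<integral>\<^sup>+y. w y * indicator (cball x (h x)) y \<partial>lborel)"
    using E by metis
  have "E \<subseteq> (\<Union>x\<in>E. cball x (h x))" using h(1) by (force simp: less_imp_le)
  then obtain C where C: "countable C" "C \<subseteq> E"
     "pairwise (\<lambda>i j. disjnt (cball i (h i)) (cball j (h j))) C" "E \<subseteq> (\<Union>i\<in>C. cball i (5 * h i))"
    using Vitali_covering_lemma_cballs[of E "\<lambda>x. x" h E B] h(1) by blast
  have "emeasure lborel E = (\<integral>\<^sup>+y. indicator E y \<partial>lborel)" by simp
  also have "\<dots> \<le> (\<integral>\<^sup>+y. (\<integral>\<^sup>+i. indicator (cball i (5 * h i)) y \<partial>count_space C) \<partial>lborel)"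
  proof (intro nn_integral_mono)
    fix y
    show "(indicator E y :: ennreal) \<le> (\<integral>\<^sup>+i. indicator (cball i (5 * h i)) y \<partial>count_space C)"
    proof (cases "y \<in> E")
      case True
      then obtain i where i: "i \<in> C" "y \<in> cball i (5 * h i)" using C by blast
      have "(indicator (cball i (5 * h i)) y :: ennreal) \<le> (\<integral>\<^sup>+i. indicator (cball i (5 * h i)) y \<partial>count_space C)"
        using i by (intro nn_integral_ge_point)
      then show ?thesis using i True by simp
    qed simp
  qed
  also have "\<dots> = (\<integral>\<^sup>+i. (\<integral>\<^sup>+y. indicator (cball i (5 * h i)) y \<partial>lborel) \<partial>count_space C)"
    by (rule nn_integral_count_space_nn_integral[OF C(1)]) (auto intro!: borel_measurable_indicator)
  also have "\<dots> = (\<integral>\<^sup>+i. 5 * ennreal (2 * h i) \<partial>count_space C)"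
  proof (intro nn_integral_cong)
    fix i assume "i \<in> space (count_space C)"
    then have "0 < h i" using h(1) C by auto
    then have "(\<integral>\<^sup>+y. indicator (cball i (5 * h i)) y \<partial>lborel) = ennreal (10 * h i)"
      by (simp add: cball_eq_atLeastAtMost)
    also have "\<dots> = 5 * ennreal (2 * h i)"
      using \<open>0 < h i\<close> by (simp flip: ennreal_numeral ennreal_mult)
    finally show "(\<integral>\<^sup>+y. indicator (cball i (5 * h i)) y \<partial>lborel) = 5 * ennreal (2 * h i)" .
  qed
  finally have "ennreal \<mu> * emeasure lborel E \<le> ennreal \<mu> * (\<integral>\<^sup>+i. 5 * ennreal (2 * h i) \<partial>count_space C)"
    by (rule mult_left_mono) simp
  also have "\<dots> = (\<integral>\<^sup>+i. 5 * ennreal (2 * h i * \<mu>) \<partial>count_space C)"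
  proof -
    have "5 * ennreal (2 * h i * \<mu>) = ennreal \<mu> * (5 * ennreal (2 * h i))" for i
      using \<mu> ennreal_mult'[of \<mu> "2 * h i"] by (simp only: mult.commute[of "2 * h i" \<mu>] mult.left_commute)
    then show ?thesis by (simp add: nn_integral_cmult del: ennreal_mult'')
  qed
  also have "\<dots> \<le> (\<integral>\<^sup>+i. 5 * (\<integral>\<^sup>+y. w y * indicator (cball i (h i)) y \<partial>lborel) \<partial>count_space C)"
    using h(3) C(2) by (intro nn_integral_mono mult_left_mono) auto
  also have "\<dots> = 5 * (\<integral>\<^sup>+i. (\<integral>\<^sup>+y. w y * indicator (cball i (h i)) y \<partial>lborel) \<partial>count_space C)"
    by (rule nn_integral_cmult) simp
  also have "(\<integral>\<^sup>+i. (\<integral>\<^sup>+y. w y * indicator (cball i (h i)) y \<partial>lborel) \<partial>count_space C)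
      = (\<integral>\<^sup>+i. emeasure (density lborel w) (cball i (h i)) \<partial>count_space C)"
    by (intro nn_integral_cong) (simp add: emeasure_density)
  also have "\<dots> = emeasure (density lborel w) (\<Union>i\<in>C. cball i (h i))"
    by (rule emeasure_UN_countable[symmetric]) (use C in \<open>auto simp: disjoint_family_on_def pairwise_def disjnt_def\<close>)
  also have "\<dots> \<le> emeasure (density lborel w) S"
    using h(2) C(2) by (intro emeasure_mono) auto
  also have "\<dots> = (\<integral>\<^sup>+y. w y * indicator S y \<partial>lborel)"
    by (simp add: emeasure_density)
  finally show ?thesis by (simp add: mult_left_mono)
qed

text \<open>The superlevel set of the radial maximal function, written with an existential instead
  of a supremum: openness is then immediate, and unbounded radii are included without a
  convention.\<close>

definition radial_exceed :: "(complex \<Rightarrow> complex) \<Rightarrow> real \<Rightarrow> real set" where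
  "radial_exceed V \<mu> = {\<theta>. \<exists>r\<in>{0..<1}. \<mu> < norm (V (polar r \<theta>))}"

lemma open_radial_exceed:
  assumes V: "continuous_on (ball 0 1) V"
  shows "open (radial_exceed V \<mu>)"
proof -
  have "open {\<theta>. \<mu> < norm (V (polar r \<theta>))}" if "r \<in> {0..<1}" for r
    using that by (intro open_Collect_less continuous_intros continuous_on_compose2[OF V]) (auto simp: norm_mult)
  moreover have "radial_exceed V \<mu> = (\<Union>r\<in>{0..<1}. {\<theta>. \<mu> < norm (V (polar r \<theta>))})"
    by (auto simp: radial_exceed_def)
  ultimately show ?thesis by auto
qed

text \<open>If every centred interval about \<open>\<theta>\<close> had small average, the
  superposition of intervals that dominates the Poisson kernel would keep the value along the whole
  radius below \<open>\<mu>\<close>. So each exceptional angle is the centre of an interval with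
  large average, and Vitali's lemma measures the set of such angles.\<close>

lemma weak_type_radial_maximal:
  assumes V: "continuous_on (cball 0 1) V" "V holomorphic_on ball 0 1" and \<mu>: "0 < \<mu>"
    and \<delta>: "0 \<le> \<delta>" "(\<integral>\<^sup>+\<theta>. ennreal (norm (V (cis \<theta>))) \<partial>circle) \<le> ennreal \<delta>"
  shows "emeasure lborel (radial_exceed V \<mu> \<inter> {-pi..pi}) \<le> ennreal (640 * pi * \<delta> / \<mu>)"
proof -
  let ?w = "\<lambda>\<theta>. ennreal (norm (V (cis \<theta>)))"
  have [measurable]: "(\<lambda>\<theta>. V (cis \<theta>)) \<in> borel_measurable borel"
    by (intro borel_measurable_continuous_onI continuous_on_circle_trace V)
  have V': "continuous_on (ball 0 1) V" using V(1) by (rule continuous_on_subset) auto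
  \<comment> \<open>The Poisson bound contributes 32, the superposition 4 and the normalisation
    \<open>1 / (2 * pi)\<close>; with this threshold the total is
    \<open>4 * \<mu> / (2 * pi)\<close>, at most \<open>\<mu>\<close>.\<close>
  define \<mu>' where "\<mu>' = \<mu> / 32"
  have \<mu>': "0 < \<mu>'" using \<mu> by (simp add: \<mu>'_def)
  have ex: "\<exists>h. 0 < h \<and> h \<le> pi \<and> ennreal (2 * h * \<mu>') \<le> (\<integral>\<^sup>+y. ?w y * indicator (cball \<theta> h) y \<partial>lborel)"
    if \<theta>: "\<theta> \<in> radial_exceed V \<mu>" for \<theta>
  proof (rule ccontr)
    assume neg: "\<not> ?thesis"
    let ?u = "\<lambda>s. ?w (\<theta> + s) * indicator {-pi..pi} s"
    have avg: "(\<integral>\<^sup>+s. ?u s * indicator {-h..h} s \<partial>lborel) \<le> ennreal (2 * h * \<mu>')" if h: "0 < h" for h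
    proof -
      \<comment> \<open>The integrand lives on one period, so an interval longer than that sees no
        more mass than one of radius \<open>pi\<close>.\<close>
      define k where "k = min h pi"
      have k: "0 < k" "k \<le> pi" "k \<le> h" using h by (auto simp: k_def)
      have "(\<integral>\<^sup>+s. ?u s * indicator {-h..h} s \<partial>lborel) = (\<integral>\<^sup>+s. ?w (\<theta> + s) * indicator (cball \<theta> k) (\<theta> + s) \<partial>lborel)"
        by (intro nn_integral_cong) (auto simp: indicator_def k_def dist_real_def)
      also have "\<dots> = (\<integral>\<^sup>+y. ?w y * indicator (cball \<theta> k) y \<partial>lborel)"
      proof -
        have "(\<lambda>y. ?w y * indicator (cball \<theta> k) y) \<in> borel_measurable borel"
          by (intro borel_measurable_times_ennreal borel_measurable_indicator) auto
        from nn_integral_real_affine[OF this, of 1 \<theta>] show ?thesis by simp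
      qed
      also have "\<dots> \<le> ennreal (2 * k * \<mu>')" using neg k by (auto simp: not_le intro: less_imp_le)
      also have "\<dots> \<le> ennreal (2 * h * \<mu>')" using k \<mu>' by (intro ennreal_leI) auto
      finally show ?thesis .
    qed
    obtain r where r: "0 \<le> r" "r < 1" "\<mu> < norm (V (polar r \<theta>))"
      using \<theta> by (auto simp: radial_exceed_def)
    have in_cball: "norm (cis \<theta> * z) \<le> 1 \<longleftrightarrow> norm z \<le> 1" "norm (cis \<theta> * z) < 1 \<longleftrightarrow> norm z < 1" for z
      by (simp_all add: norm_mult)
    have U: "continuous_on (cball 0 1) (\<lambda>z. V (cis \<theta> * z))" "(\<lambda>z. V (cis \<theta> * z)) holomorphic_on ball 0 1"
       using in_cball by (auto intro!: continuous_on_compose2[OF V(1)] continuous_intros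
          holomorphic_on_compose_gen[OF _ V(2), unfolded o_def] holomorphic_intros)
    have "continuous_on UNIV (\<lambda>s. of_real (poisson r s) * V (cis \<theta> * cis s))"
      using r by (intro continuous_intros continuous_poisson continuous_on_circle_trace[OF U(1)])
    then have int: "integrable circle (\<lambda>s. of_real (poisson r s) * V (cis \<theta> * cis s))" by (rule integrable_circle)
    have "ennreal \<mu> < ennreal (norm (V (polar r \<theta>)))" using r \<mu> by (simp add: ennreal_less_iff)
    also have "\<dots> = ennreal (norm (LINT s|circle. of_real (poisson r s) * V (cis \<theta> * cis s)))"
      using poisson_formula[OF U r(1,2)] by (simp add: mult.commute)
    also have "\<dots> \<le> (\<integral>\<^sup>+s. ennreal (norm (of_real (poisson r s) * V (cis \<theta> * cis s))) \<partial>circle)"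
      by (rule integral_norm_bound_ennreal[OF int])
    also have "\<dots> = (\<integral>\<^sup>+s. ennreal (poisson r s) * ?w (\<theta> + s) \<partial>circle)"
      using poisson_nonneg[OF r(1,2)] by (intro nn_integral_cong) (simp add: norm_mult ennreal_mult cis_mult)
    also have "\<dots> = (\<integral>\<^sup>+s. ennreal (poisson r s) * ?w (\<theta> + s) * indicator {-pi..pi} s \<partial>lborel) / ennreal (2 * pi)"
      by (rule nn_integral_circle) measurable
    also have "\<dots> \<le> (\<integral>\<^sup>+s. 32 * (ennreal ((1 - r) / (max (1 - r) \<bar>s\<bar>)\<^sup>2) * ?u s) \<partial>lborel) / ennreal (2 * pi)"
    proof (intro divide_right_mono_ennreal nn_integral_mono)
      fix s
      show "ennreal (poisson r s) * ?w (\<theta> + s) * indicator {-pi..pi} s \<le> 32 * (ennreal ((1 - r) / (max (1 - r) \<bar>s\<bar>)\<^sup>2) * ?u s)"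
      proof (cases "s \<in> {-pi..pi}")
        case True
        have "poisson r s \<le> 32 * ((1 - r) / (max (1 - r) \<bar>s\<bar>)\<^sup>2)" using poisson_le(2)[OF r(1,2), of s] True by (auto simp: abs_le_iff)
        then have "ennreal (poisson r s) \<le> 32 * ennreal ((1 - r) / (max (1 - r) \<bar>s\<bar>)\<^sup>2)"
          by (metis ennreal_leI ennreal_mult' ennreal_numeral zero_le_numeral)
        then show ?thesis using True by (simp add: mult_right_mono mult.assoc[symmetric])
      qed simp
    qed
    also have "\<dots> = 32 * (\<integral>\<^sup>+s. ennreal ((1 - r) / (max (1 - r) \<bar>s\<bar>)\<^sup>2) * ?u s \<partial>lborel) / ennreal (2 * pi)"
      by (subst nn_integral_cmult) auto
    also have "\<dots> \<le> 32 * ennreal (4 * \<mu>') / ennreal (2 * pi)"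
      using r \<mu>' avg by (intro divide_right_mono_ennreal mult_left_mono kernel_le_averages) auto
    also have "\<dots> = ennreal (128 * \<mu>' / (2 * pi))"
      using \<mu>' by (simp add: divide_ennreal flip: ennreal_numeral ennreal_mult)
    also have "\<dots> \<le> ennreal \<mu>"
    proof (intro ennreal_leI)
      have "2 \<le> pi" by (rule pi_ge_two)
      then have "4 * \<mu> / (2 * pi) \<le> 4 * \<mu> / (2 * 2)" using \<mu> by (intro divide_left_mono) auto
      then show "128 * \<mu>' / (2 * pi) \<le> \<mu>" by (simp add: \<mu>'_def)
    qed
    finally show False by simp
  qed
  \<comment> \<open>Intervals of radius at most \<open>pi\<close> about points of one period stay
    within two periods, whose total mass is twice \<open>2 * pi * \<delta>\<close>. With the factor
    5 and \<open>\<mu>' = \<mu> / 32\<close> this produces 640.\<close>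
  have "ennreal \<mu>' * emeasure lborel (radial_exceed V \<mu> \<inter> {-pi..pi}) \<le> 5 * (\<integral>\<^sup>+y. ?w y * indicator {-pi-pi..pi+pi} y \<partial>lborel)"
  proof (rule Vitali_measure_bound[OF _ _ \<mu>'])
    fix x assume x: "x \<in> radial_exceed V \<mu> \<inter> {-pi..pi}"
    then obtain h where "0 < h \<and> h \<le> pi \<and> ennreal (2 * h * \<mu>') \<le> (\<integral>\<^sup>+y. ?w y * indicator (cball x h) y \<partial>lborel)"
      using ex by blast
    then show "\<exists>h. 0 < h \<and> h \<le> pi \<and> ennreal (2 * h * \<mu>') \<le> (\<integral>\<^sup>+y. ?w y * indicator (cball x h) y \<partial>lborel) \<and> cball x h \<subseteq> {-pi-pi..pi+pi}"
      using x by (intro exI[of _ h]) (auto simp: cball_eq_atLeastAtMost)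
  qed (use open_radial_exceed[OF V', of \<mu>] in auto)
  also have "(\<integral>\<^sup>+y. ?w y * indicator {-pi-pi..pi+pi} y \<partial>lborel) \<le> (\<integral>\<^sup>+y. ?w y * indicator {-pi-pi..-pi-pi+2*pi} y + ?w y * indicator {0..0+2*pi} y \<partial>lborel)"
    by (intro nn_integral_mono) (auto simp: indicator_def)
  also have "\<dots> = (\<integral>\<^sup>+y. ?w y * indicator {-pi-pi..-pi-pi+2*pi} y \<partial>lborel) + (\<integral>\<^sup>+y. ?w y * indicator {0..0+2*pi} y \<partial>lborel)"
    by (rule nn_integral_add) auto
  also have "(\<integral>\<^sup>+y. ?w y * indicator {-pi-pi..-pi-pi+2*pi} y \<partial>lborel) = (\<integral>\<^sup>+y. ?w y * indicator {0..0+2*pi} y \<partial>lborel)"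
    by (subst nn_integral_real_affine[where c=1 and t="-2*pi"])
       (use cis_period[of "_ - 2 * pi"] in \<open>auto intro!: nn_integral_cong simp: indicator_def\<close>)
  also have "(\<integral>\<^sup>+y. ?w y * indicator {0..0+2*pi} y \<partial>lborel) \<le> ennreal (2 * pi * \<delta>)"
  proof -
    have "(\<integral>\<^sup>+y. ?w y * indicator {0..0+2*pi} y \<partial>lborel) / ennreal (2 * pi) \<le> ennreal \<delta>"
      using \<delta>(2) nn_integral_circle_interval[of ?w 0] by simp
    then show ?thesis
      using \<delta>(1) by (cases "(\<integral>\<^sup>+y. ?w y * indicator {0..0+2*pi} y \<partial>lborel)")
        (auto simp: divide_ennreal ennreal_top_divide top_unique field_simps intro!: ennreal_leI)
  qed
  finally have "ennreal \<mu>' * emeasure lborel (radial_exceed V \<mu> \<inter> {-pi..pi}) \<le> 5 * (ennreal (2 * pi * \<delta>) + ennreal (2 * pi * \<delta>))"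
    by (simp add: mult_left_mono add_mono)
  also have "\<dots> = ennreal (20 * pi * \<delta>)"
    using \<delta> by (simp flip: ennreal_numeral ennreal_mult ennreal_plus)
  finally have "ennreal (1 / \<mu>') * (ennreal \<mu>' * emeasure lborel (radial_exceed V \<mu> \<inter> {-pi..pi})) \<le> ennreal (1 / \<mu>') * ennreal (20 * pi * \<delta>)"
    by (rule mult_left_mono) simp
  also have "ennreal (1 / \<mu>') * ennreal (20 * pi * \<delta>) = ennreal (640 * pi * \<delta> / \<mu>)"
    using \<mu> \<delta> by (simp add: \<mu>'_def flip: ennreal_mult)
  also have "ennreal (1 / \<mu>') * (ennreal \<mu>' * emeasure lborel (radial_exceed V \<mu> \<inter> {-pi..pi})) = emeasure lborel (radial_exceed V \<mu> \<inter> {-pi..pi})"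
    using \<mu>' by (simp add: mult.assoc[symmetric] flip: ennreal_mult)
  finally show ?thesis .
qed

section \<open>Existence of radial limits\<close>

lemma Lp_le_imp_L1:
  assumes p: "1 \<le> p" and [measurable]: "\<phi> \<in> borel_measurable borel" and W: "Lp_le p \<phi> W"
  shows "(\<integral>\<^sup>+\<theta>. ennreal (norm (\<phi> \<theta>)) \<partial>circle) \<le> ennreal W"
proof (rule ccontr)
  assume neg: "\<not> ?thesis"
  have W0: "0 \<le> W" using W by (rule Lp_le_nonneg)
  obtain y where y: "0 \<le> y" "W < y" "ennreal y \<le> (\<integral>\<^sup>+\<theta>. ennreal (norm (\<phi> \<theta>)) \<partial>circle)"
  proof (cases "(\<integral>\<^sup>+\<theta>. ennreal (norm (\<phi> \<theta>)) \<partial>circle)")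
    case (real r)
    then have "W < r" using neg W0 by (auto simp: not_le ennreal_less_iff)
    then show ?thesis using that[of r] real by auto
  next
    case top
    then show ?thesis using that[of "W + 1"] W0 by auto
  qed
  have "ennreal (y powr p) \<le> ennreal (1 powr (p - 1)) * (\<integral>\<^sup>+\<theta>. ennreal (norm (\<phi> \<theta>) powr p * 1 powr (1 - p)) \<partial>circle)"
    using p y by (intro Jensen_weighted) auto
  also have "\<dots> \<le> ennreal (W powr p)" using W by (simp add: Lp_le_def)
  finally have "y powr p \<le> W powr p" using powr_ge_zero by (simp add: ennreal_le_iff)
  moreover have "W powr p < y powr p" using y W0 p by (intro powr_less_mono2) auto
  ultimately show False by simp
qed

text \<open>A Borel measurable version of the boundary function: the limit is taken along one fixed
  sequence of radii, so that measurability of sequential limits applies. It agrees with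
  \<open>boundary_fun\<close> almost everywhere once radial limits exist.\<close>

definition bdry :: "(complex \<Rightarrow> complex) \<Rightarrow> real \<Rightarrow> complex" where
  "bdry g \<theta> = lim (\<lambda>n. g (of_real (1 - 1 / (real n + 2)) * cis \<theta>))"

lemma bdry_measurable [measurable]:
  assumes "g holomorphic_on ball 0 1"
  shows "bdry g \<in> borel_measurable borel"
  unfolding bdry_def[abs_def]
  by (intro borel_measurable_lim_metric trace_measurable(2)[OF assms]) (auto simp: field_simps)

lemma bdry_period: "bdry g (\<theta> + 2 * pi) = bdry g \<theta>"
  by (simp add: bdry_def)

lemma filterlim_radii: "filterlim (\<lambda>n. 1 - 1 / (real n + 2)) (at_left 1) sequentially"
proof -
  have "(\<lambda>n. 1 - 1 / (real n + 2)) \<longlonglongrightarrow> 1 - 0"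
    by (intro tendsto_diff tendsto_const tendsto_divide_0[OF tendsto_const] filterlim_at_top_imp_at_infinity
        filterlim_tendsto_add_at_top[OF tendsto_const filterlim_real_sequentially, of 2, simplified add.commute])
  then show ?thesis
    by (auto simp: filterlim_at intro!: always_eventually)
qed

lemma AE_shift:
  assumes "AE x in lborel. P (x::real)"
  shows "AE x in lborel. P (x + h)"
proof -
  obtain N where N: "{x. \<not> P x} \<subseteq> N" "N \<in> null_sets lborel"
    using assms by (auto elim!: AE_E simp: null_sets_def)
  then have "AE x in lborel. x \<notin> N" using AE_not_in by blast
  then have "AE x in lborel. h + 1 * x \<notin> N"
    using N by (intro AE_borel_affine) (auto simp: null_sets_def)
  then show ?thesis by eventually_elim (use N in \<open>auto simp: add.commute\<close>)
qed

lemma AE_period: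
  assumes "AE x in lborel. x \<in> {-pi..pi} \<longrightarrow> P x" and per: "\<And>x. P (x + 2 * pi) \<longleftrightarrow> P x"
  shows "AE x in lborel. P x"
proof -
  have per_int: "P (x + 2 * pi * of_int k) \<longleftrightarrow> P x" for x and k :: int
  proof (induction k rule: int_induct[where k=0])
    case base then show ?case by simp
  next
    case (step1 i)
    then show ?case using per[of "x + 2 * pi * of_int i"] by (simp add: algebra_simps)
  next
    case (step2 i)
    then show ?case using per[of "x + 2 * pi * (of_int i - 1)"] by (simp add: algebra_simps)
  qed
  have "AE x in lborel. \<forall>k::int. x + 2 * pi * of_int k \<in> {-pi..pi} \<longrightarrow> P (x + 2 * pi * of_int k)"
    using AE_shift[OF assms(1)] by (simp add: AE_all_countable)
  then show ?thesis
  proof eventually_elim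
    fix x assume *: "\<forall>k::int. x + 2 * pi * of_int k \<in> {-pi..pi} \<longrightarrow> P (x + 2 * pi * of_int k)"
    define k where "k = - \<lfloor>(x + pi) / (2 * pi)\<rfloor>"
    have "- of_int k \<le> (x + pi) / (2 * pi)" "(x + pi) / (2 * pi) < - of_int k + 1"
      unfolding k_def by linarith+
    then have "x + 2 * pi * of_int k \<in> {-pi..pi}" by (auto simp: field_simps)
    then show "P x" using * per_int by blast
  qed
qed

text \<open>Interchange of limits: \<open>G\<close> is uniformly approximated by functions that have
  limits at 1, so those limits form a Cauchy sequence and \<open>G\<close> inherits their
  limit.\<close>

lemma uniformly_approximable_limit:
  fixes G :: "real \<Rightarrow> complex" and Gk :: "nat \<Rightarrow> real \<Rightarrow> complex"
  assumes cont: "\<And>k. (Gk k \<longlongrightarrow> c k) (at_left 1)"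
    and approx: "\<And>k r. N \<le> k \<Longrightarrow> 0 \<le> r \<Longrightarrow> r < 1 \<Longrightarrow> norm (Gk k r - G r) \<le> 2 * (1 / 2) ^ k"
  shows "\<exists>l. (G \<longlongrightarrow> l) (at_left 1)"
proof -
  have ev: "eventually (\<lambda>r::real. 0 \<le> r \<and> r < 1) (at_left 1)"
    by (rule eventually_at_leftI[of 0]) auto
  have ck: "norm (c k - c m) \<le> 4 * (1 / 2) ^ k" if "N \<le> k" "k \<le> m" for k m
  proof -
    have "((\<lambda>r. norm (Gk k r - Gk m r)) \<longlongrightarrow> norm (c k - c m)) (at_left 1)"
      by (intro tendsto_intros cont)
    moreover have "eventually (\<lambda>r. norm (Gk k r - Gk m r) \<le> 4 * (1 / 2) ^ k) (at_left 1)"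
      using ev
    proof eventually_elim
      fix r :: real assume r: "0 \<le> r \<and> r < 1"
      have "norm (Gk k r - Gk m r) \<le> norm (Gk k r - G r) + norm (Gk m r - G r)"
        using norm_triangle_ineq4[of "Gk k r - G r" "Gk m r - G r"] by simp
      also have "\<dots> \<le> 2 * (1 / 2) ^ k + 2 * (1 / 2) ^ m" using approx[of k r] approx[of m r] that r by auto
      also have "(1 / 2 :: real) ^ m \<le> (1 / 2) ^ k" using that by (intro power_decreasing) auto
      finally show "norm (Gk k r - Gk m r) \<le> 4 * (1 / 2) ^ k" by simp
    qed
    ultimately show ?thesis by (intro tendsto_upperbound) auto
  qed
  have half: "\<exists>k\<ge>N. 4 * (1 / 2) ^ k < e" if "0 < e" for e :: real
  proof -
    have "(\<lambda>k. 4 * (1 / 2 :: real) ^ k) \<longlonglongrightarrow> 4 * 0" by (intro tendsto_intros LIMSEQ_power_zero) auto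
    then have "eventually (\<lambda>k. 4 * (1 / 2 :: real) ^ k < e) sequentially" by (rule order_tendstoD(2)) (use that in simp)
    then obtain K where "\<And>k. K \<le> k \<Longrightarrow> 4 * (1 / 2 :: real) ^ k < e" by (auto simp: eventually_sequentially)
    then show ?thesis by (intro exI[of _ "max K N"]) auto
  qed
  have "Cauchy c"
  proof (rule metric_CauchyI)
    fix e :: real assume "0 < e"
    then obtain K where K: "N \<le> K" "4 * (1 / 2) ^ K < e / 2" using half[of "e / 2"] by auto
    have "dist (c m) (c n) < e" if "K \<le> m" "K \<le> n" for m n
    proof -
      have "dist (c m) (c n) \<le> norm (c K - c m) + norm (c K - c n)"
        using dist_triangle3[of "c m" "c n" "c K"] by (simp add: dist_norm)
      then show ?thesis using ck[of K m] ck[of K n] that K by simp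
    qed
    then show "\<exists>M. \<forall>m\<ge>M. \<forall>n\<ge>M. dist (c m) (c n) < e" by blast
  qed
  then obtain l where l: "c \<longlonglongrightarrow> l" using Cauchy_convergent convergent_def by blast
  have cl: "norm (c k - l) \<le> 4 * (1 / 2) ^ k" if "N \<le> k" for k
  proof (rule tendsto_upperbound)
    show "(\<lambda>m. norm (c k - c m)) \<longlonglongrightarrow> norm (c k - l)" by (intro tendsto_intros l)
    show "eventually (\<lambda>m. norm (c k - c m) \<le> 4 * (1 / 2) ^ k) sequentially"
      using ck[OF that] by (auto simp: eventually_sequentially)
  qed auto
  have "(G \<longlongrightarrow> l) (at_left 1)"
  proof (rule tendstoI)
    fix e :: real assume "0 < e"
    then obtain k where k: "N \<le> k" "4 * (1 / 2) ^ k < e / 3" using half[of "e / 3"] by auto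
    have "eventually (\<lambda>r. dist (Gk k r) (c k) < e / 3) (at_left 1)"
      using \<open>0 < e\<close> by (intro tendstoD[OF cont]) simp
    then show "eventually (\<lambda>r. dist (G r) l < e) (at_left 1)"
      using ev
    proof eventually_elim
      fix r :: real assume r: "dist (Gk k r) (c k) < e / 3" "0 \<le> r \<and> r < 1"
      have "G r - l = (Gk k r - c k) + (c k - l) - (Gk k r - G r)" by simp
      then have "norm (G r - l) \<le> norm (Gk k r - c k) + norm (c k - l) + norm (Gk k r - G r)"
        by (metis norm_triangle_ineq norm_triangle_ineq4 add_right_mono order_trans)
      then show "dist (G r) l < e"
        using r k(2) cl[OF k(1)] approx[OF k(1), of r] \<open>0 < e\<close> unfolding dist_norm by linarith
    qed
  qed
  then show ?thesis by blast
qed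

text \<open>Radii are chosen so that consecutive dilates differ by at most 4^(-k) in norm. The
  weak-type estimate at level 2^(-k) then bounds the exceptional sets by a multiple of 2^(-k), and
  Borel--Cantelli leaves almost every radius outside all but finitely many. On such a radius the
  dilates converge uniformly, and each of them, being continuous up to the circle, has a radial
  limit.\<close>

theorem Fatou_radial_limit:
  assumes g: "g \<in> Hardy p" and p: "1 < p"
  shows "AE \<theta> in lborel. ((\<lambda>r. g (polar r \<theta>)) \<longlongrightarrow> bdry g \<theta>) (at_left 1)"
proof -
  have hol: "g holomorphic_on ball 0 1" using g by (rule Hardy_holomorphic)
  have contg: "continuous_on (ball 0 1) g" using hol by (rule holomorphic_on_imp_continuous_on)
  have "\<exists>r0. 0 < r0 \<and> r0 < 1 \<and> (\<forall>r s. r0 \<le> r \<longrightarrow> r < 1 \<longrightarrow> r0 \<le> s \<longrightarrow> s < 1 \<longrightarrow>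
       Lp_le p (\<lambda>\<theta>. g (polar r \<theta>) - g (polar s \<theta>)) ((1 / 4) ^ k))" for k :: nat
  proof -
    have "0 < (1 / 4 :: real) ^ k" by simp
    then obtain r0 where "0 < r0" "r0 < 1" "\<And>r s. r0 \<le> r \<Longrightarrow> r < 1 \<Longrightarrow> r0 \<le> s \<Longrightarrow> s < 1 \<Longrightarrow>
       Lp_le p (\<lambda>\<theta>. g (polar r \<theta>) - g (polar s \<theta>)) ((1 / 4) ^ k)"
      by (rule Hardy_dilates_Cauchy[OF g p]) auto
    then show ?thesis by blast
  qed
  then obtain R where R: "\<And>k. 0 < R k" "\<And>k. R k < 1" "\<And>k r s. R k \<le> r \<Longrightarrow> r < 1 \<Longrightarrow> R k \<le> s \<Longrightarrow> s < 1 \<Longrightarrow>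
       Lp_le p (\<lambda>\<theta>. g (polar r \<theta>) - g (polar s \<theta>)) ((1 / 4) ^ k)"
    by metis
  \<comment> \<open>The maximum exceeds every threshold up to index \<open>k\<close>, so both radii
    in the difference \<open>V k\<close> lie beyond \<open>R k\<close>; the extra element forces the
    radii to tend to 1.\<close>
  define s where "s k = Max (insert (1 - 1 / (real k + 2)) (R ` {..k}))" for k
  have sR: "R k \<le> s k" "R k \<le> s (Suc k)" "1 - 1 / (real k + 2) \<le> s k" for k
    unfolding s_def by (intro Max_ge; auto)+
  have s1: "s k < 1" "0 < s k" "1 - 1 / (real k + 2) \<le> s k" for k
  proof -
    show "s k < 1" unfolding s_def using R(2) by (subst Max_less_iff) auto
    show "0 < s k" using R(1)[of k] sR(1)[of k] by linarith
  qed (rule sR)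
  have s_lim: "s \<longlonglongrightarrow> 1"
  proof (rule tendsto_sandwich)
    show "(\<lambda>n. 1 - 1 / (real n + 2)) \<longlonglongrightarrow> 1" using filterlim_radii by (simp add: filterlim_at)
  qed (use s1 in \<open>auto intro!: always_eventually less_imp_le\<close>)
  define V where "V k z = g (of_real (s k) * z) - g (of_real (s (Suc k)) * z)" for k z
  have V: "continuous_on (cball 0 1) (V k)" "V k holomorphic_on ball 0 1" for k
    unfolding V_def[abs_def] using s1 less_imp_le[OF s1(2)]
    by (intro continuous_intros holomorphic_intros holomorphic_rotate_dilate[OF hol]; simp)+
  define E where "E k = radial_exceed (V k) ((1 / 2) ^ k)" for k
  have [measurable]: "E k \<in> sets borel" for k
    unfolding E_def using V(1)[of k] by (intro borel_open open_radial_exceed) (auto intro: continuous_on_subset)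
  have meas: "emeasure lborel (E k \<inter> {-pi..pi}) \<le> ennreal (640 * pi * (1 / 2) ^ k)" for k
  proof -
    have "(\<integral>\<^sup>+\<theta>. ennreal (norm (V k (cis \<theta>))) \<partial>circle) \<le> ennreal ((1 / 4) ^ k)"
      unfolding V_def using s1 sR p less_imp_le[OF s1(2)]
      by (intro Lp_le_imp_L1[of p] borel_measurable_diff trace_measurable hol R) auto
    then have "emeasure lborel (E k \<inter> {-pi..pi}) \<le> ennreal (640 * pi * (1 / 4) ^ k / (1 / 2) ^ k)"
      unfolding E_def by (intro weak_type_radial_maximal V) auto
    also have "640 * pi * (1 / 4) ^ k / (1 / 2) ^ k = 640 * pi * (1 / 2) ^ k"
      by (simp add: power_divide field_simps flip: power_mult_distrib)
    finally show ?thesis .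
  qed
  have "AE x in lborel. eventually (\<lambda>k. x \<in> space lborel - (E k \<inter> {-pi..pi})) sequentially"
  proof (rule borel_cantelli_AE1)
    show "emeasure lborel (E k \<inter> {-pi..pi}) < \<infinity>" for k
      using meas[of k] by (auto intro: le_less_trans)
    show "summable (\<lambda>k. measure lborel (E k \<inter> {-pi..pi}))"
    proof (rule summable_comparison_test')
      show "summable (\<lambda>k. 640 * pi * (1 / 2) ^ k)" by (intro summable_mult summable_geometric) auto
      show "norm (measure lborel (E k \<inter> {-pi..pi})) \<le> 640 * pi * (1 / 2) ^ k" for k
        using meas[of k] by (simp add: measure_def enn2real_leI)
    qed
  qed auto
  then have "AE x in lborel. x \<in> {-pi..pi} \<longrightarrow> eventually (\<lambda>k. x \<notin> E k) sequentially"
    by eventually_elim (rule impI, erule eventually_mono, simp)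
  then have "AE x in lborel. eventually (\<lambda>k. x \<notin> E k) sequentially"
    by (rule AE_period) (simp add: E_def radial_exceed_def)
  then show ?thesis
  proof eventually_elim
    fix \<theta> assume "eventually (\<lambda>k. \<theta> \<notin> E k) sequentially"
    then obtain N where "\<forall>k\<ge>N. \<forall>r\<in>{0..<1}. norm (V k (polar r \<theta>)) \<le> (1 / 2) ^ k"
      by (auto simp: eventually_sequentially E_def radial_exceed_def not_less)
    then have N: "\<And>k r. N \<le> k \<Longrightarrow> 0 \<le> r \<Longrightarrow> r < 1 \<Longrightarrow> norm (V k (polar r \<theta>)) \<le> (1 / 2) ^ k"
      by auto
    have in_ball: "of_real r * cis \<theta> \<in> ball 0 1" if "0 \<le> r" "r < 1" for r
      using that by (simp add: norm_mult)
    have sr: "0 \<le> s k * r" "s k * r < 1" if "0 \<le> r" "r \<le> 1" for k r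
    proof -
      show "0 \<le> s k * r" using that s1(2)[of k] by simp
      have "s k * r \<le> s k * 1" using that s1(2)[of k] by (intro mult_left_mono) auto
      also have "\<dots> < 1" using s1(1)[of k] by simp
      finally show "s k * r < 1" .
    qed
    \<comment> \<open>Subtracting \<open>2 * (1 / 2) ^ (k + m)\<close> strengthens the induction
      hypothesis so that the geometric sum closes exactly.\<close>
    have tele: "norm (g (polar (s k * r) \<theta>) - g (of_real (s (k + m) * r) * cis \<theta>)) \<le> 2 * (1 / 2) ^ k - 2 * (1 / 2) ^ (k + m)"
      if "N \<le> k" "0 \<le> r" "r < 1" for k m r
    proof (induction m)
      case (Suc m)
      have "norm (g (polar (s k * r) \<theta>) - g (of_real (s (k + Suc m) * r) * cis \<theta>))
         \<le> norm (g (polar (s k * r) \<theta>) - g (of_real (s (k + m) * r) * cis \<theta>)) + norm (V (k + m) (polar r \<theta>))"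
        unfolding V_def by (rule order_trans[OF _ norm_triangle_ineq]) (simp add: mult.assoc)
      also have "\<dots> \<le> 2 * (1 / 2) ^ k - 2 * (1 / 2) ^ (k + m) + (1 / 2) ^ (k + m)"
        using Suc N[of "k + m" r] that by (intro add_mono) auto
      finally show ?case by simp
    qed simp
    have approx: "norm (g (polar (s k * r) \<theta>) - g (polar r \<theta>)) \<le> 2 * (1 / 2) ^ k"
      if "N \<le> k" "0 \<le> r" "r < 1" for k r
    proof (rule tendsto_upperbound)
      have "(\<lambda>m. of_real (s (m + k) * r) * cis \<theta>) \<longlonglongrightarrow> of_real (1 * r) * cis \<theta>"
        using LIMSEQ_ignore_initial_segment[OF s_lim, of k] by (intro tendsto_intros) auto
      then have "(\<lambda>m. g (of_real (s (m + k) * r) * cis \<theta>)) \<longlonglongrightarrow> g (polar (1 * r) \<theta>)"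
      proof (rule continuous_on_tendsto_compose[OF contg])
        show "of_real (1 * r) * cis \<theta> \<in> ball 0 1" using in_ball[of r] that by simp
        show "eventually (\<lambda>m. of_real (s (m + k) * r) * cis \<theta> \<in> ball 0 1) sequentially"
          using that by (intro always_eventually allI in_ball sr) auto
      qed
      then show "(\<lambda>m. norm (g (polar (s k * r) \<theta>) - g (of_real (s (m + k) * r) * cis \<theta>)))
          \<longlonglongrightarrow> norm (g (polar (s k * r) \<theta>) - g (polar r \<theta>))"
        by (intro tendsto_intros) simp
      show "eventually (\<lambda>m. norm (g (polar (s k * r) \<theta>) - g (of_real (s (m + k) * r) * cis \<theta>)) \<le> 2 * (1 / 2) ^ k) sequentially"
      proof (intro always_eventually allI)
        fix m
        have "norm (g (polar (s k * r) \<theta>) - g (of_real (s (m + k) * r) * cis \<theta>)) \<le> 2 * (1 / 2) ^ k - 2 * (1 / 2) ^ (k + m)"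
          using tele[OF that, of m] by (simp add: add.commute)
        then show "norm (g (polar (s k * r) \<theta>) - g (of_real (s (m + k) * r) * cis \<theta>)) \<le> 2 * (1 / 2) ^ k"
          using zero_le_power[of "1 / 2 :: real" "k + m"] by linarith
      qed
    qed auto
    have "\<exists>l. ((\<lambda>r. g (polar r \<theta>)) \<longlongrightarrow> l) (at_left 1)"
    proof (rule uniformly_approximable_limit[where Gk="\<lambda>k r. g (polar (s k * r) \<theta>)"])
      fix k
      have "((\<lambda>r. of_real (s k * r) * cis \<theta>) \<longlongrightarrow> of_real (s k * 1) * cis \<theta>) (at_left 1)"
        by (intro tendsto_intros)
      moreover have "eventually (\<lambda>r::real. of_real (s k * r) * cis \<theta> \<in> ball 0 1) (at_left 1)"
        proof (rule eventually_at_leftI[of 0])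
        show "of_real (s k * r) * cis \<theta> \<in> ball 0 1" if "r \<in> {0<..<1}" for r
          using that by (intro in_ball sr) auto
      qed simp
      ultimately show "((\<lambda>r. g (polar (s k * r) \<theta>)) \<longlongrightarrow> g (polar (s k * 1) \<theta>)) (at_left 1)"
        by (intro continuous_on_tendsto_compose[OF contg] in_ball sr) auto
    qed (use approx in auto)
    then obtain l where l: "((\<lambda>r. g (polar r \<theta>)) \<longlongrightarrow> l) (at_left 1)" by blast
    have "(\<lambda>n. g (of_real (1 - 1 / (real n + 2)) * cis \<theta>)) \<longlonglongrightarrow> l"
      using filterlim_compose[OF l filterlim_radii] .
    then have "bdry g \<theta> = l" unfolding bdry_def by (rule limI)
    then show "((\<lambda>r. g (polar r \<theta>)) \<longlongrightarrow> bdry g \<theta>) (at_left 1)" using l by simp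
  qed
qed

section \<open>Boundary functions and their increments\<close>

lemma bdry_AE_lim:
  assumes "g \<in> Hardy p" "1 < p"
  shows "AE \<theta> in lborel. (\<lambda>n. g (of_real (1 - 1 / (real n + 2)) * cis \<theta>)) \<longlonglongrightarrow> bdry g \<theta>"
  using Fatou_radial_limit[OF assms] by eventually_elim (rule filterlim_compose[OF _ filterlim_radii])

lemma boundary_fun_AE_bdry:
  assumes "g \<in> Hardy p" "1 < p"
  shows "AE \<theta> in lborel. boundary_fun g \<theta> = bdry g \<theta>"
  using Fatou_radial_limit[OF assms]
  by eventually_elim (auto simp: boundary_fun_def intro!: tendsto_Lim)

lemma radii_bounds: "0 \<le> 1 - 1 / (real n + 2)" "1 - 1 / (real n + 2) < 1"
  by (auto simp: field_simps)

text \<open>One of the two radii in the Cauchy property of the dilates is sent to 1, using Fatou's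
  lemma.\<close>

lemma bdry_Lp_approx:
  assumes g: "g \<in> Hardy p" and p: "1 < p" and \<epsilon>: "0 < \<epsilon>"
  obtains r0 where "r0 < 1" "\<And>r. r0 \<le> r \<Longrightarrow> r < 1 \<Longrightarrow> Lp_le p (\<lambda>\<theta>. g (polar r \<theta>) - bdry g \<theta>) \<epsilon>"
proof -
  have hol: "g holomorphic_on ball 0 1" using g by (rule Hardy_holomorphic)
  obtain r0 where r0: "0 < r0" "r0 < 1" "\<And>r s. r0 \<le> r \<Longrightarrow> r < 1 \<Longrightarrow> r0 \<le> s \<Longrightarrow> s < 1 \<Longrightarrow>
       Lp_le p (\<lambda>\<theta>. g (polar r \<theta>) - g (polar s \<theta>)) \<epsilon>"
    using Hardy_dilates_Cauchy[OF g p \<epsilon>] by blast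
  show ?thesis
  proof (rule that[OF r0(2)])
    fix r assume r: "r0 \<le> r" "r < 1"
    show "Lp_le p (\<lambda>\<theta>. g (polar r \<theta>) - bdry g \<theta>) \<epsilon>"
    proof (rule Lp_le_AE_lim[where \<phi>n="\<lambda>n \<theta>. g (polar r \<theta>) - g (of_real (1 - 1 / (real n + 2)) * cis \<theta>)"])
      show "AE \<theta> in circle. (\<lambda>n. g (polar r \<theta>) - g (of_real (1 - 1 / (real n + 2)) * cis \<theta>)) \<longlonglongrightarrow> g (polar r \<theta>) - bdry g \<theta>"
        using AE_circleI[OF bdry_AE_lim[OF g p]] by eventually_elim (intro tendsto_intros)
      have "eventually (\<lambda>x. x \<in> {r0<..<1}) (at_left 1)" using r0 by (auto simp: eventually_at_left_field)
      then have "eventually (\<lambda>n. 1 - 1 / (real n + 2) \<in> {r0<..<1}) sequentially"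
        using filterlim_radii by (auto simp: filterlim_iff)
      then show "eventually (\<lambda>n. Lp_le p (\<lambda>\<theta>. g (polar r \<theta>) - g (of_real (1 - 1 / (real n + 2)) * cis \<theta>)) \<epsilon>) sequentially"
        by eventually_elim (rule r0(3); use r in auto)
      show "(\<lambda>\<theta>. g (polar r \<theta>) - g (of_real (1 - 1 / (real n + 2)) * cis \<theta>)) \<in> borel_measurable borel" for n
        using r r0 radii_bounds[of n] by (intro borel_measurable_diff trace_measurable hol) auto
    qed (use p \<epsilon> in auto)
  qed
qed

lemma bdry_Lp_le:
  assumes g: "g \<in> Hardy p" and p: "1 < p"
  shows "Lp_le p (bdry g) (Hardy_norm p g)"
proof (rule Lp_le_AE_lim[where \<phi>n="\<lambda>n \<theta>. g (of_real (1 - 1 / (real n + 2)) * cis \<theta>)"])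
  show "AE \<theta> in circle. (\<lambda>n. g (of_real (1 - 1 / (real n + 2)) * cis \<theta>)) \<longlonglongrightarrow> bdry g \<theta>"
    using AE_circleI[OF bdry_AE_lim[OF g p]] .
  show "eventually (\<lambda>n. Lp_le p (\<lambda>\<theta>. g (of_real (1 - 1 / (real n + 2)) * cis \<theta>)) (Hardy_norm p g)) sequentially"
    using p by (intro always_eventually allI Hardy_Lp_le[OF g] radii_bounds) auto
  show "(\<lambda>\<theta>. g (of_real (1 - 1 / (real n + 2)) * cis \<theta>)) \<in> borel_measurable borel" for n
    using radii_bounds[of n] by (intro trace_measurable Hardy_holomorphic[OF g])
qed (use p Hardy_norm_nonneg[OF g] in auto)

lemma bdry_diff_Lp_le:
  assumes g: "g \<in> Hardy p" and p: "1 < p"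
  shows "Lp_le p (\<lambda>\<theta>. bdry g (\<theta> + h) - bdry g \<theta>) (2 * Hardy_norm p g)"
proof -
  have [measurable]: "bdry g \<in> borel_measurable borel" using Hardy_holomorphic[OF g] by measurable
  have "Lp_le p (\<lambda>\<theta>. bdry g (\<theta> + h)) (Hardy_norm p g)"
    using bdry_Lp_le[OF g p] by (subst Lp_le_shift) (auto simp: bdry_period)
  then show ?thesis
    using Lp_le_diff[of p "\<lambda>\<theta>. bdry g (\<theta> + h)" "bdry g" "Hardy_norm p g" "Hardy_norm p g"] bdry_Lp_le[OF g p] p by simp
qed

text \<open>Both versions of the boundary function agree almost everywhere, also after a shift, and
  the bound of the increment by \<open>2 * Hardy_norm p g\<close> rules out the default value of the
  Lebesgue integral.\<close>

lemma boundary_increment_le_iff: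
  assumes g: "g \<in> Hardy p" and p: "1 < p"
  shows "((LINT \<theta>:{0..2*pi}|lebesgue. norm (boundary_fun g (\<theta> + h) - boundary_fun g \<theta>) powr p) / (2 * pi)) powr (1 / p) \<le> W
    \<longleftrightarrow> Lp_le p (\<lambda>\<theta>. bdry g (\<theta> + h) - bdry g \<theta>) W"
proof -
  have [measurable]: "bdry g \<in> borel_measurable borel" using Hardy_holomorphic[OF g] by measurable
  let ?f = "\<lambda>\<theta>. norm (bdry g (\<theta> + h) - bdry g \<theta>) powr p"
  let ?f' = "\<lambda>\<theta>. norm (boundary_fun g (\<theta> + h) - boundary_fun g \<theta>) powr p"
  have ae: "AE \<theta> in lebesgue. ?f \<theta> = ?f' \<theta>"
  proof (rule AE_completion)
    show "AE \<theta> in lborel. ?f \<theta> = ?f' \<theta>"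
      using boundary_fun_AE_bdry[OF g p] AE_shift[OF boundary_fun_AE_bdry[OF g p], of h]
      by eventually_elim simp
  qed
  have m: "?f \<in> borel_measurable lebesgue" by (intro measurable_completion) measurable
  then have m': "?f' \<in> borel_measurable lebesgue" using ae by (rule borel_measurable_AE)
  have "(LINT \<theta>:{0..2*pi}|lebesgue. ?f' \<theta>) = (LINT \<theta>:{0..2*pi}|lebesgue. ?f \<theta>)"
    unfolding set_lebesgue_integral_def
  proof (rule integral_cong_AE)
    show "AE x in lebesgue. indicator {0..2*pi} x *\<^sub>R ?f' x = indicator {0..2*pi} x *\<^sub>R ?f x"
      using ae by eventually_elim simp
  qed (intro borel_measurable_scaleR borel_measurable_indicator m m'; simp)+
  moreover have "((LINT \<theta>:{0..2*pi}|lebesgue. ?f \<theta>) / (2 * pi)) powr (1 / p) \<le> W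
     \<longleftrightarrow> Lp_le p (\<lambda>\<theta>. bdry g (\<theta> + h) - bdry g \<theta>) W"
  proof (rule mean_le_iff_Lp_le)
    show "bdry g (x + 2 * pi + h) - bdry g (x + 2 * pi) = bdry g (x + h) - bdry g x" for x
      using bdry_period[of g "x + h"] bdry_period[of g x] by (simp add: add_ac)
  qed (use bdry_diff_Lp_le[OF g p] p in auto)
  ultimately show ?thesis by simp
qed

text \<open>The function z -> g(cis(u) z) - g(z) is holomorphic, so its means grow with the radius;
  near radius 1 they differ from the boundary increment by as little as desired.\<close>

lemma Hardy_translation_le:
  assumes g: "g \<in> Hardy p" and p: "1 < p" and s: "0 \<le> s" "s < 1"
    and W: "Lp_le p (\<lambda>\<theta>. bdry g (\<theta> + u) - bdry g \<theta>) W"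
  shows "Lp_le p (\<lambda>\<theta>. g (polar s (\<theta> + u)) - g (polar s \<theta>)) W"
proof (rule Lp_le_limit[OF _ Lp_le_nonneg[OF W]])
  fix \<eta> :: real assume \<eta>: "0 < \<eta>"
  have hol: "g holomorphic_on ball 0 1" using g by (rule Hardy_holomorphic)
  have [measurable]: "bdry g \<in> borel_measurable borel" using hol by measurable
  obtain r0 where r0: "r0 < 1" "\<And>r. r0 \<le> r \<Longrightarrow> r < 1 \<Longrightarrow> Lp_le p (\<lambda>\<theta>. g (polar r \<theta>) - bdry g \<theta>) (\<eta> / 2)"
    using bdry_Lp_approx[OF g p, of "\<eta> / 2"] \<eta> by auto
  define r where "r = max s r0"
  have r: "0 \<le> r" "s \<le> r" "r0 \<le> r" "r < 1" using s r0 by (auto simp: r_def)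
  have [measurable]: "(\<lambda>\<theta>. g (polar r \<theta>)) \<in> borel_measurable borel"
    using trace_measurable(2)[OF hol r(1,4)] .
  have d: "Lp_le p (\<lambda>\<theta>. g (polar r \<theta>) - bdry g \<theta>) (\<eta> / 2)" using r0 r by blast
  then have "Lp_le p (\<lambda>\<theta>. g (polar r (\<theta> + u)) - bdry g (\<theta> + u)) (\<eta> / 2)"
    by (subst Lp_le_shift[where \<phi>="\<lambda>\<theta>. g (polar r \<theta>) - bdry g \<theta>"]) (auto simp: bdry_period)
  with W have "Lp_le p (\<lambda>\<theta>. (g (polar r (\<theta> + u)) - bdry g (\<theta> + u)) + (bdry g (\<theta> + u) - bdry g \<theta>)) (\<eta> / 2 + W)"
    using p trace_measurable(1)[OF hol r(1,4)] by (intro Lp_le_add) auto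
  with d have "Lp_le p (\<lambda>\<theta>. ((g (polar r (\<theta> + u)) - bdry g (\<theta> + u)) + (bdry g (\<theta> + u) - bdry g \<theta>))
       - (g (polar r \<theta>) - bdry g \<theta>)) (\<eta> / 2 + W + \<eta> / 2)"
    using p trace_measurable(1)[OF hol r(1,4)] by (intro Lp_le_diff) auto
  then have *: "Lp_le p (\<lambda>\<theta>. g (polar r (\<theta> + u)) - g (polar r \<theta>)) (W + \<eta>)"
    by (simp add: add.commute)
  let ?F = "\<lambda>z. g (cis u * z) - g z"
  have eq: "?F (polar x \<theta>) = g (polar x (\<theta> + u)) - g (polar x \<theta>)" for x \<theta>
  proof -
    have "cis u * (polar x \<theta>) = of_real x * cis (\<theta> + u)" by (simp add: mult.left_commute cis_mult add.commute)
    then show ?thesis by (simp only:)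
  qed
  have F: "?F holomorphic_on ball 0 1"
    by (intro holomorphic_intros holomorphic_on_compose_gen[OF _ hol, unfolded o_def] hol) (auto simp: norm_mult)
  show "Lp_le p (\<lambda>\<theta>. g (polar s (\<theta> + u)) - g (polar s \<theta>)) (W + \<eta>)"
    using Lp_le_radius_mono[of p ?F s r "W + \<eta>"] F * p s r unfolding eq by simp
qed (use p in simp)

section \<open>Mean Lipschitz functions\<close>

lemma nn_integral_even_le:
  fixes f :: "real \<Rightarrow> ennreal"
  assumes [measurable]: "f \<in> borel_measurable borel"
  shows "(\<integral>\<^sup>+s. f \<bar>s\<bar> \<partial>lborel) \<le> 2 * (\<integral>\<^sup>+s. f s * indicator {0..} s \<partial>lborel)"
proof -
  have "(\<integral>\<^sup>+s. f \<bar>s\<bar> \<partial>lborel) \<le> (\<integral>\<^sup>+s. f s * indicator {0..} s + f (- s) * indicator {0..} (- s) \<partial>lborel)"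
    by (intro nn_integral_mono) (auto simp: indicator_def abs_if)
  also have "\<dots> = (\<integral>\<^sup>+s. f s * indicator {0..} s \<partial>lborel) + (\<integral>\<^sup>+s. f (- s) * indicator {0..} (- s) \<partial>lborel)"
    by (rule nn_integral_add) measurable
  also have "(\<integral>\<^sup>+s. f (- s) * indicator {0..} (- s) \<partial>lborel) = (\<integral>\<^sup>+s. f s * indicator {0..} s \<partial>lborel)"
    using nn_integral_real_affine[of "\<lambda>s. f s * indicator {0..} s" "-1" 0] by simp
  finally show ?thesis by (simp add: mult_2)
qed

text \<open>For \<open>c < 1 < b + c\<close> this is the integral of
  \<open>max 1 \<bar>s\<bar> powr (- b) * \<bar>s\<bar> powr (- c)\<close> over the line, split at
  1; scaling by \<open>x\<close> produces the power \<open>1 - b - c\<close>.\<close>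

definition power_kernel_const :: "real \<Rightarrow> real \<Rightarrow> real" where
  "power_kernel_const b c = 2 / (1 - c) + 2 / (b + c - 1)"

lemma power_kernel_const_pos: "c < 1 \<Longrightarrow> 1 < b + c \<Longrightarrow> 0 < power_kernel_const b c"
  by (simp add: power_kernel_const_def add_pos_pos)

lemma power_kernel_integral:
  assumes c: "c < 1" "1 < b + c" and x: "0 < x"
  shows "(\<integral>\<^sup>+s. ennreal (max x \<bar>s\<bar> powr (- b) * \<bar>s\<bar> powr (- c)) \<partial>lborel)
    \<le> ennreal (power_kernel_const b c * x powr (1 - b - c))"
proof -
  have 1: "(\<integral>\<^sup>+s. ennreal (s powr (- c)) * indicator {0..x} s \<partial>lborel) = ennreal (x powr (1 - c) / (1 - c))"
    using nn_integral_has_integral_lebesgue'[OF _ has_integral_powr_from_0[of "- c" x]] c x by simp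
  have 2: "(\<integral>\<^sup>+s. ennreal (s powr (- b - c)) * indicator {x..} s \<partial>lborel) = ennreal (x powr (1 - b - c) / (b + c - 1))"
  proof -
    have "- (x powr (- b - c + 1) / (- b - c + 1)) = x powr (1 - b - c) / (b + c - 1)"
      using c by (simp add: field_simps)
    then show ?thesis
      using nn_integral_has_integral_lebesgue'[OF _ has_integral_powr_to_inf[of "- b - c" x]] c x by simp
  qed
  let ?f = "\<lambda>s. ennreal (max x s powr (- b) * s powr (- c))"
  have "(\<integral>\<^sup>+s. ?f \<bar>s\<bar> \<partial>lborel) \<le> 2 * (\<integral>\<^sup>+s. ?f s * indicator {0..} s \<partial>lborel)"
    by (rule nn_integral_even_le) measurable
  also have "(\<integral>\<^sup>+s. ?f s * indicator {0..} s \<partial>lborel)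
     \<le> (\<integral>\<^sup>+s. ennreal (x powr (- b)) * (ennreal (s powr (- c)) * indicator {0..x} s) + ennreal (s powr (- b - c)) * indicator {x..} s \<partial>lborel)"
  proof (intro nn_integral_mono)
    fix s :: real
    show "?f s * indicator {0..} s \<le> ennreal (x powr (- b)) * (ennreal (s powr (- c)) * indicator {0..x} s) + ennreal (s powr (- b - c)) * indicator {x..} s"
    proof (cases "s \<le> x")
      case True
      then show ?thesis using x by (auto simp: indicator_def max_absorb1 ennreal_mult intro: add_increasing2)
    next
      case False
      then have "s powr (- b) * s powr (- c) = s powr (- b - c)" using x by (simp flip: powr_add)
      then show ?thesis using False x by (simp add: max_absorb2)
    qed
  qed
  also have "\<dots> = ennreal (x powr (- b)) * ennreal (x powr (1 - c) / (1 - c)) + ennreal (x powr (1 - b - c) / (b + c - 1))"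
    by (subst nn_integral_add) (auto simp: nn_integral_cmult 1 2)
  also have "\<dots> = ennreal (x powr (- b) * (x powr (1 - c) / (1 - c)) + x powr (1 - b - c) / (b + c - 1))"
    using c by (subst ennreal_mult[symmetric]; (subst ennreal_plus[symmetric])?) auto
  also have "x powr (- b) * (x powr (1 - c) / (1 - c)) = x powr (1 - b - c) / (1 - c)"
    using x by (simp add: algebra_simps flip: powr_add)
  finally have "(\<integral>\<^sup>+s. ?f \<bar>s\<bar> \<partial>lborel) \<le> 2 * ennreal (x powr (1 - b - c) / (1 - c) + x powr (1 - b - c) / (b + c - 1))"
    by (simp add: mult_left_mono)
  also have "\<dots> = ennreal (2 * (x powr (1 - b - c) / (1 - c) + x powr (1 - b - c) / (b + c - 1)))"
    using c by (subst ennreal_mult) auto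
  also have "2 * (x powr (1 - b - c) / (1 - c) + x powr (1 - b - c) / (b + c - 1)) = power_kernel_const b c * x powr (1 - b - c)"
    by (simp add: power_kernel_const_def algebra_simps)
  finally show ?thesis .
qed

section \<open>From boundary increments to the second derivative\<close>

lemma ennreal_divide_2pi_le: "y / ennreal (2 * pi) \<le> y"
proof (cases y)
  case (real r)
  have "r * 1 \<le> r * (2 * pi)" using real pi_ge_two by (intro mult_left_mono) auto
  then have "r / (2 * pi) \<le> r" by (simp add: field_simps)
  then show ?thesis using real by (simp add: divide_ennreal ennreal_leI)
qed simp

text \<open>The 128 is 2 from the factorial times the cube of 4 from
  \<open>norm_cis_diff_ge\<close>. The exponent 3 is the power of the Cauchy kernel;
  \<open>- 1 / q\<close> and \<open>- 1\<close> encode the two growth rates of the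
  increment.\<close>

definition second_deriv_const :: "real \<Rightarrow> real" where
  "second_deriv_const q = 128 * (power_kernel_const 3 (- 1 / q) + power_kernel_const 3 (- 1))"

text \<open>Cauchy's formula of order 2 on the circle of radius \<open>s\<close>, evaluated at
  relative radius \<open>r\<close>, expresses g'' by angular increments, and Minkowski's inequality
  takes the mean under the integral. Keeping \<open>s\<close> below 1 avoids boundary integrals,
  while the bound depends on \<open>r\<close> only.\<close>

lemma second_derivative_bound:
  assumes g: "g \<in> Hardy q" and q: "1 < q" and eB: "0 \<le> \<epsilon>" "0 \<le> B"
    and inc: "\<And>u. \<bar>u\<bar> \<le> pi \<Longrightarrow> Lp_le q (\<lambda>\<theta>. bdry g (\<theta> + u) - bdry g \<theta>) (\<epsilon> * \<bar>u\<bar> powr (1 / q) + B * \<bar>u\<bar>)"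
    and s: "0 \<le> s" "s < 1" and r: "0 \<le> r" "r < 1"
  shows "Lp_le q (\<lambda>\<theta>. of_real (s\<^sup>2) * deriv (deriv g) (polar (s * r) \<theta>))
     (second_deriv_const q * (\<epsilon> * (1 - r) powr (1 / q - 2) + B / (1 - r)))"
proof -
  have hol: "g holomorphic_on ball 0 1" using g by (rule Hardy_holomorphic)
  let ?I = "\<lambda>u. indicat_real {-pi..pi} u"
  let ?k = "\<lambda>u. 2 / (cis u - of_real r) ^ 3"
  let ?A = "\<lambda>u \<theta>. of_real (?I u) * (?k u * (g (polar s (\<theta> + u)) - g (polar s \<theta>)))"
  let ?W = "\<lambda>u. ?I u * (norm (?k u) * (\<epsilon> * \<bar>u\<bar> powr (1 / q) + B * \<bar>u\<bar>))"
  have ne: "cis u - of_real r \<noteq> 0" for u using cis_ne[of "of_real r" u] r by auto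
  have km: "continuous_on UNIV ?k" using ne by (intro continuous_intros) auto
  then have [measurable]: "?k \<in> borel_measurable borel" by (rule borel_measurable_continuous_onI)
  have m1: "(\<lambda>(u, \<theta>). g (polar s (\<theta> + u))) \<in> borel_measurable (borel \<Otimes>\<^sub>M borel)"
    using pair_trace_measurable[OF hol s] .
  have m2 [measurable]: "(\<lambda>\<theta>. g (polar s \<theta>)) \<in> borel_measurable borel" using trace_measurable(2)[OF hol s] .
  have Anorm: "(\<lambda>(u, \<theta>). ?A u \<theta>) \<in> borel_measurable (borel \<Otimes>\<^sub>M borel)"
  proof -
    have [measurable]: "(\<lambda>x. g (polar s (snd x + fst x))) \<in> borel_measurable (borel \<Otimes>\<^sub>M borel)"
      using m1 by (simp add: case_prod_beta')
    have [measurable]: "(\<lambda>x::real \<times> real. g (polar s (snd x))) \<in> borel_measurable (borel \<Otimes>\<^sub>M borel)"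
      by (rule measurable_compose[OF measurable_snd m2])
    have [measurable]: "(\<lambda>x::real \<times> real. ?k (fst x)) \<in> borel_measurable (borel \<Otimes>\<^sub>M borel)"
      using \<open>?k \<in> borel_measurable borel\<close> by (rule measurable_compose[OF measurable_fst])
    show ?thesis unfolding case_prod_beta'
      by (intro borel_measurable_times borel_measurable_diff borel_measurable_of_real) measurable
  qed
  show ?thesis
  proof (rule Minkowski_integral[OF _ circle.finite_measure_axioms, where A="?A" and W="?W"])
    show "(\<lambda>(u, \<theta>). ?A u \<theta>) \<in> borel_measurable (circle \<Otimes>\<^sub>M borel)"
      using Anorm by (simp cong: measurable_cong_sets sets_pair_measure_cong)
    show "Lp_le q (?A u) (?W u)" for u
    proof (cases "\<bar>u\<bar> \<le> pi")
      case True
      have "Lp_le q (\<lambda>\<theta>. ?k u * (g (polar s (\<theta> + u)) - g (polar s \<theta>)))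
         (norm (?k u) * (\<epsilon> * \<bar>u\<bar> powr (1 / q) + B * \<bar>u\<bar>))"
        using q trace_measurable[OF hol s]
        by (intro Lp_le_cmult Hardy_translation_le[OF g q s inc[OF True]]) auto
      then show ?thesis using True by (simp add: abs_le_iff)
    next
      case False
      then have "?I u = 0" by (auto simp: abs_le_iff indicator_def)
      then show ?thesis using Lp_le_sup[of "\<lambda>_. 0" 0 q] q by simp
    qed
    show "ennreal (norm (of_real (s\<^sup>2) * deriv (deriv g) (polar (s * r) \<theta>))) \<le> (\<integral>\<^sup>+u. ennreal (norm (?A u \<theta>)) \<partial>circle)" for \<theta>
    proof -
      let ?c = "of_real s * cis \<theta>"
      have c: "norm ?c < 1" using s by (simp add: norm_mult)
      \<comment> \<open>Subtracting the value at the centre angle changes no derivative but turns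
        values of \<open>g\<close> into increments, whose size is controlled.\<close>
      let ?V = "\<lambda>w. g (?c * w) - g ?c"
      have V: "continuous_on (cball 0 1) ?V" "?V holomorphic_on ball 0 1"
        by (intro continuous_intros holomorphic_intros holomorphic_rotate_dilate[OF hol c])+
      let ?h = "\<lambda>u. ?V (cis u) * cis u / (cis u - of_real r) ^ 3"
      have "continuous_on UNIV ?h"
        using ne by (intro continuous_intros continuous_on_circle_trace[OF V(1)]) auto
      then have int: "integrable circle ?h" by (rule integrable_circle)
      have "(deriv ^^ 2) ?V (of_real r) = (deriv ^^ 2) (\<lambda>w. g (?c * w)) (of_real r) - (deriv ^^ 2) (\<lambda>w. g ?c) (of_real r)"
        using r by (intro higher_deriv_diff[of _ "ball 0 1"] holomorphic_rotate_dilate[OF hol c] holomorphic_intros) auto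
      also have "(deriv ^^ 2) (\<lambda>w. g (?c * w)) (of_real r) = ?c ^ 2 * (deriv ^^ 2) g (?c * of_real r)"
      proof (rule higher_deriv_compose_linear[OF hol open_ball open_ball])
        show "?c * w \<in> ball 0 1" if "w \<in> ball 0 1" for w
        proof -
          have "norm (?c * w) \<le> 1 * norm w" unfolding norm_mult[of ?c] using c by (intro mult_right_mono) auto
          then show ?thesis using that by simp
        qed
      qed (use r in auto)
      finally have d: "(deriv ^^ 2) ?V (of_real r) = ?c ^ 2 * deriv (deriv g) (polar (s * r) \<theta>)"
        by (simp add: numeral_2_eq_2 mult_ac)
      have h3: "Suc 2 = 3" by simp
      have "(LINT u|circle. ?h u) = (deriv ^^ 2) ?V (of_real r) / fact 2"
        using Cauchy_circle[OF V, of "of_real r" 2] r unfolding h3 by simp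
      moreover have "(LINT u|circle. 2 * ?h u) = 2 * (LINT u|circle. ?h u)" by (rule integral_mult_right_zero)
      ultimately have L: "(LINT u|circle. 2 * ?h u) = ?c ^ 2 * deriv (deriv g) (polar (s * r) \<theta>)"
        unfolding d by (simp add: mult.commute)
      have N1: "norm (of_real (s\<^sup>2) * deriv (deriv g) (polar (s * r) \<theta>)) = norm (LINT u|circle. 2 * ?h u)"
        unfolding L by (simp add: norm_mult norm_power)
      have N2: "ennreal (norm (LINT u|circle. 2 * ?h u)) \<le> (\<integral>\<^sup>+u. ennreal (norm (2 * ?h u)) \<partial>circle)"
        by (rule integral_norm_bound_ennreal[OF integrable_mult_right[OF int]])
      have N3: "(\<integral>\<^sup>+u. ennreal (norm (2 * ?h u)) \<partial>circle) = (\<integral>\<^sup>+u. ennreal (norm (?A u \<theta>)) \<partial>circle)"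
      proof (rule nn_integral_cong_AE)
        have "norm (2 * ?h u) = norm (?A u \<theta>)" if "u \<in> {-pi..pi}" for u
        proof -
          have e: "?c * cis u = of_real s * cis (\<theta> + u)" by (simp add: cis_mult mult.assoc)
          have "2 * ?h u = ?k u * (g (polar s (\<theta> + u)) - g ?c) * cis u" unfolding e by simp
          then have "norm (2 * ?h u) = norm (?k u * (g (polar s (\<theta> + u)) - g ?c))"
            by (simp only: norm_mult norm_cis mult_1_right)
          then show ?thesis using that by simp
        qed
        then show "AE u in circle. ennreal (norm (2 * ?h u)) = ennreal (norm (?A u \<theta>))"
          by (intro eventually_mono[OF AE_circle_range]) (simp only:)
      qed
      show ?thesis unfolding N1 using N2 unfolding N3 .
    qed
    show "(\<integral>\<^sup>+u. ennreal (?W u) \<partial>circle) \<le> ennreal (second_deriv_const q * (\<epsilon> * (1 - r) powr (1 / q - 2) + B / (1 - r)))"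
    proof -
      let ?x = "1 - r"
      let ?g1 = "\<lambda>u. ennreal (max ?x \<bar>u\<bar> powr (- 3) * \<bar>u\<bar> powr (- (- 1 / q)))"
      let ?g2 = "\<lambda>u. ennreal (max ?x \<bar>u\<bar> powr (- 3) * \<bar>u\<bar> powr (- (- 1)))"
      have x: "0 < ?x" using r by simp
      have kle: "norm (?k u) \<le> 128 * max ?x \<bar>u\<bar> powr (- 3)" if u: "\<bar>u\<bar> \<le> pi" for u
      proof -
        have m: "0 < max ?x \<bar>u\<bar>" using x by auto
        have "norm (?k u) = 2 / norm (cis u - of_real r) ^ 3" by (simp add: norm_divide norm_power)
        also have "\<dots> \<le> 2 / (max ?x \<bar>u\<bar> / 4) ^ 3"
          using norm_cis_diff_ge[of r u] r u m ne[of u] by (intro divide_left_mono power_mono mult_pos_pos zero_less_power) auto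
        also have "\<dots> = 128 / max ?x \<bar>u\<bar> ^ 3" by (simp add: power_divide)
        also have "\<dots> = 128 * max ?x \<bar>u\<bar> powr (- 3)" using m by (simp add: powr_minus_divide)
        finally show ?thesis .
      qed
      have "(\<integral>\<^sup>+u. ennreal (?W u) \<partial>circle) = (\<integral>\<^sup>+u. ennreal (?W u) * indicator {-pi..pi} u \<partial>lborel) / ennreal (2 * pi)"
        by (rule nn_integral_circle) measurable
      also have "\<dots> \<le> (\<integral>\<^sup>+u. ennreal (?W u) * indicator {-pi..pi} u \<partial>lborel)"
        by (rule ennreal_divide_2pi_le)
      also have "\<dots> \<le> (\<integral>\<^sup>+u. ennreal (128 * \<epsilon>) * ?g1 u + ennreal (128 * B) * ?g2 u \<partial>lborel)"
      proof (intro nn_integral_mono)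
        fix u :: real
        show "ennreal (?W u) * indicator {-pi..pi} u \<le> ennreal (128 * \<epsilon>) * ?g1 u + ennreal (128 * B) * ?g2 u"
        proof (cases "\<bar>u\<bar> \<le> pi")
          case True
          have "norm (?k u) * (\<epsilon> * \<bar>u\<bar> powr (1 / q) + B * \<bar>u\<bar>) \<le> (128 * max ?x \<bar>u\<bar> powr (- 3)) * (\<epsilon> * \<bar>u\<bar> powr (1 / q) + B * \<bar>u\<bar>)"
            using kle[OF True] eB by (intro mult_right_mono) auto
          also have "\<dots> = 128 * \<epsilon> * (max ?x \<bar>u\<bar> powr (- 3) * \<bar>u\<bar> powr (- (- 1 / q))) + 128 * B * (max ?x \<bar>u\<bar> powr (- 3) * \<bar>u\<bar> powr (- (- 1)))"
            by (simp add: algebra_simps)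
          finally have "ennreal (norm (?k u) * (\<epsilon> * \<bar>u\<bar> powr (1 / q) + B * \<bar>u\<bar>)) \<le> ennreal (128 * \<epsilon>) * ?g1 u + ennreal (128 * B) * ?g2 u"
            using eB by (simp flip: ennreal_mult ennreal_plus add: ennreal_leI)
          moreover have "u \<in> {-pi..pi}" using True by auto
          ultimately show ?thesis by simp
        next
          case False
          then have "u \<notin> {-pi..pi}" by auto
          then show ?thesis by simp
        qed
      qed
      also have "\<dots> = ennreal (128 * \<epsilon>) * (\<integral>\<^sup>+u. ?g1 u \<partial>lborel) + ennreal (128 * B) * (\<integral>\<^sup>+u. ?g2 u \<partial>lborel)"
        by (subst nn_integral_add) (auto simp: nn_integral_cmult)
      also have "\<dots> \<le> ennreal (128 * \<epsilon>) * ennreal (power_kernel_const 3 (- 1 / q) * ?x powr (1 - 3 - (- 1 / q)))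
          + ennreal (128 * B) * ennreal (power_kernel_const 3 (- 1) * ?x powr (1 - 3 - (- 1)))"
        using x q by (intro add_mono mult_left_mono power_kernel_integral) (auto simp: field_simps)
      also have "\<dots> = ennreal (128 * \<epsilon> * (power_kernel_const 3 (- 1 / q) * ?x powr (1 / q - 2)) + 128 * B * (power_kernel_const 3 (- 1) / ?x))"
      proof -
        have "0 < power_kernel_const 3 (- 1 / q)" "0 < power_kernel_const 3 (- 1)"
          using q by (auto intro!: power_kernel_const_pos simp: field_simps)
        then show ?thesis using eB x by (simp add: powr_minus_divide flip: ennreal_mult ennreal_plus)
      qed
      also have "\<dots> \<le> ennreal (second_deriv_const q * (\<epsilon> * (1 - r) powr (1 / q - 2) + B / (1 - r)))"
      proof (intro ennreal_leI)
        define k1 k2 where "k1 = power_kernel_const 3 (- 1 / q)" and "k2 = power_kernel_const 3 (- 1)"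
        have k: "0 < k1" "0 < k2"
          unfolding k1_def k2_def using q by (auto intro!: power_kernel_const_pos simp: field_simps)
        define X Y where "X = \<epsilon> * (1 - r) powr (1 / q - 2)" and "Y = B / (1 - r)"
        have XY: "0 \<le> X" "0 \<le> Y" using eB r by (auto simp: X_def Y_def)
        have "128 * \<epsilon> * (k1 * ?x powr (1 / q - 2)) + 128 * B * (k2 / ?x) = 128 * k1 * X + 128 * k2 * Y"
          by (simp add: X_def Y_def)
        also have "\<dots> \<le> 128 * (k1 + k2) * X + 128 * (k1 + k2) * Y"
          using k XY by (intro add_mono mult_right_mono) auto
        also have "\<dots> = second_deriv_const q * (X + Y)"
          by (simp add: second_deriv_const_def k1_def k2_def algebra_simps)
        finally show "128 * \<epsilon> * (power_kernel_const 3 (- 1 / q) * ?x powr (1 / q - 2)) + 128 * B * (power_kernel_const 3 (- 1) / ?x)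
          \<le> second_deriv_const q * (\<epsilon> * (1 - r) powr (1 / q - 2) + B / (1 - r))"
          unfolding k1_def k2_def X_def Y_def .
      qed
      finally show ?thesis .
    qed
    have "0 < power_kernel_const 3 (- 1 / q)" "0 < power_kernel_const 3 (- 1)"
      using q by (auto intro!: power_kernel_const_pos simp: field_simps)
    then show "0 \<le> second_deriv_const q * (\<epsilon> * (1 - r) powr (1 / q - 2) + B / (1 - r))"
      using eB r by (intro mult_nonneg_nonneg add_nonneg_nonneg) (auto simp: second_deriv_const_def)
  qed (use q in auto)
qed

text \<open>The little-oh bound holds for angles below some \<open>t0\<close>. From
  \<open>t0\<close> on, the trivial bound \<open>2 * N = B * t0\<close> is at most
  \<open>B * u\<close>; a linear term is of lower order than the power \<open>1 / q\<close>, which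
  is why it may carry a large constant.\<close>

lemma mean_Lipschitz_increment:
  assumes g: "g \<in> little_mean_Lipschitz q (1 / q)" and q: "1 < q" and \<epsilon>: "0 < \<epsilon>"
  obtains B where "0 \<le> B" "\<And>u. \<bar>u\<bar> \<le> pi \<Longrightarrow> Lp_le q (\<lambda>\<theta>. bdry g (\<theta> + u) - bdry g \<theta>) (\<epsilon> * \<bar>u\<bar> powr (1 / q) + B * \<bar>u\<bar>)"
proof -
  have gH: "g \<in> Hardy q" and o: "(\<lambda>t. mean_modulus q g t) \<in> o[at_right 0](\<lambda>t. t powr (1 / q))"
    using g by (auto simp: little_mean_Lipschitz_def)
  have [measurable]: "bdry g \<in> borel_measurable borel" using Hardy_holomorphic[OF gH] by measurable
  define N where "N = Hardy_norm q g"
  have N0: "0 \<le> N" using Hardy_norm_nonneg[OF gH] q by (simp add: N_def)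
  let ?m = "\<lambda>h. ((LINT \<theta>:{0..2*pi}|lebesgue. norm (boundary_fun g (\<theta> + h) - boundary_fun g \<theta>) powr q) / (2 * pi)) powr (1 / q)"
  have bd: "?m h \<le> 2 * N" for h
    using boundary_increment_le_iff[OF gH q, of h] bdry_diff_Lp_le[OF gH q] by (simp add: N_def)
  from landau_o.smallD[OF o \<epsilon>] have "eventually (\<lambda>t. norm (mean_modulus q g t) \<le> \<epsilon> * norm (t powr (1 / q))) (at_right 0)" .
  then obtain t0 where t0: "0 < t0" "\<And>t. 0 < t \<Longrightarrow> t < t0 \<Longrightarrow> norm (mean_modulus q g t) \<le> \<epsilon> * norm (t powr (1 / q))"
    by (auto simp: eventually_at_right_field)
  define B where "B = 2 * N / t0"
  have B0: "0 \<le> B" using N0 t0 by (simp add: B_def)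
  have pos: "Lp_le q (\<lambda>\<theta>. bdry g (\<theta> + u) - bdry g \<theta>) (\<epsilon> * u powr (1 / q) + B * u)" if u: "0 < u" for u
  proof (cases "u < t0")
    case True
    have "?m u \<le> mean_modulus q g u" unfolding mean_modulus_def
      by (rule cSUP_upper) (use u bd in \<open>auto intro!: bdd_aboveI2\<close>)
    also have "\<dots> \<le> \<epsilon> * u powr (1 / q)" using t0(2)[OF u True] by simp
    also have "\<dots> \<le> \<epsilon> * u powr (1 / q) + B * u" using B0 u by simp
    finally show ?thesis using boundary_increment_le_iff[OF gH q] by blast
  next
    case False
    have "2 * N = B * t0" using t0 by (simp add: B_def)
    also have "\<dots> \<le> \<epsilon> * u powr (1 / q) + B * u" using False B0 \<epsilon> by (intro add_increasing mult_left_mono) auto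
    finally show ?thesis using bdry_diff_Lp_le[OF gH q, of u] q by (auto simp: N_def intro: Lp_le_mono)
  qed
  show thesis
  proof (rule that[OF B0])
    fix u :: real
    consider "u = 0" | "0 < u" | "u < 0" by linarith
    then show "Lp_le q (\<lambda>\<theta>. bdry g (\<theta> + u) - bdry g \<theta>) (\<epsilon> * \<bar>u\<bar> powr (1 / q) + B * \<bar>u\<bar>)"
    proof cases
      case 1
      then show ?thesis using q Lp_le_sup[of "\<lambda>_. 0" 0 q] by simp
    next
      case 2
      then show ?thesis using pos by simp
    next
      case 3
      then have "Lp_le q (\<lambda>\<theta>. bdry g (\<theta> + - u) - bdry g \<theta>) (\<epsilon> * \<bar>u\<bar> powr (1 / q) + B * \<bar>u\<bar>)"
        using pos[of "- u"] by simp
      then have "Lp_le q (\<lambda>\<theta>. bdry g (\<theta> + u + - u) - bdry g (\<theta> + u)) (\<epsilon> * \<bar>u\<bar> powr (1 / q) + B * \<bar>u\<bar>)"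
      proof (subst Lp_le_shift[where s=u and \<phi>="\<lambda>\<theta>. bdry g (\<theta> + - u) - bdry g \<theta>"])
        show "bdry g (x + 2 * pi + - u) - bdry g (x + 2 * pi) = bdry g (x + - u) - bdry g x" for x
          using bdry_period[of g "x - u"] bdry_period[of g x] by (simp add: algebra_simps)
      qed measurable
      then show ?thesis by (simp add: Lp_le_def norm_minus_commute)
    qed
  qed
qed

text \<open>Up to the threshold \<open>y0\<close>, where \<open>B * y powr (e - d)\<close> reaches
  at most \<open>\<epsilon>\<close>, the steeper power dominates; beyond it the left side is below
  its value at \<open>y0\<close>.\<close>

lemma powr_absorb:
  fixes d e \<epsilon> B :: real
  assumes de: "0 < d" "d < e" and \<epsilon>: "0 < \<epsilon>" and B: "0 \<le> B"
  obtains B' where "0 \<le> B'" "\<And>y. 0 < y \<Longrightarrow> B * y powr (- d) \<le> \<epsilon> * y powr (- e) + B'"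
proof -
  define y0 where "y0 = (\<epsilon> / (B + 1)) powr (1 / (e - d))"
  have y0: "0 < y0" "y0 powr (e - d) = \<epsilon> / (B + 1)" using de \<epsilon> B by (auto simp: y0_def powr_powr)
  show thesis
  proof (rule that[of "B * y0 powr (- d)"])
    fix y :: real assume y: "0 < y"
    show "B * y powr (- d) \<le> \<epsilon> * y powr (- e) + B * y0 powr (- d)"
    proof (cases "y \<le> y0")
      case True
      have "B * y powr (e - d) \<le> B * y0 powr (e - d)" using True y de B by (intro mult_left_mono powr_mono2) auto
      also have "\<dots> \<le> \<epsilon>" using B \<epsilon> unfolding y0 by (simp add: field_simps)
      finally have "B * y powr (e - d) * y powr (- e) \<le> \<epsilon> * y powr (- e)" by (rule mult_right_mono) simp
      also have "B * y powr (e - d) * y powr (- e) = B * y powr (- d)" using y by (simp add: mult.assoc flip: powr_add)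
      finally show ?thesis using B by (simp add: add_increasing2)
    next
      case False
      then have "B * y powr (- d) \<le> B * y0 powr (- d)" using y0 de B by (intro mult_left_mono powr_mono2') auto
      then show ?thesis using \<epsilon> by (simp add: add_increasing)
    qed
  qed (use B in simp)
qed

text \<open>The lower-order term \<open>B / (1 - r)\<close> is absorbed, since
  \<open>1 < 2 - 1 / q\<close>, into half of the main term and a constant. Radii below 1/4 are left
  to monotonicity of means, because the Cauchy estimate carries the factor
  \<open>1 / x\<close>.\<close>

lemma mean_Lipschitz_second_derivative:
  assumes g: "g \<in> little_mean_Lipschitz q (1 / q)" and q: "1 < q" and \<epsilon>: "0 < \<epsilon>"
  obtains B where "0 \<le> B" "\<And>x. 0 \<le> x \<Longrightarrow> x < 1 \<Longrightarrow>
     Lp_le q (\<lambda>\<theta>. deriv (deriv g) (polar x \<theta>)) (\<epsilon> * (1 - x) powr (1 / q - 2) + B)"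
proof -
  have gH: "g \<in> Hardy q" using g by (simp add: little_mean_Lipschitz_def)
  have hol: "g holomorphic_on ball 0 1" using gH by (rule Hardy_holomorphic)
  have hol2: "deriv (deriv g) holomorphic_on ball 0 1" using hol by (intro holomorphic_intros) auto
  define K where "K = second_deriv_const q"
  have "0 < power_kernel_const 3 (- 1 / q)" "0 < power_kernel_const 3 (- 1)"
    using q by (auto intro!: power_kernel_const_pos simp: field_simps)
  then have K: "0 < K" by (simp add: K_def second_deriv_const_def)
  \<comment> \<open>The 32 is 4 from \<open>1 / x\<close>, 4 from halving the distance to the
    boundary, and 2 because half of \<open>\<epsilon>\<close> is reserved for the lower-order
    term.\<close>
  define e where "e = \<epsilon> / (32 * K)"
  have e: "0 < e" using \<epsilon> K by (simp add: e_def)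
  obtain B where B: "0 \<le> B" "\<And>u. \<bar>u\<bar> \<le> pi \<Longrightarrow> Lp_le q (\<lambda>\<theta>. bdry g (\<theta> + u) - bdry g \<theta>) (e * \<bar>u\<bar> powr (1 / q) + B * \<bar>u\<bar>)"
    using mean_Lipschitz_increment[OF g q e] by blast
  have d1: "(1::real) < 2 - 1 / q" using q by (simp add: field_simps)
  obtain B1 where B1: "0 \<le> B1" "\<And>y. 0 < y \<Longrightarrow> 8 * K * B * y powr (- 1) \<le> \<epsilon> / 2 * y powr (- (2 - 1 / q)) + B1"
    using powr_absorb[of 1 "2 - 1 / q" "\<epsilon> / 2" "8 * K * B"] d1 \<epsilon> K B by auto
  define B2 where "B2 = integral_mean q (1 / 4) (deriv (deriv g))"
  have B2: "0 \<le> B2" by (simp add: B2_def integral_mean_nonneg)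
  show thesis
  proof (rule that[of "B1 + B2"])
    fix x :: real assume x: "0 \<le> x" "x < 1"
    show "Lp_le q (\<lambda>\<theta>. deriv (deriv g) (polar x \<theta>)) (\<epsilon> * (1 - x) powr (1 / q - 2) + (B1 + B2))"
    proof (cases "x < 1 / 4")
      case True
      have "Lp_le q (\<lambda>\<theta>. deriv (deriv g) (polar (1 / 4) \<theta>)) B2"
        unfolding B2_def using q by (intro Lp_le_integral_mean hol2) auto
      then have "Lp_le q (\<lambda>\<theta>. deriv (deriv g) (polar x \<theta>)) B2"
        using Lp_le_radius_mono[of q "deriv (deriv g)" x "1 / 4" B2] True x q hol2 by auto
      then show ?thesis by (rule Lp_le_mono) (use B1 \<epsilon> q in \<open>auto intro!: add_nonneg_nonneg\<close>)
    next
      case False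
      \<comment> \<open>Taking both radii equal to \<open>sqrt x\<close> shares the distance to the
        boundary: \<open>1 - sqrt x\<close> is at least half of \<open>1 - x\<close>.\<close>
      define s where "s = sqrt x"
      have s: "0 \<le> s" "s < 1" "s\<^sup>2 = x" "s * s = x" using x by (auto simp: s_def)
      have xs: "(1 - x) / 2 \<le> 1 - s"
      proof -
        have "1 - x = (1 - s) * (1 + s)" using s(4) by (simp add: algebra_simps)
        also have "\<dots> \<le> (1 - s) * 2" using s by (intro mult_left_mono) auto
        finally show ?thesis by simp
      qed
      have y: "0 < 1 - x" using x by simp
      have p1: "(1 - s) powr (1 / q - 2) \<le> 4 * (1 - x) powr (1 / q - 2)"
      proof -
        have "(1 - s) powr (1 / q - 2) \<le> ((1 - x) / 2) powr (1 / q - 2)"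
          using xs y d1 by (intro powr_mono2') auto
        also have "\<dots> = (1 - x) powr (1 / q - 2) * 2 powr (2 - 1 / q)"
          using y by (simp add: powr_divide powr_diff)
        also have "\<dots> \<le> (1 - x) powr (1 / q - 2) * 2 powr 2"
          using q by (intro mult_left_mono powr_mono) auto
        finally show ?thesis by simp
      qed
      have p2: "B / (1 - s) \<le> 2 * B * (1 - x) powr (- 1)"
      proof -
        have "B / (1 - s) \<le> B / ((1 - x) / 2)" using xs y s B by (intro divide_left_mono) auto
        then show ?thesis using y by (simp add: powr_minus_divide mult.commute)
      qed
      have "Lp_le q (\<lambda>\<theta>. of_real (s\<^sup>2) * deriv (deriv g) (polar (s * s) \<theta>)) (K * (e * (1 - s) powr (1 / q - 2) + B / (1 - s)))"
        unfolding K_def using s e B q by (intro second_derivative_bound[OF gH]) auto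
      from Lp_le_cmult[OF this, of "1 / of_real x"]
      have "Lp_le q (\<lambda>\<theta>. deriv (deriv g) (polar x \<theta>)) (1 / x * (K * (e * (1 - s) powr (1 / q - 2) + B / (1 - s))))"
        using False q trace_measurable(2)[OF hol2 x] unfolding s(3,4) by (simp add: norm_divide)
      then show ?thesis
      proof (rule Lp_le_mono)
        have "1 / x * (K * (e * (1 - s) powr (1 / q - 2) + B / (1 - s))) \<le> 4 * (K * (e * (4 * (1 - x) powr (1 / q - 2)) + 2 * B * (1 - x) powr (- 1)))"
        proof (intro mult_mono)
          show "1 / x \<le> 4" using False x by (simp add: field_simps)
          have "e * (1 - s) powr (1 / q - 2) \<le> e * (4 * (1 - x) powr (1 / q - 2))"
            using p1 e by (intro mult_left_mono) auto
          then show "e * (1 - s) powr (1 / q - 2) + B / (1 - s) \<le> e * (4 * (1 - x) powr (1 / q - 2)) + 2 * B * (1 - x) powr (- 1)"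
            using p2 by (rule add_mono)
          have "0 \<le> B / (1 - s)" "0 \<le> e * (1 - s) powr (1 / q - 2)" using s B e by auto
          then show "0 \<le> e * (1 - s) powr (1 / q - 2) + B / (1 - s)" "0 \<le> K * (e * (1 - s) powr (1 / q - 2) + B / (1 - s))"
            using K by auto
        qed (use K in auto)
        also have "\<dots> = 16 * K * e * (1 - x) powr (1 / q - 2) + 8 * K * B * (1 - x) powr (- 1)"
          by (simp add: algebra_simps)
        also have "16 * K * e = \<epsilon> / 2" using K by (simp add: e_def)
        also have "8 * K * B * (1 - x) powr (- 1) \<le> \<epsilon> / 2 * (1 - x) powr (1 / q - 2) + B1"
          using B1(2)[OF y] by simp
        finally show "1 / x * (K * (e * (1 - s) powr (1 / q - 2) + B / (1 - s))) \<le> \<epsilon> * (1 - x) powr (1 / q - 2) + (B1 + B2)"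
          using B2 by simp
      qed (use q in simp)
    qed
  qed (use B1 B2 in simp)
qed

text \<open>The Hardy--Littlewood argument: an increment by the angle \<open>h\<close> is bounded by
  going in to radius \<open>1 - h\<close>, turning there, and coming out again. Membership in the
  Hardy space is obtained from the same radial integral.\<close>

lemma little_mean_LipschitzI:
  assumes hol: "g holomorphic_on ball 0 1" and p: "1 < p"
    and small: "\<And>\<epsilon>. 0 < \<epsilon> \<Longrightarrow> \<exists>r0. 0 \<le> r0 \<and> r0 < 1 \<and>
       (\<forall>r. r0 \<le> r \<longrightarrow> r < 1 \<longrightarrow> Lp_le p (\<lambda>\<theta>. deriv g (polar r \<theta>)) (\<epsilon> * (1 - r) powr (1 / p - 1)))"
  shows "g \<in> little_mean_Lipschitz p (1 / p)"
proof -
  have inc: "Lp_le p (\<lambda>\<theta>. g (polar R \<theta>) - g (polar r \<theta>)) (\<epsilon> * (p * (1 - r) powr (1 / p)))"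
    if \<epsilon>: "0 < \<epsilon>" and small: "\<And>r. r0 \<le> r \<Longrightarrow> r < 1 \<Longrightarrow> Lp_le p (\<lambda>\<theta>. deriv g (polar r \<theta>)) (\<epsilon> * (1 - r) powr (1 / p - 1))"
    and r: "0 \<le> r" "r0 \<le> r" "r \<le> R" "R < 1" for \<epsilon> r0 r R
  proof (rule Lp_le_radial_increment[OF _ hol])
    show "Lp_le p (\<lambda>\<theta>. deriv g (polar x \<theta>)) (\<epsilon> * (1 - x) powr (1 / p - 1))" if "x \<in> {r..R}" for x
      using that r by (intro small) auto
    have "(\<integral>\<^sup>+x. ennreal (\<epsilon> * (1 - x) powr (1 / p - 1)) * indicator {r..R} x \<partial>lborel)
       = ennreal (- \<epsilon> * p * (1 - R) powr (1 / p) - (- \<epsilon> * p * (1 - r) powr (1 / p)))"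
    proof (rule nn_integral_FTC_Icc)
      show "((\<lambda>x. - \<epsilon> * p * (1 - x) powr (1 / p)) has_real_derivative \<epsilon> * (1 - x) powr (1 / p - 1)) (at x)" if "x \<in> {r..R}" for x
        using that r p by (auto intro!: derivative_eq_intros simp: powr_diff)
    qed (use \<epsilon> r in auto)
    also have "\<dots> \<le> ennreal (\<epsilon> * (p * (1 - r) powr (1 / p)))"
      using \<epsilon> p by (intro ennreal_leI) simp
    finally show "(\<integral>\<^sup>+x. ennreal (\<epsilon> * (1 - x) powr (1 / p - 1)) * indicator {r..R} x \<partial>lborel) \<le> ennreal (\<epsilon> * (p * (1 - r) powr (1 / p)))" .
  qed (use r p \<epsilon> in auto)
  have gH: "g \<in> Hardy p"
  proof -
    obtain r0 where r0: "0 \<le> r0" "r0 < 1" "\<And>r. r0 \<le> r \<Longrightarrow> r < 1 \<Longrightarrow> Lp_le p (\<lambda>\<theta>. deriv g (polar r \<theta>)) (1 * (1 - r) powr (1 / p - 1))"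
      using small[of 1] by auto
    define C where "C = 1 * (p * (1 - r0) powr (1 / p)) + integral_mean p r0 g"
    have big: "Lp_le p (\<lambda>\<theta>. g (polar r \<theta>)) C" if r: "r0 \<le> r" "r < 1" for r
    proof -
      have "Lp_le p (\<lambda>\<theta>. (g (polar r \<theta>) - g (polar r0 \<theta>)) + g (polar r0 \<theta>)) C"
        unfolding C_def using inc[where \<epsilon>=1 and r0=r0 and r=r0 and R=r, OF zero_less_one r0(3)] r0(1,2) r p
        by (intro Lp_le_add Lp_le_integral_mean hol borel_measurable_diff trace_measurable) auto
      then show ?thesis by simp
    qed
    show ?thesis
    proof (rule HardyI(1)[OF hol, where C=C])
      fix r :: real assume r: "0 < r" "r < 1"
      show "Lp_le p (\<lambda>\<theta>. g (polar r \<theta>)) C"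
        using Lp_le_radius_mono[of p g r "max r r0" C] big[of "max r r0"] r r0 p hol by auto
    qed (use p in simp)
  qed
  let ?m = "\<lambda>h. ((LINT \<theta>:{0..2*pi}|lebesgue. norm (boundary_fun g (\<theta> + h) - boundary_fun g \<theta>) powr p) / (2 * pi)) powr (1 / p)"
  have "(\<lambda>t. mean_modulus p g t) \<in> o[at_right 0](\<lambda>t. t powr (1 / p))"
  proof (rule landau_o.smallI)
    fix c :: real assume c: "0 < c"
    \<comment> \<open>Each radial leg costs \<open>p\<close> times \<open>h powr (1 / p)\<close>,
      from the antiderivative of \<open>(1 - x) powr (1 / p - 1)\<close>, and the rotation costs it
      once.\<close>
    define \<epsilon> where "\<epsilon> = c / (2 * p + 1)"
    have \<epsilon>: "0 < \<epsilon>" using c p by (simp add: \<epsilon>_def)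
    obtain r0 where r0: "0 \<le> r0" "r0 < 1" "\<And>r. r0 \<le> r \<Longrightarrow> r < 1 \<Longrightarrow> Lp_le p (\<lambda>\<theta>. deriv g (polar r \<theta>)) (\<epsilon> * (1 - r) powr (1 / p - 1))"
      using small[OF \<epsilon>] by auto
    have term_le: "?m h \<le> c * h powr (1 / p)" if h: "0 < h" "h \<le> 1 - r0" for h
    proof -
      define r where "r = 1 - h"
      have r: "0 \<le> r" "r0 \<le> r" "r < 1" "1 - r = h" using h r0 by (auto simp: r_def)
      have fin: "Lp_le p (\<lambda>\<theta>. g (polar R (\<theta> + h)) - g (polar R \<theta>)) (c * h powr (1 / p))" if R: "r \<le> R" "R < 1" for R
      proof -
        let ?d = "\<lambda>\<theta>. g (polar R \<theta>) - g (polar r \<theta>)"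
        have d: "Lp_le p ?d (\<epsilon> * (p * h powr (1 / p)))"
        proof -
          have "Lp_le p ?d (\<epsilon> * (p * (1 - r) powr (1 / p)))"
            by (rule inc[OF \<epsilon>, of r0]) (use r0(3) r R in auto)
          then show ?thesis by (simp add: r(4))
        qed
        have [measurable]: "?d \<in> borel_measurable borel" "(\<lambda>\<theta>. ?d (\<theta> + h)) \<in> borel_measurable borel"
          "(\<lambda>\<theta>. g (polar r (\<theta> + h)) - g (polar r \<theta>)) \<in> borel_measurable borel"
          using r R by (intro borel_measurable_diff trace_measurable hol; simp)+
        have d': "Lp_le p (\<lambda>\<theta>. ?d (\<theta> + h)) (\<epsilon> * (p * h powr (1 / p)))"
          using d by (subst Lp_le_shift[where \<phi>="?d"]) auto
        have rot: "Lp_le p (\<lambda>\<theta>. g (polar r (\<theta> + h)) - g (polar r \<theta>)) (\<bar>h\<bar> * (r * (\<epsilon> * (1 - r) powr (1 / p - 1))))"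
          using p r by (intro Lp_le_rotation_increment hol r0) auto
        have "Lp_le p (\<lambda>\<theta>. (?d (\<theta> + h) + (g (polar r (\<theta> + h)) - g (polar r \<theta>))) - ?d \<theta>)
          (\<epsilon> * (p * h powr (1 / p)) + \<bar>h\<bar> * (r * (\<epsilon> * (1 - r) powr (1 / p - 1))) + \<epsilon> * (p * h powr (1 / p)))"
          by (intro Lp_le_diff Lp_le_add d d' rot borel_measurable_add borel_measurable_diff trace_measurable hol)
            (use p r R in auto)
        then have "Lp_le p (\<lambda>\<theta>. g (polar R (\<theta> + h)) - g (polar R \<theta>))
          (\<epsilon> * (p * h powr (1 / p)) + \<bar>h\<bar> * (r * (\<epsilon> * (1 - r) powr (1 / p - 1))) + \<epsilon> * (p * h powr (1 / p)))"
          by simp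
        then show ?thesis
        proof (rule Lp_le_mono)
          have "\<bar>h\<bar> * (r * (\<epsilon> * (1 - r) powr (1 / p - 1))) \<le> h * (1 * (\<epsilon> * h powr (1 / p - 1)))"
            using r h \<epsilon> by (simp only: r(4) abs_of_pos[OF h(1)]) (intro mult_left_mono mult_right_mono; auto)
          also have "\<dots> = \<epsilon> * h powr (1 / p)" using h by (simp add: powr_diff)
          finally have "\<epsilon> * (p * h powr (1 / p)) + \<bar>h\<bar> * (r * (\<epsilon> * (1 - r) powr (1 / p - 1))) + \<epsilon> * (p * h powr (1 / p)) \<le> \<epsilon> * (2 * p + 1) * h powr (1 / p)"
            by (simp add: algebra_simps)
          also have "\<epsilon> * (2 * p + 1) = c" using p by (simp add: \<epsilon>_def)
          finally show "\<epsilon> * (p * h powr (1 / p)) + \<bar>h\<bar> * (r * (\<epsilon> * (1 - r) powr (1 / p - 1))) + \<epsilon> * (p * h powr (1 / p)) \<le> c * h powr (1 / p)" .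
        qed (use p in simp)
      qed
      have "Lp_le p (\<lambda>\<theta>. bdry g (\<theta> + h) - bdry g \<theta>) (c * h powr (1 / p))"
      proof (rule Lp_le_AE_lim[where \<phi>n="\<lambda>n \<theta>. g (of_real (1 - 1 / (real n + 2)) * cis (\<theta> + h)) - g (of_real (1 - 1 / (real n + 2)) * cis \<theta>)"])
        show "AE \<theta> in circle. (\<lambda>n. g (of_real (1 - 1 / (real n + 2)) * cis (\<theta> + h)) - g (of_real (1 - 1 / (real n + 2)) * cis \<theta>))
           \<longlonglongrightarrow> bdry g (\<theta> + h) - bdry g \<theta>"
          using AE_circleI[OF bdry_AE_lim[OF gH p]] AE_circleI[OF AE_shift[OF bdry_AE_lim[OF gH p], of h]]
          by eventually_elim (intro tendsto_intros)
        have "eventually (\<lambda>x. x \<in> {r<..<1}) (at_left 1)" using r by (auto simp: eventually_at_left_field)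
        then have "eventually (\<lambda>n. 1 - 1 / (real n + 2) \<in> {r<..<1}) sequentially"
          using filterlim_radii by (auto simp: filterlim_iff)
        then show "eventually (\<lambda>n. Lp_le p (\<lambda>\<theta>. g (of_real (1 - 1 / (real n + 2)) * cis (\<theta> + h)) - g (of_real (1 - 1 / (real n + 2)) * cis \<theta>)) (c * h powr (1 / p))) sequentially"
          by eventually_elim (rule fin; simp)
        show "(\<lambda>\<theta>. g (of_real (1 - 1 / (real n + 2)) * cis (\<theta> + h)) - g (of_real (1 - 1 / (real n + 2)) * cis \<theta>)) \<in> borel_measurable borel" for n
          using radii_bounds[of n] by (intro borel_measurable_diff trace_measurable hol) auto
      qed (use p c in auto)
      then show ?thesis using boundary_increment_le_iff[OF gH p] by blast
    qed
    have ev: "eventually (\<lambda>t. 0 < t \<and> t < 1 - r0) (at_right 0)"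
      using r0 by (intro eventually_at_rightI[of 0 "1 - r0"]) auto
    then show "eventually (\<lambda>t. norm (mean_modulus p g t) \<le> c * norm (t powr (1 / p))) (at_right 0)"
    proof eventually_elim
      fix t :: real assume t: "0 < t \<and> t < 1 - r0"
      have le: "?m h \<le> c * t powr (1 / p)" if "h \<in> {0<..t}" for h
      proof -
        have "?m h \<le> c * h powr (1 / p)" using that t by (intro term_le) auto
        also have "\<dots> \<le> c * t powr (1 / p)" using that c p by (intro mult_left_mono powr_mono2) auto
        finally show ?thesis .
      qed
      have "mean_modulus p g t \<le> c * t powr (1 / p)" unfolding mean_modulus_def
        by (rule cSUP_least) (use le t in auto)
      moreover have "0 \<le> mean_modulus p g t" unfolding mean_modulus_def
        by (rule cSUP_upper2[where x=t]) (use t bdd_aboveI2[of "{0<..t}" ?m, OF le] in auto)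
      ultimately show "norm (mean_modulus p g t) \<le> c * norm (t powr (1 / p))" by simp
    qed
  qed
  with gH show ?thesis by (simp add: little_mean_Lipschitz_def)
qed

section \<open>The Fejer--Riesz inequality\<close>

text \<open>Homogeneous of degree -1 in \<open>(\<tau>, s)\<close>. The exponent is 0 for
  Fejer--Riesz and for the kernel \<open>max \<tau> \<bar>s\<bar> powr (- 1)\<close>, and
  \<open>1 - 1 / q\<close> when means of order \<open>q\<close> are integrated towards the
  boundary.\<close>

definition hom_kernel :: "real \<Rightarrow> real \<Rightarrow> real \<Rightarrow> real" where
  "hom_kernel \<alpha> \<tau> s = \<tau> powr \<alpha> * \<bar>s\<bar> powr (- \<alpha>) * max \<tau> \<bar>s\<bar> powr (- 1)"

definition Schur_const :: "real \<Rightarrow> real \<Rightarrow> real" where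
  "Schur_const p \<alpha> = power_kernel_const 1 (\<alpha> + 1 / p) powr (p - 1) * power_kernel_const 1 (1 - 1 / p - \<alpha>)"

lemma hom_kernel_nonneg: "0 \<le> hom_kernel \<alpha> \<tau> s"
  by (simp add: hom_kernel_def)

lemma hom_kernel_measurable [measurable]:
  "(\<lambda>(\<tau>, s). hom_kernel \<alpha> \<tau> s) \<in> borel_measurable (borel \<Otimes>\<^sub>M borel)" "hom_kernel \<alpha> \<tau> \<in> borel_measurable borel"
  unfolding hom_kernel_def by measurable

lemma Schur_const_nonneg:
  assumes "1 < p" "- 1 / p < \<alpha>" "\<alpha> < 1 - 1 / p"
  shows "0 \<le> Schur_const p \<alpha>"
proof -
  have "0 < power_kernel_const 1 (1 - 1 / p - \<alpha>)" using assms by (intro power_kernel_const_pos) auto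
  then show ?thesis by (simp add: Schur_const_def)
qed

text \<open>Schur test for a kernel homogeneous of degree \<open>-1\<close> with test function \<open>|s| powr (- 1 / p)\<close>.\<close>

lemma Schur_hom_kernel:
  fixes v \<Phi> :: "real \<Rightarrow> real"
  assumes p: "1 < p" and \<alpha>: "- 1 / p < \<alpha>" "\<alpha> < 1 - 1 / p"
    and [measurable]: "v \<in> borel_measurable borel" and v: "\<And>s. 0 \<le> v s"
    and \<Phi>: "\<And>\<tau>. 0 < \<tau> \<Longrightarrow> 0 \<le> \<Phi> \<tau>" "\<And>\<tau>. 0 < \<tau> \<Longrightarrow> ennreal (\<Phi> \<tau>) \<le> (\<integral>\<^sup>+s. hom_kernel \<alpha> \<tau> s * v s \<partial>lborel)"
  shows "(\<integral>\<^sup>+\<tau>. ennreal (\<Phi> \<tau> powr p) * indicator {0<..} \<tau> \<partial>lborel)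
     \<le> ennreal (Schur_const p \<alpha>) * (\<integral>\<^sup>+s. v s powr p \<partial>lborel)"
proof -
  \<comment> \<open>\<open>C1\<close> comes from integrating kernel times test function in
    \<open>s\<close>, \<open>C2\<close> from the dual integral in \<open>\<tau>\<close>. The two
    bounds on \<open>\<alpha>\<close> are precisely the convergence conditions of these
    integrals.\<close>
  define C1 C2 where "C1 = power_kernel_const 1 (\<alpha> + 1 / p)" and "C2 = power_kernel_const 1 (1 - 1 / p - \<alpha>)"
  have C: "0 < C1" "0 < C2" unfolding C1_def C2_def using \<alpha> by (auto intro!: power_kernel_const_pos)
  let ?W = "\<lambda>\<tau> s. hom_kernel \<alpha> \<tau> s * \<bar>s\<bar> powr (- 1 / p)"
  let ?E = "\<lambda>\<tau> s. hom_kernel \<alpha> \<tau> s * (v s powr p * \<bar>s\<bar> powr (1 - 1 / p))"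
  have jensen: "ennreal (\<Phi> \<tau> powr p) \<le> ennreal (C1 powr (p - 1) * \<tau> powr (- (1 - 1 / p))) * (\<integral>\<^sup>+s. ?E \<tau> s \<partial>lborel)"
    if \<tau>: "0 < \<tau>" for \<tau>
  proof -
    have "(\<integral>\<^sup>+s. ?W \<tau> s \<partial>lborel) = (\<integral>\<^sup>+s. ennreal (\<tau> powr \<alpha>) * ennreal (max \<tau> \<bar>s\<bar> powr (- 1) * \<bar>s\<bar> powr (- (\<alpha> + 1 / p))) \<partial>lborel)"
      by (intro nn_integral_cong) (simp add: hom_kernel_def powr_add powr_diff powr_minus divide_inverse mult_ac flip: ennreal_mult)
    also have "\<dots> = ennreal (\<tau> powr \<alpha>) * (\<integral>\<^sup>+s. ennreal (max \<tau> \<bar>s\<bar> powr (- 1) * \<bar>s\<bar> powr (- (\<alpha> + 1 / p))) \<partial>lborel)"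
      by (rule nn_integral_cmult) measurable
    also have "\<dots> \<le> ennreal (\<tau> powr \<alpha>) * ennreal (C1 * \<tau> powr (1 - 1 - (\<alpha> + 1 / p)))"
      unfolding C1_def using \<alpha> \<tau> by (intro mult_left_mono power_kernel_integral) auto
    also have "\<dots> = ennreal (\<tau> powr \<alpha> * (C1 * \<tau> powr (1 - 1 - (\<alpha> + 1 / p))))"
      using C by (simp add: ennreal_mult)
    also have "\<tau> powr \<alpha> * (C1 * \<tau> powr (1 - 1 - (\<alpha> + 1 / p))) = C1 * \<tau> powr (- 1 / p)"
      by (simp add: mult.left_commute flip: powr_add)
    finally have W: "(\<integral>\<^sup>+s. ?W \<tau> s \<partial>lborel) \<le> ennreal (C1 * \<tau> powr (- 1 / p))" .
    have "ennreal (\<Phi> \<tau> powr p) \<le> ennreal ((C1 * \<tau> powr (- 1 / p)) powr (p - 1)) *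
       (\<integral>\<^sup>+s. ennreal ((hom_kernel \<alpha> \<tau> s * v s) powr p * ?W \<tau> s powr (1 - p)) \<partial>lborel)"
    proof (rule Jensen_weighted[OF _ _ _ _ _ _ _ W])
      show "hom_kernel \<alpha> \<tau> s * v s = 0" if "?W \<tau> s = 0" for s
        using that by (auto simp: hom_kernel_def)
    qed (use p \<tau> C v \<Phi> hom_kernel_nonneg in auto)
    also have "(C1 * \<tau> powr (- 1 / p)) powr (p - 1) = C1 powr (p - 1) * \<tau> powr (- (1 - 1 / p))"
    proof -
      have "(C1 * \<tau> powr (- 1 / p)) powr (p - 1) = C1 powr (p - 1) * \<tau> powr (- 1 / p * (p - 1))"
        using C by (subst powr_mult) (auto simp: powr_powr)
      also have "- 1 / p * (p - 1) = - (1 - 1 / p)" using p by (simp add: field_simps)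
      finally show ?thesis .
    qed
    also have "(\<integral>\<^sup>+s. ennreal ((hom_kernel \<alpha> \<tau> s * v s) powr p * ?W \<tau> s powr (1 - p)) \<partial>lborel) = (\<integral>\<^sup>+s. ?E \<tau> s \<partial>lborel)"
    proof (intro nn_integral_cong arg_cong[where f=ennreal])
      fix s
      show "(hom_kernel \<alpha> \<tau> s * v s) powr p * ?W \<tau> s powr (1 - p) = ?E \<tau> s"
      proof (cases "s = 0")
        case True
        then show ?thesis by (simp add: hom_kernel_def)
      next
        case False
        then have k: "0 < hom_kernel \<alpha> \<tau> s" using \<tau> by (simp add: hom_kernel_def)
        have e1: "(hom_kernel \<alpha> \<tau> s * v s) powr p = hom_kernel \<alpha> \<tau> s powr p * v s powr p"
          by (rule powr_mult)
        have e2: "?W \<tau> s powr (1 - p) = hom_kernel \<alpha> \<tau> s powr (1 - p) * \<bar>s\<bar> powr (- 1 / p * (1 - p))"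
          using k by (subst powr_mult) (auto simp: powr_powr)
        have e3: "- 1 / p * (1 - p) = 1 - 1 / p" using p by (simp add: field_simps)
        have e4: "hom_kernel \<alpha> \<tau> s powr p * hom_kernel \<alpha> \<tau> s powr (1 - p) = hom_kernel \<alpha> \<tau> s"
          using k by (simp flip: powr_add)
        have "(hom_kernel \<alpha> \<tau> s * v s) powr p * ?W \<tau> s powr (1 - p)
            = (hom_kernel \<alpha> \<tau> s powr p * hom_kernel \<alpha> \<tau> s powr (1 - p)) * (v s powr p * \<bar>s\<bar> powr (- 1 / p * (1 - p)))"
          unfolding e1 e2 by (simp only: mult_ac)
        then show ?thesis unfolding e3 e4 .
      qed
    qed
    finally show ?thesis .
  qed
  have "(\<integral>\<^sup>+\<tau>. ennreal (\<Phi> \<tau> powr p) * indicator {0<..} \<tau> \<partial>lborel)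
    \<le> (\<integral>\<^sup>+\<tau>. (\<integral>\<^sup>+s. ennreal (C1 powr (p - 1) * \<tau> powr (- (1 - 1 / p))) * indicator {0<..} \<tau> * ennreal (?E \<tau> s) \<partial>lborel) \<partial>lborel)"
  proof (intro nn_integral_mono)
    fix \<tau> :: real
    have "ennreal (\<Phi> \<tau> powr p) * indicator {0<..} \<tau> \<le> ennreal (C1 powr (p - 1) * \<tau> powr (- (1 - 1 / p))) * indicator {0<..} \<tau> * (\<integral>\<^sup>+s. ?E \<tau> s \<partial>lborel)"
      using jensen[of \<tau>] by (auto simp: indicator_def)
    also have "\<dots> = (\<integral>\<^sup>+s. ennreal (C1 powr (p - 1) * \<tau> powr (- (1 - 1 / p))) * indicator {0<..} \<tau> * ennreal (?E \<tau> s) \<partial>lborel)"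
      by (rule nn_integral_cmult[symmetric]) measurable
    finally show "ennreal (\<Phi> \<tau> powr p) * indicator {0<..} \<tau> \<le> (\<integral>\<^sup>+s. ennreal (C1 powr (p - 1) * \<tau> powr (- (1 - 1 / p))) * indicator {0<..} \<tau> * ennreal (?E \<tau> s) \<partial>lborel)" .
  qed
  also have "\<dots> = (\<integral>\<^sup>+s. (\<integral>\<^sup>+\<tau>. ennreal (C1 powr (p - 1) * \<tau> powr (- (1 - 1 / p))) * indicator {0<..} \<tau> * ennreal (?E \<tau> s) \<partial>lborel) \<partial>lborel)"
    by (rule lborel_pair.Fubini'[symmetric]) measurable
  also have "\<dots> \<le> (\<integral>\<^sup>+s. ennreal (C1 powr (p - 1) * C2) * ennreal (v s powr p) \<partial>lborel)"
  proof (rule nn_integral_mono_AE)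
    have "AE s in lborel. s \<noteq> (0::real)" by (rule AE_lborel_singleton)
    then show "AE s in lborel. (\<integral>\<^sup>+\<tau>. ennreal (C1 powr (p - 1) * \<tau> powr (- (1 - 1 / p))) * indicator {0<..} \<tau> * ennreal (?E \<tau> s) \<partial>lborel)
       \<le> ennreal (C1 powr (p - 1) * C2) * ennreal (v s powr p)"
    proof eventually_elim
      fix s :: real assume s: "s \<noteq> 0"
      define D where "D = C1 powr (p - 1) * v s powr p * \<bar>s\<bar> powr (1 - 1 / p - \<alpha>)"
      have D: "0 \<le> D" by (simp add: D_def)
      have "(\<integral>\<^sup>+\<tau>. ennreal (C1 powr (p - 1) * \<tau> powr (- (1 - 1 / p))) * indicator {0<..} \<tau> * ennreal (?E \<tau> s) \<partial>lborel)
        \<le> (\<integral>\<^sup>+\<tau>. ennreal D * ennreal (max \<bar>s\<bar> \<bar>\<tau>\<bar> powr (- 1) * \<bar>\<tau>\<bar> powr (- (1 - 1 / p - \<alpha>))) \<partial>lborel)"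
      proof (intro nn_integral_mono)
        fix \<tau> :: real
        show "ennreal (C1 powr (p - 1) * \<tau> powr (- (1 - 1 / p))) * indicator {0<..} \<tau> * ennreal (?E \<tau> s)
          \<le> ennreal D * ennreal (max \<bar>s\<bar> \<bar>\<tau>\<bar> powr (- 1) * \<bar>\<tau>\<bar> powr (- (1 - 1 / p - \<alpha>)))"
        proof (cases "0 < \<tau>")
          case True
          have e1: "\<tau> powr (- (1 - 1 / p)) * \<tau> powr \<alpha> = \<tau> powr (- (1 - 1 / p - \<alpha>))" by (simp add: algebra_simps flip: powr_add)
          have e2: "\<bar>s\<bar> powr (- \<alpha>) * \<bar>s\<bar> powr (1 - 1 / p) = \<bar>s\<bar> powr (1 - 1 / p - \<alpha>)" by (simp flip: powr_add)
          have "C1 powr (p - 1) * \<tau> powr (- (1 - 1 / p)) * ?E \<tau> s = C1 powr (p - 1) * v s powr p * (\<bar>s\<bar> powr (- \<alpha>) * \<bar>s\<bar> powr (1 - 1 / p))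
              * (max \<tau> \<bar>s\<bar> powr (- 1) * (\<tau> powr (- (1 - 1 / p)) * \<tau> powr \<alpha>))"
            unfolding hom_kernel_def by (simp only: mult_ac)
          then have "C1 powr (p - 1) * \<tau> powr (- (1 - 1 / p)) * ?E \<tau> s = D * (max \<bar>s\<bar> \<bar>\<tau>\<bar> powr (- 1) * \<bar>\<tau>\<bar> powr (- (1 - 1 / p - \<alpha>)))"
            unfolding e1 e2 D_def abs_of_pos[OF True] by (simp only: max.commute)
          then show ?thesis using True D C hom_kernel_nonneg[of \<alpha> \<tau> s] by (simp flip: ennreal_mult)
        qed simp
      qed
      also have "\<dots> = ennreal D * (\<integral>\<^sup>+\<tau>. ennreal (max \<bar>s\<bar> \<bar>\<tau>\<bar> powr (- 1) * \<bar>\<tau>\<bar> powr (- (1 - 1 / p - \<alpha>))) \<partial>lborel)"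
        by (rule nn_integral_cmult) measurable
      also have "\<dots> \<le> ennreal D * ennreal (C2 * \<bar>s\<bar> powr (1 - 1 - (1 - 1 / p - \<alpha>)))"
        unfolding C2_def using \<alpha> s by (intro mult_left_mono power_kernel_integral) auto
      also have "\<dots> = ennreal (D * (C2 * \<bar>s\<bar> powr (1 - 1 - (1 - 1 / p - \<alpha>))))"
        using D C by (simp add: ennreal_mult)
      also have "D * (C2 * \<bar>s\<bar> powr (1 - 1 - (1 - 1 / p - \<alpha>)))
          = C1 powr (p - 1) * C2 * v s powr p * (\<bar>s\<bar> powr (1 - 1 / p - \<alpha>) * \<bar>s\<bar> powr (- (1 - 1 / p - \<alpha>)))"
        by (simp add: D_def)
      also have "\<bar>s\<bar> powr (1 - 1 / p - \<alpha>) * \<bar>s\<bar> powr (- (1 - 1 / p - \<alpha>)) = 1"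
        using s by (simp only: powr_add[symmetric]) simp
      finally show "(\<integral>\<^sup>+\<tau>. ennreal (C1 powr (p - 1) * \<tau> powr (- (1 - 1 / p))) * indicator {0<..} \<tau> * ennreal (?E \<tau> s) \<partial>lborel)
       \<le> ennreal (C1 powr (p - 1) * C2) * ennreal (v s powr p)"
        using C by (simp add: ennreal_mult)
    qed
  qed
  also have "\<dots> = ennreal (C1 powr (p - 1) * C2) * (\<integral>\<^sup>+s. v s powr p \<partial>lborel)"
    by (rule nn_integral_cmult) measurable
  finally show ?thesis by (simp add: Schur_const_def C1_def C2_def)
qed

section \<open>Integrals of Hardy functions along a radius\<close>

definition Fejer_Riesz_const :: "real \<Rightarrow> real" where
  "Fejer_Riesz_const p = Schur_const p 0 * (32 powr p * (2 * pi))"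

lemma Fejer_Riesz_const_nonneg: "1 < p \<Longrightarrow> 0 \<le> Fejer_Riesz_const p"
  using Schur_const_nonneg[of p 0] by (simp add: Fejer_Riesz_const_def field_simps)

text \<open>At distance \<open>\<tau>\<close> from the circle the Poisson kernel is at most
  \<open>32 / max \<tau> \<bar>s\<bar>\<close>, a kernel of degree -1, so the Schur test with
  \<open>\<alpha> = 0\<close> bounds the integral along the radius by the mean on the circle. The 32
  and the period \<open>2 * pi\<close> make up the constant; sharpness is not aimed at.\<close>

lemma Fejer_Riesz_dilate:
  assumes F: "F holomorphic_on ball 0 1" and p: "1 < p" and R: "0 \<le> R" "R < 1"
    and M: "Lp_le p (\<lambda>\<theta>. F (polar R \<theta>)) M"
  shows "(\<integral>\<^sup>+u. ennreal (norm (F (of_real (R * (1 - u)))) powr p) * indicator {0<..<1} u \<partial>lborel)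
     \<le> ennreal (Fejer_Riesz_const p * M powr p)"
proof -
  define v where "v s = 32 * (indicat_real {-pi..pi} s * norm (F (polar R s)))" for s
  have [measurable]: "(\<lambda>s. F (polar R s)) \<in> borel_measurable borel" using trace_measurable(2)[OF F R] .
  have [measurable]: "v \<in> borel_measurable borel" unfolding v_def[abs_def] by measurable
  define \<Phi> where "\<Phi> \<tau> = (if \<tau> \<le> 1 then norm (F (of_real (R * (1 - \<tau>)))) else 0)" for \<tau>
  have "(\<integral>\<^sup>+\<tau>. ennreal (\<Phi> \<tau> powr p) * indicator {0<..} \<tau> \<partial>lborel) \<le> ennreal (Schur_const p 0) * (\<integral>\<^sup>+s. v s powr p \<partial>lborel)"
  proof (rule Schur_hom_kernel[OF p])
    fix \<tau> :: real assume \<tau>: "0 < \<tau>"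
    show "ennreal (\<Phi> \<tau>) \<le> (\<integral>\<^sup>+s. hom_kernel 0 \<tau> s * v s \<partial>lborel)"
    proof (cases "\<tau> \<le> 1")
      case True
      define r where "r = 1 - \<tau>"
      have r: "0 \<le> r" "r < 1" "1 - r = \<tau>" using True \<tau> by (auto simp: r_def)
      have Rc: "norm (complex_of_real R) < 1" using R by simp
      note V = holomorphic_rotate_dilate[OF F Rc]
      have int: "integrable circle (\<lambda>s. of_real (poisson r s) * F (polar R s))"
        using r by (intro integrable_circle continuous_intros continuous_poisson continuous_on_circle_trace[OF V(2)])
      have "F (of_real (R * r)) = (LINT s|circle. of_real (poisson r s) * F (polar R s))"
        using poisson_formula[OF V(2,1) r(1,2)] by simp
      then have "ennreal (\<Phi> \<tau>) \<le> (\<integral>\<^sup>+s. ennreal (norm (of_real (poisson r s) * F (polar R s))) \<partial>circle)"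
        using integral_norm_bound_ennreal[OF int] True by (simp add: \<Phi>_def r_def)
      also have "\<dots> = (\<integral>\<^sup>+s. ennreal (norm (of_real (poisson r s) * F (polar R s))) * indicator {-pi..pi} s \<partial>lborel) / ennreal (2 * pi)"
        by (rule nn_integral_circle) measurable
      also have "\<dots> \<le> (\<integral>\<^sup>+s. ennreal (norm (of_real (poisson r s) * F (polar R s))) * indicator {-pi..pi} s \<partial>lborel)"
        by (rule ennreal_divide_2pi_le)
      also have "\<dots> \<le> (\<integral>\<^sup>+s. hom_kernel 0 \<tau> s * v s \<partial>lborel)"
      proof (rule nn_integral_mono_AE)
        \<comment> \<open>At \<open>s = 0\<close> the kernel vanishes because
          \<open>0 powr 0\<close> is 0, so the comparison holds only away from that point.\<close>
        have "AE s in lborel. s \<noteq> (0::real)" by (rule AE_lborel_singleton)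
        then show "AE s in lborel. ennreal (norm (of_real (poisson r s) * F (polar R s))) * indicator {-pi..pi} s \<le> ennreal (hom_kernel 0 \<tau> s * v s)"
        proof eventually_elim
          fix s :: real assume s: "s \<noteq> 0"
          show "ennreal (norm (of_real (poisson r s) * F (polar R s))) * indicator {-pi..pi} s \<le> ennreal (hom_kernel 0 \<tau> s * v s)"
          proof (cases "s \<in> {-pi..pi}")
            case True
            then have "\<bar>s\<bar> \<le> pi" by auto
            then have "poisson r s \<le> 32 * \<tau> / (max \<tau> \<bar>s\<bar>)\<^sup>2" using poisson_le(2)[OF r(1,2), of s] r by simp
            also have "\<dots> \<le> 32 * max \<tau> \<bar>s\<bar> / (max \<tau> \<bar>s\<bar>)\<^sup>2" by (intro divide_right_mono) auto
            also have "\<dots> = 32 * hom_kernel 0 \<tau> s"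
              using s \<tau> by (simp add: hom_kernel_def power2_eq_square powr_minus_divide)
            finally have "poisson r s * norm (F (polar R s)) \<le> 32 * hom_kernel 0 \<tau> s * norm (F (polar R s))"
              by (rule mult_right_mono) simp
            then show ?thesis using True poisson_nonneg[OF r(1,2)]
              by (auto simp: norm_mult v_def mult_ac intro!: ennreal_leI)
          qed simp
        qed
      qed
      finally show ?thesis .
    qed (simp add: \<Phi>_def)
  next
    show "v \<in> borel_measurable borel" by measurable
  qed (use p in \<open>auto simp: v_def \<Phi>_def field_simps\<close>)
  also have "(\<integral>\<^sup>+s. v s powr p \<partial>lborel) = (\<integral>\<^sup>+s. ennreal (32 powr p) * (ennreal (norm (F (polar R s)) powr p) * indicator {-pi..pi} s) \<partial>lborel)"
    by (intro nn_integral_cong) (auto simp: v_def indicator_def powr_mult ennreal_mult)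
  also have "\<dots> = ennreal (32 powr p) * (\<integral>\<^sup>+s. ennreal (norm (F (polar R s)) powr p) * indicator {-pi..pi} s \<partial>lborel)"
    by (rule nn_integral_cmult) measurable
  also have "(\<integral>\<^sup>+s. ennreal (norm (F (polar R s)) powr p) * indicator {-pi..pi} s \<partial>lborel) \<le> ennreal (2 * pi * M powr p)"
  proof -
    have "(\<integral>\<^sup>+s. ennreal (norm (F (polar R s)) powr p) * indicator {-pi..pi} s \<partial>lborel) / ennreal (2 * pi) \<le> ennreal (M powr p)"
      using M by (subst nn_integral_circle[symmetric]) (auto simp: Lp_le_def)
    then show ?thesis
      by (cases "(\<integral>\<^sup>+s. ennreal (norm (F (polar R s)) powr p) * indicator {-pi..pi} s \<partial>lborel)")
        (auto simp: divide_ennreal ennreal_top_divide top_unique field_simps intro!: ennreal_leI)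
  qed
  finally have "(\<integral>\<^sup>+\<tau>. ennreal (\<Phi> \<tau> powr p) * indicator {0<..} \<tau> \<partial>lborel)
    \<le> ennreal (Schur_const p 0) * (ennreal (32 powr p) * ennreal (2 * pi * M powr p))"
    by (simp add: mult_left_mono)
  also have "\<dots> = ennreal (Fejer_Riesz_const p * M powr p)"
    using Schur_const_nonneg[OF p, of 0] p by (simp add: Fejer_Riesz_const_def mult_ac field_simps flip: ennreal_mult)
  finally have *: "(\<integral>\<^sup>+\<tau>. ennreal (\<Phi> \<tau> powr p) * indicator {0<..} \<tau> \<partial>lborel) \<le> ennreal (Fejer_Riesz_const p * M powr p)" .
  show ?thesis
    by (rule order_trans[OF nn_integral_mono *]) (auto simp: \<Phi>_def indicator_def)
qed

lemma Fejer_Riesz: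
  assumes F: "F \<in> Hardy p" and p: "1 < p"
  shows "(\<integral>\<^sup>+u. ennreal (norm (F (of_real (1 - u))) powr p) * indicator {0<..<1} u \<partial>lborel)
     \<le> ennreal (Fejer_Riesz_const p * Hardy_norm p F powr p)"
proof -
  have hol: "F holomorphic_on ball 0 1" using F by (rule Hardy_holomorphic)
  have cont: "continuous_on (ball 0 1) F" using hol by (rule holomorphic_on_imp_continuous_on)
  let ?R = "\<lambda>n. 1 - 1 / (real n + 2)"
  let ?f = "\<lambda>n u. ennreal (norm (F (of_real (?R n * (1 - u)))) powr p) * indicator {0<..<1} u"
  have R: "?R \<longlonglongrightarrow> 1" using filterlim_radii by (simp add: filterlim_at)
  have Ru: "norm (complex_of_real (?R n * (1 - u))) < 1" if "u \<in> {0<..<1}" for n u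
  proof -
    have "\<bar>?R n * (1 - u)\<bar> \<le> 1 * (1 - u)" unfolding abs_mult using that radii_bounds[of n] by (intro mult_mono) auto
    also have "\<dots> < 1" using that by simp
    finally show ?thesis by (simp only: norm_of_real)
  qed
  have [measurable]: "?f n \<in> borel_measurable borel" for n
  proof -
    \<comment> \<open>Outside the open interval the argument may leave the disc, where
      \<open>F\<close> is arbitrary; it is replaced by an interior value, which the indicator
      hides.\<close>
    let ?u = "\<lambda>u. of_real (?R n * (1 - (if u \<in> {0<..<1} then u else 1 / 2)))"
    have "(\<lambda>u. F (?u u)) \<in> borel_measurable borel"
      by (rule continuous_trace_measurable[OF cont]) (measurable, rule Ru, auto)
    then have "(\<lambda>u. ennreal (norm (F (?u u)) powr p) * indicator {0<..<1} u) \<in> borel_measurable borel" by measurable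
    also have "(\<lambda>u. ennreal (norm (F (?u u)) powr p) * indicator {0<..<1} u) = ?f n"
      by (auto simp: indicator_def fun_eq_iff)
    finally show ?thesis .
  qed
  have "(\<integral>\<^sup>+u. ennreal (norm (F (of_real (1 - u))) powr p) * indicator {0<..<1} u \<partial>lborel) = (\<integral>\<^sup>+u. liminf (\<lambda>n. ?f n u) \<partial>lborel)"
  proof (intro nn_integral_cong)
    fix u :: real
    show "ennreal (norm (F (of_real (1 - u))) powr p) * indicator {0<..<1} u = liminf (\<lambda>n. ?f n u)"
    proof (cases "u \<in> {0<..<1}")
      case True
      have "(\<lambda>n. F (of_real (?R n * (1 - u)))) \<longlonglongrightarrow> F (of_real (1 * (1 - u)))"
      proof (rule continuous_on_tendsto_compose[OF cont])
        show "(\<lambda>n. complex_of_real (?R n * (1 - u))) \<longlonglongrightarrow> of_real (1 * (1 - u))"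
          by (intro tendsto_intros R)
        show "eventually (\<lambda>n. complex_of_real (?R n * (1 - u)) \<in> ball 0 1) sequentially"
          using Ru[OF True] by (intro always_eventually allI) (simp only: mem_ball dist_0_norm)
        show "complex_of_real (1 * (1 - u)) \<in> ball 0 1"
          using True unfolding mem_ball dist_0_norm norm_of_real by simp
      qed
      then have "(\<lambda>n. ennreal (norm (F (of_real (?R n * (1 - u)))) powr p)) \<longlonglongrightarrow> ennreal (norm (F (of_real (1 * (1 - u)))) powr p)"
        using p by (intro tendsto_ennrealI tendsto_powr' tendsto_norm tendsto_const) auto
      then show ?thesis using True lim_imp_Liminf[OF sequentially_bot] by fastforce
    next
      case False
      then show ?thesis by (simp add: Liminf_const)
    qed
  qed
  also have "\<dots> \<le> liminf (\<lambda>n. \<integral>\<^sup>+u. ?f n u \<partial>lborel)"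
    by (rule nn_integral_liminf) measurable
  also have "\<dots> \<le> liminf (\<lambda>n. ennreal (Fejer_Riesz_const p * Hardy_norm p F powr p))"
    using radii_bounds p by (intro Liminf_mono always_eventually allI Fejer_Riesz_dilate hol Hardy_Lp_le F) auto
  also have "\<dots> = ennreal (Fejer_Riesz_const p * Hardy_norm p F powr p)" by (simp add: Liminf_const)
  finally show ?thesis .
qed

section \<open>The generalized Hilbert operator\<close>

text \<open>Half open, because a function in the Hardy space is unrestricted at the point 1 and
  holomorphy yields measurability only below it.\<close>

abbreviation unit_seg :: "real measure" where
  "unit_seg \<equiv> restrict_space lborel {0..<1}"

lemma finite_measure_unit_seg: "finite_measure unit_seg"
  by (rule finite_measureI) (auto simp: emeasure_restrict_space)

lemma space_unit_seg [simp]: "space unit_seg = {0..<1}"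
  by (simp add: space_restrict_space)

lemma nn_integral_unit_seg_reflect:
  fixes \<phi> :: "real \<Rightarrow> ennreal"
  assumes "\<phi> \<in> borel_measurable unit_seg"
  shows "(\<integral>\<^sup>+t. \<phi> t \<partial>unit_seg) = (\<integral>\<^sup>+u. \<phi> (1 - u) * indicator {0<..<1} u \<partial>lborel)"
proof -
  have [measurable]: "(\<lambda>t. \<phi> t * indicator {0..<1} t) \<in> borel_measurable borel"
    using assms by (subst (asm) borel_measurable_restrict_space_iff_ennreal) auto
  have "(\<integral>\<^sup>+t. \<phi> t \<partial>unit_seg) = (\<integral>\<^sup>+t. \<phi> t * indicator {0..<1} t \<partial>lborel)"
    by (rule nn_integral_restrict_space) auto
  also have "\<dots> = (\<integral>\<^sup>+u. \<phi> (1 - u) * indicator {0..<1} (1 - u) \<partial>lborel)"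
    using nn_integral_real_affine[of "\<lambda>t. \<phi> t * indicator {0..<1} t" "-1" 1] by simp
  also have "\<dots> = (\<integral>\<^sup>+u. \<phi> (1 - u) * indicator {0<..<1} u \<partial>lborel)"
  proof (rule nn_integral_cong_AE)
    have "AE u in lborel. u \<noteq> (1::real)" by (rule AE_lborel_singleton)
    then show "AE u in lborel. \<phi> (1 - u) * indicator {0..<1} (1 - u) = \<phi> (1 - u) * indicator {0<..<1} u"
      by eventually_elim (auto simp: indicator_def)
  qed
  finally show ?thesis .
qed

lemma of_real_unit_seg_measurable [measurable]: "(\<lambda>t. of_real t :: complex) \<in> borel_measurable unit_seg"
  by (intro measurable_restrict_space1) simp

lemma segment_measurable:
  assumes F: "F holomorphic_on ball 0 1" and z: "norm z \<le> 1"
  shows "(\<lambda>t. F (of_real t * z)) \<in> borel_measurable unit_seg"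
proof (rule continuous_trace_measurable[OF holomorphic_on_imp_continuous_on[OF F]])
  show "norm (of_real t * z) < 1" if "t \<in> space unit_seg" for t
    using that mult_mono[of t t "norm z" 1] z by (auto simp: norm_mult intro: le_less_trans[of _ "t * 1"])
qed measurable

lemma segment_measurable' [measurable (raw)]:
  assumes "F holomorphic_on ball 0 1"
  shows "(\<lambda>t. F (of_real t)) \<in> borel_measurable unit_seg"
  using segment_measurable[OF assms, of 1] by simp

text \<open>The variable is the distance to the point 1, so singular behaviour sits at 0, and the
  extension by zero lets integrals run over the whole line as in the Schur test.\<close>

definition seg_abs :: "(complex \<Rightarrow> complex) \<Rightarrow> real \<Rightarrow> real" where
  "seg_abs f u = indicator {0<..<1} u * norm (f (of_real (1 - u)))"

lemma seg_abs_nonneg: "0 \<le> seg_abs f u"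
  by (simp add: seg_abs_def)

lemma seg_abs_measurable [measurable]:
  assumes f: "f holomorphic_on ball 0 1"
  shows "seg_abs f \<in> borel_measurable borel"
proof -
  let ?u = "\<lambda>u. of_real (1 - (if u \<in> {0<..<1} then u else 1 / 2)) :: complex"
  have "(\<lambda>u. f (?u u)) \<in> borel_measurable borel"
  proof (rule continuous_trace_measurable[OF holomorphic_on_imp_continuous_on[OF f]])
    show "norm (?u u) < 1" for u :: real unfolding norm_of_real by auto
  qed measurable
  then have "(\<lambda>u. indicator {0<..<1} u * norm (f (?u u))) \<in> borel_measurable borel" by measurable
  also have "(\<lambda>u. indicator {0<..<1} u * norm (f (?u u))) = seg_abs f"
    by (auto simp: seg_abs_def indicator_def fun_eq_iff)
  finally show ?thesis .
qed

lemma nn_integral_seg_abs: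
  assumes f: "f holomorphic_on ball 0 1" and k: "k \<in> borel_measurable borel" "\<And>u. 0 \<le> k u"
  shows "(\<integral>\<^sup>+t. ennreal (k (1 - t) * norm (f (of_real t))) \<partial>unit_seg) = (\<integral>\<^sup>+u. ennreal (k u * seg_abs f u) \<partial>lborel)"
proof -
  have [measurable]: "(\<lambda>t. k (1 - t)) \<in> borel_measurable unit_seg"
    by (intro measurable_restrict_space1 measurable_compose[OF _ k(1)]) measurable
  have "(\<lambda>t. ennreal (k (1 - t) * norm (f (of_real t)))) \<in> borel_measurable unit_seg"
    using f by measurable
  then show ?thesis
    by (subst nn_integral_unit_seg_reflect) (auto intro!: nn_integral_cong simp: seg_abs_def indicator_def)
qed

lemma seg_abs_Hardy:
  assumes f: "f \<in> Hardy p" and p: "1 < p"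
  shows "(\<integral>\<^sup>+u. ennreal (seg_abs f u powr p) \<partial>lborel) \<le> ennreal (Fejer_Riesz_const p * Hardy_norm p f powr p)"
    and "(\<integral>\<^sup>+u. ennreal (seg_abs f u) \<partial>lborel) < \<infinity>"
proof -
  have [measurable]: "seg_abs f \<in> borel_measurable borel" using Hardy_holomorphic[OF f] by measurable
  have "(\<integral>\<^sup>+u. ennreal (seg_abs f u powr p) \<partial>lborel) = (\<integral>\<^sup>+u. ennreal (norm (f (of_real (1 - u))) powr p) * indicator {0<..<1} u \<partial>lborel)"
    using p by (intro nn_integral_cong) (auto simp: seg_abs_def indicator_def)
  then show 1: "(\<integral>\<^sup>+u. ennreal (seg_abs f u powr p) \<partial>lborel) \<le> ennreal (Fejer_Riesz_const p * Hardy_norm p f powr p)"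
    using Fejer_Riesz[OF f p] by simp
  have "(\<integral>\<^sup>+u. ennreal (seg_abs f u) \<partial>lborel) \<le> (\<integral>\<^sup>+u. ennreal (seg_abs f u powr p) + indicator {0<..<1} u \<partial>lborel)"
  proof (intro nn_integral_mono)
    fix u :: real
    show "ennreal (seg_abs f u) \<le> ennreal (seg_abs f u powr p) + indicator {0<..<1} u"
    proof (cases "seg_abs f u \<le> 1")
      case True
      then show ?thesis by (cases "u \<in> {0<..<1}") (auto simp: seg_abs_def intro!: add_increasing)
    next
      case False
      then have "seg_abs f u powr 1 \<le> seg_abs f u powr p" using p by (intro powr_mono) auto
      then have "ennreal (seg_abs f u) \<le> ennreal (seg_abs f u powr p)" using False by (intro ennreal_leI) simp
      then show ?thesis by (intro add_increasing2) auto
    qed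
  qed
  also have "\<dots> = (\<integral>\<^sup>+u. ennreal (seg_abs f u powr p) \<partial>lborel) + 1"
    by (subst nn_integral_add) auto
  also have "\<dots> < \<infinity>" using 1 by (auto simp: top_unique less_top[symmetric])
  finally show "(\<integral>\<^sup>+u. ennreal (seg_abs f u) \<partial>lborel) < \<infinity>" .
qed

section \<open>The operator as an integral over the segment, and its derivative\<close>

lemma integrable_unit_seg:
  assumes f: "f \<in> Hardy p" and p: "1 < p"
  shows "integrable unit_seg (\<lambda>t. f (of_real t))"
proof (rule integrableI_bounded)
  have hol: "f holomorphic_on ball 0 1" using f by (rule Hardy_holomorphic)
  then show "(\<lambda>t. f (of_real t)) \<in> borel_measurable unit_seg" by measurable
  show "(\<integral>\<^sup>+t. ennreal (norm (f (of_real t))) \<partial>unit_seg) < \<infinity>"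
    using nn_integral_seg_abs[OF hol, of "\<lambda>_. 1"] seg_abs_Hardy(2)[OF f p] by simp
qed

text \<open>Replaces the Lebesgue integral of the definition by one over a Borel measure; the end
  point 1 is a null set.\<close>

lemma gen_Hilbert_eq:
  assumes f: "f holomorphic_on ball 0 1" and g: "g holomorphic_on ball 0 1" and z: "norm z < 1"
  shows "gen_Hilbert g f z = (LINT t|unit_seg. f (of_real t) * deriv g (of_real t * z))"
proof -
  have g': "deriv g holomorphic_on ball 0 1" using g by (intro holomorphic_intros) auto
  let ?h = "\<lambda>t. f (of_real t) * deriv g (of_real t * z)"
  have "?h \<in> borel_measurable unit_seg"
    using segment_measurable[OF g', of z] z f by simp
  then have m: "(\<lambda>t. indicator {0..<1} t *\<^sub>R ?h t) \<in> borel_measurable borel"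
    by (subst (asm) borel_measurable_restrict_space_iff) auto
  then have m': "(\<lambda>t. indicator {0..<1} t *\<^sub>R ?h t) \<in> borel_measurable lebesgue"
    by (intro measurable_completion) simp
  have ae: "AE t in lebesgue. indicator {0..<1} t *\<^sub>R ?h t = indicator {0..1} t *\<^sub>R ?h t"
  proof (rule AE_completion)
    have "AE t in lborel. t \<noteq> (1::real)" by (rule AE_lborel_singleton)
    then show "AE t in lborel. indicator {0..<1} t *\<^sub>R ?h t = indicator {0..1} t *\<^sub>R ?h t"
      by eventually_elim (auto simp: indicator_def)
  qed
  have "gen_Hilbert g f z = (LINT t|lebesgue. indicator {0..1} t *\<^sub>R ?h t)"
    by (simp add: gen_Hilbert_def set_lebesgue_integral_def)
  also have "\<dots> = (LINT t|lebesgue. indicator {0..<1} t *\<^sub>R ?h t)"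
    using ae by (intro integral_cong_AE borel_measurable_AE[OF m' ae] m') auto
  also have "\<dots> = (LINT t|lborel. indicator {0..<1} t *\<^sub>R ?h t)"
    by (rule integral_completion) (use m in simp)
  also have "\<dots> = (LINT t|unit_seg. ?h t)"
    by (rule integral_restrict_space[symmetric]) auto
  finally show ?thesis .
qed

lemma holomorphic_bounded_cball:
  assumes "G holomorphic_on ball 0 1" "\<rho> < 1"
  obtains C where "0 \<le> C" "\<And>w. norm w \<le> \<rho> \<Longrightarrow> norm (G w) \<le> C"
proof -
  have "compact (G ` cball 0 \<rho>)"
    using assms by (intro compact_continuous_image holomorphic_on_imp_continuous_on holomorphic_on_subset[OF assms(1)]) auto
  then obtain C where "\<And>z. z \<in> cball 0 \<rho> \<Longrightarrow> norm (G z) \<le> C"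
    by (meson bounded_iff compact_imp_bounded image_eqI)
  then show ?thesis by (intro that[of "max 0 C"]) (auto intro: max.coboundedI2)
qed

lemma integrable_segment_product:
  fixes f G :: "complex \<Rightarrow> complex"
  assumes f: "integrable unit_seg (\<lambda>t. f (of_real t))"
    and G: "G holomorphic_on ball 0 1" and z: "norm z < 1"
  shows "integrable unit_seg (\<lambda>t. f (of_real t) * G (of_real t * z))"
proof -
  obtain C where C: "0 \<le> C" "\<And>w. norm w \<le> norm z \<Longrightarrow> norm (G w) \<le> C"
    using holomorphic_bounded_cball[OF G z] by blast
  show ?thesis
  proof (rule Bochner_Integration.integrable_bound[where f="\<lambda>t. of_real C * f (of_real t)"])
    have [measurable]: "(\<lambda>t. f (of_real t)) \<in> borel_measurable unit_seg" using f by (rule borel_measurable_integrable)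
    have "(\<lambda>t. G (of_real t * z)) \<in> borel_measurable unit_seg"
      using z by (intro segment_measurable[OF G]) simp
    then show "(\<lambda>t. f (of_real t) * G (of_real t * z)) \<in> borel_measurable unit_seg" by measurable
    show "AE t in unit_seg. norm (f (of_real t) * G (of_real t * z)) \<le> norm (of_real C * f (of_real t))"
    proof (rule AE_I2)
      fix t assume "t \<in> space unit_seg"
      then have "norm (of_real t * z) \<le> norm z" by (simp add: norm_mult mult_left_le_one_le)
      then have "norm (G (of_real t * z)) \<le> C" by (rule C(2))
      then show "norm (f (of_real t) * G (of_real t * z)) \<le> norm (of_real C * f (of_real t))"
        using C(1) by (simp add: norm_mult mult.commute[of C] mult_left_mono)
    qed
  qed (use f in simp)
qed

text \<open>Differentiation under the integral by dominated convergence along sequences: difference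
  quotients of \<open>G\<close> are bounded by the maximum of its derivative on a slightly larger
  closed disc, and \<open>f\<close> is integrable on the segment.\<close>

lemma segment_integral_derivative:
  fixes f G :: "complex \<Rightarrow> complex"
  assumes f: "integrable unit_seg (\<lambda>t. f (of_real t))"
    and G: "G holomorphic_on ball 0 1" and z: "norm z < 1"
  shows "((\<lambda>z. LINT t|unit_seg. f (of_real t) * G (of_real t * z)) has_field_derivative
     (LINT t|unit_seg. f (of_real t) * (of_real t * deriv G (of_real t * z)))) (at z)"
proof -
  have G': "deriv G holomorphic_on ball 0 1" using G by (intro holomorphic_intros) auto
  \<comment> \<open>A radius strictly between that of \<open>z\<close> and 1 contains all but
    finitely many terms of a sequence tending to \<open>z\<close>.\<close>
  define \<rho> where "\<rho> = (1 + norm z) / 2"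
  have \<rho>: "norm z < \<rho>" "\<rho> < 1" "0 < \<rho>" using z norm_ge_zero[of z] by (auto simp: \<rho>_def intro: add_pos_nonneg)
  obtain C where C: "0 \<le> C" "\<And>w. norm w \<le> \<rho> \<Longrightarrow> norm (deriv G w) \<le> C"
    using holomorphic_bounded_cball[OF G' \<rho>(2)] by blast
  have fm [measurable]: "(\<lambda>t. f (of_real t)) \<in> borel_measurable unit_seg" using f by (rule borel_measurable_integrable)
  let ?F = "\<lambda>z. LINT t|unit_seg. f (of_real t) * G (of_real t * z)"
  let ?d = "\<lambda>w t. f (of_real t) * ((G (of_real t * w) - G (of_real t * z)) / (w - z))"
  show ?thesis unfolding has_field_derivative_iff tendsto_at_iff_sequentially comp_def
  proof (intro allI impI)
    fix X :: "nat \<Rightarrow> complex" assume X: "\<forall>i. X i \<in> UNIV - {z}" "X \<longlonglongrightarrow> z"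
    have "eventually (\<lambda>n. X n \<in> ball 0 \<rho>) sequentially"
      using X(2) \<rho> by (intro topological_tendstoD) auto
    then obtain N where N: "\<And>n. N \<le> n \<Longrightarrow> norm (X n) < \<rho>" by (auto simp: eventually_sequentially)
    define Y where "Y n = X (n + N)" for n
    have Y: "Y \<longlonglongrightarrow> z" "\<And>n. Y n \<noteq> z" "\<And>n. norm (Y n) < \<rho>"
      using X N LIMSEQ_ignore_initial_segment[OF X(2), of N] by (auto simp: Y_def[abs_def])
    have tz: "norm (of_real t * w) \<le> \<rho>" if "t \<in> {0..<1}" "norm w < \<rho>" for t :: real and w :: complex
      using that mult_left_le_one_le[of "norm w" t] by (auto simp: norm_mult)
    have "(\<lambda>n. LINT t|unit_seg. ?d (Y n) t) \<longlonglongrightarrow> (LINT t|unit_seg. f (of_real t) * (of_real t * deriv G (of_real t * z)))"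
    proof (rule integral_dominated_convergence[where w="\<lambda>t. C * norm (f (of_real t))"])
      have "(\<lambda>t. of_real t * deriv G (of_real t * z)) \<in> borel_measurable unit_seg"
        by (intro borel_measurable_times of_real_unit_seg_measurable segment_measurable[OF G']) (use z in simp)
      then show "(\<lambda>t. f (of_real t) * (of_real t * deriv G (of_real t * z))) \<in> borel_measurable unit_seg" by measurable
      show "?d (Y n) \<in> borel_measurable unit_seg" for n
        by (intro borel_measurable_times fm borel_measurable_divide borel_measurable_diff segment_measurable[OF G] borel_measurable_const)
          (use z Y(3)[of n] \<rho> in auto)
      show "integrable unit_seg (\<lambda>t. C * norm (f (of_real t)))" using f by simp
      show "AE t in unit_seg. (\<lambda>n. ?d (Y n) t) \<longlonglongrightarrow> f (of_real t) * (of_real t * deriv G (of_real t * z))"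
      proof (rule AE_I2)
        fix t assume t: "t \<in> space unit_seg"
        then have "of_real t * z \<in> ball 0 1" using tz[of t z] \<rho> by simp
        then have "(G has_field_derivative deriv G (of_real t * z)) (at (of_real t * z))"
          using G holomorphic_derivI by blast
        then have "((\<lambda>w. G (of_real t * w)) has_field_derivative deriv G (of_real t * z) * of_real t) (at z)"
          by (rule DERIV_chain2) (auto intro!: derivative_eq_intros)
        then have "(\<lambda>n. (G (of_real t * Y n) - G (of_real t * z)) / (Y n - z)) \<longlonglongrightarrow> deriv G (of_real t * z) * of_real t"
          unfolding has_field_derivative_iff tendsto_at_iff_sequentially comp_def using Y by blast
        then show "(\<lambda>n. ?d (Y n) t) \<longlonglongrightarrow> f (of_real t) * (of_real t * deriv G (of_real t * z))"
          by (intro tendsto_mult tendsto_const) (simp add: mult.commute)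
      qed
      show "AE t in unit_seg. norm (?d (Y n) t) \<le> C * norm (f (of_real t))" for n
      proof (rule AE_I2)
        fix t assume t: "t \<in> space unit_seg"
        have "norm (G (of_real t * Y n) - G (of_real t * z)) \<le> C * norm (of_real t * Y n - of_real t * z)"
        proof (rule field_differentiable_bound[of "cball 0 \<rho>"])
          show "(G has_field_derivative deriv G x) (at x within cball 0 \<rho>)" if "x \<in> cball 0 \<rho>" for x
            using that \<rho> G by (intro has_field_derivative_at_within[OF holomorphic_derivI[of G "ball 0 1"]]) auto
        qed (use C t tz[of t z] tz[of t "Y n"] \<rho> Y in auto)
        also have "\<dots> = C * (t * norm (Y n - z))" using t by (simp add: norm_mult flip: right_diff_distrib)
        also have "\<dots> \<le> C * (1 * norm (Y n - z))" using t C by (intro mult_left_mono mult_right_mono) auto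
        finally have "norm ((G (of_real t * Y n) - G (of_real t * z)) / (Y n - z)) \<le> C"
          using Y(2)[of n] by (simp add: norm_divide divide_le_eq)
        then show "norm (?d (Y n) t) \<le> C * norm (f (of_real t))"
          unfolding norm_mult by (subst mult.commute) (rule mult_right_mono; simp)
      qed
    qed
    moreover have "(LINT t|unit_seg. ?d (Y n) t) = (?F (Y n) - ?F z) / (Y n - z)" for n
    proof -
      have "norm (Y n) < 1" using Y(3)[of n] \<rho> by simp
      then have "?F (Y n) - ?F z = (LINT t|unit_seg. f (of_real t) * G (of_real t * Y n) - f (of_real t) * G (of_real t * z))"
        using integrable_segment_product[OF f G] z by (intro Bochner_Integration.integral_diff[symmetric]) auto
      moreover have "(LINT t|unit_seg. ?d (Y n) t) = (LINT t|unit_seg. (f (of_real t) * G (of_real t * Y n) - f (of_real t) * G (of_real t * z)) / (Y n - z))"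
        by (intro Bochner_Integration.integral_cong) (auto simp: right_diff_distrib diff_divide_distrib)
      ultimately show ?thesis by simp
    qed
    ultimately have "(\<lambda>n. (?F (Y n) - ?F z) / (Y n - z)) \<longlonglongrightarrow> (LINT t|unit_seg. f (of_real t) * (of_real t * deriv G (of_real t * z)))"
      by (simp only:)
    then show "(\<lambda>n. (?F (X n) - ?F z) / (X n - z)) \<longlonglongrightarrow> (LINT t|unit_seg. f (of_real t) * (of_real t * deriv G (of_real t * z)))"
      unfolding Y_def by (rule LIMSEQ_offset)
  qed
qed

lemma gen_Hilbert_derivative:
  assumes f: "f \<in> Hardy p" and p: "1 < p" and g: "g holomorphic_on ball 0 1" and z: "norm z < 1"
  shows "(gen_Hilbert g f has_field_derivative
     (LINT t|unit_seg. f (of_real t) * (of_real t * deriv (deriv g) (of_real t * z)))) (at z)"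
proof -
  have g': "deriv g holomorphic_on ball 0 1" using g by (intro holomorphic_intros) auto
  have "((\<lambda>z. LINT t|unit_seg. f (of_real t) * deriv g (of_real t * z)) has_field_derivative
     (LINT t|unit_seg. f (of_real t) * (of_real t * deriv (deriv g) (of_real t * z)))) (at z)"
    by (rule segment_integral_derivative[OF integrable_unit_seg[OF f p] g' z])
  then show ?thesis
  proof (rule has_field_derivative_transform_within_open[where S="ball 0 1"])
    show "(LINT t|unit_seg. f (of_real t) * deriv g (of_real t * w)) = gen_Hilbert g f w" if "w \<in> ball 0 1" for w
      using gen_Hilbert_eq[OF Hardy_holomorphic[OF f] g, of w] that by simp
  qed (use z in auto)
qed

lemma gen_Hilbert_holomorphic:
  assumes "f \<in> Hardy p" "1 < p" "g holomorphic_on ball 0 1"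
  shows "gen_Hilbert g f holomorphic_on ball 0 1"
  unfolding holomorphic_on_open[OF open_ball]
proof (intro ballI exI)
  show "(gen_Hilbert g f has_field_derivative
     (LINT t|unit_seg. f (of_real t) * (of_real t * deriv (deriv g) (of_real t * x)))) (at x)" if "x \<in> ball 0 1" for x
    using that by (intro gen_Hilbert_derivative[OF assms]) simp
qed

lemma gen_Hilbert_diff:
  assumes f: "f1 \<in> Hardy p" "f2 \<in> Hardy p" and p: "1 < p" and g: "g holomorphic_on ball 0 1" and z: "norm z < 1"
  shows "gen_Hilbert g (\<lambda>w. f1 w - f2 w) z = gen_Hilbert g f1 z - gen_Hilbert g f2 z"
proof -
  have g': "deriv g holomorphic_on ball 0 1" using g by (intro holomorphic_intros) auto
  have hol: "f1 holomorphic_on ball 0 1" "f2 holomorphic_on ball 0 1" using f by (auto intro: Hardy_holomorphic)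
  have "(\<lambda>w. f1 w - f2 w) holomorphic_on ball 0 1" using hol by (intro holomorphic_intros)
  moreover have "integrable unit_seg (\<lambda>t. f1 (of_real t) * deriv g (of_real t * z))"
    "integrable unit_seg (\<lambda>t. f2 (of_real t) * deriv g (of_real t * z))"
    by (rule integrable_segment_product[OF integrable_unit_seg[OF f(1) p] g' z])
      (rule integrable_segment_product[OF integrable_unit_seg[OF f(2) p] g' z])
  ultimately show ?thesis
    using hol g z by (simp add: gen_Hilbert_eq left_diff_distrib Bochner_Integration.integral_diff)
qed

text \<open>With \<open>v = seg_abs f\<close> this bounds the size of the derivative of the image at
  radius \<open>1 - \<tau>\<close>. The exponent \<open>b\<close> is \<open>2 - 1 / q\<close> for
  q-means, 2 for the supremum, and 1 after integrating the supremum bound or splitting off a power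
  of \<open>\<tau>\<close>. The value is extended real so that Tonelli's theorem applies at
  once.\<close>

definition kernel_mean :: "real \<Rightarrow> real \<Rightarrow> real \<Rightarrow> (real \<Rightarrow> real) \<Rightarrow> real \<Rightarrow> ennreal" where
  "kernel_mean b \<epsilon> B v \<tau> = (\<integral>\<^sup>+u. ennreal ((\<epsilon> * max \<tau> \<bar>u\<bar> powr (- b) + B) * v u) \<partial>lborel)"

lemma kernel_mean_measurable [measurable]:
  assumes [measurable]: "v \<in> borel_measurable borel"
  shows "kernel_mean b \<epsilon> B v \<in> borel_measurable borel"
  unfolding kernel_mean_def[abs_def] by measurable

lemma kernel_mean_finite:
  assumes [measurable]: "v \<in> borel_measurable borel" and v: "\<And>u. 0 \<le> v u" "(\<integral>\<^sup>+u. ennreal (v u) \<partial>lborel) < \<infinity>"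
    and eB: "0 \<le> \<epsilon>" "0 \<le> B" and \<tau>: "0 < \<tau>" and b: "0 \<le> b"
  shows "kernel_mean b \<epsilon> B v \<tau> < \<infinity>"
proof -
  have "kernel_mean b \<epsilon> B v \<tau> \<le> (\<integral>\<^sup>+u. ennreal (\<epsilon> * \<tau> powr (- b) + B) * ennreal (v u) \<partial>lborel)"
    unfolding kernel_mean_def
  proof (intro nn_integral_mono)
    fix u
    have "max \<tau> \<bar>u\<bar> powr (- b) \<le> \<tau> powr (- b)" using \<tau> b by (intro powr_mono2') auto
    then have "(\<epsilon> * max \<tau> \<bar>u\<bar> powr (- b) + B) * v u \<le> (\<epsilon> * \<tau> powr (- b) + B) * v u"
      using eB v(1)[of u] by (intro mult_right_mono add_mono mult_left_mono) auto
    then show "ennreal ((\<epsilon> * max \<tau> \<bar>u\<bar> powr (- b) + B) * v u) \<le> ennreal (\<epsilon> * \<tau> powr (- b) + B) * ennreal (v u)"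
      using eB v(1)[of u] by (subst ennreal_mult[symmetric]) (auto intro!: ennreal_leI)
  qed
  also have "\<dots> = ennreal (\<epsilon> * \<tau> powr (- b) + B) * (\<integral>\<^sup>+u. ennreal (v u) \<partial>lborel)"
    by (rule nn_integral_cmult) measurable
  also have "\<dots> < \<infinity>" using v(2) by (simp add: ennreal_mult_less_top)
  finally show ?thesis .
qed

section \<open>Means and size of the derivative of the image\<close>

lemma one_minus_mult_ge:
  fixes t \<tau> :: real
  assumes "0 \<le> t" "t \<le> 1" "0 \<le> \<tau>" "\<tau> \<le> 1"
  shows "max \<tau> \<bar>1 - t\<bar> \<le> 1 - t * (1 - \<tau>)"
proof -
  have "1 - t * (1 - \<tau>) = \<tau> + (1 - t) * (1 - \<tau>)" "1 - t * (1 - \<tau>) = (1 - t) + t * \<tau>" by (auto simp: algebra_simps)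
  moreover have "0 \<le> (1 - t) * (1 - \<tau>)" "0 \<le> t * \<tau>" using assms by auto
  ultimately have "\<tau> \<le> 1 - t * (1 - \<tau>)" "1 - t \<le> 1 - t * (1 - \<tau>)" by linarith+
  then show ?thesis using assms by simp
qed

text \<open>Minkowski's inequality in \<open>t\<close>: the argument of g'' lies at distance at
  least \<open>max \<tau> \<bar>1 - t\<bar>\<close> from the circle, and the exponent
  \<open>1 / q - 2\<close> is negative, so the mean of g'' may be replaced by its bound at that
  distance.\<close>

lemma gen_Hilbert_deriv_mean:
  assumes f: "f \<in> Hardy p" and p: "1 < p" and g: "g holomorphic_on ball 0 1" and q: "1 < q"
    and eB: "0 \<le> \<epsilon>" "0 \<le> B"
    and bound: "\<And>x. 0 \<le> x \<Longrightarrow> x < 1 \<Longrightarrow> Lp_le q (\<lambda>\<theta>. deriv (deriv g) (polar x \<theta>)) (\<epsilon> * (1 - x) powr (1 / q - 2) + B)"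
    and \<tau>: "0 < \<tau>" "\<tau> \<le> 1"
  shows "Lp_le q (\<lambda>\<theta>. deriv (gen_Hilbert g f) (polar (1 - \<tau>) \<theta>)) (enn2real (kernel_mean (2 - 1 / q) \<epsilon> B (seg_abs f) \<tau>))"
proof -
  have hol: "f holomorphic_on ball 0 1" using f by (rule Hardy_holomorphic)
  have g'': "deriv (deriv g) holomorphic_on ball 0 1" using g by (intro holomorphic_intros) auto
  have [measurable]: "seg_abs f \<in> borel_measurable borel" using hol by measurable
  let ?b = "2 - 1 / q"
  have b: "1 < ?b" using q by (simp add: field_simps)
  have fin: "kernel_mean ?b \<epsilon> B (seg_abs f) \<tau> < \<infinity>"
    using seg_abs_Hardy(2)[OF f p] seg_abs_nonneg eB \<tau> b by (intro kernel_mean_finite) auto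
  let ?k = "\<lambda>u. \<epsilon> * max \<tau> \<bar>u\<bar> powr (- ?b) + B"
  let ?A = "\<lambda>t \<theta>. f (of_real t) * (of_real t * deriv (deriv g) (of_real (t * (1 - \<tau>)) * cis \<theta>))"
  have fm [measurable]: "(\<lambda>t. f (of_real t)) \<in> borel_measurable unit_seg" using hol by measurable
  have tt: "0 \<le> t * (1 - \<tau>)" "t * (1 - \<tau>) < 1" if "t \<in> {0..<1}" for t
    using that \<tau> mult_left_le[of "1 - \<tau>" t] by auto
  show ?thesis
  proof (rule Minkowski_integral[OF _ finite_measure_unit_seg, where A="?A" and W="\<lambda>t. ?k (1 - t) * norm (f (of_real t))"])
    have "(\<lambda>x. of_real (fst x * (1 - \<tau>)) * cis (snd x)) \<in> borel_measurable (unit_seg \<Otimes>\<^sub>M borel)"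
      by (intro continuous_pair_measurable continuous_intros)
    then have mA: "(\<lambda>x. deriv (deriv g) (of_real (fst x * (1 - \<tau>)) * cis (snd x))) \<in> borel_measurable (unit_seg \<Otimes>\<^sub>M borel)"
    proof (rule continuous_trace_measurable[OF holomorphic_on_imp_continuous_on[OF g'']])
      fix x :: "real \<times> real" assume "x \<in> space (unit_seg \<Otimes>\<^sub>M borel)"
      then have "fst x \<in> {0..<1}" by (simp add: space_pair_measure mem_Times_iff)
      from tt[OF this] show "norm (of_real (fst x * (1 - \<tau>)) * cis (snd x)) < 1"
        unfolding norm_mult norm_of_real norm_cis by simp
    qed
    have mB: "(\<lambda>x. f (of_real (fst x)) * of_real (fst x)) \<in> borel_measurable (unit_seg \<Otimes>\<^sub>M borel)"
      by (rule measurable_compose[OF measurable_fst, where g="\<lambda>t. f (of_real t) * of_real t"]) measurable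
    show "(\<lambda>(t, \<theta>). ?A t \<theta>) \<in> borel_measurable (unit_seg \<Otimes>\<^sub>M borel)"
      unfolding case_prod_beta' mult.assoc[symmetric] by (rule borel_measurable_times[OF mB mA])
    have "(\<lambda>t. ?k (1 - t)) \<in> borel_measurable unit_seg" by (intro measurable_restrict_space1) measurable
    then show "(\<lambda>t. ?k (1 - t) * norm (f (of_real t))) \<in> borel_measurable unit_seg" by measurable
    show "Lp_le q (?A t) (?k (1 - t) * norm (f (of_real t)))" if "t \<in> space unit_seg" for t
    proof -
      have t: "t \<in> {0..<1}" using that by simp
      have "(1 - t * (1 - \<tau>)) powr (1 / q - 2) \<le> max \<tau> \<bar>1 - t\<bar> powr (1 / q - 2)"
        using one_minus_mult_ge[of t \<tau>] t \<tau> b by (intro powr_mono2') auto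
      then have "\<epsilon> * (1 - t * (1 - \<tau>)) powr (1 / q - 2) + B \<le> ?k (1 - t)"
        using eB by (auto intro!: mult_left_mono)
      then have "Lp_le q (\<lambda>\<theta>. deriv (deriv g) (of_real (t * (1 - \<tau>)) * cis \<theta>)) (?k (1 - t))"
        using bound[OF tt[OF t]] q by (auto intro: Lp_le_mono)
      from Lp_le_cmult[OF this _ trace_measurable(2)[OF g'' tt[OF t]], of "f (of_real t) * of_real t"]
      have "Lp_le q (?A t) (norm (f (of_real t) * of_real t) * ?k (1 - t))" using q by (simp add: mult.assoc)
      moreover have "norm (f (of_real t) * of_real t) * ?k (1 - t) \<le> ?k (1 - t) * norm (f (of_real t))"
      proof -
        have "norm (f (of_real t) * of_real t) \<le> norm (f (of_real t))"
          using t by (simp add: norm_mult mult_left_le)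
        then show ?thesis using eB by (subst mult.commute) (intro mult_left_mono; simp)
      qed
      ultimately show ?thesis using q by (auto intro: Lp_le_mono)
    qed
    show "(\<integral>\<^sup>+t. ennreal (?k (1 - t) * norm (f (of_real t))) \<partial>unit_seg) \<le> ennreal (enn2real (kernel_mean ?b \<epsilon> B (seg_abs f) \<tau>))"
      using nn_integral_seg_abs[OF hol, of ?k] eB fin by (simp add: kernel_mean_def)
    show "ennreal (norm (deriv (gen_Hilbert g f) (polar (1 - \<tau>) \<theta>))) \<le> (\<integral>\<^sup>+t. ennreal (norm (?A t \<theta>)) \<partial>unit_seg)" for \<theta>
    proof -
      let ?z = "of_real (1 - \<tau>) * cis \<theta>"
      have z: "norm ?z < 1" unfolding norm_mult norm_of_real using \<tau> by simp
      have eq: "of_real (t * (1 - \<tau>)) * cis \<theta> = of_real t * ?z" for t by simp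
      have "(\<lambda>t. of_real t * f (of_real t)) \<in> borel_measurable unit_seg" by measurable
      have "integrable unit_seg (\<lambda>t. of_real t * f (of_real t))"
      proof (rule Bochner_Integration.integrable_bound[OF integrable_unit_seg[OF f p]])
        show "AE t in unit_seg. norm (of_real t * f (of_real t)) \<le> norm (f (of_real t))"
          by (rule AE_I2) (auto simp: norm_mult mult_left_le_one_le)
      qed measurable
      then have int: "integrable unit_seg (\<lambda>t. ?A t \<theta>)"
        using integrable_segment_product[of "\<lambda>w. w * f w" "deriv (deriv g)" ?z] g'' z unfolding eq by (simp add: mult_ac)
      have "deriv (gen_Hilbert g f) ?z = (LINT t|unit_seg. ?A t \<theta>)"
        unfolding eq by (rule DERIV_imp_deriv[OF gen_Hilbert_derivative[OF f p g z]])
      then show ?thesis using integral_norm_bound_ennreal[OF int] by simp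
    qed
  qed (use q in auto)
qed

text \<open>The same estimate for single values of g'' in place of means, hence without Minkowski's
  inequality and with exponent -2.\<close>

lemma gen_Hilbert_deriv_sup:
  assumes f: "f \<in> Hardy p" and p: "1 < p" and g: "g holomorphic_on ball 0 1"
    and eB: "0 \<le> \<epsilon>" "0 \<le> B"
    and bound: "\<And>w. norm w < 1 \<Longrightarrow> norm (deriv (deriv g) w) \<le> \<epsilon> * (1 - norm w) powr (- 2) + B"
    and \<tau>: "0 < \<tau>" "\<tau> \<le> 1"
  shows "ennreal (norm (deriv (gen_Hilbert g f) (polar (1 - \<tau>) \<theta>))) \<le> kernel_mean 2 \<epsilon> B (seg_abs f) \<tau>"
proof -
  have hol: "f holomorphic_on ball 0 1" using f by (rule Hardy_holomorphic)
  have g'': "deriv (deriv g) holomorphic_on ball 0 1" using g by (intro holomorphic_intros) auto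
  let ?z = "of_real (1 - \<tau>) * cis \<theta>"
  have nz: "norm ?z = 1 - \<tau>" unfolding norm_mult norm_of_real using \<tau> by simp
  then have z: "norm ?z < 1" using \<tau> by simp
  let ?k = "\<lambda>u. \<epsilon> * max \<tau> \<bar>u\<bar> powr (- 2) + B"
  let ?A = "\<lambda>t. f (of_real t) * (of_real t * deriv (deriv g) (of_real t * ?z))"
  have fm [measurable]: "(\<lambda>t. f (of_real t)) \<in> borel_measurable unit_seg" using hol by measurable
  have "integrable unit_seg (\<lambda>t. of_real t * f (of_real t))"
  proof (rule Bochner_Integration.integrable_bound[OF integrable_unit_seg[OF f p]])
    show "AE t in unit_seg. norm (of_real t * f (of_real t)) \<le> norm (f (of_real t))"
      by (rule AE_I2) (auto simp: norm_mult mult_left_le_one_le)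
  qed measurable
  then have int: "integrable unit_seg ?A"
    using integrable_segment_product[of "\<lambda>w. w * f w" "deriv (deriv g)" ?z] g'' z by (simp add: mult_ac)
  have "deriv (gen_Hilbert g f) ?z = (LINT t|unit_seg. ?A t)"
    by (rule DERIV_imp_deriv[OF gen_Hilbert_derivative[OF f p g z]])
  then have "ennreal (norm (deriv (gen_Hilbert g f) ?z)) \<le> (\<integral>\<^sup>+t. ennreal (norm (?A t)) \<partial>unit_seg)"
    using integral_norm_bound_ennreal[OF int] by simp
  also have "\<dots> \<le> (\<integral>\<^sup>+t. ennreal (?k (1 - t) * norm (f (of_real t))) \<partial>unit_seg)"
  proof (intro nn_integral_mono ennreal_leI)
    fix t assume "t \<in> space unit_seg"
    then have t: "0 \<le> t" "t < 1" by auto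
    have ntz: "norm (of_real t * ?z) = t * (1 - \<tau>)" using t nz by (simp only: norm_mult[of "of_real t"] norm_of_real abs_of_nonneg)
    have lt: "t * (1 - \<tau>) < 1" using t \<tau> mult_left_le[of "1 - \<tau>" t] by auto
    have "norm (deriv (deriv g) (of_real t * ?z)) \<le> \<epsilon> * (1 - t * (1 - \<tau>)) powr (- 2) + B"
      using bound[of "of_real t * ?z"] lt unfolding ntz by simp
    also have "(1 - t * (1 - \<tau>)) powr (- 2) \<le> max \<tau> \<bar>1 - t\<bar> powr (- 2)"
      using one_minus_mult_ge[of t \<tau>] t \<tau> by (intro powr_mono2') auto
    finally have k: "norm (deriv (deriv g) (of_real t * ?z)) \<le> ?k (1 - t)" using eB by (simp add: mult_left_mono)
    have "norm (?A t) = norm (f (of_real t)) * (t * norm (deriv (deriv g) (of_real t * ?z)))"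
      using t by (simp add: norm_mult)
    also have "\<dots> \<le> norm (f (of_real t)) * (1 * ?k (1 - t))"
      using t k eB by (intro mult_left_mono mult_mono) auto
    finally show "norm (?A t) \<le> ?k (1 - t) * norm (f (of_real t))" by (simp add: mult.commute)
  qed
  also have "\<dots> = kernel_mean 2 \<epsilon> B (seg_abs f) \<tau>"
    unfolding kernel_mean_def using eB by (intro nn_integral_seg_abs hol) auto
  finally show ?thesis .
qed

section \<open>Mixed-norm embedding\<close>

lemma powr_add_le:
  fixes x y p :: real
  assumes "0 \<le> x" "0 \<le> y" "0 \<le> p"
  shows "(x + y) powr p \<le> 2 powr p * (x powr p + y powr p)"
proof -
  have "(x + y) powr p \<le> (2 * max x y) powr p" using assms by (intro powr_mono2) auto
  also have "\<dots> = 2 powr p * max x y powr p" using assms by (simp add: powr_mult)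
  also have "\<dots> \<le> 2 powr p * (x powr p + y powr p)"
    by (intro mult_left_mono) (auto simp: max_def)
  finally show ?thesis .
qed

text \<open>The constant part of the kernel contributes at most \<open>B * Y\<close> for each
  \<open>\<tau>\<close>. The Schur test is applied to the excess over this amount; on the interval
  from 0 to 1 the constant has finite p-norm, and recombining costs \<open>2 powr p\<close>.\<close>

lemma Schur_plus_const:
  fixes v \<Phi> :: "real \<Rightarrow> real"
  assumes p: "1 < p" and \<alpha>: "- 1 / p < \<alpha>" "\<alpha> < 1 - 1 / p"
    and [measurable]: "v \<in> borel_measurable borel" "\<Phi> \<in> borel_measurable borel" and v: "\<And>u. 0 \<le> v u"
    and X: "(\<integral>\<^sup>+u. ennreal (v u powr p) \<partial>lborel) \<le> ennreal (X powr p)"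
    and Y: "0 \<le> Y" "(\<integral>\<^sup>+u. ennreal (v u) \<partial>lborel) \<le> ennreal Y"
    and cB: "0 \<le> c" "0 \<le> B"
    and \<Phi>: "\<And>\<tau>. 0 < \<tau> \<Longrightarrow> \<tau> \<le> 1 \<Longrightarrow> 0 \<le> \<Phi> \<tau>"
      "\<And>\<tau>. 0 < \<tau> \<Longrightarrow> \<tau> \<le> 1 \<Longrightarrow> ennreal (\<Phi> \<tau>) \<le> (\<integral>\<^sup>+u. ennreal ((c * hom_kernel \<alpha> \<tau> u + B) * v u) \<partial>lborel)"
  shows "(\<integral>\<^sup>+\<tau>. ennreal (\<Phi> \<tau> powr p) * indicator {0<..1} \<tau> \<partial>lborel)
     \<le> ennreal (2 powr p * (Schur_const p \<alpha> * c powr p * X powr p + (B * Y) powr p))"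
proof -
  have S0: "0 \<le> Schur_const p \<alpha>" using Schur_const_nonneg[OF p \<alpha>] .
  \<comment> \<open>Truncated at 0 and cut off beyond 1, so that the hypothesis of the Schur test
    holds for every positive \<open>\<tau>\<close>.\<close>
  define \<Psi> where "\<Psi> \<tau> = (if \<tau> \<le> 1 then max 0 (\<Phi> \<tau> - B * Y) else 0)" for \<tau>
  have [measurable]: "\<Psi> \<in> borel_measurable borel" unfolding \<Psi>_def[abs_def] by measurable
  have "(\<integral>\<^sup>+\<tau>. ennreal (\<Psi> \<tau> powr p) * indicator {0<..} \<tau> \<partial>lborel) \<le> ennreal (Schur_const p \<alpha>) * (\<integral>\<^sup>+u. ennreal ((c * v u) powr p) \<partial>lborel)"
  proof (rule Schur_hom_kernel[OF p \<alpha>])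
    show "ennreal (\<Psi> \<tau>) \<le> (\<integral>\<^sup>+u. ennreal (hom_kernel \<alpha> \<tau> u * (c * v u)) \<partial>lborel)" if \<tau>: "0 < \<tau>" for \<tau>
    proof (cases "\<tau> \<le> 1 \<and> B * Y < \<Phi> \<tau>")
      case True
      then have "ennreal (\<Psi> \<tau>) + ennreal (B * Y) = ennreal (\<Phi> \<tau>)"
        using cB Y by (simp add: \<Psi>_def flip: ennreal_plus)
      also have "\<dots> \<le> (\<integral>\<^sup>+u. ennreal ((c * hom_kernel \<alpha> \<tau> u + B) * v u) \<partial>lborel)"
        using \<Phi>(2) \<tau> True by blast
      also have "\<dots> = (\<integral>\<^sup>+u. ennreal (hom_kernel \<alpha> \<tau> u * (c * v u)) + ennreal B * ennreal (v u) \<partial>lborel)"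
        using cB v hom_kernel_nonneg by (intro nn_integral_cong) (simp add: algebra_simps flip: ennreal_mult ennreal_plus)
      also have "\<dots> = (\<integral>\<^sup>+u. ennreal (hom_kernel \<alpha> \<tau> u * (c * v u)) \<partial>lborel) + ennreal B * (\<integral>\<^sup>+u. ennreal (v u) \<partial>lborel)"
        by (subst nn_integral_add) (auto simp: nn_integral_cmult)
      also have "\<dots> \<le> (\<integral>\<^sup>+u. ennreal (hom_kernel \<alpha> \<tau> u * (c * v u)) \<partial>lborel) + ennreal (B * Y)"
        using Y cB by (simp add: ennreal_mult add_left_mono mult_left_mono)
      finally show ?thesis
        by (simp add: add.commute[of _ "ennreal (B * Y)"])
    next
      case False
      then have "\<Psi> \<tau> = 0" by (auto simp: \<Psi>_def)
      then show ?thesis by simp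
    qed
  qed (use cB v in \<open>auto simp: \<Psi>_def\<close>)
  also have "(\<integral>\<^sup>+u. ennreal ((c * v u) powr p) \<partial>lborel) = ennreal (c powr p) * (\<integral>\<^sup>+u. ennreal (v u powr p) \<partial>lborel)"
    using cB v by (subst nn_integral_cmult[symmetric]) (auto simp: powr_mult ennreal_mult)
  also have "ennreal (Schur_const p \<alpha>) * (ennreal (c powr p) * (\<integral>\<^sup>+u. ennreal (v u powr p) \<partial>lborel))
      \<le> ennreal (Schur_const p \<alpha>) * (ennreal (c powr p) * ennreal (X powr p))"
    using X by (intro mult_left_mono) auto
  finally have 1: "(\<integral>\<^sup>+\<tau>. ennreal (\<Psi> \<tau> powr p) * indicator {0<..} \<tau> \<partial>lborel) \<le> ennreal (Schur_const p \<alpha> * c powr p * X powr p)"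
    using S0 by (simp add: ennreal_mult mult.assoc)
  have "(\<integral>\<^sup>+\<tau>. ennreal (\<Phi> \<tau> powr p) * indicator {0<..1} \<tau> \<partial>lborel)
    \<le> (\<integral>\<^sup>+\<tau>. ennreal (2 powr p) * (ennreal (\<Psi> \<tau> powr p) * indicator {0<..} \<tau> + ennreal ((B * Y) powr p) * indicator {0<..1} \<tau>) \<partial>lborel)"
  proof (intro nn_integral_mono)
    fix \<tau> :: real
    show "ennreal (\<Phi> \<tau> powr p) * indicator {0<..1} \<tau>
      \<le> ennreal (2 powr p) * (ennreal (\<Psi> \<tau> powr p) * indicator {0<..} \<tau> + ennreal ((B * Y) powr p) * indicator {0<..1} \<tau>)"
    proof (cases "\<tau> \<in> {0<..1}")
      case True
      then have "\<Phi> \<tau> \<le> \<Psi> \<tau> + B * Y" "0 \<le> \<Phi> \<tau>" using \<Phi>(1) by (auto simp: \<Psi>_def)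
      then have "\<Phi> \<tau> powr p \<le> (\<Psi> \<tau> + B * Y) powr p" using p by (intro powr_mono2) auto
      also have "\<dots> \<le> 2 powr p * (\<Psi> \<tau> powr p + (B * Y) powr p)"
        using p cB Y by (intro powr_add_le) (auto simp: \<Psi>_def)
      finally show ?thesis using True by (simp add: ennreal_leI flip: ennreal_mult ennreal_plus)
    qed simp
  qed
  also have "\<dots> = ennreal (2 powr p) * ((\<integral>\<^sup>+\<tau>. ennreal (\<Psi> \<tau> powr p) * indicator {0<..} \<tau> \<partial>lborel) + ennreal ((B * Y) powr p))"
    by (subst nn_integral_cmult) (auto simp: nn_integral_add nn_integral_cmult_indicator)
  also have "\<dots> \<le> ennreal (2 powr p) * (ennreal (Schur_const p \<alpha> * c powr p * X powr p) + ennreal ((B * Y) powr p))"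
    using 1 by (intro mult_left_mono add_right_mono) auto
  also have "\<dots> = ennreal (2 powr p * (Schur_const p \<alpha> * c powr p * X powr p + (B * Y) powr p))"
    using S0 by (simp flip: ennreal_mult ennreal_plus)
  finally show ?thesis .
qed

text \<open>At the last level \<open>m\<close> above which at least half of the mass lies, both the mass above \<open>\<tau>\<close> and
  the mass below \<open>2 \<tau>\<close> are at least half of the total for every \<open>\<tau>\<close> between \<open>m / 2\<close> and \<open>m\<close>.\<close>

lemma crossing:
  fixes w :: "real \<Rightarrow> real"
  assumes [measurable]: "w \<in> borel_measurable borel" and w: "\<And>\<tau>. 0 \<le> w \<tau>" "\<And>\<tau>. \<tau> \<notin> {\<delta>..1} \<Longrightarrow> w \<tau> = 0" and \<delta>: "0 < \<delta>"
    and S: "0 \<le> S" "(\<integral>\<^sup>+\<tau>. ennreal (w \<tau>) \<partial>lborel) = ennreal S" and q: "0 < q" "q < p"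
  defines "Hi \<equiv> \<lambda>\<tau>. enn2real (\<integral>\<^sup>+x. ennreal (w x) * indicator {\<tau>..} x \<partial>lborel)"
    and "Lo \<equiv> \<lambda>\<tau>. enn2real (\<integral>\<^sup>+x. ennreal (w x) * indicator {..\<tau>} x \<partial>lborel)"
  shows "ennreal (S powr p) \<le> ennreal (2 powr p * 2) * (\<integral>\<^sup>+\<tau>. ennreal (Hi \<tau> powr (p - q) * (Lo (2 * \<tau>) powr q / \<tau>)) * indicator {0<..1} \<tau> \<partial>lborel)"
proof (cases "S = 0")
  case True
  then show ?thesis using q by simp
next
  case False
  then have S0: "0 < S" using S by simp
  have le: "(\<integral>\<^sup>+x. ennreal (w x) * indicator A x \<partial>lborel) \<le> ennreal S" for A
    unfolding S(2)[symmetric] by (intro nn_integral_mono) (auto simp: indicator_def)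
  have Hi: "ennreal (Hi \<tau>) = (\<integral>\<^sup>+x. ennreal (w x) * indicator {\<tau>..} x \<partial>lborel)" for \<tau>
    using le[of "{\<tau>..}"] unfolding Hi_def by (intro ennreal_enn2real) (auto simp: less_top[symmetric] top_unique)
  have Lo: "ennreal (Lo \<tau>) = (\<integral>\<^sup>+x. ennreal (w x) * indicator {..\<tau>} x \<partial>lborel)" for \<tau>
    using le[of "{..\<tau>}"] unfolding Lo_def by (intro ennreal_enn2real) (auto simp: less_top[symmetric] top_unique)
  have nn: "0 \<le> Hi \<tau>" "0 \<le> Lo \<tau>" for \<tau> by (auto simp: Hi_def Lo_def)
  have mono: "Hi y \<le> Hi x" if "x \<le> y" for x y
  proof -
    have "ennreal (Hi y) \<le> ennreal (Hi x)" unfolding Hi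
      using that by (intro nn_integral_mono) (auto simp: indicator_def)
    then show ?thesis using nn by simp
  qed
  have sum: "S \<le> Hi \<tau> + Lo \<tau>" for \<tau>
  proof -
    have "ennreal S \<le> (\<integral>\<^sup>+x. ennreal (w x) * indicator {\<tau>..} x + ennreal (w x) * indicator {..\<tau>} x \<partial>lborel)"
      unfolding S(2)[symmetric] by (intro nn_integral_mono) (auto simp: indicator_def)
    also have "\<dots> = ennreal (Hi \<tau> + Lo \<tau>)" using nn by (subst nn_integral_add) (auto simp: Hi Lo)
    finally show ?thesis using nn[of \<tau>] by (subst (asm) ennreal_le_iff) auto
  qed
  define T where "T = {\<tau>. S / 2 \<le> Hi \<tau>}"
  have "ennreal (Hi \<delta>) = ennreal S" unfolding Hi S(2)[symmetric]
    using w(2) by (intro nn_integral_cong) (auto simp: indicator_def)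
  then have \<delta>T: "\<delta> \<in> T" using S nn[of \<delta>] by (simp add: T_def)
  have Tle: "\<tau> \<le> 1" if "\<tau> \<in> T" for \<tau>
  proof (rule ccontr)
    assume "\<not> \<tau> \<le> 1"
    then have z: "ennreal (w x) * indicator {\<tau>..} x = 0" for x using w(2)[of x] by (auto simp: indicator_def)
    have "(\<integral>\<^sup>+x. ennreal (w x) * indicator {\<tau>..} x \<partial>lborel) = (\<integral>\<^sup>+x. 0 \<partial>(lborel::real measure))" by (intro nn_integral_cong z)
    then have "Hi \<tau> = 0" by (simp add: Hi_def)
    then show False using that S0 by (simp add: T_def)
  qed
  then have bdd: "bdd_above T" by (rule bdd_aboveI)
  have T1: "Sup T \<le> 1" using \<delta>T Tle by (intro cSup_least) auto
  define m where "m = Sup T"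
  have m: "\<delta> \<le> m" "m \<le> 1" using cSup_upper[OF \<delta>T bdd] T1 by (auto simp: m_def)
  have m0: "0 < m" using m \<delta> by simp
  have key: "(S / 2) powr p / m \<le> Hi \<tau> powr (p - q) * (Lo (2 * \<tau>) powr q / \<tau>)" if \<tau>: "m / 2 < \<tau>" "\<tau> < m" for \<tau>
  proof -
    obtain y where "y \<in> T" "\<tau> < y" using \<tau>(2) \<delta>T less_cSup_iff[OF _ bdd, of \<tau>] unfolding m_def by blast
    then have h: "S / 2 \<le> Hi \<tau>" using mono[of \<tau> y] by (simp add: T_def)
    have "2 * \<tau> \<notin> T" using \<tau>(1) cSup_upper[OF _ bdd, of "2 * \<tau>"] by (auto simp: m_def)
    then have l: "S / 2 \<le> Lo (2 * \<tau>)" using sum[of "2 * \<tau>"] by (simp add: T_def)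
    have \<tau>0: "0 < \<tau>" using \<tau> m0 by simp
    have "(S / 2) powr p / m = (S / 2) powr (p - q) * ((S / 2) powr q / m)"
      using S0 by (simp flip: powr_add)
    also have "\<dots> \<le> Hi \<tau> powr (p - q) * (Lo (2 * \<tau>) powr q / \<tau>)"
      using h l q S0 \<tau> \<tau>0 by (intro mult_mono frac_le powr_mono2) auto
    finally show ?thesis .
  qed
  \<comment> \<open>The lower bound \<open>(S / 2) powr p / m\<close> holds on an interval of length
    \<open>m / 2\<close>; the \<open>m\<close> cancels, leaving a constant independent of where the
    crossing occurs.\<close>
  have "ennreal ((S / 2) powr p / m) * ennreal (m / 2) = (\<integral>\<^sup>+\<tau>. ennreal ((S / 2) powr p / m) * indicator {m/2<..<m} \<tau> \<partial>lborel)"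
    using m0 by (simp add: nn_integral_cmult_indicator)
  also have "\<dots> \<le> (\<integral>\<^sup>+\<tau>. ennreal (Hi \<tau> powr (p - q) * (Lo (2 * \<tau>) powr q / \<tau>)) * indicator {0<..1} \<tau> \<partial>lborel)"
    using m m0 key by (intro nn_integral_mono) (auto simp: indicator_def intro!: ennreal_leI)
  finally have "ennreal (2 powr p * 2) * (ennreal ((S / 2) powr p / m) * ennreal (m / 2)) \<le>
     ennreal (2 powr p * 2) * (\<integral>\<^sup>+\<tau>. ennreal (Hi \<tau> powr (p - q) * (Lo (2 * \<tau>) powr q / \<tau>)) * indicator {0<..1} \<tau> \<partial>lborel)"
    by (rule mult_left_mono) simp
  also have "ennreal (2 powr p * 2) * (ennreal ((S / 2) powr p / m) * ennreal (m / 2)) = ennreal (S powr p)"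
    using m0 S0 by (simp add: powr_divide flip: ennreal_mult)
  finally show ?thesis .
qed

text \<open>For \<open>x\<close> above \<open>\<tau>\<close> the maximum of \<open>x\<close> and
  \<open>\<bar>u\<bar>\<close> equals that of \<open>x\<close> and \<open>m\<close>, so the integral
  is of power type with constant \<open>power_kernel_const 2 0 = 4\<close>. One power of the kernel
  is gained.\<close>

lemma kernel_tail_integral:
  fixes \<tau> u :: real
  assumes \<tau>: "0 < \<tau>" and eB: "0 \<le> \<epsilon>" "0 \<le> B"
  shows "(\<integral>\<^sup>+x. ennreal (\<epsilon> * max x \<bar>u\<bar> powr (- 2) + B) * indicator {\<tau>..1} x \<partial>lborel) \<le> ennreal (4 * \<epsilon> * max \<tau> \<bar>u\<bar> powr (- 1) + B)"
proof -
  define m where "m = max \<tau> \<bar>u\<bar>"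
  have m: "0 < m" using \<tau> by (simp add: m_def)
  have "(\<integral>\<^sup>+x. ennreal (\<epsilon> * max x \<bar>u\<bar> powr (- 2) + B) * indicator {\<tau>..1} x \<partial>lborel)
    \<le> (\<integral>\<^sup>+x. ennreal \<epsilon> * ennreal (max m \<bar>x\<bar> powr (- 2) * \<bar>x\<bar> powr (- 0)) + ennreal B * indicator {0..1} x \<partial>lborel)"
  proof (intro nn_integral_mono)
    fix x :: real
    show "ennreal (\<epsilon> * max x \<bar>u\<bar> powr (- 2) + B) * indicator {\<tau>..1} x \<le> ennreal \<epsilon> * ennreal (max m \<bar>x\<bar> powr (- 2) * \<bar>x\<bar> powr (- 0)) + ennreal B * indicator {0..1} x"
    proof (cases "x \<in> {\<tau>..1}")
      case True
      then have "max m \<bar>x\<bar> = max x \<bar>u\<bar>" using \<tau> by (auto simp: m_def max_def)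
      then show ?thesis using True \<tau> eB by (simp flip: ennreal_mult ennreal_plus)
    qed simp
  qed
  also have "\<dots> = ennreal \<epsilon> * (\<integral>\<^sup>+x. ennreal (max m \<bar>x\<bar> powr (- 2) * \<bar>x\<bar> powr (- 0)) \<partial>lborel) + ennreal B"
    by (subst nn_integral_add) (auto simp: nn_integral_cmult)
  also have "\<dots> \<le> ennreal \<epsilon> * ennreal (power_kernel_const 2 0 * m powr (1 - 2 - 0)) + ennreal B"
    using m by (intro add_right_mono mult_left_mono power_kernel_integral) auto
  also have "\<dots> = ennreal (4 * \<epsilon> * max \<tau> \<bar>u\<bar> powr (- 1) + B)"
    using eB by (simp add: power_kernel_const_def m_def mult_ac flip: ennreal_mult ennreal_plus)
  finally show ?thesis .
qed

text \<open>If \<open>\<tau> \<le> u\<close> the kernel is at most \<open>u powr (- b)\<close> on a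
  length \<open>2 * \<tau>\<close>; otherwise the integral over the whole line is of order
  \<open>u powr (1 - b)\<close>. Both are instances of one expression with
  \<open>\<tau> / max \<tau> u\<close>.\<close>

lemma kernel_head_integral:
  fixes \<tau> u :: real
  assumes \<tau>: "0 < \<tau>" and u: "0 < u" and b: "1 < b" and eB: "0 \<le> \<epsilon>" "0 \<le> B"
  shows "(\<integral>\<^sup>+x. ennreal (\<epsilon> * max x \<bar>u\<bar> powr (- b) + B) * indicator {0<..2 * \<tau>} x \<partial>lborel)
    \<le> ennreal (\<epsilon> * (2 + power_kernel_const b 0) * \<tau> * (u powr (1 - b) * max \<tau> \<bar>u\<bar> powr (- 1)) + 2 * \<tau> * B)"
proof -
  define C where "C = power_kernel_const b 0"
  have C: "0 < C" using b by (simp add: C_def power_kernel_const_pos)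
  have split: "(\<integral>\<^sup>+x. ennreal (\<epsilon> * max x \<bar>u\<bar> powr (- b) + B) * indicator {0<..2 * \<tau>} x \<partial>lborel)
      = ennreal \<epsilon> * (\<integral>\<^sup>+x. ennreal (max x u powr (- b)) * indicator {0<..2 * \<tau>} x \<partial>lborel) + ennreal (2 * \<tau> * B)"
  proof -
    have "(\<integral>\<^sup>+x. ennreal (\<epsilon> * max x \<bar>u\<bar> powr (- b) + B) * indicator {0<..2 * \<tau>} x \<partial>lborel)
      = (\<integral>\<^sup>+x. ennreal \<epsilon> * (ennreal (max x u powr (- b)) * indicator {0<..2 * \<tau>} x) + ennreal B * indicator {0<..2 * \<tau>} x \<partial>lborel)"
      using eB u by (intro nn_integral_cong) (auto simp: indicator_def simp flip: ennreal_mult ennreal_plus)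
    also have "\<dots> = ennreal \<epsilon> * (\<integral>\<^sup>+x. ennreal (max x u powr (- b)) * indicator {0<..2 * \<tau>} x \<partial>lborel) + ennreal B * ennreal (2 * \<tau>)"
      using \<tau> by (subst nn_integral_add) (auto simp: nn_integral_cmult nn_integral_cmult_indicator)
    finally show ?thesis using eB \<tau> by (simp add: mult.commute flip: ennreal_mult)
  qed
  have "(\<integral>\<^sup>+x. ennreal (max x u powr (- b)) * indicator {0<..2 * \<tau>} x \<partial>lborel) \<le> ennreal ((2 + C) * \<tau> * (u powr (1 - b) * max \<tau> \<bar>u\<bar> powr (- 1)))"
  proof (cases "\<tau> \<le> u")
    case True
    have "(\<integral>\<^sup>+x. ennreal (max x u powr (- b)) * indicator {0<..2 * \<tau>} x \<partial>lborel) \<le> (\<integral>\<^sup>+x. ennreal (u powr (- b)) * indicator {0<..2 * \<tau>} x \<partial>lborel)"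
      using u b by (intro nn_integral_mono) (auto simp: indicator_def intro!: ennreal_leI powr_mono2')
    also have "\<dots> = ennreal (u powr (- b) * (2 * \<tau>))"
      using \<tau> by (simp add: nn_integral_cmult_indicator flip: ennreal_mult)
    also have "u powr (- b) * (2 * \<tau>) = 2 * \<tau> * (u powr (1 - b) * max \<tau> \<bar>u\<bar> powr (- 1))"
      using True u by (simp add: max_absorb2 powr_diff powr_minus_divide)
    also have "\<dots> \<le> (2 + C) * \<tau> * (u powr (1 - b) * max \<tau> \<bar>u\<bar> powr (- 1))"
      using C \<tau> by (intro mult_right_mono) auto
    finally show ?thesis by (simp add: ennreal_leI)
  next
    case False
    have "(\<integral>\<^sup>+x. ennreal (max x u powr (- b)) * indicator {0<..2 * \<tau>} x \<partial>lborel) \<le> (\<integral>\<^sup>+x. ennreal (max u \<bar>x\<bar> powr (- b) * \<bar>x\<bar> powr (- 0)) \<partial>lborel)"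
      by (intro nn_integral_mono) (auto simp: indicator_def max.commute)
    also have "\<dots> \<le> ennreal (C * u powr (1 - b - 0))"
      unfolding C_def using b u by (intro power_kernel_integral) auto
    also have "C * u powr (1 - b - 0) = C * \<tau> * (u powr (1 - b) * max \<tau> \<bar>u\<bar> powr (- 1))"
      using False \<tau> u by (simp add: max_absorb1 powr_minus_divide)
    also have "\<dots> \<le> (2 + C) * \<tau> * (u powr (1 - b) * max \<tau> \<bar>u\<bar> powr (- 1))"
      using C \<tau> by (intro mult_right_mono) auto
    finally show ?thesis by (simp add: ennreal_leI)
  qed
  then have "ennreal \<epsilon> * (\<integral>\<^sup>+x. ennreal (max x u powr (- b)) * indicator {0<..2 * \<tau>} x \<partial>lborel) + ennreal (2 * \<tau> * B)
    \<le> ennreal \<epsilon> * ennreal ((2 + C) * \<tau> * (u powr (1 - b) * max \<tau> \<bar>u\<bar> powr (- 1))) + ennreal (2 * \<tau> * B)"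
    by (intro add_right_mono mult_left_mono) auto
  also have "\<dots> = ennreal (\<epsilon> * ((2 + C) * \<tau> * (u powr (1 - b) * max \<tau> \<bar>u\<bar> powr (- 1))) + 2 * \<tau> * B)"
  proof -
    have "ennreal \<epsilon> * ennreal Z + ennreal W = ennreal (\<epsilon> * Z + W)" if "0 \<le> Z" "0 \<le> W" for Z W
      using eB that by (simp flip: ennreal_mult ennreal_plus)
    then show ?thesis using eB C \<tau> by simp
  qed
  finally show ?thesis unfolding split C_def by (simp add: mult.assoc)
qed

section \<open>Kernel means integrated away from the boundary and towards it\<close>

lemma kernel_mean_tail:
  assumes [measurable]: "v \<in> borel_measurable borel" and v: "\<And>u. 0 \<le> v u"
    and \<tau>: "0 < \<tau>" and eB: "0 \<le> \<epsilon>" "0 \<le> B"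
  shows "(\<integral>\<^sup>+x. kernel_mean 2 \<epsilon> B v x * indicator {\<tau>..1} x \<partial>lborel) \<le> (\<integral>\<^sup>+u. ennreal ((4 * \<epsilon> * max \<tau> \<bar>u\<bar> powr (- 1) + B) * v u) \<partial>lborel)"
proof -
  have "(\<integral>\<^sup>+x. kernel_mean 2 \<epsilon> B v x * indicator {\<tau>..1} x \<partial>lborel)
      = (\<integral>\<^sup>+x. (\<integral>\<^sup>+u. ennreal ((\<epsilon> * max x \<bar>u\<bar> powr (- 2) + B) * v u) * indicator {\<tau>..1} x \<partial>lborel) \<partial>lborel)"
    unfolding kernel_mean_def by (intro nn_integral_cong nn_integral_multc[symmetric]) measurable
  also have "\<dots> = (\<integral>\<^sup>+u. (\<integral>\<^sup>+x. ennreal ((\<epsilon> * max x \<bar>u\<bar> powr (- 2) + B) * v u) * indicator {\<tau>..1} x \<partial>lborel) \<partial>lborel)"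
    by (rule lborel_pair.Fubini'[symmetric]) measurable
  also have "\<dots> = (\<integral>\<^sup>+u. (\<integral>\<^sup>+x. ennreal (\<epsilon> * max x \<bar>u\<bar> powr (- 2) + B) * indicator {\<tau>..1} x \<partial>lborel) * ennreal (v u) \<partial>lborel)"
  proof (intro nn_integral_cong)
    fix u
    show "(\<integral>\<^sup>+x. ennreal ((\<epsilon> * max x \<bar>u\<bar> powr (- 2) + B) * v u) * indicator {\<tau>..1} x \<partial>lborel)
       = (\<integral>\<^sup>+x. ennreal (\<epsilon> * max x \<bar>u\<bar> powr (- 2) + B) * indicator {\<tau>..1} x \<partial>lborel) * ennreal (v u)"
      using eB v[of u] by (subst nn_integral_multc[symmetric]) (auto intro!: nn_integral_cong simp: ennreal_mult mult_ac simp del: ennreal_plus)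
  qed
  also have "\<dots> \<le> (\<integral>\<^sup>+u. ennreal (4 * \<epsilon> * max \<tau> \<bar>u\<bar> powr (- 1) + B) * ennreal (v u) \<partial>lborel)"
    by (intro nn_integral_mono mult_right_mono kernel_tail_integral \<tau> eB) auto
  also have "\<dots> = (\<integral>\<^sup>+u. ennreal ((4 * \<epsilon> * max \<tau> \<bar>u\<bar> powr (- 1) + B) * v u) \<partial>lborel)"
    using eB v by (intro nn_integral_cong) (auto simp: ennreal_mult simp del: ennreal_plus)
  finally show ?thesis .
qed

lemma kernel_mean_head:
  assumes [measurable]: "v \<in> borel_measurable borel" and v: "\<And>u. 0 \<le> v u" "\<And>u. u \<le> 0 \<Longrightarrow> v u = 0"
    and \<tau>: "0 < \<tau>" and b: "1 < b" and eB: "0 \<le> \<epsilon>" "0 \<le> B"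
  shows "(\<integral>\<^sup>+x. kernel_mean b \<epsilon> B v x * indicator {0<..2 * \<tau>} x \<partial>lborel)
    \<le> (\<integral>\<^sup>+u. ennreal ((\<epsilon> * (2 + power_kernel_const b 0) * \<tau> * (\<bar>u\<bar> powr (1 - b) * max \<tau> \<bar>u\<bar> powr (- 1)) + 2 * \<tau> * B) * v u) \<partial>lborel)"
proof -
  have "(\<integral>\<^sup>+x. kernel_mean b \<epsilon> B v x * indicator {0<..2 * \<tau>} x \<partial>lborel)
      = (\<integral>\<^sup>+x. (\<integral>\<^sup>+u. ennreal ((\<epsilon> * max x \<bar>u\<bar> powr (- b) + B) * v u) * indicator {0<..2 * \<tau>} x \<partial>lborel) \<partial>lborel)"
    unfolding kernel_mean_def by (intro nn_integral_cong nn_integral_multc[symmetric]) measurable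
  also have "\<dots> = (\<integral>\<^sup>+u. (\<integral>\<^sup>+x. ennreal ((\<epsilon> * max x \<bar>u\<bar> powr (- b) + B) * v u) * indicator {0<..2 * \<tau>} x \<partial>lborel) \<partial>lborel)"
    by (rule lborel_pair.Fubini'[symmetric]) measurable
  also have "\<dots> \<le> (\<integral>\<^sup>+u. ennreal ((\<epsilon> * (2 + power_kernel_const b 0) * \<tau> * (\<bar>u\<bar> powr (1 - b) * max \<tau> \<bar>u\<bar> powr (- 1)) + 2 * \<tau> * B) * v u) \<partial>lborel)"
  proof (intro nn_integral_mono)
    fix u
    show "(\<integral>\<^sup>+x. ennreal ((\<epsilon> * max x \<bar>u\<bar> powr (- b) + B) * v u) * indicator {0<..2 * \<tau>} x \<partial>lborel)
       \<le> ennreal ((\<epsilon> * (2 + power_kernel_const b 0) * \<tau> * (\<bar>u\<bar> powr (1 - b) * max \<tau> \<bar>u\<bar> powr (- 1)) + 2 * \<tau> * B) * v u)"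
    proof (cases "u \<le> 0")
      case False
      then have u: "0 < u" by simp
      have C: "0 < power_kernel_const b 0" using b by (simp add: power_kernel_const_pos)
      have "(\<integral>\<^sup>+x. ennreal ((\<epsilon> * max x \<bar>u\<bar> powr (- b) + B) * v u) * indicator {0<..2 * \<tau>} x \<partial>lborel)
         = (\<integral>\<^sup>+x. ennreal (\<epsilon> * max x \<bar>u\<bar> powr (- b) + B) * indicator {0<..2 * \<tau>} x \<partial>lborel) * ennreal (v u)"
        using eB v(1)[of u] by (subst nn_integral_multc[symmetric]) (auto intro!: nn_integral_cong simp: ennreal_mult mult_ac simp del: ennreal_plus)
      also have "\<dots> \<le> ennreal (\<epsilon> * (2 + power_kernel_const b 0) * \<tau> * (u powr (1 - b) * max \<tau> \<bar>u\<bar> powr (- 1)) + 2 * \<tau> * B) * ennreal (v u)"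
        by (intro mult_right_mono kernel_head_integral \<tau> u b eB) auto
      also have "\<dots> = ennreal ((\<epsilon> * (2 + power_kernel_const b 0) * \<tau> * (u powr (1 - b) * max \<tau> \<bar>u\<bar> powr (- 1)) + 2 * \<tau> * B) * v u)"
        using eB v(1)[of u] C \<tau> by (intro ennreal_mult[symmetric]) auto
      finally show ?thesis using u by simp
    qed (simp add: v(2))
  qed
  finally show ?thesis .
qed

text \<open>The factor \<open>2 powr p * 2\<close> is from the crossing inequality, the second
  \<open>2 powr p\<close> from \<open>Schur_plus_const\<close>; the bracket adds the Schur bounds of
  the two parts and their constant terms. The outer 2 and the root come from
  \<open>powr_sum_const_le\<close>.\<close>

definition embed_const :: "real \<Rightarrow> real \<Rightarrow> real" where
  "embed_const p q = (2 * (2 powr p * 2 * 2 powr p * (Schur_const p 0 * 4 powr p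
      + Schur_const p (1 - 1 / q) * (2 + power_kernel_const (2 - 1 / q) 0) powr p + 1 + 2 powr p))) powr (1 / p)"

lemma powr_sum_const_le:
  fixes D x y p :: real
  assumes "0 \<le> D" "0 \<le> x" "0 \<le> y" "1 \<le> p"
  shows "D * (x powr p + y powr p) \<le> ((2 * D) powr (1 / p) * (x + y)) powr p"
proof -
  have "x powr p \<le> (x + y) powr p" "y powr p \<le> (x + y) powr p" using assms by (auto intro!: powr_mono2)
  then have "D * (x powr p + y powr p) \<le> D * (2 * (x + y) powr p)" using assms by (intro mult_left_mono) auto
  also have "\<dots> = ((2 * D) powr (1 / p) * (x + y)) powr p" using assms by (simp add: powr_mult powr_powr)
  finally show ?thesis .
qed

text \<open>On each radius the crossing inequality bounds the p-th power of the total variation of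
  \<open>F\<close> by an integral over \<open>\<tau>\<close> of a product: variation away from the
  boundary to the power \<open>p - q\<close>, times variation near it to the power \<open>q\<close>.
  The first factor is bounded uniformly in the angle by the pointwise estimate, so after integration
  in the angle the second enters only through its q-mean, which Minkowski's inequality controls.
  Both resulting functions of \<open>\<tau>\<close> have finite p-norm by the Schur test.\<close>

lemma mixed_norm_embedding:
  fixes F :: "complex \<Rightarrow> complex" and v :: "real \<Rightarrow> real"
  assumes F: "F holomorphic_on ball 0 1" and q: "1 < q" "q < p"
    and [measurable]: "v \<in> borel_measurable borel" and v: "\<And>u. 0 \<le> v u" "\<And>u. u \<le> 0 \<Longrightarrow> v u = 0"
    and X: "0 \<le> X" "(\<integral>\<^sup>+u. ennreal (v u powr p) \<partial>lborel) \<le> ennreal (X powr p)"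
    and Y: "0 \<le> Y" "(\<integral>\<^sup>+u. ennreal (v u) \<partial>lborel) \<le> ennreal Y"
    and eB: "0 \<le> \<epsilon>" "0 \<le> B"
    and mq: "\<And>\<tau>. 0 < \<tau> \<Longrightarrow> \<tau> \<le> 1 \<Longrightarrow>
       Lp_le q (\<lambda>\<theta>. deriv F (polar (1 - \<tau>) \<theta>)) (enn2real (kernel_mean (2 - 1 / q) \<epsilon> B v \<tau>))"
    and ms: "\<And>\<tau> \<theta>. 0 < \<tau> \<Longrightarrow> \<tau> \<le> 1 \<Longrightarrow>
       ennreal (norm (deriv F (polar (1 - \<tau>) \<theta>))) \<le> kernel_mean 2 \<epsilon> B v \<tau>"
    and r: "0 < r" "r < 1"
  shows "Lp_le p (\<lambda>\<theta>. F (polar r \<theta>) - F 0) (embed_const p q * (\<epsilon> * X + B * Y))"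
proof -
  have p: "1 < p" using q by simp
  define b where "b = 2 - 1 / q"
  have b: "1 < b" "0 \<le> b" "1 - b = - (1 - 1 / q)" using q by (auto simp: b_def field_simps)
  define \<delta> where "\<delta> = 1 - r"
  have \<delta>: "0 < \<delta>" "\<delta> < 1" using r by (auto simp: \<delta>_def)
  have F': "deriv F holomorphic_on ball 0 1" using F by (intro holomorphic_intros) auto
  have Yfin: "(\<integral>\<^sup>+u. ennreal (v u) \<partial>lborel) < \<infinity>" using Y(2) by (auto simp: less_top[symmetric] top_unique)
  \<comment> \<open>Clipping \<open>\<tau>\<close> to the interval from \<open>\<delta>\<close> to 1
    keeps the argument in the disc, so that \<open>D\<close> is continuous for all real arguments
    and jointly measurable.\<close>
  define D where "D \<theta> \<tau> = deriv F (of_real (1 - max \<delta> (min 1 \<tau>)) * cis \<theta>)" for \<theta> \<tau>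
  have clip: "norm (complex_of_real (1 - max \<delta> (min 1 \<tau>)) * cis \<theta>) \<le> r" for \<tau> \<theta>
    unfolding norm_mult norm_of_real norm_cis using \<delta> by (auto simp: \<delta>_def)
  have contD: "continuous_on UNIV (\<lambda>x::real \<times> real. D (snd x) (fst x))"
    unfolding D_def using le_less_trans[OF clip r(2)]
    by (intro continuous_on_compose2[OF holomorphic_on_imp_continuous_on[OF F']] continuous_intros) auto
  then have mD: "(\<lambda>x::real \<times> real. D (snd x) (fst x)) \<in> borel_measurable (borel \<Otimes>\<^sub>M borel)"
    unfolding borel_prod by (rule borel_measurable_continuous_onI)
  define w where "w \<theta> \<tau> = indicator {\<delta>..1} \<tau> * norm (D \<theta> \<tau>)" for \<theta> \<tau>
  have w_eq: "w \<theta> \<tau> = norm (deriv F (polar (1 - \<tau>) \<theta>))" if "\<tau> \<in> {\<delta>..1}" for \<theta> \<tau>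
    using that by (simp add: w_def D_def max_absorb2 min_absorb2)
  have w0: "w \<theta> \<tau> = 0" if "\<tau> \<notin> {\<delta>..1}" for \<theta> \<tau> using that by (simp add: w_def)
  have wnn: "0 \<le> w \<theta> \<tau>" for \<theta> \<tau> by (simp add: w_def)
  have mw [measurable]: "(\<lambda>(\<tau>, \<theta>). w \<theta> \<tau>) \<in> borel_measurable (borel \<Otimes>\<^sub>M borel)"
    unfolding w_def case_prod_beta' using mD by measurable
  have mw1 [measurable]: "w \<theta> \<in> borel_measurable borel" for \<theta>
    using measurable_compose[OF measurable_Pair2'[of \<theta> borel borel] mw] by simp
  obtain C where C: "0 \<le> C" "\<And>z. norm z \<le> r \<Longrightarrow> norm (deriv F z) \<le> C"
    using holomorphic_bounded_cball[OF F' r(2)] by blast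
  define S where "S \<theta> = enn2real (\<integral>\<^sup>+\<tau>. ennreal (w \<theta> \<tau>) \<partial>lborel)" for \<theta>
  have S: "(\<integral>\<^sup>+\<tau>. ennreal (w \<theta> \<tau>) \<partial>lborel) = ennreal (S \<theta>)" for \<theta>
  proof -
    have "(\<integral>\<^sup>+\<tau>. ennreal (w \<theta> \<tau>) \<partial>lborel) \<le> (\<integral>\<^sup>+\<tau>. ennreal C * indicator {\<delta>..1} \<tau> \<partial>lborel)"
    proof -
      have "norm (D \<theta> \<tau>) \<le> C" for \<tau> unfolding D_def by (rule C(2)[OF clip])
      then show ?thesis unfolding w_def by (intro nn_integral_mono) (auto simp: indicator_def intro!: ennreal_leI)
    qed
    also have "\<dots> < \<infinity>" using \<delta> by (simp add: nn_integral_cmult_indicator ennreal_mult_less_top)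
    finally show ?thesis unfolding S_def by (simp add: ennreal_enn2real)
  qed
  have Fle: "norm (F (polar r \<theta>) - F 0) \<le> S \<theta>" for \<theta>
  proof -
    have "ennreal (norm (F (polar r \<theta>) - F (polar 0 \<theta>))) \<le> (\<integral>\<^sup>+x. norm (cis \<theta> * deriv F (polar x \<theta>)) \<partial>restrict_space lborel {0..r})"
    proof (rule norm_FTC_le[where f="\<lambda>x. F (polar x \<theta>)"])
      show "continuous_on {0..r} (\<lambda>x. cis \<theta> * deriv F (polar x \<theta>))"
        using r by (intro continuous_intros continuous_on_compose2[OF holomorphic_on_imp_continuous_on[OF F']])
          (auto simp: norm_mult)
      show "((\<lambda>x. F (polar x \<theta>)) has_vector_derivative cis \<theta> * deriv F (polar x \<theta>)) (at x within {0..r})"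
        if "x \<in> {0..r}" for x using that r by (intro radial_vector_derivative[OF F]) auto
    qed (use r in simp)
    also have "\<dots> = (\<integral>\<^sup>+x. ennreal (w \<theta> (1 - x)) \<partial>lborel)"
    proof -
      have "(\<integral>\<^sup>+x. norm (cis \<theta> * deriv F (polar x \<theta>)) \<partial>restrict_space lborel {0..r})
         = (\<integral>\<^sup>+x. ennreal (norm (cis \<theta> * deriv F (polar x \<theta>))) * indicator {0..r} x \<partial>lborel)"
        by (rule nn_integral_restrict_space) auto
      also have "\<dots> = (\<integral>\<^sup>+x. ennreal (w \<theta> (1 - x)) \<partial>lborel)"
      proof (intro nn_integral_cong)
        fix x :: real
        show "ennreal (norm (cis \<theta> * deriv F (polar x \<theta>))) * indicator {0..r} x = ennreal (w \<theta> (1 - x))"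
        proof (cases "x \<in> {0..r}")
          case True
          then have "1 - x \<in> {\<delta>..1}" by (auto simp: \<delta>_def)
          then show ?thesis using True w_eq[of "1 - x" \<theta>] by (simp add: norm_mult)
        next
          case False
          then have "1 - x \<notin> {\<delta>..1}" by (auto simp: \<delta>_def)
          then show ?thesis using False by (simp add: w0)
        qed
      qed
      finally show ?thesis .
    qed
    also have "\<dots> = (\<integral>\<^sup>+\<tau>. ennreal (w \<theta> \<tau>) \<partial>lborel)"
      using nn_integral_real_affine[of "\<lambda>\<tau>. ennreal (w \<theta> \<tau>)" "-1" 1] by simp
    finally show ?thesis unfolding S using wnn by (simp add: S_def)
  qed
  define Hi where "Hi \<theta> \<tau> = enn2real (\<integral>\<^sup>+x. ennreal (w \<theta> x) * indicator {\<tau>..} x \<partial>lborel)" for \<theta> \<tau>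
  define Lo where "Lo \<theta> \<tau> = enn2real (\<integral>\<^sup>+x. ennreal (w \<theta> x) * indicator {..\<tau>} x \<partial>lborel)" for \<theta> \<tau>
  have cross: "ennreal (S \<theta> powr p) \<le> ennreal (2 powr p * 2) *
     (\<integral>\<^sup>+\<tau>. ennreal (Hi \<theta> \<tau> powr (p - q) * (Lo \<theta> (2 * \<tau>) powr q / \<tau>)) * indicator {0<..1} \<tau> \<partial>lborel)" for \<theta>
    unfolding Hi_def Lo_def by (rule crossing[OF _ _ _ \<delta>(1)]) (use q wnn w0 S in \<open>auto simp: S_def\<close>)
  \<comment> \<open>The pointwise bound integrated from \<open>\<tau>\<close> to 1. It does not
    depend on the angle and therefore may leave the angular integral.\<close>
  define A where "A \<tau> = enn2real (kernel_mean 1 (4 * \<epsilon>) B v \<tau>)" for \<tau>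
  have A: "ennreal (A \<tau>) = kernel_mean 1 (4 * \<epsilon>) B v \<tau>" if "0 < \<tau>" for \<tau>
    unfolding A_def using kernel_mean_finite[OF _ v(1) Yfin, of "4 * \<epsilon>" B \<tau> 1] eB that
    by (simp add: ennreal_enn2real)
  have Ann: "0 \<le> A \<tau>" for \<tau> by (simp add: A_def)
  have mA [measurable]: "A \<in> borel_measurable borel" unfolding A_def[abs_def] by measurable
  have HiA: "Hi \<theta> \<tau> \<le> A \<tau>" if \<tau>: "0 < \<tau>" for \<theta> \<tau>
  proof -
    have "(\<integral>\<^sup>+x. ennreal (w \<theta> x) * indicator {\<tau>..} x \<partial>lborel) \<le> (\<integral>\<^sup>+x. kernel_mean 2 \<epsilon> B v x * indicator {\<tau>..1} x \<partial>lborel)"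
    proof (intro nn_integral_mono)
      fix x :: real
      show "ennreal (w \<theta> x) * indicator {\<tau>..} x \<le> kernel_mean 2 \<epsilon> B v x * indicator {\<tau>..1} x"
        using w_eq[of x \<theta>] w0[of x \<theta>] ms[of x \<theta>] \<delta> by (cases "x \<in> {\<delta>..1}") (auto simp: indicator_def)
    qed
    also have "\<dots> \<le> kernel_mean 1 (4 * \<epsilon>) B v \<tau>"
      unfolding kernel_mean_def[of 1] by (rule kernel_mean_tail[OF _ v(1) \<tau> eB]) simp
    finally have "(\<integral>\<^sup>+x. ennreal (w \<theta> x) * indicator {\<tau>..} x \<partial>lborel) \<le> ennreal (A \<tau>)" by (simp add: A[OF \<tau>])
    then show ?thesis unfolding Hi_def using Ann by (intro enn2real_leI) auto
  qed
  \<comment> \<open>The Minkowski bound for the q-mean of the variation within distance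
    \<open>2 * \<tau>\<close> of the circle; the cut at \<open>\<delta>\<close> keeps it
    finite.\<close>
  define \<beta> where "\<beta> \<tau> = (\<integral>\<^sup>+x. kernel_mean b \<epsilon> B v x * indicator {\<delta>..1} x * indicator {..2 * \<tau>} x \<partial>lborel)" for \<tau>
  have kfin: "kernel_mean b \<epsilon> B v x < \<infinity>" if "0 < x" for x
    using kernel_mean_finite[OF _ v(1) Yfin eB that b(2)] by simp
  have \<beta>fin: "\<beta> \<tau> < \<infinity>" for \<tau>
  proof -
    have "\<beta> \<tau> \<le> (\<integral>\<^sup>+x. kernel_mean b \<epsilon> B v \<delta> * indicator {\<delta>..1} x \<partial>lborel)"
      unfolding \<beta>_def
    proof (intro nn_integral_mono)
      fix x :: real
      have "kernel_mean b \<epsilon> B v x \<le> kernel_mean b \<epsilon> B v \<delta>" if "\<delta> \<le> x"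
        unfolding kernel_mean_def using that \<delta> eB b v(1)
        by (intro nn_integral_mono ennreal_leI mult_right_mono add_right_mono mult_left_mono powr_mono2') auto
      then show "kernel_mean b \<epsilon> B v x * indicator {\<delta>..1} x * indicator {..2 * \<tau>} x \<le> kernel_mean b \<epsilon> B v \<delta> * indicator {\<delta>..1} x"
        by (auto simp: indicator_def)
    qed
    also have "\<dots> = kernel_mean b \<epsilon> B v \<delta> * ennreal (1 - \<delta>)" using \<delta> by (simp add: nn_integral_cmult_indicator)
    also have "\<dots> < \<infinity>" using kfin[OF \<delta>(1)] by (simp add: ennreal_mult_less_top)
    finally show ?thesis .
  qed
  have m\<beta> [measurable]: "\<beta> \<in> borel_measurable borel"
  proof -
    have "(\<lambda>\<tau>. \<integral>\<^sup>+x. kernel_mean b \<epsilon> B v x * indicator {\<delta>..1} x * (if x \<le> 2 * \<tau> then 1 else 0) \<partial>lborel) \<in> borel_measurable borel"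
      by measurable
    then show ?thesis by (simp add: \<beta>_def[abs_def] indicator_def cong: if_cong)
  qed
  have LoL: "Lp_le q (\<lambda>\<theta>. of_real (Lo \<theta> (2 * \<tau>))) (enn2real (\<beta> \<tau>))" for \<tau>
  proof (rule Minkowski_integral[OF _ finite_measure_restrict_interval[of \<delta> 1],
      where A="\<lambda>x \<theta>. of_real (indicator {..2 * \<tau>} x) * D \<theta> x" and W="\<lambda>x. indicator {..2 * \<tau>} x * enn2real (kernel_mean b \<epsilon> B v x)"])
    have "(\<lambda>x. D (snd x) (fst x)) \<in> borel_measurable (restrict_space lborel {\<delta>..1} \<Otimes>\<^sub>M borel)"
      by (rule continuous_pair_measurable[OF contD])
    moreover have "(\<lambda>x. complex_of_real (indicator {..2 * \<tau>} (fst x))) \<in> borel_measurable (restrict_space lborel {\<delta>..1} \<Otimes>\<^sub>M borel)"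
      by (rule measurable_compose[OF measurable_fst measurable_restrict_space1]) measurable
    ultimately show "(\<lambda>(x, \<theta>). of_real (indicator {..2 * \<tau>} x) * D \<theta> x) \<in> borel_measurable (restrict_space lborel {\<delta>..1} \<Otimes>\<^sub>M borel)"
      unfolding case_prod_beta' by (rule borel_measurable_times[rotated])
    show "(\<lambda>x. indicator {..2 * \<tau>} x * enn2real (kernel_mean b \<epsilon> B v x)) \<in> borel_measurable (restrict_space lborel {\<delta>..1})"
      by (rule measurable_restrict_space1) measurable
    show "Lp_le q (\<lambda>\<theta>. of_real (indicator {..2 * \<tau>} x) * D \<theta> x) (indicator {..2 * \<tau>} x * enn2real (kernel_mean b \<epsilon> B v x))"
      if "x \<in> space (restrict_space lborel {\<delta>..1})" for x
    proof -
      have x: "\<delta> \<le> x" "x \<le> 1" "0 < x" using that \<delta> by (auto simp: space_restrict_space)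
      then have "(\<lambda>\<theta>. D \<theta> x) = (\<lambda>\<theta>. deriv F (polar (1 - x) \<theta>))" by (simp add: D_def max_absorb2 min_absorb2)
      then have "Lp_le q (\<lambda>\<theta>. D \<theta> x) (enn2real (kernel_mean b \<epsilon> B v x))" using mq[of x] x by (simp add: b_def)
      then show ?thesis using Lp_le_sup[of "\<lambda>_. 0" 0 q] q by (auto simp: indicator_def)
    qed
    show "(\<integral>\<^sup>+x. ennreal (indicator {..2 * \<tau>} x * enn2real (kernel_mean b \<epsilon> B v x)) \<partial>restrict_space lborel {\<delta>..1}) \<le> ennreal (enn2real (\<beta> \<tau>))"
    proof -
      have "(\<integral>\<^sup>+x. ennreal (indicator {..2 * \<tau>} x * enn2real (kernel_mean b \<epsilon> B v x)) \<partial>restrict_space lborel {\<delta>..1})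
         = (\<integral>\<^sup>+x. ennreal (indicator {..2 * \<tau>} x * enn2real (kernel_mean b \<epsilon> B v x)) * indicator {\<delta>..1} x \<partial>lborel)"
        by (rule nn_integral_restrict_space) auto
      also have "\<dots> = \<beta> \<tau>" unfolding \<beta>_def
        using kfin \<delta> by (intro nn_integral_cong) (auto simp: indicator_def ennreal_enn2real)
      finally show ?thesis using \<beta>fin[of \<tau>] by (simp add: ennreal_enn2real)
    qed
    show "ennreal (norm (complex_of_real (Lo \<theta> (2 * \<tau>)))) \<le> (\<integral>\<^sup>+x. ennreal (norm (of_real (indicator {..2 * \<tau>} x) * D \<theta> x)) \<partial>restrict_space lborel {\<delta>..1})" for \<theta>
    proof -
      have "ennreal (Lo \<theta> (2 * \<tau>)) \<le> (\<integral>\<^sup>+x. ennreal (w \<theta> x) * indicator {..2 * \<tau>} x \<partial>lborel)"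
        unfolding Lo_def by (cases "(\<integral>\<^sup>+x. ennreal (w \<theta> x) * indicator {..2 * \<tau>} x \<partial>lborel)") auto
      also have "\<dots> = (\<integral>\<^sup>+x. ennreal (norm (of_real (indicator {..2 * \<tau>} x) * D \<theta> x)) * indicator {\<delta>..1} x \<partial>lborel)"
        by (intro nn_integral_cong) (auto simp: w_def indicator_def)
      also have "\<dots> = (\<integral>\<^sup>+x. ennreal (norm (of_real (indicator {..2 * \<tau>} x) * D \<theta> x)) \<partial>restrict_space lborel {\<delta>..1})"
        by (rule nn_integral_restrict_space[symmetric]) auto
      finally show ?thesis by (simp add: Lo_def)
    qed
  qed (use q in auto)
  \<comment> \<open>The factor absorbs the measure \<open>d\<tau> / \<tau>\<close>: the q-th power
    of \<open>\<Phi>\<close> is that of \<open>\<beta>\<close> divided by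
    \<open>\<tau>\<close>.\<close>
  define \<Phi> where "\<Phi> \<tau> = \<tau> powr (- 1 / q) * enn2real (\<beta> \<tau>)" for \<tau>
  have m\<Phi> [measurable]: "\<Phi> \<in> borel_measurable borel" unfolding \<Phi>_def[abs_def] by measurable
  have mLo [measurable]: "(\<lambda>(\<theta>, \<tau>). Lo \<theta> (2 * \<tau>)) \<in> borel_measurable (borel \<Otimes>\<^sub>M borel)"
  proof -
    have [measurable]: "(\<lambda>((\<theta>, \<tau>), x). w \<theta> x) \<in> borel_measurable ((borel \<Otimes>\<^sub>M borel) \<Otimes>\<^sub>M borel)"
    proof -
      have "(\<lambda>y. (snd y, fst (fst y))) \<in> (borel \<Otimes>\<^sub>M borel) \<Otimes>\<^sub>M borel \<rightarrow>\<^sub>M borel \<Otimes>\<^sub>M borel" by measurable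
      from measurable_compose[OF this mw] show ?thesis by (simp add: case_prod_beta')
    qed
    have "(\<lambda>(\<theta>, \<tau>). enn2real (\<integral>\<^sup>+x. ennreal (w \<theta> x) * (if x \<le> 2 * \<tau> then 1 else 0) \<partial>lborel)) \<in> borel_measurable (borel \<Otimes>\<^sub>M borel)"
      by measurable
    then show ?thesis by (simp add: Lo_def indicator_def cong: if_cong)
  qed
  have "(\<integral>\<^sup>+\<theta>. ennreal (S \<theta> powr p) \<partial>circle) \<le> (\<integral>\<^sup>+\<theta>. ennreal (2 powr p * 2) *
     (\<integral>\<^sup>+\<tau>. ennreal (A \<tau> powr (p - q) / \<tau>) * indicator {0<..1} \<tau> * ennreal (Lo \<theta> (2 * \<tau>) powr q) \<partial>lborel) \<partial>circle)"
  proof (intro nn_integral_mono order_trans[OF cross] mult_left_mono)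
    fix \<theta> \<tau> :: real
    show "ennreal (Hi \<theta> \<tau> powr (p - q) * (Lo \<theta> (2 * \<tau>) powr q / \<tau>)) * indicator {0<..1} \<tau>
       \<le> ennreal (A \<tau> powr (p - q) / \<tau>) * indicator {0<..1} \<tau> * ennreal (Lo \<theta> (2 * \<tau>) powr q)"
    proof (cases "\<tau> \<in> {0<..1}")
      case True
      then have "Hi \<theta> \<tau> powr (p - q) \<le> A \<tau> powr (p - q)"
        using HiA q by (intro powr_mono2) (auto simp: Hi_def)
      then have "Hi \<theta> \<tau> powr (p - q) * (Lo \<theta> (2 * \<tau>) powr q / \<tau>) \<le> A \<tau> powr (p - q) * (Lo \<theta> (2 * \<tau>) powr q / \<tau>)"
        using True by (intro mult_right_mono) auto
      then show ?thesis using True by (simp add: ennreal_leI flip: ennreal_mult)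
    qed simp
  qed simp
  also have "\<dots> = ennreal (2 powr p * 2) * (\<integral>\<^sup>+\<theta>.
     (\<integral>\<^sup>+\<tau>. ennreal (A \<tau> powr (p - q) / \<tau>) * indicator {0<..1} \<tau> * ennreal (Lo \<theta> (2 * \<tau>) powr q) \<partial>lborel) \<partial>circle)"
    by (rule nn_integral_cmult) measurable
  also have "(\<integral>\<^sup>+\<theta>. (\<integral>\<^sup>+\<tau>. ennreal (A \<tau> powr (p - q) / \<tau>) * indicator {0<..1} \<tau> * ennreal (Lo \<theta> (2 * \<tau>) powr q) \<partial>lborel) \<partial>circle)
     = (\<integral>\<^sup>+\<tau>. (\<integral>\<^sup>+\<theta>. ennreal (A \<tau> powr (p - q) / \<tau>) * indicator {0<..1} \<tau> * ennreal (Lo \<theta> (2 * \<tau>) powr q) \<partial>circle) \<partial>lborel)"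
  proof -
    interpret pair_sigma_finite circle lborel ..
    show ?thesis by (rule Fubini'[symmetric]) measurable
  qed
  also have "\<dots> \<le> (\<integral>\<^sup>+\<tau>. ennreal (A \<tau> powr p) * indicator {0<..1} \<tau> + ennreal (\<Phi> \<tau> powr p) * indicator {0<..1} \<tau> \<partial>lborel)"
  proof (intro nn_integral_mono)
    fix \<tau> :: real
    have [measurable]: "(\<lambda>\<theta>. Lo \<theta> (2 * \<tau>)) \<in> borel_measurable borel"
      using measurable_compose[OF measurable_Pair2'[of \<tau> borel borel] mLo] by simp
    have "(\<integral>\<^sup>+\<theta>. ennreal (A \<tau> powr (p - q) / \<tau>) * indicator {0<..1} \<tau> * ennreal (Lo \<theta> (2 * \<tau>) powr q) \<partial>circle)
       = ennreal (A \<tau> powr (p - q) / \<tau>) * indicator {0<..1} \<tau> * (\<integral>\<^sup>+\<theta>. ennreal (Lo \<theta> (2 * \<tau>) powr q) \<partial>circle)"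
      by (rule nn_integral_cmult) measurable
    also have "\<dots> \<le> ennreal (A \<tau> powr (p - q) / \<tau>) * indicator {0<..1} \<tau> * ennreal (enn2real (\<beta> \<tau>) powr q)"
      using LoL[of \<tau>] by (intro mult_left_mono) (auto simp: Lp_le_def Lo_def)
    also have "\<dots> \<le> ennreal (A \<tau> powr p) * indicator {0<..1} \<tau> + ennreal (\<Phi> \<tau> powr p) * indicator {0<..1} \<tau>"
    proof (cases "\<tau> \<in> {0<..1}")
      case True
      then have \<tau>: "0 < \<tau>" by simp
      have "\<Phi> \<tau> powr q = (\<tau> powr (- 1 / q)) powr q * enn2real (\<beta> \<tau>) powr q" unfolding \<Phi>_def by (rule powr_mult)
      also have "(\<tau> powr (- 1 / q)) powr q = 1 / \<tau>" unfolding powr_powr using \<tau> q by (simp add: powr_minus_divide)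
      finally have "A \<tau> powr (p - q) / \<tau> * enn2real (\<beta> \<tau>) powr q = A \<tau> powr (p - q) * \<Phi> \<tau> powr q" by simp
      \<comment> \<open>The exponents \<open>p - q\<close> and \<open>q\<close> add up to
        \<open>p\<close>, so replacing both bases by the larger one separates the product into two
        p-th powers.\<close>
      also have "\<dots> \<le> max (A \<tau>) (\<Phi> \<tau>) powr (p - q) * max (A \<tau>) (\<Phi> \<tau>) powr q"
        using Ann[of \<tau>] q by (intro mult_mono powr_mono2) (auto simp: \<Phi>_def)
      also have "\<dots> = max (A \<tau>) (\<Phi> \<tau>) powr p" by (simp flip: powr_add)
      also have "\<dots> \<le> A \<tau> powr p + \<Phi> \<tau> powr p" by (auto simp: max_def)
      finally have "ennreal (A \<tau> powr (p - q) / \<tau> * enn2real (\<beta> \<tau>) powr q) \<le> ennreal (A \<tau> powr p) + ennreal (\<Phi> \<tau> powr p)"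
        by (simp add: ennreal_leI flip: ennreal_plus)
      then show ?thesis using True by (simp flip: ennreal_mult)
    qed simp
    finally show "(\<integral>\<^sup>+\<theta>. ennreal (A \<tau> powr (p - q) / \<tau>) * indicator {0<..1} \<tau> * ennreal (Lo \<theta> (2 * \<tau>) powr q) \<partial>circle)
      \<le> ennreal (A \<tau> powr p) * indicator {0<..1} \<tau> + ennreal (\<Phi> \<tau> powr p) * indicator {0<..1} \<tau>" .
  qed
  also have "\<dots> = (\<integral>\<^sup>+\<tau>. ennreal (A \<tau> powr p) * indicator {0<..1} \<tau> \<partial>lborel) + (\<integral>\<^sup>+\<tau>. ennreal (\<Phi> \<tau> powr p) * indicator {0<..1} \<tau> \<partial>lborel)"
    by (rule nn_integral_add) measurable
  also have "\<dots> \<le> ennreal (2 powr p * (Schur_const p 0 * (4 * \<epsilon>) powr p * X powr p + (B * Y) powr p))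
     + ennreal (2 powr p * (Schur_const p (1 - 1 / q) * (\<epsilon> * (2 + power_kernel_const b 0)) powr p * X powr p + (2 * B * Y) powr p))"
  proof (intro add_mono)
    show "(\<integral>\<^sup>+\<tau>. ennreal (A \<tau> powr p) * indicator {0<..1} \<tau> \<partial>lborel) \<le> ennreal (2 powr p * (Schur_const p 0 * (4 * \<epsilon>) powr p * X powr p + (B * Y) powr p))"
    proof (rule Schur_plus_const[OF p _ _ _ _ v(1) X(2) Y])
      show "ennreal (A \<tau>) \<le> (\<integral>\<^sup>+u. ennreal ((4 * \<epsilon> * hom_kernel 0 \<tau> u + B) * v u) \<partial>lborel)" if "0 < \<tau>" for \<tau>
        unfolding A[OF that] kernel_mean_def
      proof (intro nn_integral_mono)
        fix u
        show "ennreal ((4 * \<epsilon> * max \<tau> \<bar>u\<bar> powr (- 1) + B) * v u) \<le> ennreal ((4 * \<epsilon> * hom_kernel 0 \<tau> u + B) * v u)"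
          using that v(2)[of u] by (cases "u \<le> 0") (auto simp: hom_kernel_def)
      qed
    qed (use p eB Ann in \<open>auto simp: field_simps\<close>)
    show "(\<integral>\<^sup>+\<tau>. ennreal (\<Phi> \<tau> powr p) * indicator {0<..1} \<tau> \<partial>lborel)
      \<le> ennreal (2 powr p * (Schur_const p (1 - 1 / q) * (\<epsilon> * (2 + power_kernel_const b 0)) powr p * X powr p + (2 * B * Y) powr p))"
    proof (rule Schur_plus_const[OF p _ _ _ _ v(1) X(2) Y])
      have K: "0 < power_kernel_const b 0" using b by (simp add: power_kernel_const_pos)
      show "0 \<le> \<epsilon> * (2 + power_kernel_const b 0)" using K eB by simp
      \<comment> \<open>The kernel belonging to \<open>\<Phi>\<close> has exponent
        \<open>1 - 1 / q\<close>, and the Schur test admits it exactly when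
        \<open>1 / p < 1 / q\<close>. This is where \<open>q < p\<close> is decisive.\<close>
      have "0 < 1 / q" "1 / q < 1" "0 < 1 / p" "1 / p < 1 / q" using q by (auto simp: field_simps)
      moreover have "- 1 / p = - (1 / p)" by simp
      ultimately show "- 1 / p < 1 - 1 / q" "1 - 1 / q < 1 - 1 / p" by linarith+
      show "ennreal (\<Phi> \<tau>) \<le> (\<integral>\<^sup>+u. ennreal ((\<epsilon> * (2 + power_kernel_const b 0) * hom_kernel (1 - 1 / q) \<tau> u + 2 * B) * v u) \<partial>lborel)"
        if \<tau>: "0 < \<tau>" "\<tau> \<le> 1" for \<tau>
      proof -
        let ?c = "\<epsilon> * (2 + power_kernel_const b 0)"
        let ?k = "\<lambda>u. ?c * \<tau> * (\<bar>u\<bar> powr (1 - b) * max \<tau> \<bar>u\<bar> powr (- 1)) + 2 * \<tau> * B"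
        have "\<beta> \<tau> \<le> (\<integral>\<^sup>+x. kernel_mean b \<epsilon> B v x * indicator {0<..2 * \<tau>} x \<partial>lborel)"
          unfolding \<beta>_def using \<delta> by (intro nn_integral_mono) (auto simp: indicator_def)
        also have "\<dots> \<le> (\<integral>\<^sup>+u. ennreal (?k u * v u) \<partial>lborel)"
          by (rule kernel_mean_head[OF _ v \<tau>(1) b(1) eB]) simp
        finally have "ennreal (\<tau> powr (- 1 / q)) * \<beta> \<tau> \<le> ennreal (\<tau> powr (- 1 / q)) * (\<integral>\<^sup>+u. ennreal (?k u * v u) \<partial>lborel)"
          by (rule mult_left_mono) simp
        also have "\<dots> = (\<integral>\<^sup>+u. ennreal (\<tau> powr (- 1 / q)) * ennreal (?k u * v u) \<partial>lborel)"
          by (rule nn_integral_cmult[symmetric]) measurable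
        also have "\<dots> \<le> (\<integral>\<^sup>+u. ennreal ((?c * hom_kernel (1 - 1 / q) \<tau> u + 2 * B) * v u) \<partial>lborel)"
        proof (intro nn_integral_mono)
          fix u
          have e: "\<tau> powr (- 1 / q) * \<tau> = \<tau> powr (1 - 1 / q)" using \<tau> by (simp add: powr_diff powr_minus_divide)
          have t1: "\<tau> powr (1 - 1 / q) \<le> 1" using \<tau> q by (intro powr_le1) auto
          have "\<tau> powr (- 1 / q) * ?k u = ?c * hom_kernel (1 - 1 / q) \<tau> u + 2 * (\<tau> powr (- 1 / q) * \<tau>) * B"
            unfolding hom_kernel_def b(3) e[symmetric] by (simp add: algebra_simps add_divide_distrib)
          also have "\<dots> \<le> ?c * hom_kernel (1 - 1 / q) \<tau> u + 2 * 1 * B"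
            unfolding e using t1 eB by (intro add_left_mono mult_right_mono) auto
          finally have "\<tau> powr (- 1 / q) * ?k u * v u \<le> (?c * hom_kernel (1 - 1 / q) \<tau> u + 2 * B) * v u"
            using v(1)[of u] by (intro mult_right_mono) auto
          then show "ennreal (\<tau> powr (- 1 / q)) * ennreal (?k u * v u) \<le> ennreal ((?c * hom_kernel (1 - 1 / q) \<tau> u + 2 * B) * v u)"
            using K eB \<tau> v(1)[of u] by (subst ennreal_mult[symmetric]) (auto simp: mult.assoc intro!: ennreal_leI)
        qed
        finally show ?thesis unfolding \<Phi>_def using \<beta>fin[of \<tau>] by (simp add: ennreal_mult ennreal_enn2real)
      qed
    qed (use p eB in \<open>auto simp: \<Phi>_def\<close>)
  qed
  finally have main: "(\<integral>\<^sup>+\<theta>. ennreal (S \<theta> powr p) \<partial>circle) \<le> ennreal (2 powr p * 2) *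
    (ennreal (2 powr p * (Schur_const p 0 * (4 * \<epsilon>) powr p * X powr p + (B * Y) powr p))
     + ennreal (2 powr p * (Schur_const p (1 - 1 / q) * (\<epsilon> * (2 + power_kernel_const b 0)) powr p * X powr p + (2 * B * Y) powr p)))"
    by (simp add: mult_left_mono)
  define s0 s1 k where "s0 = Schur_const p 0" and "s1 = Schur_const p (1 - 1 / q)" and "k = 2 + power_kernel_const b 0"
  have iq: "0 < 1 / q" "1 / q < 1" "0 < 1 / p" "1 / p < 1 / q" using q by (auto simp: field_simps)
  have s: "0 \<le> s0" "0 \<le> s1" "0 < k"
    using Schur_const_nonneg[OF p, of 0] Schur_const_nonneg[OF p, of "1 - 1 / q"] iq p b power_kernel_const_pos[of 0 b]
    by (auto simp: s0_def s1_def k_def)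
  define K0 where "K0 = 2 powr p * 2 * 2 powr p * (s0 * 4 powr p + s1 * k powr p + 1 + 2 powr p)"
  have K0: "0 \<le> K0" using s by (simp add: K0_def)
  have "2 powr p * 2 * (2 powr p * (s0 * (4 * \<epsilon>) powr p * X powr p + (B * Y) powr p) + 2 powr p * (s1 * (\<epsilon> * k) powr p * X powr p + (2 * B * Y) powr p))
     = 2 powr p * 2 * 2 powr p * ((s0 * 4 powr p + s1 * k powr p) * (\<epsilon> * X) powr p + (1 + 2 powr p) * (B * Y) powr p)"
    using eB X(1) Y(1) s by (simp add: powr_mult algebra_simps)
  also have "\<dots> \<le> 2 powr p * 2 * 2 powr p * ((s0 * 4 powr p + s1 * k powr p + 1 + 2 powr p) * (\<epsilon> * X) powr p + (s0 * 4 powr p + s1 * k powr p + 1 + 2 powr p) * (B * Y) powr p)"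
  proof -
    have "0 \<le> s0 * 4 powr p" "0 \<le> s1 * k powr p" using s by auto
    then have "s0 * 4 powr p + s1 * k powr p \<le> s0 * 4 powr p + s1 * k powr p + 1 + 2 powr p"
      "1 + 2 powr p \<le> s0 * 4 powr p + s1 * k powr p + 1 + 2 powr p" by simp_all
    then show ?thesis
      by (intro mult_left_mono[OF add_mono] mult_right_mono) auto
  qed
  also have "\<dots> = K0 * ((\<epsilon> * X) powr p + (B * Y) powr p)" by (simp add: K0_def algebra_simps)
  also have "\<dots> \<le> (embed_const p q * (\<epsilon> * X + B * Y)) powr p"
    using powr_sum_const_le[OF K0, of "\<epsilon> * X" "B * Y" p] eB X(1) Y(1) p
    by (simp add: embed_const_def K0_def s0_def s1_def k_def b_def)
  finally have "(\<integral>\<^sup>+\<theta>. ennreal (S \<theta> powr p) \<partial>circle) \<le> ennreal ((embed_const p q * (\<epsilon> * X + B * Y)) powr p)"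
    using main s unfolding s0_def[symmetric] s1_def[symmetric] k_def[symmetric]
    by (simp add: order_trans ennreal_leI flip: ennreal_plus ennreal_mult)
  then have "Lp_le p (\<lambda>\<theta>. of_real (S \<theta>)) (embed_const p q * (\<epsilon> * X + B * Y))"
    using eB X(1) Y(1) by (simp add: Lp_le_def S_def embed_const_def)
  then show ?thesis
    by (rule Lp_le_dominated) (use Fle p in \<open>auto simp: S_def\<close>)
qed

section \<open>Norms from means of the derivative\<close>

lemma Bernoulli_powr_le:
  fixes x \<alpha> :: real
  assumes "- 1 \<le> x" "0 < \<alpha>" "\<alpha> \<le> 1"
  shows "(1 + x) powr \<alpha> \<le> 1 + \<alpha> * x"
proof (cases "x = - 1")
  case False
  then have "(1 + x) powr \<alpha> * 1 powr (1 - \<alpha>) \<le> \<alpha> * (1 + x) + (1 - \<alpha>) * 1"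
    using assms by (intro Youngs_inequality_0) auto
  then show ?thesis by (simp add: algebra_simps)
qed (use assms in simp)

text \<open>If \<open>norm a \<le> 2 * norm b\<close>, every term is of order
  \<open>norm b powr p\<close>: 9 from the sum and 4 from the linear term give the 13. Otherwise
  concavity of the power \<open>p / 2\<close> expands the squared modulus, and the quadratic
  remainder \<open>norm a powr (p - 2) * (norm b)\<^sup>2\<close> is at most
  \<open>norm b powr p\<close> because the exponent \<open>p - 2\<close> is not positive.\<close>

lemma norm_add_powr_le:
  fixes a b :: complex
  assumes p: "1 < p" "p \<le> 2"
  shows "norm (a + b) powr p \<le> norm a powr p + p * norm a powr (p - 2) * Re (cnj a * b) + 13 * norm b powr p"
proof (cases "norm a \<le> 2 * norm b")
  case True
  have "norm (a + b) \<le> 3 * norm b" using norm_triangle_ineq[of a b] True by simp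
  then have "norm (a + b) powr p \<le> (3 * norm b) powr p" using p by (intro powr_mono2) auto
  also have "\<dots> = 3 powr p * norm b powr p" by (simp add: powr_mult)
  also have "\<dots> \<le> 3 powr 2 * norm b powr p" using p by (intro mult_right_mono powr_mono) auto
  finally have 1: "norm (a + b) powr p \<le> 9 * norm b powr p" by simp
  have "\<bar>Re (cnj a * b)\<bar> \<le> norm a * norm b" using abs_Re_le_cmod[of "cnj a * b"] by (simp add: norm_mult)
  then have "- Re (cnj a * b) \<le> norm a * norm b" by simp
  then have "norm a powr (p - 2) * - Re (cnj a * b) \<le> norm a powr (p - 2) * (norm a * norm b)" by (rule mult_left_mono) simp
  also have "\<dots> = norm a powr (p - 1) * norm b"
    by (cases "a = 0") (auto simp: powr_diff power2_eq_square)
  also have "\<dots> \<le> (2 * norm b) powr (p - 1) * norm b" using True p by (intro mult_right_mono powr_mono2) auto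
  also have "\<dots> = 2 powr (p - 1) * norm b powr p" by (cases "b = 0") (auto simp: powr_mult powr_diff)
  also have "\<dots> \<le> 2 powr 1 * norm b powr p" using p by (intro mult_right_mono powr_mono) auto
  finally have "p * (norm a powr (p - 2) * - Re (cnj a * b)) \<le> p * (2 * norm b powr p)"
    using p by (intro mult_left_mono) auto
  also have "\<dots> \<le> 2 * (2 * norm b powr p)" using p by (intro mult_right_mono) auto
  finally have 2: "- (p * norm a powr (p - 2) * Re (cnj a * b)) \<le> 4 * norm b powr p"
    by (simp only: mult_minus_right mult.assoc)
  show ?thesis using 1 2 powr_ge_zero[of "norm a" p] by linarith
next
  case False
  then have a: "0 < norm a" using norm_ge_zero[of b] by linarith
  \<comment> \<open>The relative change of the squared modulus. Bernoulli's inequality in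
    \<open>x\<close> keeps the linear term exact, which the later cancellation requires.\<close>
  define x where "x = (2 * Re (cnj a * b) + (norm b)\<^sup>2) / (norm a)\<^sup>2"
  have sq: "(norm (a + b))\<^sup>2 = (norm a)\<^sup>2 * (1 + x)"
  proof -
    have "(norm a)\<^sup>2 * x = 2 * Re (cnj a * b) + (norm b)\<^sup>2" using a by (simp add: x_def)
    moreover have "(norm (a + b))\<^sup>2 = (norm a)\<^sup>2 + (2 * Re (cnj a * b) + (norm b)\<^sup>2)"
      unfolding cmod_power2 by (simp add: power2_eq_square algebra_simps)
    ultimately show ?thesis unfolding distrib_left by simp
  qed
  have "0 \<le> (norm a)\<^sup>2 * (1 + x)" unfolding sq[symmetric] by simp
  then have x: "- 1 \<le> x" using a by (simp add: zero_le_mult_iff)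
  have "norm (a + b) powr p = ((norm (a + b))\<^sup>2) powr (p / 2)"
    by (cases "a + b = 0") (auto simp: powr_powr simp flip: powr_numeral)
  also have "\<dots> = norm a powr p * (1 + x) powr (p / 2)"
  proof -
    have "((norm a)\<^sup>2) powr (p / 2) = norm a powr p" using a by (simp add: powr_powr flip: powr_numeral)
    then show ?thesis unfolding sq powr_mult by simp
  qed
  also have "\<dots> \<le> norm a powr p * (1 + p / 2 * x)"
    using p x by (intro mult_left_mono Bernoulli_powr_le) auto
  also have "\<dots> = norm a powr p + p * norm a powr (p - 2) * Re (cnj a * b) + p / 2 * (norm a powr (p - 2) * (norm b)\<^sup>2)"
    using a by (simp add: x_def powr_diff field_simps)
  also have "norm a powr (p - 2) * (norm b)\<^sup>2 \<le> norm b powr p"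
  proof (cases "b = 0")
    case False
    have "norm b \<le> norm a" using \<open>\<not> norm a \<le> 2 * norm b\<close> norm_ge_zero[of b] by linarith
    then have "norm a powr (p - 2) \<le> norm b powr (p - 2)"
      using False p by (intro powr_mono2') auto
    then have "norm a powr (p - 2) * (norm b)\<^sup>2 \<le> norm b powr (p - 2) * (norm b)\<^sup>2" by (rule mult_right_mono) simp
    also have "\<dots> = norm b powr p" using False by (simp add: powr_diff)
    finally show ?thesis .
  qed simp
  also have "p / 2 * norm b powr p \<le> 13 * norm b powr p" using p by (intro mult_right_mono) auto
  finally show ?thesis using p by (simp add: mult_left_mono)
qed

lemma integrable_circle_real:
  fixes f :: "real \<Rightarrow> real"
  assumes "continuous_on UNIV f"
  shows "integrable circle f"
proof -
  have "integrable circle (\<lambda>x. complex_of_real (f x))"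
    using assms by (intro integrable_circle continuous_intros)
  then show ?thesis using complex_of_real_integrable_eq by blast
qed

text \<open>The Poisson average of \<open>F(R cis(\<theta> + s)) - F(r cis \<theta>)\<close> vanishes, so the first-order term
  of the inequality above drops out.\<close>

lemma poisson_increment:
  assumes p: "1 < p" "p \<le> 2" and F: "F holomorphic_on ball 0 1" and r: "0 \<le> r" "r < R" "R < 1"
  shows "(\<integral>\<^sup>+\<theta>. ennreal (norm (F (polar R \<theta>)) powr p) \<partial>circle)
     \<le> (\<integral>\<^sup>+\<theta>. ennreal (norm (F (polar r \<theta>)) powr p) \<partial>circle)
       + 13 * (\<integral>\<^sup>+s. ennreal (poisson (r / R) s) *
           (\<integral>\<^sup>+\<theta>. ennreal (norm (F (polar R (\<theta> + s)) - F (polar r \<theta>)) powr p) \<partial>circle) \<partial>circle)"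
proof -
  have q: "0 \<le> r / R" "r / R < 1" using r by auto
  have R: "0 \<le> R" "r < 1" using r by auto
  let ?P = "poisson (r / R)"
  let ?a = "\<lambda>\<theta>. F (polar r \<theta>)" and ?X = "\<lambda>s \<theta>. F (polar R (\<theta> + s))"
  have contX: "continuous_on UNIV (\<lambda>s. ?X s \<theta>)" for \<theta>
    using r by (intro continuous_on_compose2[OF holomorphic_on_imp_continuous_on[OF F]] continuous_intros) (auto simp: norm_mult)
  have contP: "continuous_on UNIV ?P"
    using continuous_on_Re[OF continuous_poisson[OF q]] by simp
  have contp: "continuous_on UNIV (\<lambda>s. ?P s * norm (f s) powr p)" if "continuous_on UNIV f" for f :: "real \<Rightarrow> complex"
    using that p by (intro continuous_intros contP continuous_on_powr') auto
  have pt: "(\<integral>\<^sup>+s. ennreal (?P s * norm (?X s \<theta>) powr p) \<partial>circle)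
     \<le> ennreal (norm (?a \<theta>) powr p) + 13 * (\<integral>\<^sup>+s. ennreal (?P s * norm (?X s \<theta> - ?a \<theta>) powr p) \<partial>circle)" for \<theta>
  proof -
    define a where "a = ?a \<theta>"
    define c where "c = p * norm a powr (p - 2)"
    define L where "L s = c * Re (cnj a * (of_real (?P s) * ?X s \<theta> - of_real (?P s) * a))" for s
    have i1: "integrable circle (\<lambda>s. ?P s * norm (?X s \<theta>) powr p)"
      by (intro integrable_circle_real contp contX)
    have i2: "integrable circle (\<lambda>s. ?P s * norm (?X s \<theta> - a) powr p)"
      by (intro integrable_circle_real contp continuous_on_diff contX continuous_on_const)
    have i3: "integrable circle ?P" by (intro integrable_circle_real contP)
    have iX: "integrable circle (\<lambda>s. of_real (?P s) * ?X s \<theta>)"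
      by (rule poisson_dilate(2)[OF F r])
    have iP: "integrable circle (\<lambda>s. of_real (?P s) * a)"
      using i3 by simp
    have Pa: "(LINT s|circle. of_real (?P s) * a) = a"
      using poisson_integral_1(1)[OF q] by simp
    have iZ: "integrable circle (\<lambda>s. of_real (?P s) * ?X s \<theta> - of_real (?P s) * a)"
      using iX iP by (rule Bochner_Integration.integrable_diff)
    have "(LINT s|circle. of_real (?P s) * ?X s \<theta> - of_real (?P s) * a) = 0"
      using Bochner_Integration.integral_diff[OF iX iP] poisson_dilate(1)[OF F r, of \<theta>] Pa by (simp add: a_def)
    then have "(LINT s|circle. cnj a * (of_real (?P s) * ?X s \<theta> - of_real (?P s) * a)) = 0"
      by (subst integral_mult_right_zero) simp
    then have "(LINT s|circle. Re (cnj a * (of_real (?P s) * ?X s \<theta> - of_real (?P s) * a))) = 0"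
      by (simp only: integral_Re[OF integrable_mult_right[OF iZ, of "cnj a"]]) simp
    then have L0: "(LINT s|circle. L s) = 0" unfolding L_def by (subst integral_mult_right_zero) simp
    have iL: "integrable circle L" unfolding L_def
      by (intro integrable_mult_right integrable_Re iZ)
    have P1: "(LINT s|circle. ?P s) = 1"
      using poisson_integral_1(1)[OF q] integral_complex_of_real[of circle ?P] of_real_eq_1_iff by metis
    have "(LINT s|circle. ?P s * norm (?X s \<theta>) powr p)
       \<le> (LINT s|circle. ?P s * norm a powr p + L s + 13 * (?P s * norm (?X s \<theta> - a) powr p))"
    proof (rule integral_mono[OF i1])
      show "integrable circle (\<lambda>s. ?P s * norm a powr p + L s + 13 * (?P s * norm (?X s \<theta> - a) powr p))"
        using i2 i3 iL by simp
      fix s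
      have "norm (a + (?X s \<theta> - a)) powr p \<le> norm a powr p + c * Re (cnj a * (?X s \<theta> - a)) + 13 * norm (?X s \<theta> - a) powr p"
        unfolding c_def by (rule norm_add_powr_le[OF p])
      then have "?P s * norm (a + (?X s \<theta> - a)) powr p \<le> ?P s * (norm a powr p + c * Re (cnj a * (?X s \<theta> - a)) + 13 * norm (?X s \<theta> - a) powr p)"
        using poisson_nonneg[OF q] by (rule mult_left_mono)
      also have "\<dots> = ?P s * norm a powr p + ?P s * (c * Re (cnj a * (?X s \<theta> - a))) + 13 * (?P s * norm (?X s \<theta> - a) powr p)"
        by (simp add: distrib_left mult.left_commute)
      also have "?P s * (c * Re (cnj a * (?X s \<theta> - a))) = L s"
      proof -
        have eq: "cnj a * (of_real (?P s) * ?X s \<theta> - of_real (?P s) * a) = of_real (?P s) * (cnj a * (?X s \<theta> - a))"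
          by (simp add: right_diff_distrib mult_ac)
        have "Re (of_real (?P s) * w) = ?P s * Re w" for w by simp
        then have "L s = c * (?P s * Re (cnj a * (?X s \<theta> - a)))" unfolding L_def eq by (simp only:)
        then show ?thesis by (simp only: mult.left_commute)
      qed
      finally show "?P s * norm (?X s \<theta>) powr p \<le> ?P s * norm a powr p + L s + 13 * (?P s * norm (?X s \<theta> - a) powr p)" by simp
    qed
    also have "\<dots> = norm a powr p + 13 * (LINT s|circle. ?P s * norm (?X s \<theta> - a) powr p)"
      using i2 i3 iL L0 P1 by simp
    finally have "ennreal (LINT s|circle. ?P s * norm (?X s \<theta>) powr p) \<le> ennreal (norm a powr p + 13 * (LINT s|circle. ?P s * norm (?X s \<theta> - a) powr p))"
      by (rule ennreal_leI)
    also have "\<dots> = ennreal (norm a powr p) + 13 * ennreal (LINT s|circle. ?P s * norm (?X s \<theta> - a) powr p)"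
      using poisson_nonneg[OF q] by (subst ennreal_plus) (auto simp: ennreal_mult)
    finally show ?thesis
      using nn_integral_eq_integral[OF i1] nn_integral_eq_integral[OF i2] poisson_nonneg[OF q] by (simp add: a_def)
  qed
  have mX [measurable]: "(\<lambda>(s, \<theta>). ?X s \<theta>) \<in> borel_measurable (borel \<Otimes>\<^sub>M borel)"
    by (rule pair_trace_measurable[OF F R(1) r(3)])
  have ma [measurable]: "?a \<in> borel_measurable borel" by (rule trace_measurable(2)[OF F r(1) R(2)])
  have mX1 [measurable]: "?X s \<in> borel_measurable borel" for s by (rule trace_measurable(1)[OF F R(1) r(3)])
  interpret pair_sigma_finite circle circle ..
  have swap: "(\<integral>\<^sup>+\<theta>. (\<integral>\<^sup>+s. ennreal (?P s * norm (Z s \<theta>) powr p) \<partial>circle) \<partial>circle)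
     = (\<integral>\<^sup>+s. ennreal (?P s) * (\<integral>\<^sup>+\<theta>. ennreal (norm (Z s \<theta>) powr p) \<partial>circle) \<partial>circle)"
    if [measurable]: "(\<lambda>(s, \<theta>). Z s \<theta>) \<in> borel_measurable (borel \<Otimes>\<^sub>M borel)" "\<And>s. Z s \<in> borel_measurable borel" for Z :: "real \<Rightarrow> real \<Rightarrow> complex"
  proof -
    have "(\<integral>\<^sup>+\<theta>. (\<integral>\<^sup>+s. ennreal (?P s * norm (Z s \<theta>) powr p) \<partial>circle) \<partial>circle)
      = (\<integral>\<^sup>+s. (\<integral>\<^sup>+\<theta>. ennreal (?P s * norm (Z s \<theta>) powr p) \<partial>circle) \<partial>circle)"
      by (rule Fubini') measurable
    also have "\<dots> = (\<integral>\<^sup>+s. ennreal (?P s) * (\<integral>\<^sup>+\<theta>. ennreal (norm (Z s \<theta>) powr p) \<partial>circle) \<partial>circle)"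
      using poisson_nonneg[OF q] by (intro nn_integral_cong) (simp add: ennreal_mult nn_integral_cmult)
    finally show ?thesis .
  qed
  have "(\<integral>\<^sup>+\<theta>. ennreal (norm (F (polar R \<theta>)) powr p) \<partial>circle)
      = (\<integral>\<^sup>+s. ennreal (?P s) * (\<integral>\<^sup>+\<theta>. ennreal (norm (?X s \<theta>) powr p) \<partial>circle) \<partial>circle)"
  proof -
    have "(\<integral>\<^sup>+\<theta>. ennreal (norm (?X s \<theta>) powr p) \<partial>circle) = (\<integral>\<^sup>+\<theta>. ennreal (norm (F (polar R \<theta>)) powr p) \<partial>circle)" for s
      using nn_integral_circle_shift[of "\<lambda>\<theta>. ennreal (norm (F (polar R \<theta>)) powr p)" s] trace_measurable(2)[OF F R(1) r(3)] by simp
    then show ?thesis using poisson_integral_1(2)[OF q] by (simp add: nn_integral_multc)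
  qed
  also have "\<dots> = (\<integral>\<^sup>+\<theta>. (\<integral>\<^sup>+s. ennreal (?P s * norm (?X s \<theta>) powr p) \<partial>circle) \<partial>circle)"
    by (rule swap[symmetric, OF mX mX1])
  also have "\<dots> \<le> (\<integral>\<^sup>+\<theta>. ennreal (norm (?a \<theta>) powr p) + 13 * (\<integral>\<^sup>+s. ennreal (?P s * norm (?X s \<theta> - ?a \<theta>) powr p) \<partial>circle) \<partial>circle)"
    by (intro nn_integral_mono pt)
  also have "\<dots> = (\<integral>\<^sup>+\<theta>. ennreal (norm (?a \<theta>) powr p) \<partial>circle) + 13 * (\<integral>\<^sup>+\<theta>. (\<integral>\<^sup>+s. ennreal (?P s * norm (?X s \<theta> - ?a \<theta>) powr p) \<partial>circle) \<partial>circle)"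
    by (subst nn_integral_add) (auto simp: nn_integral_cmult)
  also have "(\<integral>\<^sup>+\<theta>. (\<integral>\<^sup>+s. ennreal (?P s * norm (?X s \<theta> - ?a \<theta>) powr p) \<partial>circle) \<partial>circle)
     = (\<integral>\<^sup>+s. ennreal (?P s) * (\<integral>\<^sup>+\<theta>. ennreal (norm (?X s \<theta> - ?a \<theta>) powr p) \<partial>circle) \<partial>circle)"
    by (rule swap) measurable
  finally show ?thesis .
qed

text \<open>The two points are joined by a path along the radii and the circle of radius
  \<open>1 - min 1 (max x |s|)\<close>.\<close>

lemma Lp_le_path_increment:
  fixes \<mu> :: "real \<Rightarrow> real"
  assumes p: "1 \<le> p" and F: "F holomorphic_on ball 0 1" and x: "0 < x" "x \<le> 1"
    and [measurable]: "\<mu> \<in> borel_measurable borel"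
    and anti: "\<And>\<sigma> \<tau>. 0 < \<sigma> \<Longrightarrow> \<sigma> \<le> \<tau> \<Longrightarrow> \<mu> \<tau> \<le> \<mu> \<sigma>"
    and \<mu>: "\<And>\<tau>. 0 < \<tau> \<Longrightarrow> \<tau> \<le> 1 \<Longrightarrow> Lp_le p (\<lambda>\<theta>. deriv F (polar (1 - \<tau>) \<theta>)) (\<mu> \<tau>)"
    and Q: "0 \<le> Q" "(\<integral>\<^sup>+\<tau>. ennreal (\<mu> \<tau>) * indicator {x / 2..min 1 (max x \<bar>s\<bar>)} \<tau> \<partial>lborel) = ennreal Q"
  shows "Lp_le p (\<lambda>\<theta>. F (polar (1 - x / 2) (\<theta> + s)) - F (polar (1 - x) \<theta>)) (4 * Q)"
proof -
  define y where "y = min 1 (max x \<bar>s\<bar>)"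
  have y: "x \<le> y" "y \<le> 1" "0 < y" using x by (auto simp: y_def)
  have radial: "Lp_le p (\<lambda>\<theta>. F (polar R \<theta>) - F (polar (1 - y) \<theta>)) Q"
    if R: "1 - y \<le> R" "R \<le> 1 - x / 2" for R
  proof (rule Lp_le_radial_increment[OF p F, where W="\<lambda>\<sigma>. \<mu> (1 - \<sigma>)"])
    show "Lp_le p (\<lambda>\<theta>. deriv F (polar \<sigma> \<theta>)) (\<mu> (1 - \<sigma>))" if "\<sigma> \<in> {1 - y..R}" for \<sigma>
      using \<mu>[of "1 - \<sigma>"] that R x y by auto
    have "(\<integral>\<^sup>+\<sigma>. ennreal (\<mu> (1 - \<sigma>)) * indicator {1 - y..R} \<sigma> \<partial>lborel) = (\<integral>\<^sup>+\<tau>. ennreal (\<mu> \<tau>) * indicator {1 - R..y} \<tau> \<partial>lborel)"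
      using nn_integral_real_affine[of "\<lambda>\<tau>. ennreal (\<mu> \<tau>) * indicator {1 - R..y} \<tau>" "-1" 1]
      by (simp add: indicator_def) (intro nn_integral_cong, auto)
    also have "\<dots> \<le> ennreal Q"
      unfolding Q(2)[symmetric] y_def[symmetric] using R by (intro nn_integral_mono) (auto simp: indicator_def)
    finally show "(\<integral>\<^sup>+\<sigma>. ennreal (\<mu> (1 - \<sigma>)) * indicator {1 - y..R} \<sigma> \<partial>lborel) \<le> ennreal Q" .
  qed (use R x y Q in auto)
  have rot: "Lp_le p (\<lambda>\<theta>. F (polar (1 - y) (\<theta> + s)) - F (polar (1 - y) \<theta>)) (2 * Q)"
  proof (cases "y = 1")
    case True
    \<comment> \<open>For \<open>y = 1\<close> the circle has shrunk to the origin and turning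
      changes nothing.\<close>
    then show ?thesis using Q p Lp_le_sup[of "\<lambda>_. 0" "2 * Q" p] by simp
  next
    case False
    then have sy: "\<bar>s\<bar> \<le> y" using y by (auto simp: y_def min_def split: if_splits)
    have \<mu>y: "Lp_le p (\<lambda>\<theta>. deriv F (polar (1 - y) \<theta>)) (\<mu> y)" using \<mu> y by simp
    then have \<mu>0: "0 \<le> \<mu> y" by (rule Lp_le_nonneg)
    \<comment> \<open>Since \<open>\<mu>\<close> is decreasing, the stretch from
      \<open>y / 2\<close> to \<open>y\<close>, which belongs to the radial path, already
      contributes \<open>\<mu> y * (y / 2)\<close> to \<open>Q\<close>. The rotation is thus paid
      for by the radial integral, at most \<open>2 * Q\<close>.\<close>
    have "ennreal (\<mu> y * (y / 2)) = (\<integral>\<^sup>+\<tau>. ennreal (\<mu> y) * indicator {y / 2..y} \<tau> \<partial>lborel)"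
      using y \<mu>0 by (subst ennreal_mult) (simp_all add: nn_integral_cmult_indicator)
    also have "\<dots> \<le> ennreal Q"
      unfolding Q(2)[symmetric] y_def[symmetric] using y anti by (intro nn_integral_mono) (auto simp: indicator_def intro!: ennreal_leI)
    finally have "\<mu> y * y \<le> 2 * Q" using Q by (simp add: ennreal_le_iff)
    moreover have "\<bar>s\<bar> * ((1 - y) * \<mu> y) \<le> y * (1 * \<mu> y)" using sy y \<mu>0 by (intro mult_mono mult_right_mono) auto
    ultimately have "\<bar>s\<bar> * ((1 - y) * \<mu> y) \<le> 2 * Q" by (simp add: mult.commute)
    moreover have "Lp_le p (\<lambda>\<theta>. F (polar (1 - y) (\<theta> + s)) - F (polar (1 - y) \<theta>)) (\<bar>s\<bar> * ((1 - y) * \<mu> y))"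
      using y by (intro Lp_le_rotation_increment[OF p F] \<mu>y) auto
    ultimately show ?thesis using p by (auto intro: Lp_le_mono)
  qed
  have r1: "Lp_le p (\<lambda>\<theta>. F (polar (1 - x / 2) (\<theta> + s)) - F (polar (1 - y) (\<theta> + s))) Q"
    using radial[of "1 - x / 2"] x y
    by (subst Lp_le_shift[where \<phi>="\<lambda>\<theta>. F (polar (1 - x / 2) \<theta>) - F (polar (1 - y) \<theta>)"])
      (auto intro!: borel_measurable_diff trace_measurable F simp del: of_real_diff)
  have "Lp_le p (\<lambda>\<theta>. ((F (polar (1 - x / 2) (\<theta> + s)) - F (polar (1 - y) (\<theta> + s)))
      + (F (polar (1 - y) (\<theta> + s)) - F (polar (1 - y) \<theta>)))
      - (F (polar (1 - x) \<theta>) - F (polar (1 - y) \<theta>))) (Q + 2 * Q + Q)"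
    by (intro Lp_le_diff Lp_le_add p r1 rot radial borel_measurable_add borel_measurable_diff trace_measurable F)
      (use x y in auto)
  then show ?thesis by simp
qed

text \<open>Each term is at most four times the decrement of
  \<open>min (sqrt x) (sqrt (2 * \<tau>))\<close> when \<open>x\<close> is halved, because
  \<open>sqrt (1 / 2) \<le> 3 / 4\<close>; the decrements telescope.\<close>

lemma dyadic_sqrt_sum:
  fixes \<tau> :: real
  assumes "0 < \<tau>"
  shows "(\<Sum>n<N. if (1 / 2) ^ n \<le> 2 * \<tau> then sqrt ((1 / 2) ^ n) else 0) \<le> 4 * sqrt (2 * \<tau>)"
proof -
  define w where "w x = min (sqrt x) (sqrt (2 * \<tau>))" for x
  have s: "sqrt (1 / 2) \<le> 3 / 4" by (rule real_le_lsqrt) (auto simp: power2_eq_square)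
  have step: "(1 / 4) * (if x \<le> 2 * \<tau> then sqrt x else 0) \<le> w x - w (x / 2)" if "0 < x" for x
  proof (cases "x \<le> 2 * \<tau>")
    case True
    then have "w x = sqrt x" "w (x / 2) = sqrt x * sqrt (1 / 2)"
      using that real_sqrt_le_mono[OF True] real_sqrt_le_mono[of "x / 2" "2 * \<tau>"]
      by (simp_all add: w_def real_sqrt_divide)
    moreover have "sqrt x * sqrt (1 / 2) \<le> sqrt x * (3 / 4)" using s that by (intro mult_left_mono) auto
    ultimately show ?thesis using True by simp
  next
    case False
    have "w (x / 2) \<le> w x" using that unfolding w_def by (intro min.mono) auto
    then show ?thesis using False by simp
  qed
  have "(1 / 4) * (\<Sum>n<N. if (1 / 2) ^ n \<le> 2 * \<tau> then sqrt ((1 / 2) ^ n) else 0) \<le> (\<Sum>n<N. w ((1 / 2) ^ n) - w ((1 / 2) ^ Suc n))"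
    unfolding sum_distrib_left using step[of "(1 / 2) ^ _"] by (intro sum_mono) simp
  also have "\<dots> = w 1 - w ((1 / 2) ^ N)" by (subst sum_lessThan_telescope') simp
  also have "\<dots> \<le> sqrt (2 * \<tau>)"
  proof -
    have "0 \<le> w ((1 / 2) ^ N)" "w 1 \<le> sqrt (2 * \<tau>)" using assms by (simp_all add: w_def)
    then show ?thesis by linarith
  qed
  finally show ?thesis by simp
qed

text \<open>A rounded product: 13 from the power inequality, 16 bounding \<open>4 powr p\<close>,
  512 from the Poisson bound 128 times \<open>power_kernel_const 2 0 = 4\<close>, and
  \<open>sqrt 2\<close>. The factor in \<open>p - 1\<close> is the normalisation of the Jensen
  weight.\<close>

definition dyadic_const :: "real \<Rightarrow> real" where
  "dyadic_const p = 2 ^ 18 * (2 * (p - 1)) powr (p - 1)"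

text \<open>The ratio of the two radii is \<open>1 - y\<close> with \<open>y\<close> between
  \<open>x / 2\<close> and \<open>x\<close>, so the kernel lives at scale \<open>x\<close>;
  comparing the scales costs 4 on top of the 32.\<close>

lemma poisson_dyadic_le:
  assumes x: "0 < x" "x \<le> 1" and s: "\<bar>s\<bar> \<le> pi"
  shows "poisson ((1 - x) / (1 - x / 2)) s \<le> 128 * x * max x \<bar>s\<bar> powr (- 2)"
proof -
  define y where "y = 1 - (1 - x) / (1 - x / 2)"
  have y: "x / 2 \<le> y" "y \<le> x" using x by (auto simp: y_def field_simps)
  have "poisson (1 - y) s \<le> 32 * (1 - (1 - y)) / (max (1 - (1 - y)) \<bar>s\<bar>)\<^sup>2"
    using x y s by (intro poisson_le) auto
  also have "\<dots> \<le> 32 * x / (max x \<bar>s\<bar> / 2)\<^sup>2"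
    using x y by (intro frac_le power_mono) (auto simp: max_def)
  also have "\<dots> = 128 * x * max x \<bar>s\<bar> powr (- 2)"
    using x by (simp add: powr_minus_divide power_divide flip: powr_numeral)
  finally show ?thesis by (simp add: y_def)
qed

text \<open>One step from radius \<open>1 - x\<close> to \<open>1 - x / 2\<close>. The path length
  \<open>Q s\<close> is raised to the p-th power by Jensen with a power weight, and the Poisson
  kernel is then integrated in \<open>s\<close> for fixed \<open>\<tau>\<close>. What remains is
  \<open>sqrt x\<close> against \<open>\<tau> powr (- (1 / 2))\<close> on
  \<open>\<tau> \<ge> x / 2\<close>, which sums over dyadic \<open>x\<close> to a constant.\<close>

lemma dyadic_increment:
  fixes \<mu> a :: "real \<Rightarrow> real"
  assumes p: "1 < p" "p \<le> 2" and F: "F holomorphic_on ball 0 1" and x: "0 < x" "x \<le> 1"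
    and [measurable]: "\<mu> \<in> borel_measurable borel" "a \<in> borel_measurable borel"
    and anti: "\<And>\<sigma> \<tau>. 0 < \<sigma> \<Longrightarrow> \<sigma> \<le> \<tau> \<Longrightarrow> \<mu> \<tau> \<le> \<mu> \<sigma>"
    and \<mu>: "\<And>\<tau>. 0 < \<tau> \<Longrightarrow> \<tau> \<le> 1 \<Longrightarrow> Lp_le p (\<lambda>\<theta>. deriv F (polar (1 - \<tau>) \<theta>)) (\<mu> \<tau>)"
    and a: "\<And>\<tau>. 0 < \<tau> \<Longrightarrow> \<tau> \<le> 1 \<Longrightarrow> \<mu> \<tau> \<le> a \<tau> * \<tau> powr (1 / p - 1)"
  shows "(\<integral>\<^sup>+\<theta>. ennreal (norm (F (polar (1 - x / 2) \<theta>)) powr p) \<partial>circle)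
     \<le> (\<integral>\<^sup>+\<theta>. ennreal (norm (F (polar (1 - x) \<theta>)) powr p) \<partial>circle)
       + ennreal (dyadic_const p * sqrt x) * (\<integral>\<^sup>+\<tau>. ennreal (a \<tau> powr p * \<tau> powr (- (1 / 2))) * indicator {x / 2..1} \<tau> \<partial>lborel)"
proof -
  \<comment> \<open>The exponent of the Jensen weight, arranged so that
    \<open>k * (p - 1) = 1 / 2\<close>: the weight then contributes
    \<open>x powr (- (1 / 2))\<close> outside and leaves \<open>\<tau> powr (1 / 2)\<close>
    inside.\<close>
  define k where "k = 1 / (2 * (p - 1))"
  have k: "0 < k" "k * (p - 1) = 1 / 2" using p by (auto simp: k_def)
  have \<mu>0: "0 \<le> \<mu> \<tau>" if "0 < \<tau>" "\<tau> \<le> 1" for \<tau> using \<mu>[OF that] by (rule Lp_le_nonneg)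
  have a0: "0 \<le> a \<tau>" if "0 < \<tau>" "\<tau> \<le> 1" for \<tau>
    using order_trans[OF \<mu>0[OF that] a[OF that]] that by (simp add: zero_le_mult_iff)
  let ?g = "\<lambda>\<tau>. ennreal (a \<tau> powr p * \<tau> powr (1 / 2))"
  define C where "C = 16 * ((x / 2) powr (- k) / k) powr (p - 1)"
  let ?on = "\<lambda>s \<tau>. x / 2 \<le> \<tau> \<and> \<tau> \<le> 1 \<and> \<tau> \<le> max x \<bar>s\<bar>"
  define Q where "Q s = enn2real (\<integral>\<^sup>+\<tau>. ennreal (\<mu> \<tau>) * indicator {x / 2..min 1 (max x \<bar>s\<bar>)} \<tau> \<partial>lborel)" for s
  have Q0: "0 \<le> Q s" for s by (simp add: Q_def)
  have Q: "(\<integral>\<^sup>+\<tau>. ennreal (\<mu> \<tau>) * indicator {x / 2..min 1 (max x \<bar>s\<bar>)} \<tau> \<partial>lborel) = ennreal (Q s)" for s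
  proof -
    have "(\<integral>\<^sup>+\<tau>. ennreal (\<mu> \<tau>) * indicator {x / 2..min 1 (max x \<bar>s\<bar>)} \<tau> \<partial>lborel)
      \<le> (\<integral>\<^sup>+\<tau>. ennreal (\<mu> (x / 2)) * indicator {x / 2..1} \<tau> \<partial>lborel)"
      using x anti[of "x / 2"] by (intro nn_integral_mono) (auto simp: indicator_def intro!: ennreal_leI)
    also have "\<dots> < \<infinity>" using x by (simp add: nn_integral_cmult_indicator ennreal_mult_less_top)
    finally show ?thesis by (simp add: Q_def)
  qed
  have Qp: "ennreal ((4 * Q s) powr p) \<le> (\<integral>\<^sup>+\<tau>. (if ?on s \<tau> then ennreal C * ?g \<tau> else 0) \<partial>lborel)" for s
  proof -
    let ?I = "indicat_real {x / 2..min 1 (max x \<bar>s\<bar>)}"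
    let ?A = "\<lambda>\<tau>. \<mu> \<tau> * ?I \<tau>" and ?W = "\<lambda>\<tau>. \<bar>\<tau>\<bar> powr (- 1 - k) * ?I \<tau>"
    have "ennreal (Q s powr p) \<le> ennreal (((x / 2) powr (- k) / k) powr (p - 1)) * (\<integral>\<^sup>+\<tau>. ennreal (?A \<tau> powr p * ?W \<tau> powr (1 - p)) \<partial>lborel)"
    proof (rule Jensen_weighted)
      show "0 \<le> ?A \<tau>" for \<tau> using \<mu>0[of \<tau>] x by (auto simp: indicator_def)
      show "?A \<tau> = 0" if "?W \<tau> = 0" for \<tau> using that x by (auto simp: indicator_def split: if_splits)
      have "(\<integral>\<^sup>+\<tau>. ennreal (?W \<tau>) \<partial>lborel) \<le> (\<integral>\<^sup>+\<tau>. ennreal (\<tau> powr (- 1 - k)) * indicator {x / 2..} \<tau> \<partial>lborel)"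
        using x by (intro nn_integral_mono) (auto simp: indicator_def)
      also have "\<dots> = ennreal ((x / 2) powr (- k) / k)"
        using nn_integral_has_integral_lebesgue'[OF _ has_integral_powr_to_inf[of "- 1 - k" "x / 2"]] k x by simp
      finally show "(\<integral>\<^sup>+\<tau>. ennreal (?W \<tau>) \<partial>lborel) \<le> ennreal ((x / 2) powr (- k) / k)" .
      have "ennreal (Q s) = (\<integral>\<^sup>+\<tau>. ennreal (?A \<tau>) \<partial>lborel)"
        unfolding Q[symmetric] by (intro nn_integral_cong) (simp add: indicator_def)
      then show "ennreal (Q s) \<le> (\<integral>\<^sup>+\<tau>. ennreal (?A \<tau>) \<partial>lborel)" by simp
    qed (use p k Q0 in auto)
    also have "\<dots> \<le> ennreal (((x / 2) powr (- k) / k) powr (p - 1)) * (\<integral>\<^sup>+\<tau>. (if ?on s \<tau> then ?g \<tau> else 0) \<partial>lborel)"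
    proof (intro mult_left_mono nn_integral_mono)
      fix \<tau>
      show "ennreal (?A \<tau> powr p * ?W \<tau> powr (1 - p)) \<le> (if ?on s \<tau> then ?g \<tau> else 0)"
      proof (cases "?on s \<tau>")
        case True
        then have \<tau>: "0 < \<tau>" "\<tau> \<le> 1" using x by auto
        have "?A \<tau> powr p * ?W \<tau> powr (1 - p) = \<mu> \<tau> powr p * (\<tau> powr (- 1 - k)) powr (1 - p)" using True \<tau> by simp
        also have "\<dots> \<le> (a \<tau> * \<tau> powr (1 / p - 1)) powr p * (\<tau> powr (- 1 - k)) powr (1 - p)"
          using p \<mu>0[OF \<tau>] a[OF \<tau>] by (intro mult_right_mono powr_mono2) auto
        also have "\<dots> = a \<tau> powr p * (\<tau> powr ((1 / p - 1) * p + (- 1 - k) * (1 - p)))"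
          by (simp add: powr_mult powr_powr powr_add)
        also have "(1 / p - 1) * p + (- 1 - k) * (1 - p) = 1 / 2"
          using p k(2) by (simp add: algebra_simps)
        finally show ?thesis using True by (simp add: ennreal_leI)
      qed (auto simp: indicator_def)
    qed auto
    finally have "ennreal (4 powr p) * ennreal (Q s powr p) \<le> ennreal 16 *
      (ennreal (((x / 2) powr (- k) / k) powr (p - 1)) * (\<integral>\<^sup>+\<tau>. (if ?on s \<tau> then ?g \<tau> else 0) \<partial>lborel))"
      using powr_mono[of p 2 "4::real"] p by (intro mult_mono ennreal_leI) auto
    also have "\<dots> = (\<integral>\<^sup>+\<tau>. ennreal C * (if ?on s \<tau> then ?g \<tau> else 0) \<partial>lborel)"
      by (subst nn_integral_cmult) (auto simp: C_def ennreal_mult mult.assoc)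
    also have "\<dots> = (\<integral>\<^sup>+\<tau>. (if ?on s \<tau> then ennreal C * ?g \<tau> else 0) \<partial>lborel)"
      by (intro nn_integral_cong) simp
    finally show ?thesis using Q0 by (simp add: powr_mult ennreal_mult)
  qed
  define J where "J s = (\<integral>\<^sup>+\<tau>. (if ?on s \<tau> then ennreal C * ?g \<tau> else 0) \<partial>lborel)" for s
  have [measurable]: "J \<in> borel_measurable borel" unfolding J_def[abs_def] by measurable
  let ?P = "poisson ((1 - x) / (1 - x / 2))"
  have "(\<integral>\<^sup>+s. ennreal (?P s) * (\<integral>\<^sup>+\<theta>. ennreal (norm (F (polar (1 - x / 2) (\<theta> + s)) - F (polar (1 - x) \<theta>)) powr p) \<partial>circle) \<partial>circle)
     \<le> (\<integral>\<^sup>+s. ennreal (128 * x * max x \<bar>s\<bar> powr (- 2)) * J s \<partial>circle)"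
  proof (rule nn_integral_mono_AE)
    show "AE s in circle. ennreal (?P s) * (\<integral>\<^sup>+\<theta>. ennreal (norm (F (polar (1 - x / 2) (\<theta> + s)) - F (polar (1 - x) \<theta>)) powr p) \<partial>circle)
      \<le> ennreal (128 * x * max x \<bar>s\<bar> powr (- 2)) * J s"
      using AE_circle_range
    proof (rule AE_mp, intro AE_I2 impI)
      fix s assume "s \<in> {- pi..pi}"
      then have s: "\<bar>s\<bar> \<le> pi" by auto
      have "Lp_le p (\<lambda>\<theta>. F (polar (1 - x / 2) (\<theta> + s)) - F (polar (1 - x) \<theta>)) (4 * Q s)"
        by (rule Lp_le_path_increment[OF _ F x _ anti \<mu> Q0 Q]) (use p in auto)
      then have "(\<integral>\<^sup>+\<theta>. ennreal (norm (F (polar (1 - x / 2) (\<theta> + s)) - F (polar (1 - x) \<theta>)) powr p) \<partial>circle) \<le> J s"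
        using Qp[of s] unfolding Lp_le_def J_def by (auto intro: order_trans)
      then show "ennreal (?P s) * (\<integral>\<^sup>+\<theta>. ennreal (norm (F (polar (1 - x / 2) (\<theta> + s)) - F (polar (1 - x) \<theta>)) powr p) \<partial>circle)
        \<le> ennreal (128 * x * max x \<bar>s\<bar> powr (- 2)) * J s"
        using poisson_dyadic_le[OF x s] by (intro mult_mono ennreal_leI) auto
    qed
  qed
  also have "\<dots> \<le> (\<integral>\<^sup>+s. ennreal (128 * x * max x \<bar>s\<bar> powr (- 2)) * J s \<partial>lborel)"
  proof -
    have "(\<integral>\<^sup>+s. ennreal (128 * x * max x \<bar>s\<bar> powr (- 2)) * J s \<partial>circle)
      \<le> (\<integral>\<^sup>+s. ennreal (128 * x * max x \<bar>s\<bar> powr (- 2)) * J s * indicator {-pi..pi} s \<partial>lborel)"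
      by (subst nn_integral_circle) (auto intro: ennreal_divide_2pi_le)
    also have "\<dots> \<le> (\<integral>\<^sup>+s. ennreal (128 * x * max x \<bar>s\<bar> powr (- 2)) * J s \<partial>lborel)"
      by (intro nn_integral_mono) (simp add: indicator_def)
    finally show ?thesis .
  qed
  also have "\<dots> = (\<integral>\<^sup>+s. (\<integral>\<^sup>+\<tau>. ennreal (128 * x * max x \<bar>s\<bar> powr (- 2)) * (if ?on s \<tau> then ennreal C * ?g \<tau> else 0) \<partial>lborel) \<partial>lborel)"
    unfolding J_def by (intro nn_integral_cong nn_integral_cmult[symmetric]) measurable
  also have "\<dots> = (\<integral>\<^sup>+\<tau>. (\<integral>\<^sup>+s. ennreal (128 * x * max x \<bar>s\<bar> powr (- 2)) * (if ?on s \<tau> then ennreal C * ?g \<tau> else 0) \<partial>lborel) \<partial>lborel)"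
    by (rule lborel_pair.Fubini') measurable
  also have "\<dots> \<le> (\<integral>\<^sup>+\<tau>. ennreal (C * (512 * x)) * (ennreal (a \<tau> powr p * \<tau> powr (- (1 / 2))) * indicator {x / 2..1} \<tau>) \<partial>lborel)"
  proof (intro nn_integral_mono)
    fix \<tau>
    show "(\<integral>\<^sup>+s. ennreal (128 * x * max x \<bar>s\<bar> powr (- 2)) * (if ?on s \<tau> then ennreal C * ?g \<tau> else 0) \<partial>lborel)
      \<le> ennreal (C * (512 * x)) * (ennreal (a \<tau> powr p * \<tau> powr (- (1 / 2))) * indicator {x / 2..1} \<tau>)"
    proof (cases "x / 2 \<le> \<tau> \<and> \<tau> \<le> 1")
      case True
      then have \<tau>: "0 < \<tau>" using x by auto
      have "(\<integral>\<^sup>+s. ennreal (128 * x * max x \<bar>s\<bar> powr (- 2)) * (if ?on s \<tau> then ennreal C * ?g \<tau> else 0) \<partial>lborel)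
        \<le> (\<integral>\<^sup>+s. (ennreal C * ?g \<tau>) * ennreal (128 * x) * ennreal (max \<tau> \<bar>s\<bar> powr (- 2) * \<bar>s\<bar> powr (- 0)) \<partial>lborel)"
      proof (rule nn_integral_mono_AE, rule AE_mp[OF AE_lborel_singleton[of 0]], intro AE_I2 impI)
        fix s :: real assume s: "s \<noteq> 0"
        \<comment> \<open>The path for \<open>s\<close> reaches depth \<open>\<tau>\<close> only if
          \<open>\<tau> \<le> max x \<bar>s\<bar>\<close>. On that range the kernel may be replaced
          by the one at scale \<open>\<tau>\<close>, whose integral is of order
          \<open>x / \<tau>\<close>.\<close>
        have "max x \<bar>s\<bar> powr (- 2) \<le> max \<tau> \<bar>s\<bar> powr (- 2)" if "\<tau> \<le> max x \<bar>s\<bar>"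
          using that \<tau> by (intro powr_mono2') auto
        then show "ennreal (128 * x * max x \<bar>s\<bar> powr (- 2)) * (if ?on s \<tau> then ennreal C * ?g \<tau> else 0)
          \<le> (ennreal C * ?g \<tau>) * ennreal (128 * x) * ennreal (max \<tau> \<bar>s\<bar> powr (- 2) * \<bar>s\<bar> powr (- 0))"
          using s x by (auto simp: ennreal_mult mult_ac intro!: mult_left_mono ennreal_leI)
      qed
      also have "\<dots> \<le> (ennreal C * ?g \<tau>) * ennreal (128 * x) * ennreal (power_kernel_const 2 0 * \<tau> powr (1 - 2 - 0))"
        by (subst nn_integral_cmult, measurable) (intro mult_left_mono power_kernel_integral \<tau>, simp_all)
      also have "\<dots> = ennreal (C * (a \<tau> powr p * \<tau> powr (1 / 2)) * (128 * x) * (4 * \<tau> powr (- 1)))"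
      proof -
        have "ennreal a * ennreal b * ennreal c * ennreal d = ennreal (a * b * c * d)"
          if "0 \<le> a" "0 \<le> b" "0 \<le> c" "0 \<le> d" for a b c d using that by (simp add: ennreal_mult)
        moreover have "power_kernel_const 2 0 * \<tau> powr (1 - 2 - 0) = 4 * \<tau> powr (- 1)" by (simp add: power_kernel_const_def)
        ultimately show ?thesis using x by (simp only:) (simp add: C_def)
      qed
      also have "C * (a \<tau> powr p * \<tau> powr (1 / 2)) * (128 * x) * (4 * \<tau> powr (- 1)) = C * (512 * x) * (a \<tau> powr p * (\<tau> powr (1 / 2) * \<tau> powr (- 1)))"
        by simp
      also have "\<tau> powr (1 / 2) * \<tau> powr (- 1) = \<tau> powr (- (1 / 2))"
        by (simp only: powr_add[symmetric]) simp
      also have "ennreal (C * (512 * x) * (a \<tau> powr p * \<tau> powr (- (1 / 2)))) = ennreal (C * (512 * x)) * (ennreal (a \<tau> powr p * \<tau> powr (- (1 / 2))) * indicator {x / 2..1} \<tau>)"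
        using True x by (subst ennreal_mult) (auto simp: C_def)
      finally show ?thesis .
    qed auto
  qed
  also have "\<dots> = ennreal (C * (512 * x)) * (\<integral>\<^sup>+\<tau>. ennreal (a \<tau> powr p * \<tau> powr (- (1 / 2))) * indicator {x / 2..1} \<tau> \<partial>lborel)"
    by (rule nn_integral_cmult) measurable
  finally have "13 * (\<integral>\<^sup>+s. ennreal (?P s) * (\<integral>\<^sup>+\<theta>. ennreal (norm (F (polar (1 - x / 2) (\<theta> + s)) - F (polar (1 - x) \<theta>)) powr p) \<partial>circle) \<partial>circle)
     \<le> ennreal 13 * (ennreal (C * (512 * x)) * (\<integral>\<^sup>+\<tau>. ennreal (a \<tau> powr p * \<tau> powr (- (1 / 2))) * indicator {x / 2..1} \<tau> \<partial>lborel))"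
    by (simp add: mult_left_mono)
  also have "\<dots> = ennreal (13 * (C * (512 * x))) * (\<integral>\<^sup>+\<tau>. ennreal (a \<tau> powr p * \<tau> powr (- (1 / 2))) * indicator {x / 2..1} \<tau> \<partial>lborel)"
    by (subst ennreal_mult[of 13]) (use x in \<open>auto simp: C_def mult.assoc\<close>)
  also have "\<dots> \<le> ennreal (dyadic_const p * sqrt x) * (\<integral>\<^sup>+\<tau>. ennreal (a \<tau> powr p * \<tau> powr (- (1 / 2))) * indicator {x / 2..1} \<tau> \<partial>lborel)"
  proof (intro mult_right_mono ennreal_leI)
    have e: "(x / 2) powr (- k) / k = (x / 2) powr (- k) * (2 * (p - 1))" by (simp add: k_def)
    have "((x / 2) powr (- k) / k) powr (p - 1) = (x / 2) powr (- (1 / 2)) * (2 * (p - 1)) powr (p - 1)"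
      unfolding e powr_mult powr_powr mult_minus_left k(2) ..
    also have "(x / 2) powr (- (1 / 2)) = sqrt 2 / sqrt x"
      using x by (simp add: powr_minus_divide powr_half_sqrt real_sqrt_divide)
    finally have "13 * (C * (512 * x)) = (13 * 16 * 512 * sqrt 2) * ((x / sqrt x) * (2 * (p - 1)) powr (p - 1))"
      by (simp add: C_def)
    also have "x / sqrt x = sqrt x" using x by (simp add: real_div_sqrt)
    also have "(13 * 16 * 512 * sqrt 2) * (sqrt x * (2 * (p - 1)) powr (p - 1)) \<le> 2 ^ 18 * (sqrt x * (2 * (p - 1)) powr (p - 1))"
      using x sqrt2_less_2 by (intro mult_right_mono) auto
    finally show "13 * (C * (512 * x)) \<le> dyadic_const p * sqrt x" by (simp add: dyadic_const_def)
  qed simp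
  finally have "13 * (\<integral>\<^sup>+s. ennreal (?P s) * (\<integral>\<^sup>+\<theta>. ennreal (norm (F (polar (1 - x / 2) (\<theta> + s)) - F (polar (1 - x) \<theta>)) powr p) \<partial>circle) \<partial>circle)
    \<le> ennreal (dyadic_const p * sqrt x) * (\<integral>\<^sup>+\<tau>. ennreal (a \<tau> powr p * \<tau> powr (- (1 / 2))) * indicator {x / 2..1} \<tau> \<partial>lborel)" .
  then show ?thesis
    using poisson_increment[OF p F, of "1 - x" "1 - x / 2"] x by (auto elim!: order_trans intro: add_left_mono)
qed

text \<open>This bound replaces the Littlewood--Paley inequality: the mean of \<open>F'\<close> enters only through
  the weight \<open>\<tau> powr (1 / p - 1)\<close>.\<close>

lemma Lp_le_from_derivative_means:
  fixes \<mu> a :: "real \<Rightarrow> real"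
  assumes p: "1 < p" "p \<le> 2" and F: "F holomorphic_on ball 0 1"
    and [measurable]: "\<mu> \<in> borel_measurable borel" "a \<in> borel_measurable borel"
    and anti: "\<And>\<sigma> \<tau>. 0 < \<sigma> \<Longrightarrow> \<sigma> \<le> \<tau> \<Longrightarrow> \<mu> \<tau> \<le> \<mu> \<sigma>"
    and \<mu>: "\<And>\<tau>. 0 < \<tau> \<Longrightarrow> \<tau> \<le> 1 \<Longrightarrow> Lp_le p (\<lambda>\<theta>. deriv F (polar (1 - \<tau>) \<theta>)) (\<mu> \<tau>)"
    and a: "\<And>\<tau>. 0 < \<tau> \<Longrightarrow> \<tau> \<le> 1 \<Longrightarrow> \<mu> \<tau> \<le> a \<tau> * \<tau> powr (1 / p - 1)"
    and G: "0 \<le> G" "(\<integral>\<^sup>+\<tau>. ennreal (a \<tau> powr p) * indicator {0<..1} \<tau> \<partial>lborel) \<le> ennreal G"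
    and r: "0 \<le> r" "r < 1"
  shows "Lp_le p (\<lambda>\<theta>. F (polar r \<theta>)) ((norm (F 0) powr p + 8 * dyadic_const p * G) powr (1 / p))"
proof -
  define I where "I n = (\<integral>\<^sup>+\<theta>. ennreal (norm (F (of_real (1 - (1 / 2) ^ n) * cis \<theta>)) powr p) \<partial>circle)" for n
  have K: "0 \<le> dyadic_const p" by (simp add: dyadic_const_def)
  let ?h = "\<lambda>n \<tau>. ennreal (a \<tau> powr p * \<tau> powr (- (1 / 2))) * indicator {(1 / 2) ^ n / 2..1} \<tau>"
  have step: "I (Suc n) \<le> I n + (\<integral>\<^sup>+\<tau>. ennreal (dyadic_const p * sqrt ((1 / 2) ^ n)) * ?h n \<tau> \<partial>lborel)" for n
  proof -
    have "I (Suc n) \<le> I n + ennreal (dyadic_const p * sqrt ((1 / 2) ^ n)) * (\<integral>\<^sup>+\<tau>. ?h n \<tau> \<partial>lborel)"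
      using dyadic_increment[OF p F, of "(1 / 2) ^ n", OF _ _ _ _ anti \<mu> a]
      by (simp add: I_def power_le_one mult.commute)
    then show ?thesis by (subst nn_integral_cmult) auto
  qed
  have sum: "I N \<le> I 0 + (\<integral>\<^sup>+\<tau>. (\<Sum>n<N. ennreal (dyadic_const p * sqrt ((1 / 2) ^ n)) * ?h n \<tau>) \<partial>lborel)" for N
  proof -
    have "I N \<le> I 0 + (\<Sum>n<N. (\<integral>\<^sup>+\<tau>. ennreal (dyadic_const p * sqrt ((1 / 2) ^ n)) * ?h n \<tau> \<partial>lborel))"
    proof (induction N)
      case (Suc N)
      then show ?case using order_trans[OF step add_right_mono[OF Suc]] by (simp add: add.assoc)
    qed simp
    then show ?thesis by (subst nn_integral_sum) auto
  qed
  \<comment> \<open>For fixed \<open>\<tau>\<close> only the scales with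
    \<open>(1 / 2) ^ n \<le> 2 * \<tau>\<close> occur. Their square roots sum to at most
    \<open>4 * sqrt (2 * \<tau>)\<close>, which cancels \<open>\<tau> powr (- (1 / 2))\<close> and
    leaves the factor 8, uniformly in \<open>N\<close>.\<close>
  have pt: "(\<Sum>n<N. ennreal (dyadic_const p * sqrt ((1 / 2) ^ n)) * ?h n \<tau>) \<le> ennreal (8 * dyadic_const p) * (ennreal (a \<tau> powr p) * indicator {0<..1} \<tau>)" for N \<tau>
  proof (cases "0 < \<tau> \<and> \<tau> \<le> 1")
    case True
    then have \<tau>: "0 < \<tau>" "\<tau> \<le> 1" by auto
    let ?c = "dyadic_const p * (a \<tau> powr p * \<tau> powr (- (1 / 2)))"
    have "(\<Sum>n<N. ennreal (dyadic_const p * sqrt ((1 / 2) ^ n)) * ?h n \<tau>)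
      = (\<Sum>n<N. ennreal (?c * (if (1 / 2) ^ n \<le> 2 * \<tau> then sqrt ((1 / 2) ^ n) else 0)))"
      using \<tau> K by (intro sum.cong refl) (auto simp: indicator_def ennreal_mult mult_ac)
    also have "\<dots> = ennreal (?c * (\<Sum>n<N. if (1 / 2) ^ n \<le> 2 * \<tau> then sqrt ((1 / 2) ^ n) else 0))"
      unfolding sum_distrib_left using K by (intro sum_ennreal) auto
    also have "\<dots> \<le> ennreal (?c * (4 * sqrt (2 * \<tau>)))"
      using K by (intro ennreal_leI mult_left_mono dyadic_sqrt_sum \<tau>) auto
    also have "?c * (4 * sqrt (2 * \<tau>)) = (4 * sqrt 2) * dyadic_const p * a \<tau> powr p * (\<tau> powr (- (1 / 2)) * \<tau> powr (1 / 2))"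
      using \<tau> by (simp add: real_sqrt_mult powr_half_sqrt)
    also have "\<tau> powr (- (1 / 2)) * \<tau> powr (1 / 2) = 1" using \<tau> by (simp flip: powr_add)
    also have "ennreal ((4 * sqrt 2) * dyadic_const p * a \<tau> powr p * 1) \<le> ennreal (8 * dyadic_const p * a \<tau> powr p)"
      using mult_right_mono[of "sqrt 2" 2 "4 * dyadic_const p * a \<tau> powr p"] sqrt2_less_2 K
      by (intro ennreal_leI) (simp add: mult_ac)
    finally show ?thesis using True K by (simp add: ennreal_mult)
  next
    case False
    have "0 < (1 / 2 :: real) ^ n / 2" for n by simp
    then have "\<not> ((1 / 2) ^ n / 2 \<le> \<tau> \<and> \<tau> \<le> 1)" for n using False by (meson less_le_trans)
    then have "?h n \<tau> = 0" for n by simp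
    then have "(\<Sum>n<N. ennreal (dyadic_const p * sqrt ((1 / 2) ^ n)) * ?h n \<tau>) = 0"
      by (simp only: mult_zero_right sum.neutral_const)
    then show ?thesis by (simp only: zero_le)
  qed
  define W where "W = norm (F 0) powr p + 8 * dyadic_const p * G"
  have W0: "0 \<le> W" using K G by (simp add: W_def)
  have IN: "I N \<le> ennreal W" for N
  proof -
    have "I N \<le> I 0 + (\<integral>\<^sup>+\<tau>. ennreal (8 * dyadic_const p) * (ennreal (a \<tau> powr p) * indicator {0<..1} \<tau>) \<partial>lborel)"
      by (intro order_trans[OF sum] add_left_mono nn_integral_mono pt)
    also have "\<dots> = I 0 + ennreal (8 * dyadic_const p) * (\<integral>\<^sup>+\<tau>. ennreal (a \<tau> powr p) * indicator {0<..1} \<tau> \<partial>lborel)"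
      by (subst nn_integral_cmult) auto
    also have "\<dots> \<le> I 0 + ennreal (8 * dyadic_const p) * ennreal G"
      by (intro add_left_mono mult_left_mono G) auto
    also have "I 0 = ennreal (norm (F 0) powr p)" by (simp add: I_def emeasure_circle_UNIV)
    finally show ?thesis using K G by (simp add: W_def ennreal_mult)
  qed
  \<comment> \<open>Finitely many dyadic steps reach a circle outside radius \<open>r\<close>, and
    means are monotone.\<close>
  obtain N where N: "(1 / 2) ^ N < 1 - r" using real_arch_pow_inv[of "1 - r" "1 / 2"] r by auto
  have L: "Lp_le p (\<lambda>\<theta>. F (of_real (1 - (1 / 2) ^ N) * cis \<theta>)) (W powr (1 / p))"
    using IN[of N] W0 p unfolding Lp_le_def I_def by (simp add: powr_powr)
  show ?thesis
    by (rule Lp_le_radius_mono[OF _ F _ _ _ L[unfolded W_def]]) (use p r N in auto)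
qed

section \<open>Compactness\<close>

definition seg_norm :: "(complex \<Rightarrow> complex) \<Rightarrow> real" where
  "seg_norm f = enn2real (\<integral>\<^sup>+u. ennreal (seg_abs f u) \<partial>lborel)"

lemma seg_norm_nonneg: "0 \<le> seg_norm f"
  by (simp add: seg_norm_def)

lemma nn_integral_seg_norm:
  assumes "f \<in> Hardy p" "1 < p"
  shows "(\<integral>\<^sup>+u. ennreal (seg_abs f u) \<partial>lborel) = ennreal (seg_norm f)"
  using seg_abs_Hardy(2)[OF assms] by (simp add: seg_norm_def)

text \<open>The Fejer--Riesz bound for the p-norm of \<open>f\<close> along the radius, in
  first-power form so that it can be scaled together with \<open>\<epsilon>\<close>.\<close>

definition seg_bound :: "real \<Rightarrow> (complex \<Rightarrow> complex) \<Rightarrow> real" where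
  "seg_bound p f = Fejer_Riesz_const p powr (1 / p) * Hardy_norm p f"

lemma seg_bound:
  assumes f: "f \<in> Hardy p" and p: "1 < p"
  shows "0 \<le> seg_bound p f" "(\<integral>\<^sup>+u. ennreal (seg_abs f u powr p) \<partial>lborel) \<le> ennreal (seg_bound p f powr p)"
  using seg_abs_Hardy(1)[OF f p] Fejer_Riesz_const_nonneg[OF p] Hardy_norm_nonneg[OF f] p
  by (auto simp: seg_bound_def powr_mult powr_powr)

lemma norm_gen_Hilbert_0_le:
  assumes f: "f \<in> Hardy p" and p: "1 < p" and g: "g holomorphic_on ball 0 1"
  shows "norm (gen_Hilbert g f 0) \<le> norm (deriv g 0) * seg_norm f"
proof -
  have hol: "f holomorphic_on ball 0 1" using f by (rule Hardy_holomorphic)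
  have "gen_Hilbert g f 0 = (LINT t|unit_seg. f (of_real t)) * deriv g 0"
    using gen_Hilbert_eq[OF hol g, of 0] by simp
  moreover have "ennreal (norm (LINT t|unit_seg. f (of_real t))) \<le> ennreal (seg_norm f)"
    using integral_norm_bound_ennreal[OF integrable_unit_seg[OF f p]]
      nn_integral_seg_abs[OF hol, of "\<lambda>_. 1"] nn_integral_seg_norm[OF f p] by simp
  ultimately show ?thesis
    using mult_left_mono[of "norm (LINT t|unit_seg. f (of_real t))" "seg_norm f" "norm (deriv g 0)"] seg_norm_nonneg[of f]
    by (simp add: norm_mult ennreal_le_iff mult.commute)
qed

text \<open>An Ehrling-type inequality: an arbitrarily small multiple of the norm plus a large
  multiple of a weaker norm. It is the common interface of the two ranges of exponents; compactness
  is derived from it once.\<close>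

definition segment_controlled :: "real \<Rightarrow> ((complex \<Rightarrow> complex) \<Rightarrow> complex \<Rightarrow> complex) \<Rightarrow> bool" where
  "segment_controlled p T \<longleftrightarrow> (\<forall>\<epsilon>>0. \<exists>B\<ge>0. \<forall>f\<in>Hardy p. \<forall>r. 0 < r \<longrightarrow> r < 1 \<longrightarrow>
     Lp_le p (\<lambda>\<theta>. T f (polar r \<theta>)) (\<epsilon> * Hardy_norm p f + B * seg_norm f))"

text \<open>A fixed factor \<open>C\<close> and the Fejer--Riesz constant are harmless since
  \<open>\<epsilon>\<close> is arbitrary: it is divided by their product plus 1 beforehand.\<close>

lemma segment_controlledI:
  assumes p: "1 < p" and C: "0 \<le> C"
    and le: "\<And>\<epsilon>. 0 < \<epsilon> \<Longrightarrow> \<exists>B\<ge>0. \<forall>f\<in>Hardy p. \<forall>r. 0 < r \<longrightarrow> r < 1 \<longrightarrow>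
       Lp_le p (\<lambda>\<theta>. T f (polar r \<theta>)) (C * (\<epsilon> * seg_bound p f) + B * seg_norm f)"
  shows "segment_controlled p T"
  unfolding segment_controlled_def
proof (intro allI impI)
  fix \<epsilon> :: real assume \<epsilon>: "0 < \<epsilon>"
  define D where "D = C * Fejer_Riesz_const p powr (1 / p)"
  have D: "0 \<le> D" using C by (simp add: D_def)
  obtain B where B: "0 \<le> B" "\<And>f r. f \<in> Hardy p \<Longrightarrow> 0 < r \<Longrightarrow> r < 1 \<Longrightarrow>
       Lp_le p (\<lambda>\<theta>. T f (polar r \<theta>)) (C * (\<epsilon> / (D + 1) * seg_bound p f) + B * seg_norm f)"
    using le[of "\<epsilon> / (D + 1)"] \<epsilon> D by auto
  show "\<exists>B\<ge>0. \<forall>f\<in>Hardy p. \<forall>r. 0 < r \<longrightarrow> r < 1 \<longrightarrow>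
     Lp_le p (\<lambda>\<theta>. T f (polar r \<theta>)) (\<epsilon> * Hardy_norm p f + B * seg_norm f)"
  proof (intro exI conjI ballI allI impI)
    fix f r assume f: "f \<in> Hardy p" and r: "0 < r" "r < (1::real)"
    have N: "0 \<le> Hardy_norm p f" using Hardy_norm_nonneg[OF f] p by simp
    have "C * (\<epsilon> / (D + 1) * seg_bound p f) = D / (D + 1) * (\<epsilon> * Hardy_norm p f)"
      by (simp add: D_def seg_bound_def)
    also have "\<dots> \<le> 1 * (\<epsilon> * Hardy_norm p f)"
      using D \<epsilon> N by (intro mult_right_mono) auto
    finally show "Lp_le p (\<lambda>\<theta>. T f (polar r \<theta>)) (\<epsilon> * Hardy_norm p f + B * seg_norm f)"
      using p by (intro Lp_le_mono[OF B(2)[OF f r]]) auto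
  qed (fact B)
qed

text \<open>Since \<open>max \<tau> \<bar>u\<bar>\<close> is at least \<open>\<tau>\<close>, the
  kernel of exponent \<open>2 - 1 / p\<close> is at most the kernel of degree -1 times
  \<open>\<tau> powr (1 / p - 1)\<close>. That power is exactly the one the dyadic estimate allows,
  and the Schur test with \<open>\<alpha> = 0\<close> handles the rest.\<close>

lemma gen_Hilbert_controlled_le_2:
  assumes p: "1 < p" "p \<le> 2" and g: "g \<in> little_mean_Lipschitz p (1 / p)"
  shows "segment_controlled p (gen_Hilbert g)"
proof (rule segment_controlledI)
  have hol: "g holomorphic_on ball 0 1" using g by (auto simp: little_mean_Lipschitz_def intro: Hardy_holomorphic)
  define S where "S = Schur_const p 0"
  have S: "0 \<le> S" using Schur_const_nonneg[of p 0] p by (simp add: S_def)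
  define D where "D = 8 * dyadic_const p * 2 powr p * (S + 1) + 1"
  have K: "0 \<le> dyadic_const p" by (simp add: dyadic_const_def)
  have D: "0 \<le> D" "1 \<le> D" using S K by (auto simp: D_def)
  define C where "C = (2 * D) powr (1 / p)"
  show C: "0 \<le> C" by (simp add: C_def)
  fix \<epsilon> :: real assume \<epsilon>: "0 < \<epsilon>"
  obtain B where B: "0 \<le> B" and g'': "\<And>x. 0 \<le> x \<Longrightarrow> x < 1 \<Longrightarrow>
     Lp_le p (\<lambda>\<theta>. deriv (deriv g) (polar x \<theta>)) (\<epsilon> * (1 - x) powr (1 / p - 2) + B)"
    using mean_Lipschitz_second_derivative[OF g p(1) \<epsilon>] by blast
  \<comment> \<open>One constant for both the lower-order part of the kernel and the value of the
    image at 0.\<close>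
  define B2 where "B2 = B + norm (deriv g 0)"
  have B2: "B \<le> B2" "norm (deriv g 0) \<le> B2" "0 \<le> B2" using B by (auto simp: B2_def)
  have main: "Lp_le p (\<lambda>\<theta>. gen_Hilbert g f (polar r \<theta>)) (C * (\<epsilon> * seg_bound p f + B2 * seg_norm f))"
    if f: "f \<in> Hardy p" and r: "0 < r" "r < 1" for f r
  proof -
    let ?v = "seg_abs f" and ?F = "gen_Hilbert g f" and ?X = "seg_bound p f" and ?Y = "seg_norm f"
    have [measurable]: "?v \<in> borel_measurable borel" using Hardy_holomorphic[OF f] by measurable
    have fin: "kernel_mean b \<epsilon> B ?v \<tau> < \<infinity>" if "0 < \<tau>" "0 \<le> b" for b \<tau>
      using that \<epsilon> B seg_abs_Hardy(2)[OF f p(1)] by (intro kernel_mean_finite) (auto simp: seg_abs_nonneg)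
    have X: "0 \<le> ?X" using seg_bound[OF f p(1)] by simp
    define \<mu> where "\<mu> \<tau> = enn2real (kernel_mean (2 - 1 / p) \<epsilon> B ?v \<tau>)" for \<tau>
    define a where "a \<tau> = enn2real (kernel_mean 1 \<epsilon> B ?v \<tau>)" for \<tau>
    have b: "0 \<le> 2 - 1 / p" "0 \<le> 1 - 1 / p" using p by (auto simp: field_simps)
    define G where "G = 2 powr p * (S * \<epsilon> powr p * ?X powr p + (B * ?Y) powr p)"
    have G0: "0 \<le> G" using S by (simp add: G_def)
    have L: "Lp_le p (\<lambda>\<theta>. ?F (polar r \<theta>)) ((norm (?F 0) powr p + 8 * dyadic_const p * G) powr (1 / p))"
    proof (rule Lp_le_from_derivative_means[where \<mu>=\<mu> and a=a])
      show "?F holomorphic_on ball 0 1" by (rule gen_Hilbert_holomorphic[OF f p(1) hol])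
      show "\<mu> \<in> borel_measurable borel" "a \<in> borel_measurable borel"
        unfolding \<mu>_def[abs_def] a_def[abs_def] by measurable
      show "\<mu> \<tau> \<le> \<mu> \<sigma>" if "0 < \<sigma>" "\<sigma> \<le> \<tau>" for \<sigma> \<tau>
        unfolding \<mu>_def
      proof (rule enn2real_mono)
        show "kernel_mean (2 - 1 / p) \<epsilon> B ?v \<tau> \<le> kernel_mean (2 - 1 / p) \<epsilon> B ?v \<sigma>"
          unfolding kernel_mean_def using that \<epsilon> b
          by (intro nn_integral_mono ennreal_leI mult_right_mono add_right_mono mult_left_mono powr_mono2')
            (auto simp: seg_abs_nonneg)
        show "kernel_mean (2 - 1 / p) \<epsilon> B ?v \<sigma> < top" using fin[OF that(1) b(1)] by simp
      qed
      show "Lp_le p (\<lambda>\<theta>. deriv ?F (polar (1 - \<tau>) \<theta>)) (\<mu> \<tau>)" if "0 < \<tau>" "\<tau> \<le> 1" for \<tau>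
        unfolding \<mu>_def using \<epsilon> B by (intro gen_Hilbert_deriv_mean[OF f p(1) hol p(1)] g'' that) auto
      show "\<mu> \<tau> \<le> a \<tau> * \<tau> powr (1 / p - 1)" if \<tau>: "0 < \<tau>" "\<tau> \<le> 1" for \<tau>
      proof -
        have "kernel_mean (2 - 1 / p) \<epsilon> B ?v \<tau> \<le> (\<integral>\<^sup>+u. ennreal ((\<epsilon> * max \<tau> \<bar>u\<bar> powr (- 1) + B) * ?v u) * ennreal (\<tau> powr (1 / p - 1)) \<partial>lborel)"
          unfolding kernel_mean_def
        proof (intro nn_integral_mono)
          fix u
          have "max \<tau> \<bar>u\<bar> powr (- (2 - 1 / p)) = max \<tau> \<bar>u\<bar> powr (- 1) * max \<tau> \<bar>u\<bar> powr (- (1 - 1 / p))"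
            by (simp only: powr_add[symmetric]) simp
          also have "\<dots> \<le> max \<tau> \<bar>u\<bar> powr (- 1) * \<tau> powr (- (1 - 1 / p))"
            using \<tau> b by (intro mult_left_mono powr_mono2') auto
          finally have "\<epsilon> * max \<tau> \<bar>u\<bar> powr (- (2 - 1 / p)) \<le> \<epsilon> * (max \<tau> \<bar>u\<bar> powr (- 1) * \<tau> powr (1 / p - 1))"
            using \<epsilon> by (intro mult_left_mono) auto
          moreover have "B * 1 \<le> B * \<tau> powr (1 / p - 1)"
            using B \<tau> b powr_mono2'[of "1 / p - 1" \<tau> 1] by (intro mult_left_mono) auto
          ultimately have "\<epsilon> * max \<tau> \<bar>u\<bar> powr (- (2 - 1 / p)) + B \<le> (\<epsilon> * max \<tau> \<bar>u\<bar> powr (- 1) + B) * \<tau> powr (1 / p - 1)"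
            by (simp add: algebra_simps)
          then have "(\<epsilon> * max \<tau> \<bar>u\<bar> powr (- (2 - 1 / p)) + B) * ?v u \<le> ((\<epsilon> * max \<tau> \<bar>u\<bar> powr (- 1) + B) * \<tau> powr (1 / p - 1)) * ?v u"
            by (rule mult_right_mono) (rule seg_abs_nonneg)
          also have "\<dots> = ((\<epsilon> * max \<tau> \<bar>u\<bar> powr (- 1) + B) * ?v u) * \<tau> powr (1 / p - 1)" by (simp only: mult_ac)
          finally show "ennreal ((\<epsilon> * max \<tau> \<bar>u\<bar> powr (- (2 - 1 / p)) + B) * ?v u)
            \<le> ennreal ((\<epsilon> * max \<tau> \<bar>u\<bar> powr (- 1) + B) * ?v u) * ennreal (\<tau> powr (1 / p - 1))"
            using \<epsilon> B by (subst ennreal_mult[symmetric]) (auto simp: seg_abs_nonneg intro!: ennreal_leI)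
        qed
        also have "\<dots> = kernel_mean 1 \<epsilon> B ?v \<tau> * ennreal (\<tau> powr (1 / p - 1))"
          unfolding kernel_mean_def by (rule nn_integral_multc) measurable
        finally have "ennreal (\<mu> \<tau>) \<le> ennreal (a \<tau> * \<tau> powr (1 / p - 1))"
          unfolding \<mu>_def a_def using fin[OF \<tau>(1) b(1)] fin[OF \<tau>(1), of 1] by (simp add: ennreal_mult)
        then show ?thesis by (subst (asm) ennreal_le_iff) (auto simp: a_def)
      qed
      have "(\<integral>\<^sup>+\<tau>. ennreal (a \<tau> powr p) * indicator {0<..1} \<tau> \<partial>lborel)
         \<le> ennreal (2 powr p * (Schur_const p 0 * \<epsilon> powr p * ?X powr p + (B * ?Y) powr p))"
      proof (rule Schur_plus_const[OF p(1)])
        show "(\<integral>\<^sup>+u. ennreal (?v u powr p) \<partial>lborel) \<le> ennreal (?X powr p)" by (rule seg_bound[OF f p(1)])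
        show "(\<integral>\<^sup>+u. ennreal (?v u) \<partial>lborel) \<le> ennreal ?Y" by (simp add: nn_integral_seg_norm[OF f p(1)])
        show "a \<in> borel_measurable borel" unfolding a_def[abs_def] by measurable
        show "ennreal (a \<tau>) \<le> (\<integral>\<^sup>+u. ennreal ((\<epsilon> * hom_kernel 0 \<tau> u + B) * ?v u) \<partial>lborel)" if \<tau>: "0 < \<tau>" for \<tau>
        proof -
          have "ennreal (a \<tau>) = kernel_mean 1 \<epsilon> B ?v \<tau>" using fin[OF \<tau>, of 1] by (simp add: a_def)
          also have "\<dots> = (\<integral>\<^sup>+u. ennreal ((\<epsilon> * hom_kernel 0 \<tau> u + B) * ?v u) \<partial>lborel)"
            unfolding kernel_mean_def using \<tau>
            by (intro nn_integral_cong) (auto simp: seg_abs_def hom_kernel_def indicator_def)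
          finally show ?thesis by simp
        qed
      qed (use p \<epsilon> B seg_norm_nonneg[of f] in \<open>auto simp: seg_abs_nonneg a_def\<close>)
      then show "(\<integral>\<^sup>+\<tau>. ennreal (a \<tau> powr p) * indicator {0<..1} \<tau> \<partial>lborel) \<le> ennreal G"
        by (simp add: G_def S_def)
    qed (use p r G0 in auto)
    have Y: "0 \<le> ?Y" by (rule seg_norm_nonneg)
    have "norm (?F 0) powr p + 8 * dyadic_const p * G \<le> D * ((\<epsilon> * ?X) powr p + (B2 * ?Y) powr p)"
    proof -
      have "norm (?F 0) \<le> B2 * ?Y"
        using norm_gen_Hilbert_0_le[OF f p(1) hol] mult_right_mono[OF B2(2) Y] by simp
      then have 1: "norm (?F 0) powr p \<le> 1 * ((\<epsilon> * ?X) powr p + (B2 * ?Y) powr p)"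
        using powr_mono2[of p "norm (?F 0)" "B2 * ?Y"] p by (simp add: add_increasing)
      have "(B * ?Y) powr p \<le> (B2 * ?Y) powr p"
        using B B2 Y p by (intro powr_mono2 mult_right_mono) auto
      moreover have "S * \<epsilon> powr p * ?X powr p = S * (\<epsilon> * ?X) powr p" by (simp add: powr_mult)
      moreover have "0 \<le> S * (B2 * ?Y) powr p" using S by simp
      ultimately have "S * \<epsilon> powr p * ?X powr p + (B * ?Y) powr p \<le> (S + 1) * ((\<epsilon> * ?X) powr p + (B2 * ?Y) powr p)"
        using powr_ge_zero[of "\<epsilon> * ?X" p] by (simp only: distrib_left distrib_right)
      then have "8 * dyadic_const p * 2 powr p * (S * \<epsilon> powr p * ?X powr p + (B * ?Y) powr p)
        \<le> 8 * dyadic_const p * 2 powr p * ((S + 1) * ((\<epsilon> * ?X) powr p + (B2 * ?Y) powr p))"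
        using K by (intro mult_left_mono) auto
      with 1 have "norm (?F 0) powr p + 8 * dyadic_const p * 2 powr p * (S * \<epsilon> powr p * ?X powr p + (B * ?Y) powr p)
        \<le> 1 * ((\<epsilon> * ?X) powr p + (B2 * ?Y) powr p) + 8 * dyadic_const p * 2 powr p * ((S + 1) * ((\<epsilon> * ?X) powr p + (B2 * ?Y) powr p))"
        by (rule add_mono)
      also have "\<dots> = D * ((\<epsilon> * ?X) powr p + (B2 * ?Y) powr p)" by (simp only: D_def distrib_right mult.assoc add.commute)
      finally show ?thesis by (simp add: G_def mult.assoc)
    qed
    also have "\<dots> \<le> (C * (\<epsilon> * ?X + B2 * ?Y)) powr p"
      unfolding C_def using D \<epsilon> X B2 Y p by (intro powr_sum_const_le) auto
    finally have "(norm (?F 0) powr p + 8 * dyadic_const p * G) powr (1 / p) \<le> ((C * (\<epsilon> * ?X + B2 * ?Y)) powr p) powr (1 / p)"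
      using K G0 p by (intro powr_mono2) auto
    also have "\<dots> = C * (\<epsilon> * ?X + B2 * ?Y)" using C \<epsilon> X B2 Y p by (simp add: powr_powr)
    finally show ?thesis using p by (intro Lp_le_mono[OF L]) auto
  qed
  show "\<exists>B\<ge>0. \<forall>f\<in>Hardy p. \<forall>r. 0 < r \<longrightarrow> r < 1 \<longrightarrow>
     Lp_le p (\<lambda>\<theta>. gen_Hilbert g f (polar r \<theta>)) (C * (\<epsilon> * seg_bound p f) + B * seg_norm f)"
    using main B2 C by (intro exI[of _ "C * B2"]) (auto simp: distrib_left mult.assoc)
qed (use p in auto)

text \<open>Point evaluation from the circle halfway to the boundary costs
  \<open>(2 / y) powr (1 / q)\<close>, which turns \<open>y powr (1 / q - 2)\<close> into
  \<open>y powr (- 2)\<close>. The 16 is the product of 2 from \<open>2 powr (1 / q)\<close>, 4 from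
  halving the distance, and 2 from absorbing the lower-order term.\<close>

lemma second_derivative_sup_bound:
  assumes g: "g holomorphic_on ball 0 1" and q: "1 < q" and eB: "0 < \<epsilon>" "0 \<le> B"
    and g'': "\<And>x. 0 \<le> x \<Longrightarrow> x < 1 \<Longrightarrow>
      Lp_le q (\<lambda>\<theta>. deriv (deriv g) (polar x \<theta>)) (\<epsilon> / 16 * (1 - x) powr (1 / q - 2) + B)"
  obtains B' where "0 \<le> B'" "\<And>w. norm w < 1 \<Longrightarrow> norm (deriv (deriv g) w) \<le> \<epsilon> * (1 - norm w) powr (- 2) + B'"
proof -
  have hol: "deriv (deriv g) holomorphic_on ball 0 1" using g by (intro holomorphic_intros) auto
  have iq: "0 < 1 / q" "1 / q < 2" using q by (auto simp: field_simps)
  obtain B3 where B3: "0 \<le> B3" "\<And>y. 0 < y \<Longrightarrow> B * y powr (- (1 / q)) \<le> \<epsilon> / 16 * y powr (- 2) + B3"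
    using powr_absorb[OF iq, of "\<epsilon> / 16" B] eB by auto
  show thesis
  proof (rule that[of "2 * B3"])
    fix w :: complex assume w: "norm w < 1"
    define y where "y = (1 - norm w) / 2"
    have y: "0 < y" "1 - (1 - y) = y" using w by (auto simp: y_def)
    have R: "norm w < 1 - y" "1 - y < 1" using w by (auto simp: y_def field_simps)
    have y1: "y \<le> 1" using norm_ge_zero[of w] unfolding y_def by (simp add: field_simps)
    have "norm (deriv (deriv g) (polar (norm w) (Arg w)))
      \<le> (2 * (1 - y) / (1 - y - norm w)) powr (1 / q) * (\<epsilon> / 16 * (1 - (1 - y)) powr (1 / q - 2) + B)"
      using q R y1 by (intro Lp_le_point_bound[OF _ hol] g'') auto
    also have "of_real (norm w) * cis (Arg w) = w" using rcis_cmod_Arg[of w] by (simp add: rcis_def)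
    also have "1 - y - norm w = y" by (simp add: y_def field_simps)
    also have "(2 * (1 - y) / y) powr (1 / q) * (\<epsilon> / 16 * (1 - (1 - y)) powr (1 / q - 2) + B)
      \<le> (2 / y) powr (1 / q) * (\<epsilon> / 16 * (1 - (1 - y)) powr (1 / q - 2) + B)"
      using y y1 eB iq by (intro mult_right_mono powr_mono2 divide_right_mono) auto
    also have "\<dots> = 2 powr (1 / q) * (\<epsilon> / 16 * y powr (- 2) + B * y powr (- (1 / q)))"
    proof -
      have e: "y powr (- (1 / q)) * y powr (1 / q - 2) = y powr (- 2)" by (simp only: powr_add[symmetric]) simp
      have h: "(2 / y) powr (1 / q) = 2 powr (1 / q) * y powr (- (1 / q))" by (simp add: powr_divide powr_minus_divide)
      show ?thesis unfolding h y(2) e[symmetric] by (simp only: distrib_left mult_ac)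
    qed
    also have "\<dots> \<le> 2 powr 1 * (\<epsilon> / 16 * y powr (- 2) + (\<epsilon> / 16 * y powr (- 2) + B3))"
      using q eB B3 y iq by (intro mult_mono powr_mono add_left_mono) auto
    also have "y powr (- 2) = 4 * (1 - norm w) powr (- 2)"
    proof -
      have "2 powr (- 2) = (1 / 4 :: real)" by (simp add: powr_minus_divide)
      then show ?thesis using w by (simp only: y_def powr_divide) simp
    qed
    finally show "norm (deriv (deriv g) w) \<le> \<epsilon> * (1 - norm w) powr (- 2) + 2 * B3" by (simp add: algebra_simps)
  qed (use B3 in auto)
qed

text \<open>The mean bound and the supremum bound for g'' come from the same membership, with a
  common \<open>\<epsilon>\<close> and a common \<open>B\<close>, and feed the two hypotheses of
  \<open>mixed_norm_embedding\<close>. The value at 0 is added separately.\<close>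

lemma gen_Hilbert_controlled_less:
  assumes q: "1 < q" "q < p" and g: "g \<in> little_mean_Lipschitz q (1 / q)"
  shows "segment_controlled p (gen_Hilbert g)"
proof (rule segment_controlledI)
  show p: "1 < p" using q by simp
  have hol: "g holomorphic_on ball 0 1" using g by (auto simp: little_mean_Lipschitz_def intro: Hardy_holomorphic)
  show C: "0 \<le> embed_const p q" by (simp add: embed_const_def)
  fix \<epsilon> :: real assume \<epsilon>: "0 < \<epsilon>"
  obtain B1 where B1: "0 \<le> B1" "\<And>x. 0 \<le> x \<Longrightarrow> x < 1 \<Longrightarrow>
     Lp_le q (\<lambda>\<theta>. deriv (deriv g) (polar x \<theta>)) (\<epsilon> / 16 * (1 - x) powr (1 / q - 2) + B1)"
    using mean_Lipschitz_second_derivative[OF g q(1), of "\<epsilon> / 16"] \<epsilon> by auto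
  obtain B2 where B2: "0 \<le> B2" "\<And>w. norm w < 1 \<Longrightarrow> norm (deriv (deriv g) w) \<le> \<epsilon> * (1 - norm w) powr (- 2) + B2"
    using second_derivative_sup_bound[OF hol q(1) \<epsilon> B1] by blast
  define B where "B = B1 + B2"
  have B: "0 \<le> B" using B1 B2 by (simp add: B_def)
  have mean: "Lp_le q (\<lambda>\<theta>. deriv (deriv g) (polar x \<theta>)) (\<epsilon> * (1 - x) powr (1 / q - 2) + B)"
    if "0 \<le> x" "x < 1" for x
    using that \<epsilon> B2 q by (intro Lp_le_mono[OF B1(2)] add_mono mult_right_mono) (auto simp: B_def)
  have sup: "norm (deriv (deriv g) w) \<le> \<epsilon> * (1 - norm w) powr (- 2) + B" if "norm w < 1" for w
    using B2(2)[OF that] B1 by (simp add: B_def)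
  let ?B = "embed_const p q * B + norm (deriv g 0)"
  have main: "Lp_le p (\<lambda>\<theta>. gen_Hilbert g f (polar r \<theta>)) (embed_const p q * (\<epsilon> * seg_bound p f) + ?B * seg_norm f)"
    if f: "f \<in> Hardy p" and r: "0 < r" "r < 1" for f r
  proof -
    let ?F = "gen_Hilbert g f"
    have holF: "?F holomorphic_on ball 0 1" by (rule gen_Hilbert_holomorphic[OF f p hol])
    have "Lp_le p (\<lambda>\<theta>. ?F (polar r \<theta>) - ?F 0) (embed_const p q * (\<epsilon> * seg_bound p f + B * seg_norm f))"
    proof (rule mixed_norm_embedding[OF holF q])
      show "seg_abs f \<in> borel_measurable borel" using Hardy_holomorphic[OF f] by measurable
      show "(\<integral>\<^sup>+u. ennreal (seg_abs f u) \<partial>lborel) \<le> ennreal (seg_norm f)" by (simp add: nn_integral_seg_norm[OF f p])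
      show "Lp_le q (\<lambda>\<theta>. deriv ?F (polar (1 - \<tau>) \<theta>)) (enn2real (kernel_mean (2 - 1 / q) \<epsilon> B (seg_abs f) \<tau>))"
        if "0 < \<tau>" "\<tau> \<le> 1" for \<tau>
        using \<epsilon> B by (intro gen_Hilbert_deriv_mean[OF f p hol q(1)] mean that) auto
      show "ennreal (norm (deriv ?F (polar (1 - \<tau>) \<theta>))) \<le> kernel_mean 2 \<epsilon> B (seg_abs f) \<tau>"
        if "0 < \<tau>" "\<tau> \<le> 1" for \<tau> \<theta>
        using \<epsilon> B by (intro gen_Hilbert_deriv_sup[OF f p hol] sup that) auto
    qed (use \<epsilon> B r seg_bound[OF f p] seg_norm_nonneg[of f] in \<open>auto simp: seg_abs_nonneg seg_abs_def\<close>)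
    moreover have "Lp_le p (\<lambda>\<theta>. ?F 0) (norm (deriv g 0) * seg_norm f)"
      using norm_gen_Hilbert_0_le[OF f p hol] p by (intro Lp_le_sup) auto
    ultimately have "Lp_le p (\<lambda>\<theta>. (?F (polar r \<theta>) - ?F 0) + ?F 0)
      (embed_const p q * (\<epsilon> * seg_bound p f + B * seg_norm f) + norm (deriv g 0) * seg_norm f)"
      using p r by (intro Lp_le_add borel_measurable_diff trace_measurable holF) auto
    then show ?thesis by (simp add: algebra_simps)
  qed
  show "\<exists>B\<ge>0. \<forall>f\<in>Hardy p. \<forall>r. 0 < r \<longrightarrow> r < 1 \<longrightarrow>
     Lp_le p (\<lambda>\<theta>. gen_Hilbert g f (polar r \<theta>)) (embed_const p q * (\<epsilon> * seg_bound p f) + B * seg_norm f)"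
    using main B C by (intro exI[of _ ?B]) auto
qed

section \<open>Bounded sequences that converge to 0 locally uniformly\<close>

lemma seg_abs_split:
  assumes "0 < l" "0 \<le> h" "1 < p"
  shows "h \<le> l powr (1 - p) * h powr p + (l::real)"
proof (cases "h \<le> l")
  case False
  have "h = h powr (1 - p) * h powr p" using False assms by (simp flip: powr_add)
  also have "\<dots> \<le> l powr (1 - p) * h powr p" using False assms by (intro mult_right_mono powr_mono2') auto
  finally show ?thesis using assms by simp
qed (use assms in \<open>auto intro: order_trans\<close>)

text \<open>Bounded p-norms along the radius, supplied by Fejer--Riesz, give uniform integrability
  near the point 1 because \<open>p > 1\<close>; away from it the convergence is uniform.\<close>

lemma seg_norm_tendsto_0:
  assumes p: "1 < p" and u: "\<And>n. u n \<in> Hardy p" "\<And>n. Hardy_norm p (u n) \<le> M"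
    and lim: "\<And>\<rho>. \<rho> < 1 \<Longrightarrow> uniform_limit (cball 0 \<rho>) u (\<lambda>_. 0) sequentially"
  shows "(\<lambda>n. seg_norm (u n)) \<longlonglongrightarrow> 0"
proof (rule tendstoI)
  fix \<eta> :: real assume \<eta>: "0 < \<eta>"
  have M: "0 \<le> M" using u[of 0] Hardy_norm_nonneg[of "u 0" p] p by simp
  define C where "C = Fejer_Riesz_const p * M powr p"
  have C: "0 \<le> C" using Fejer_Riesz_const_nonneg[OF p] by (simp add: C_def)
  \<comment> \<open>The truncation height: with it the part of the integral above \<open>l\<close>
    is at most \<open>\<eta> / 4\<close> for every member of the sequence.\<close>
  define l where "l = ((C + 1) / (\<eta> / 4)) powr (1 / (p - 1))"
  have l: "0 < l" using C \<eta> by (simp add: l_def)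
  have "l powr (1 - p) = (l powr (p - 1)) powr (- 1)" by (simp only: powr_powr) simp
  also have "l powr (p - 1) = (C + 1) / (\<eta> / 4)" using p C \<eta> by (simp add: l_def powr_powr)
  finally have "l powr (1 - p) * C = \<eta> / 4 * (C / (C + 1))" using C \<eta> by (simp add: powr_minus_divide)
  also have "\<dots> \<le> \<eta> / 4 * 1" using C \<eta> by (intro mult_left_mono) auto
  finally have lp: "l powr (1 - p) * C \<le> \<eta> / 4" by simp
  \<comment> \<open>Chosen after \<open>l\<close>, so that the part below height \<open>l\<close>
    contributes at most \<open>\<eta> / 4\<close> near the end point.\<close>
  define \<delta> where "\<delta> = min (1 / 2) (\<eta> / (4 * l))"
  have \<delta>: "0 < \<delta>" "\<delta> < 1" "l * \<delta> \<le> \<eta> / 4" using l \<eta> by (auto simp: \<delta>_def min_def field_simps)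
  have "\<forall>\<^sub>F n in sequentially. \<forall>z\<in>cball 0 (1 - \<delta>). dist (u n z) 0 < \<eta> / 4"
    using uniform_limitD[OF lim[of "1 - \<delta>"], of "\<eta> / 4"] \<delta> \<eta> by simp
  then show "\<forall>\<^sub>F n in sequentially. dist (seg_norm (u n)) 0 < \<eta>"
  proof eventually_elim
    case (elim n)
    have [measurable]: "seg_abs (u n) \<in> borel_measurable borel" using Hardy_holomorphic[OF u(1)] by measurable
    have pt: "ennreal (seg_abs (u n) x) \<le> ennreal (l powr (1 - p)) * ennreal (seg_abs (u n) x powr p)
      + ennreal l * indicator {0..\<delta>} x + ennreal (\<eta> / 4) * indicator {0..1} x" for x
    proof (cases "x \<in> {0..\<delta>}")
      case True
      have "ennreal (seg_abs (u n) x) \<le> ennreal (l powr (1 - p)) * ennreal (seg_abs (u n) x powr p) + ennreal l"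
        using seg_abs_split[OF l seg_abs_nonneg p, of "u n" x] l
        by (simp add: ennreal_leI flip: ennreal_mult ennreal_plus)
      then show ?thesis using True by (auto intro: order_trans)
    next
      case False
      have "seg_abs (u n) x \<le> \<eta> / 4 * indicator {0..1} x"
      proof (cases "x \<in> {0<..<1}")
        case True
        have "of_real (1 - x) \<in> cball (0::complex) (1 - \<delta>)" using True False by (auto simp del: of_real_diff)
        then show ?thesis using elim True by (auto simp: seg_abs_def simp del: of_real_diff intro: less_imp_le)
      qed (use \<eta> in \<open>auto simp: seg_abs_def indicator_def\<close>)
      then have "ennreal (seg_abs (u n) x) \<le> ennreal (\<eta> / 4 * indicator {0..1} x)" by (rule ennreal_leI)
      also have "\<dots> = ennreal (\<eta> / 4) * indicator {0..1} x" by (simp add: indicator_def)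
      finally show ?thesis using add_increasing[OF zero_le, of "ennreal (seg_abs (u n) x)"] by blast
    qed
    have "ennreal (seg_norm (u n)) = (\<integral>\<^sup>+x. ennreal (seg_abs (u n) x) \<partial>lborel)"
      using nn_integral_seg_norm[OF u(1) p] by simp
    also have "\<dots> \<le> (\<integral>\<^sup>+x. ennreal (l powr (1 - p)) * ennreal (seg_abs (u n) x powr p)
      + ennreal l * indicator {0..\<delta>} x + ennreal (\<eta> / 4) * indicator {0..1} x \<partial>lborel)"
      by (intro nn_integral_mono pt)
    also have "\<dots> = ennreal (l powr (1 - p)) * (\<integral>\<^sup>+x. ennreal (seg_abs (u n) x powr p) \<partial>lborel) + ennreal l * ennreal \<delta> + ennreal (\<eta> / 4)"
      using \<delta> by (simp add: nn_integral_add nn_integral_cmult nn_integral_cmult_indicator)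
    also have "\<dots> \<le> ennreal (l powr (1 - p)) * ennreal C + ennreal l * ennreal \<delta> + ennreal (\<eta> / 4)"
    proof (intro add_right_mono mult_left_mono)
      have "Hardy_norm p (u n) powr p \<le> M powr p"
        using u(2)[of n] Hardy_norm_nonneg[OF u(1), of n] p by (intro powr_mono2) auto
      then show "(\<integral>\<^sup>+x. ennreal (seg_abs (u n) x powr p) \<partial>lborel) \<le> ennreal C"
        using seg_abs_Hardy(1)[OF u(1) p, of n] Fejer_Riesz_const_nonneg[OF p]
        by (auto simp: C_def intro: order_trans ennreal_leI mult_left_mono)
    qed simp
    also have "\<dots> = ennreal (l powr (1 - p) * C + l * \<delta> + \<eta> / 4)"
      using C l \<delta> \<eta> by (simp add: ennreal_mult)
    finally have "seg_norm (u n) \<le> l powr (1 - p) * C + l * \<delta> + \<eta> / 4"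
      using C l \<delta> \<eta> by (subst (asm) ennreal_le_iff) auto
    then show ?case using lp \<delta>(3) \<eta> seg_norm_nonneg[of "u n"] by simp
  qed
qed

text \<open>Point evaluations from the circle halfway between \<open>\<rho>\<close> and 1 are
  bounded by one constant on the whole disc of radius \<open>\<rho>\<close>; this is the hypothesis
  of Montel's theorem.\<close>

lemma Hardy_locally_bounded:
  assumes p: "1 \<le> p" and \<rho>: "\<rho> < 1" and K: "K \<subseteq> cball 0 \<rho>"
  shows "\<exists>B. \<forall>h\<in>{h \<in> Hardy p. Hardy_norm p h \<le> C}. \<forall>z\<in>K. norm (h z) \<le> B"
proof (intro exI ballI)
  fix h z assume h: "h \<in> {h \<in> Hardy p. Hardy_norm p h \<le> C}" and z: "z \<in> K"
  define R where "R = (1 + \<rho>) / 2"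
  have zR: "norm z \<le> \<rho>" "norm z < R" "\<rho> < R" "R < 1" using z K \<rho> by (auto simp: R_def)
  have R0: "0 \<le> R" using zR norm_ge_zero[of z] by linarith
  have hH: "h \<in> Hardy p" "Hardy_norm p h \<le> C" using h by auto
  have "Lp_le p (\<lambda>\<theta>. h (polar R \<theta>)) C"
    using p by (intro Lp_le_mono[OF Hardy_Lp_le[OF hH(1) p R0 zR(4)] hH(2)]) auto
  then have "norm (h (polar (norm z) (Arg z))) \<le> (2 * R / (R - norm z)) powr (1 / p) * C"
    by (intro Lp_le_point_bound[OF p Hardy_holomorphic[OF hH(1)]] zR) auto
  also have "of_real (norm z) * cis (Arg z) = z" using rcis_cmod_Arg[of z] by (simp add: rcis_def)
  also have "(2 * R / (R - norm z)) powr (1 / p) * C \<le> (2 * R / (R - \<rho>)) powr (1 / p) * C"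
    using zR R0 p hH Hardy_norm_nonneg[OF hH(1) p] by (intro mult_right_mono powr_mono2 divide_left_mono) auto
  finally show "norm (h z) \<le> (2 * R / (R - \<rho>)) powr (1 / p) * C" .
qed

text \<open>The candidate limit is the image of the Montel limit. The differences are bounded and
  tend to 0 locally uniformly, so in the Ehrling inequality the first term is small by choice of
  \<open>\<epsilon>\<close> and the second along the sequence.\<close>

lemma compact_on_HardyI:
  assumes p: "1 < p" and g: "g holomorphic_on ball 0 1" and T: "segment_controlled p (gen_Hilbert g)"
  shows "compact_on_Hardy p (gen_Hilbert g)"
  unfolding compact_on_Hardy_def
proof (intro conjI ballI allI impI)
  have ctrl: "\<exists>B\<ge>0. \<forall>f\<in>Hardy p. \<forall>r. 0 < r \<longrightarrow> r < 1 \<longrightarrow>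
     Lp_le p (\<lambda>\<theta>. gen_Hilbert g f (polar r \<theta>)) (\<epsilon> * Hardy_norm p f + B * seg_norm f)" if "0 < \<epsilon>" for \<epsilon>
    using T that unfolding segment_controlled_def by blast
  have TH: "gen_Hilbert g f \<in> Hardy p" if f: "f \<in> Hardy p" for f
  proof -
    obtain B where "\<forall>f\<in>Hardy p. \<forall>r. 0 < r \<longrightarrow> r < 1 \<longrightarrow>
     Lp_le p (\<lambda>\<theta>. gen_Hilbert g f (polar r \<theta>)) (1 * Hardy_norm p f + B * seg_norm f)"
      using ctrl[of 1] by auto
    then show ?thesis
      using f p by (intro HardyI(1)[OF gen_Hilbert_holomorphic[OF f p g]]) auto
  qed
  show "gen_Hilbert g f \<in> Hardy p" if "f \<in> Hardy p" for f using TH[OF that] .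
  fix f :: "nat \<Rightarrow> complex \<Rightarrow> complex" and C
  assume "\<forall>n. f n \<in> Hardy p \<and> Hardy_norm p (f n) \<le> C"
  then have f: "\<And>n. f n \<in> Hardy p" "\<And>n. Hardy_norm p (f n) \<le> C" by auto
  have C: "0 \<le> C" using f[of 0] Hardy_norm_nonneg[of "f 0" p] p by simp
  obtain F k where F: "F holomorphic_on ball 0 1" and k: "strict_mono (k :: nat \<Rightarrow> nat)"
    and lim: "\<And>x. x \<in> ball 0 1 \<Longrightarrow> (\<lambda>n. f (k n) x) \<longlonglongrightarrow> F x"
    and ulim: "\<And>K. compact K \<Longrightarrow> K \<subseteq> ball 0 1 \<Longrightarrow> uniform_limit K (f \<circ> k) F sequentially"
  proof (rule Montel[of "ball 0 1" "{h \<in> Hardy p. Hardy_norm p h \<le> C}" f])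
    show "\<exists>B. \<forall>h\<in>{h \<in> Hardy p. Hardy_norm p h \<le> C}. \<forall>z\<in>K. norm (h z) \<le> B" if K: "compact K" "K \<subseteq> ball 0 1" for K
    proof (cases "K = {}")
      case False
      then obtain x where x: "x \<in> K" "\<And>y. y \<in> K \<Longrightarrow> norm y \<le> norm x"
        using continuous_attains_sup[OF K(1), of norm] by (auto intro: continuous_intros)
      then show ?thesis using K p by (intro Hardy_locally_bounded[of p "norm x"]) auto
    qed simp
  qed (use f in \<open>auto intro: Hardy_holomorphic\<close>)
  have mF: "(\<lambda>\<theta>. h (polar r \<theta>)) \<in> borel_measurable borel" if "h holomorphic_on ball 0 1" "0 < r" "r < 1" for h r
    using that by (intro trace_measurable) auto
  \<comment> \<open>Pointwise convergence on each circle and Fatou's lemma place the limit in the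
    Hardy space with the same bound.\<close>
  have FL: "Lp_le p (\<lambda>\<theta>. F (polar r \<theta>)) C" if r: "0 < r" "r < 1" for r
  proof (rule Lp_le_AE_lim)
    show "AE \<theta> in circle. (\<lambda>n. f (k n) (polar r \<theta>)) \<longlonglongrightarrow> F (polar r \<theta>)"
      using r by (intro AE_I2 lim) (simp add: norm_mult)
    show "\<forall>\<^sub>F n in sequentially. Lp_le p (\<lambda>\<theta>. f (k n) (polar r \<theta>)) C"
      using r p by (intro always_eventually allI Lp_le_mono[OF Hardy_Lp_le[OF f(1)] f(2)]) auto
  qed (use p C r mF Hardy_holomorphic[OF f(1)] in auto)
  have FH: "F \<in> Hardy p" using p by (intro HardyI(1)[OF F _ FL]) auto
  define u where "u n = (\<lambda>z. f (k n) z - F z)" for n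
  have hu: "u n holomorphic_on ball 0 1" for n
    unfolding u_def using Hardy_holomorphic[OF f(1)] F by (intro holomorphic_intros)
  have uL: "Lp_le p (\<lambda>\<theta>. u n (polar r \<theta>)) (C + C)" if r: "0 < r" "r < 1" for n r
    unfolding u_def using r p
    by (intro Lp_le_diff mF F FL Hardy_holomorphic[OF f(1)] Lp_le_mono[OF Hardy_Lp_le[OF f(1)] f(2)]) auto
  have uH: "u n \<in> Hardy p" "Hardy_norm p (u n) \<le> C + C" for n
    by (rule HardyI[OF hu _ uL]; use p in simp)+
  have ulim0: "uniform_limit (cball 0 \<rho>) u (\<lambda>_. 0) sequentially" if "\<rho> < 1" for \<rho>
  proof -
    have "uniform_limit (cball 0 \<rho>) (f \<circ> k) F sequentially" using that by (intro ulim) auto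
    then show ?thesis unfolding uniform_limit_iff u_def by (simp add: dist_norm)
  qed
  have Y: "(\<lambda>n. seg_norm (u n)) \<longlonglongrightarrow> 0" by (rule seg_norm_tendsto_0[OF p uH ulim0])
  have "(\<lambda>n. Hardy_norm p (\<lambda>z. gen_Hilbert g (f (k n)) z - gen_Hilbert g F z)) \<longlonglongrightarrow> 0"
  proof (rule tendstoI)
    fix \<eta> :: real assume \<eta>: "0 < \<eta>"
    define \<epsilon> where "\<epsilon> = \<eta> / (2 * (C + C + 1))"
    have \<epsilon>: "0 < \<epsilon>" "\<epsilon> * (C + C) < \<eta> / 2" using \<eta> C by (auto simp: \<epsilon>_def field_simps)
    obtain B where B: "0 \<le> B" "\<And>f r. f \<in> Hardy p \<Longrightarrow> 0 < r \<Longrightarrow> r < 1 \<Longrightarrow>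
       Lp_le p (\<lambda>\<theta>. gen_Hilbert g f (polar r \<theta>)) (\<epsilon> * Hardy_norm p f + B * seg_norm f)"
      using ctrl[OF \<epsilon>(1)] by auto
    have "\<forall>\<^sub>F n in sequentially. dist (seg_norm (u n)) 0 < \<eta> / (2 * (B + 1))"
      using tendstoD[OF Y] \<eta> B by simp
    then show "\<forall>\<^sub>F n in sequentially. dist (Hardy_norm p (\<lambda>z. gen_Hilbert g (f (k n)) z - gen_Hilbert g F z)) 0 < \<eta>"
    proof eventually_elim
      case (elim n)
      let ?D = "\<lambda>z. gen_Hilbert g (f (k n)) z - gen_Hilbert g F z"
      have hD: "?D holomorphic_on ball 0 1"
        by (intro holomorphic_intros gen_Hilbert_holomorphic[OF _ p g] f FH)
      have L: "Lp_le p (\<lambda>\<theta>. ?D (polar r \<theta>)) (\<epsilon> * Hardy_norm p (u n) + B * seg_norm (u n))"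
        if r: "0 < r" "r < 1" for r
      proof -
        have "?D (polar r \<theta>) = gen_Hilbert g (u n) (polar r \<theta>)" for \<theta>
          unfolding u_def using r by (intro gen_Hilbert_diff[symmetric, OF f(1) FH p g]) (simp add: norm_mult)
        then show ?thesis using B(2)[OF uH(1) r] by simp
      qed
      have "Hardy_norm p ?D \<le> \<epsilon> * Hardy_norm p (u n) + B * seg_norm (u n)"
        using p by (intro HardyI(2)[OF hD _ L]) auto
      also have "\<dots> \<le> \<epsilon> * (C + C) + (B + 1) * seg_norm (u n)"
        using uH(2)[of n] \<epsilon> B seg_norm_nonneg[of "u n"] by (intro add_mono mult_left_mono mult_right_mono) auto
      also have "(B + 1) * seg_norm (u n) \<le> \<eta> / 2"
        using elim B seg_norm_nonneg[of "u n"] by (simp add: field_simps)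
      finally have "Hardy_norm p ?D < \<eta>" using \<epsilon> by simp
      moreover have "0 \<le> Hardy_norm p ?D"
        using p by (intro Hardy_norm_nonneg HardyI(1)[OF hD _ L]) auto
      ultimately show ?case by simp
    qed
  qed
  then show "\<exists>k G. strict_mono k \<and> G \<in> Hardy p \<and> (\<lambda>n. Hardy_norm p (\<lambda>z. gen_Hilbert g (f (k n)) z - G z)) \<longlonglongrightarrow> 0"
    using k TH[OF FH] by blast
qed

section \<open>Test functions\<close>

text \<open>The limit supplied by compactness must be 0: evaluation at a point of the disc is
  continuous for the norm, and the images tend to 0 pointwise because |f| integrated over the
  segment does.\<close>

lemma compact_on_Hardy_null:
  assumes p: "1 < p" and g: "g holomorphic_on ball 0 1" and T: "compact_on_Hardy p (gen_Hilbert g)"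
    and u: "\<And>n. u n \<in> Hardy p" "\<And>n. Hardy_norm p (u n) \<le> C"
    and lim: "\<And>\<rho>. \<rho> < 1 \<Longrightarrow> uniform_limit (cball 0 \<rho>) u (\<lambda>_. 0) sequentially"
  obtains k where "strict_mono k" "(\<lambda>n. Hardy_norm p (gen_Hilbert g (u (k n)))) \<longlonglongrightarrow> 0"
proof -
  obtain k F where k: "strict_mono (k :: nat \<Rightarrow> nat)" and F: "F \<in> Hardy p"
    and conv: "(\<lambda>n. Hardy_norm p (\<lambda>z. gen_Hilbert g (u (k n)) z - F z)) \<longlonglongrightarrow> 0"
    using T u unfolding compact_on_Hardy_def by meson
  have TH: "gen_Hilbert g (u n) \<in> Hardy p" for n using T u unfolding compact_on_Hardy_def by blast
  have g': "deriv g holomorphic_on ball 0 1" using g by (intro holomorphic_intros) auto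
  define D where "D n z = gen_Hilbert g (u (k n)) z - F z" for n z
  have hD: "D n holomorphic_on ball 0 1" for n
    unfolding D_def using Hardy_holomorphic[OF TH] Hardy_holomorphic[OF F] by (intro holomorphic_intros)
  have DH: "D n \<in> Hardy p" for n
  proof (rule HardyI(1)[OF hD])
    show "Lp_le p (\<lambda>\<theta>. D n (polar r \<theta>)) (Hardy_norm p (gen_Hilbert g (u (k n))) + Hardy_norm p F)"
      if "0 < r" "r < 1" for r
      unfolding D_def using that p
      by (intro Lp_le_diff Hardy_Lp_le TH F trace_measurable Hardy_holomorphic[OF TH] Hardy_holomorphic[OF F]) auto
  qed (use p in simp)
  have D0: "(\<lambda>n. Hardy_norm p (D n)) \<longlonglongrightarrow> 0" using conv by (simp add: D_def[abs_def])
  \<comment> \<open>Both terms of the difference \<open>gen_Hilbert g (u (k n)) z - D n z\<close>,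
    which is the constant \<open>F z\<close>, tend to 0.\<close>
  have F0: "F z = 0" if z: "norm z < 1" for z
  proof -
    define R where "R = (1 + norm z) / 2"
    have R: "norm z < R" "R < 1" using z by (auto simp: R_def)
    have R0: "0 \<le> R" using R norm_ge_zero[of z] by linarith
    have zz: "of_real (norm z) * cis (Arg z) = z" using rcis_cmod_Arg[of z] by (simp add: rcis_def)
    have le: "norm (D n z) \<le> (2 * R / (R - norm z)) powr (1 / p) * Hardy_norm p (D n)" for n
      using Lp_le_point_bound[OF _ hD _ R Hardy_Lp_le[OF DH _ R0 R(2)], where \<theta>="Arg z"] p by (simp add: zz)
    have "(\<lambda>n. D n z) \<longlonglongrightarrow> 0"
      by (rule Lim_null_comparison[OF always_eventually[OF allI[OF le]] tendsto_mult_right_zero[OF D0]])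
    moreover have "(\<lambda>n. gen_Hilbert g (u (k n)) z) \<longlonglongrightarrow> 0"
    proof -
      obtain K where K: "0 \<le> K" "\<And>w. norm w \<le> norm z \<Longrightarrow> norm (deriv g w) \<le> K"
        using holomorphic_bounded_cball[OF g' z] by blast
      have le: "norm (gen_Hilbert g (u n) z) \<le> K * seg_norm (u n)" for n
      proof -
        have hol: "u n holomorphic_on ball 0 1" using u(1) by (rule Hardy_holomorphic)
        have "ennreal (norm (gen_Hilbert g (u n) z)) \<le> (\<integral>\<^sup>+t. ennreal (norm (u n (of_real t) * deriv g (of_real t * z))) \<partial>unit_seg)"
          unfolding gen_Hilbert_eq[OF hol g z]
          by (rule integral_norm_bound_ennreal[OF integrable_segment_product[OF integrable_unit_seg[OF u(1) p] g' z]])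
        also have "\<dots> \<le> (\<integral>\<^sup>+t. ennreal (K * norm (u n (of_real t))) \<partial>unit_seg)"
        proof (intro nn_integral_mono ennreal_leI)
          fix t assume "t \<in> space unit_seg"
          then have "norm (of_real t * z) \<le> norm z" by (auto simp: norm_mult intro: mult_left_le_one_le)
          then have "norm (u n (of_real t)) * norm (deriv g (of_real t * z)) \<le> norm (u n (of_real t)) * K"
            by (intro mult_left_mono K(2)) auto
          then show "norm (u n (of_real t) * deriv g (of_real t * z)) \<le> K * norm (u n (of_real t))"
            by (simp only: norm_mult mult.commute)
        qed
        also have "\<dots> = ennreal (K * seg_norm (u n))"
          using nn_integral_seg_abs[OF hol, of "\<lambda>_. K"] K Hardy_holomorphic[OF u(1)]
          by (simp add: ennreal_mult seg_abs_nonneg nn_integral_cmult nn_integral_seg_norm[OF u(1) p] seg_norm_nonneg)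
        finally show ?thesis using K seg_norm_nonneg by (subst (asm) ennreal_le_iff) auto
      qed
      have "(\<lambda>n. K * seg_norm (u (k n))) \<longlonglongrightarrow> 0"
        using tendsto_mult_right_zero[OF LIMSEQ_subseq_LIMSEQ[OF seg_norm_tendsto_0[OF p u lim] k]] by (simp add: o_def)
      then show ?thesis by (rule Lim_null_comparison[OF always_eventually, rotated]) (use le in auto)
    qed
    ultimately have "(\<lambda>n. gen_Hilbert g (u (k n)) z - D n z) \<longlonglongrightarrow> 0 - 0" by (intro tendsto_diff)
    then show ?thesis by (simp add: D_def LIMSEQ_const_iff)
  qed
  have "Hardy_norm p (gen_Hilbert g (u (k n))) \<le> Hardy_norm p (D n)" for n
  proof (rule HardyI(2)[OF Hardy_holomorphic[OF TH]])
    show "Lp_le p (\<lambda>\<theta>. gen_Hilbert g (u (k n)) (polar r \<theta>)) (Hardy_norm p (D n))" if r: "0 < r" "r < 1" for r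
    proof -
      have "D n (polar r \<theta>) = gen_Hilbert g (u (k n)) (polar r \<theta>)" for \<theta>
        unfolding D_def using F0[of "of_real r * cis \<theta>"] r by (simp add: norm_mult)
      then show ?thesis using Hardy_Lp_le[OF DH, of r n] r p by simp
    qed
  qed (use p in simp)
  then have "(\<lambda>n. Hardy_norm p (gen_Hilbert g (u (k n)))) \<longlonglongrightarrow> 0"
    using Hardy_norm_nonneg[OF TH] p by (intro tendsto_sandwich[OF _ _ tendsto_const D0] always_eventually) auto
  with k show thesis by (rule that)
qed

text \<open>The exponent \<open>2 - 1 / p\<close> normalises the function: its p-th power is
  dominated by a Poisson kernel of mass 1.\<close>

definition test_fun :: "real \<Rightarrow> real \<Rightarrow> complex \<Rightarrow> complex" where
  "test_fun p a z = of_real ((1 - a) powr (2 - 1 / p)) / (1 - of_real a * z)\<^sup>2"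

text \<open>This is \<open>(1 - a) z f'(z)\<close> for the test function \<open>f\<close>.\<close>

definition test_der :: "real \<Rightarrow> real \<Rightarrow> complex \<Rightarrow> complex" where
  "test_der p a z = of_real (2 * a * (1 - a)) * z * test_fun p a z / (1 - of_real a * z)"

section \<open>Size of the test functions\<close>

lemma norm_one_minus_ge:
  fixes z :: complex
  assumes "0 \<le> a" "norm z \<le> \<rho>"
  shows "1 - a * \<rho> \<le> norm (1 - of_real a * z)"
proof -
  have "1 - a * norm z \<le> norm (1 - of_real a * z)"
    using norm_triangle_ineq2[of 1 "of_real a * z"] assms by (simp add: norm_mult)
  then show ?thesis using mult_left_mono[OF assms(2,1)] by linarith
qed

lemma one_minus_ne:
  fixes z :: complex
  assumes "0 \<le> a" "a < 1" "norm z \<le> 1"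
  shows "1 - of_real a * z \<noteq> 0"
  using norm_one_minus_ge[of a z 1] assms by auto

lemma test_fun_holomorphic:
  assumes "0 \<le> a" "a < 1"
  shows "test_fun p a holomorphic_on ball 0 1" "test_der p a holomorphic_on ball 0 1"
proof -
  show "test_fun p a holomorphic_on ball 0 1"
    unfolding test_fun_def[abs_def] using one_minus_ne[OF assms] by (intro holomorphic_intros) auto
  then show "test_der p a holomorphic_on ball 0 1"
    unfolding test_der_def[abs_def] using one_minus_ne[OF assms] by (intro holomorphic_intros) auto
qed

text \<open>Differentiation costs a factor \<open>1 / (1 - a z)\<close>, which \<open>1 - a\<close>
  compensates since \<open>1 - a \<le> norm (1 - a z)\<close>; the 2 is the exponent of the
  denominator.\<close>

lemma norm_test_der_le:
  assumes a: "0 \<le> a" "a < 1" and z: "norm z \<le> 1"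
  shows "norm (test_der p a z) \<le> 2 * norm (test_fun p a z)"
proof -
  have N: "1 - a \<le> norm (1 - of_real a * z)" using norm_one_minus_ge[of a z 1] a z by simp
  have "a * ((1 - a) / norm (1 - of_real a * z)) \<le> 1 * 1"
    using a N by (intro mult_mono) (auto simp: divide_le_eq)
  then have "a * ((1 - a) / norm (1 - of_real a * z)) * norm z \<le> 1 * 1"
    using a z by (intro mult_mono) auto
  then have "2 * (a * ((1 - a) / norm (1 - of_real a * z)) * norm z) * norm (test_fun p a z) \<le> 2 * norm (test_fun p a z)"
    by (intro mult_right_mono) auto
  moreover have "norm (test_der p a z) = 2 * (a * ((1 - a) / norm (1 - of_real a * z)) * norm z) * norm (test_fun p a z)"
    using a by (simp add: test_der_def norm_mult norm_divide flip: of_real_diff)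
  ultimately show ?thesis by simp
qed

text \<open>With \<open>N = norm (1 - a z)\<close> the p-th power is (1 - a)^(2p-1) N^(-2p). As
  \<open>1 - a \<le> N\<close>, this is at most (1 - a) N^(-2), and \<open>N\<close> is also the
  distance in the Poisson kernel of parameter \<open>a * r\<close>.\<close>

lemma test_fun_Lp_le:
  assumes p: "1 < p" and a: "0 \<le> a" "a < 1" and r: "0 < r" "r < 1"
  shows "Lp_le p (\<lambda>\<theta>. test_fun p a (polar r \<theta>)) 1"
proof -
  define \<rho> where "\<rho> = a * r"
  have \<rho>: "0 \<le> \<rho>" "\<rho> < 1" "\<rho> \<le> a" using a r mult_left_le[of r a] by (auto simp: \<rho>_def)
  have \<rho>2: "\<rho>\<^sup>2 < 1" "1 - a \<le> 1 - \<rho>\<^sup>2"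
    using \<rho> power_strict_mono[of \<rho> 1 2] mult_left_le[of \<rho> \<rho>] by (auto simp: power2_eq_square)
  have pt: "norm (test_fun p a (polar r \<theta>)) powr p \<le> poisson \<rho> \<theta>" for \<theta>
  proof -
    define N where "N = norm (1 - of_real a * (polar r \<theta>))"
    have N: "1 - a \<le> N" unfolding N_def using norm_one_minus_ge[of a "of_real r * cis \<theta>" 1] a r by (simp add: norm_mult)
    then have N0: "0 < N" using a by simp
    have "cis \<theta> - of_real \<rho> = cis \<theta> * cnj (1 - of_real a * (polar r \<theta>))"
      by (simp add: \<rho>_def right_diff_distrib cis_cnj cis_mult)
    then have NP: "norm (cis \<theta> - of_real \<rho>) = N" by (simp only: N_def norm_mult norm_cis complex_mod_cnj mult_1)
    have "norm (test_fun p a (polar r \<theta>)) = (1 - a) powr (2 - 1 / p) * N powr (- 2)"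
      using N0 by (simp add: test_fun_def norm_divide norm_power N_def powr_minus_divide)
    then have "norm (test_fun p a (polar r \<theta>)) powr p = (1 - a) powr ((2 - 1 / p) * p) * N powr ((- 2) * p)"
      by (simp only: powr_mult powr_powr)
    also have "(2 - 1 / p) * p = 1 + (2 * p - 2)" using p by (simp add: field_simps)
    also have "(1 - a) powr (1 + (2 * p - 2)) = (1 - a) * (1 - a) powr (2 * p - 2)" using a by (simp only: powr_add) simp
    also have "(1 - a) * (1 - a) powr (2 * p - 2) * N powr ((- 2) * p) \<le> (1 - a) * N powr (2 * p - 2) * N powr ((- 2) * p)"
      using a N p by (intro mult_right_mono mult_left_mono powr_mono2) auto
    also have "\<dots> = (1 - a) * N powr (- 2)" by (simp only: mult.assoc powr_add[symmetric]) simp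
    also have "\<dots> \<le> (1 - \<rho>\<^sup>2) * N powr (- 2)" using \<rho>2 by (intro mult_right_mono) auto
    also have "\<dots> = poisson \<rho> \<theta>" using N0 by (simp add: poisson_def NP powr_minus_divide)
    finally show ?thesis .
  qed
  have "(\<integral>\<^sup>+\<theta>. ennreal (norm (test_fun p a (polar r \<theta>)) powr p) \<partial>circle) \<le> (\<integral>\<^sup>+\<theta>. ennreal (poisson \<rho> \<theta>) \<partial>circle)"
    by (intro nn_integral_mono ennreal_leI pt)
  also have "\<dots> = 1" by (rule poisson_integral_1(2)[OF \<rho>(1,2)])
  finally show ?thesis by (simp add: Lp_le_def)
qed

lemma test_fun_Hardy:
  assumes p: "1 < p" and a: "0 \<le> a" "a < 1"
  shows "test_fun p a \<in> Hardy p" "Hardy_norm p (test_fun p a) \<le> 1"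
    and "test_der p a \<in> Hardy p" "Hardy_norm p (test_der p a) \<le> 2"
proof -
  show "test_fun p a \<in> Hardy p" "Hardy_norm p (test_fun p a) \<le> 1"
    by (rule HardyI[OF test_fun_holomorphic(1)[OF a] _ test_fun_Lp_le[OF p a]]; use p in simp)+
  have L: "Lp_le p (\<lambda>\<theta>. test_der p a (polar r \<theta>)) 2" if r: "0 < r" "r < 1" for r
  proof (rule Lp_le_dominated)
    show "Lp_le p (\<lambda>\<theta>. 2 * test_fun p a (polar r \<theta>)) 2"
      using Lp_le_cmult[OF test_fun_Lp_le[OF p a r], of 2] trace_measurable(2)[OF test_fun_holomorphic(1)[OF a], of r] p r by simp
    show "norm (test_der p a (polar r \<theta>)) \<le> norm (2 * test_fun p a (polar r \<theta>))" for \<theta>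
      using norm_test_der_le[OF a, of "of_real r * cis \<theta>"] r by (simp add: norm_mult)
  qed (use p in simp)
  show "test_der p a \<in> Hardy p" "Hardy_norm p (test_der p a) \<le> 2"
    by (rule HardyI[OF test_fun_holomorphic(2)[OF a] _ L]; use p in simp)+
qed

text \<open>Stated for any family dominated by twice the test functions, so that one proof covers
  the test functions and their normalised derivatives.\<close>

lemma test_fun_null:
  assumes p: "1 < p" and a: "\<And>n. 0 \<le> a n" "\<And>n. a n < 1" "a \<longlonglongrightarrow> 1" and \<rho>: "\<rho> < 1"
    and u: "\<And>n z. norm z \<le> 1 \<Longrightarrow> norm (u n z) \<le> 2 * norm (test_fun p (a n) z)"
  shows "uniform_limit (cball 0 \<rho>) u (\<lambda>_. 0) sequentially"
  unfolding uniform_limit_iff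
proof (intro allI impI)
  fix e :: real assume e: "0 < e"
  have "(\<lambda>n. 1 - a n) \<longlonglongrightarrow> 0" using tendsto_diff[OF tendsto_const a(3), of 1] by simp
  moreover have "0 < 2 - 1 / p" using p by (simp add: field_simps)
  ultimately have "(\<lambda>n. (1 - a n) powr (2 - 1 / p)) \<longlonglongrightarrow> 0"
    using less_imp_le[OF a(2)] by (intro tendsto_zero_powrI[OF _ tendsto_const]) auto
  then have "(\<lambda>n. 2 * ((1 - a n) powr (2 - 1 / p) / (1 - \<rho>)\<^sup>2)) \<longlonglongrightarrow> 2 * (0 / (1 - \<rho>)\<^sup>2)"
    using \<rho> by (intro tendsto_intros) auto
  then have "\<forall>\<^sub>F n in sequentially. 2 * ((1 - a n) powr (2 - 1 / p) / (1 - \<rho>)\<^sup>2) < e"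
    using e by (intro order_tendstoD(2)) auto
  then show "\<forall>\<^sub>F n in sequentially. \<forall>z\<in>cball 0 \<rho>. dist (u n z) 0 < e"
  proof eventually_elim
    case (elim n)
    show ?case
    proof
      fix z :: complex assume "z \<in> cball 0 \<rho>"
      then have z: "norm z \<le> \<rho>" "0 \<le> \<rho>" using norm_ge_zero[of z] by (auto simp del: norm_ge_zero)
      have "1 - \<rho> \<le> norm (1 - of_real (a n) * z)"
        using norm_one_minus_ge[OF a(1) z(1), of n] mult_right_mono[OF less_imp_le[OF a(2)] z(2), of n] by simp
      then have "(1 - \<rho>)\<^sup>2 \<le> (norm (1 - of_real (a n) * z))\<^sup>2" using \<rho> by (intro power_mono) auto
      then have "(1 - a n) powr (2 - 1 / p) / (norm (1 - of_real (a n) * z))\<^sup>2 \<le> (1 - a n) powr (2 - 1 / p) / (1 - \<rho>)\<^sup>2"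
        using \<rho> by (intro divide_left_mono) (auto intro!: mult_pos_pos zero_less_power elim: less_le_trans[rotated])
      then have "norm (test_fun p (a n) z) \<le> (1 - a n) powr (2 - 1 / p) / (1 - \<rho>)\<^sup>2"
        by (simp add: test_fun_def norm_divide norm_power)
      then show "dist (u n z) 0 < e" using u[of z n] z \<rho> elim by simp
    qed
  qed
qed

section \<open>Recovering the derivative of the symbol from the operator\<close>

lemma unit_seg_FTC:
  fixes \<Phi> :: "real \<Rightarrow> complex"
  assumes der: "\<And>t. t \<in> {0..1} \<Longrightarrow> (\<Phi> has_vector_derivative \<Phi>' t) (at t within {0..1})" and cont: "continuous_on {0..1} \<Phi>'"
  shows "integrable unit_seg \<Phi>'" "(LINT t|unit_seg. \<Phi>' t) = \<Phi> 1 - \<Phi> 0"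
proof -
  have i: "set_integrable lborel {0..1} \<Phi>'"
    unfolding set_integrable_def by (intro borel_integrable_compact cont) auto
  have i': "set_integrable lborel {0..<1} \<Phi>'" by (rule set_integrable_subset[OF i]) auto
  then show "integrable unit_seg \<Phi>'" by (simp add: integrable_restrict_space set_integrable_def)
  have "(LINT t|unit_seg. \<Phi>' t) = (LINT t|lborel. indicator {0..<1} t *\<^sub>R \<Phi>' t)"
    by (rule integral_restrict_space) auto
  also have "\<dots> = (LINT t|lborel. indicator {0..1} t *\<^sub>R \<Phi>' t)"
  proof (rule integral_cong_AE)
    have "AE t in lborel. t \<noteq> (1::real)" by (rule AE_lborel_singleton)
    then show "AE t in lborel. indicator {0..<1} t *\<^sub>R \<Phi>' t = indicator {0..1} t *\<^sub>R \<Phi>' t"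
      by eventually_elim (auto simp: indicator_def)
  qed (use i i' in \<open>auto simp: set_integrable_def\<close>)
  also have "\<dots> = \<Phi> 1 - \<Phi> 0" using der by (intro integral_FTC_Icc cont) auto
  finally show "(LINT t|unit_seg. \<Phi>' t) = \<Phi> 1 - \<Phi> 0" .
qed

text \<open>Integrating \<open>d/dt (t f(t) g'(t z))\<close> over \<open>[0, 1]\<close> recovers \<open>f(1) g'(z)\<close> from the operator.\<close>

lemma test_fun_identity:
  assumes p: "1 < p" and a: "0 \<le> a" "a < 1" and g: "g holomorphic_on ball 0 1" and z: "norm z < 1"
  shows "of_real ((1 - a) powr (- (1 / p))) * deriv g z
    = gen_Hilbert g (test_fun p a) z + z * deriv (gen_Hilbert g (test_fun p a)) z + gen_Hilbert g (test_der p a) z / of_real (1 - a)"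
proof -
  let ?f = "test_fun p a" and ?h = "test_der p a" and ?d = "complex_of_real (1 - a)"
  have g': "deriv g holomorphic_on ball 0 1" and g'': "deriv (deriv g) holomorphic_on ball 0 1"
    using g by (auto intro!: holomorphic_intros)
  have tz: "norm (of_real t * z) < 1" if "t \<in> {0..1}" for t
    using that z mult_left_le_one_le[of "norm z" t] by (auto simp: norm_mult intro: le_less_trans)
  have ne: "1 - of_real a * of_real t \<noteq> (0::complex)" if "t \<in> {0..1}" for t
    using one_minus_ne[OF a, of "of_real t"] that by simp
  let ?\<Phi> = "\<lambda>w. w * ?f w * deriv g (w * z)"
  let ?\<Phi>' = "\<lambda>t. ?f (of_real t) * deriv g (of_real t * z) + ?f (of_real t) * (of_real t * deriv (deriv g) (of_real t * z)) * z
     + ?h (of_real t) * deriv g (of_real t * z) / ?d"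
  have d0: "?d \<noteq> 0" using a by (simp flip: of_real_diff)
  have "((\<lambda>t. ?\<Phi> (of_real t)) has_vector_derivative ?\<Phi>' t) (at t within {0..1})" if t: "t \<in> {0..1}" for t
  proof (rule has_vector_derivative_real_field)
    have 1: "(?f has_field_derivative 2 * of_real a * ?f (of_real t) / (1 - of_real a * of_real t)) (at (of_real t))"
      unfolding test_fun_def[abs_def] using ne[OF t]
      by (auto intro!: derivative_eq_intros simp: power2_eq_square divide_simps)
    have "(deriv g has_field_derivative deriv (deriv g) (of_real t * z)) (at (of_real t * z))"
      using g' tz[OF t] by (intro holomorphic_derivI[of _ "ball 0 1"]) auto
    then have 2: "((\<lambda>w. deriv g (w * z)) has_field_derivative deriv (deriv g) (of_real t * z) * z) (at (of_real t))"
      by (rule DERIV_chain2) (auto intro!: derivative_eq_intros)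
    let ?f' = "2 * of_real a * ?f (of_real t) / (1 - of_real a * of_real t)"
    have "?h (of_real t) = ?d * (of_real t * ?f')" by (simp add: test_der_def mult_ac)
    then have h: "?h (of_real t) * w / ?d = of_real t * ?f' * w" for w
      by (simp only: mult.assoc nonzero_mult_div_cancel_left[OF d0])
    show "(?\<Phi> has_field_derivative ?\<Phi>' t) (at (of_real t))"
      unfolding h by (rule DERIV_cong[OF DERIV_mult[OF DERIV_mult[OF DERIV_ident 1] 2]]) (simp add: algebra_simps)
  qed
  moreover have "continuous_on {0..1} ?\<Phi>'"
    unfolding test_der_def test_fun_def using ne tz d0
    by (intro continuous_intros continuous_on_compose2[OF holomorphic_on_imp_continuous_on[OF g']]
        continuous_on_compose2[OF holomorphic_on_imp_continuous_on[OF g'']]) auto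
  ultimately have tot: "integrable unit_seg ?\<Phi>'" "(LINT t|unit_seg. ?\<Phi>' t) = ?f 1 * deriv g z"
    using unit_seg_FTC[of "\<lambda>t. ?\<Phi> (of_real t)" ?\<Phi>'] by auto
  note fH = test_fun_Hardy[OF p a]
  have i1: "integrable unit_seg (\<lambda>t. ?f (of_real t) * deriv g (of_real t * z))"
    and i3: "integrable unit_seg (\<lambda>t. ?h (of_real t) * deriv g (of_real t * z))"
    by (rule integrable_segment_product[OF integrable_unit_seg[OF _ p] g' z], fact)+
  have v2: "(LINT t|unit_seg. ?f (of_real t) * (of_real t * deriv (deriv g) (of_real t * z))) = deriv (gen_Hilbert g ?f) z"
    using gen_Hilbert_derivative[OF fH(1) p g z] by (rule DERIV_imp_deriv[symmetric])
  have i2: "integrable unit_seg (\<lambda>t. ?f (of_real t) * (of_real t * deriv (deriv g) (of_real t * z)) * z)"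
    using Bochner_Integration.integrable_diff[OF Bochner_Integration.integrable_diff[OF tot(1) i1] integrable_divide_zero[OF i3, of ?d]] by simp
  have "(LINT t|unit_seg. ?\<Phi>' t) = gen_Hilbert g ?f z + deriv (gen_Hilbert g ?f) z * z + gen_Hilbert g ?h z / ?d"
    using i1 i2 i3 v2 by (simp add: gen_Hilbert_eq[OF _ g z] test_fun_holomorphic[OF a])
  moreover have "?f 1 = of_real ((1 - a) powr (- (1 / p)))"
  proof -
    have "?f 1 = of_real ((1 - a) powr (2 - 1 / p) / (1 - a)\<^sup>2)" by (simp add: test_fun_def)
    also have "(1 - a) powr (2 - 1 / p) / (1 - a)\<^sup>2 = (1 - a) powr (- (1 / p))"
      using a by (simp add: powr_diff powr_minus_divide)
    finally show ?thesis .
  qed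
  ultimately show ?thesis using tot(2) by (simp add: mult.commute)
qed

text \<open>On the circle the modulus of the Cauchy kernel of order 1 is a Poisson kernel divided by
  \<open>1 - \<rho>\<^sup>2\<close>. Its total mass is therefore known, and
  \<open>R * (1 - \<rho>\<^sup>2)\<close> is at least \<open>R - r\<close>.\<close>

lemma Lp_le_deriv:
  assumes p: "1 \<le> p" and F: "F holomorphic_on ball 0 1" and r: "0 \<le> r" "r < R" "R < 1"
    and W: "Lp_le p (\<lambda>\<theta>. F (polar R \<theta>)) W"
  shows "Lp_le p (\<lambda>\<theta>. deriv F (polar r \<theta>)) (W / (R - r))"
proof -
  define \<rho> where "\<rho> = r / R"
  have q: "0 \<le> \<rho>" "\<rho> < 1" and R: "0 < R" "R * \<rho> = r" using r by (auto simp: \<rho>_def)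
  have W0: "0 \<le> W" using W by (rule Lp_le_nonneg)
  have [measurable]: "(\<lambda>(s, \<theta>). F (polar R (\<theta> + s))) \<in> borel_measurable (borel \<Otimes>\<^sub>M borel)"
    using r by (intro pair_trace_measurable F) auto
  have d: "0 < 1 - \<rho>\<^sup>2" using q power_strict_mono[of \<rho> 1 2] by simp
  let ?c = "1 / (R * (1 - \<rho>\<^sup>2))"
  have c: "0 < ?c" using R d by simp
  have "\<rho>\<^sup>2 \<le> \<rho>" using q mult_left_le[of \<rho> \<rho>] by (simp add: power2_eq_square)
  then have "R * (1 - \<rho>) \<le> R * (1 - \<rho>\<^sup>2)" using R by (intro mult_left_mono) auto
  then have "R - r \<le> R * (1 - \<rho>\<^sup>2)" using R by (simp add: algebra_simps)
  then have cle: "?c * W \<le> W / (R - r)" using r W0 d R by (simp add: frac_le)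
  have "Lp_le p (\<lambda>\<theta>. deriv F (polar r \<theta>)) (?c * W)"
  proof (rule Minkowski_integral[OF p circle.finite_measure_axioms,
      where A="\<lambda>s \<theta>. of_real (?c * poisson \<rho> s) * F (polar R (\<theta> + s))"
        and W="\<lambda>s. ?c * W * poisson \<rho> s"])
    show "Lp_le p (\<lambda>\<theta>. of_real (?c * poisson \<rho> s) * F (polar R (\<theta> + s))) (?c * W * poisson \<rho> s)" for s
    proof -
      have "Lp_le p (\<lambda>\<theta>. F (polar R (\<theta> + s))) W"
        using W trace_shift[OF F, of R] r by simp
      moreover have "norm (complex_of_real (?c * poisson \<rho> s)) = ?c * poisson \<rho> s"
        using c poisson_nonneg[OF q, of s] by (simp only: norm_of_real abs_of_nonneg mult_nonneg_nonneg less_imp_le)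
      ultimately show ?thesis
        using Lp_le_cmult[of p "\<lambda>\<theta>. F (polar R (\<theta> + s))" W "of_real (?c * poisson \<rho> s)"]
          trace_measurable(1)[OF F, of R s] p r by (simp add: mult_ac)
    qed
    have "(\<integral>\<^sup>+s. ennreal (?c * W * poisson \<rho> s) \<partial>circle) = ennreal (?c * W) * (\<integral>\<^sup>+s. poisson \<rho> s \<partial>circle)"
      using W0 c poisson_nonneg[OF q] by (subst nn_integral_cmult[symmetric]) (auto simp flip: ennreal_mult)
    then show "(\<integral>\<^sup>+s. ennreal (?c * W * poisson \<rho> s) \<partial>circle) \<le> ennreal (?c * W)"
      by (simp add: poisson_integral_1[OF q])
    fix \<theta>
    let ?V = "\<lambda>w. F ((polar R \<theta>) * w)"
    have nR: "norm (polar R \<theta>) < 1" using r by (simp add: norm_mult)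
    let ?i = "\<lambda>s. ?V (cis s) * cis s / (cis s - of_real \<rho>) ^ Suc 1"
    have rr: "of_real R * cis \<theta> * of_real \<rho> = of_real r * cis \<theta>" using R(2) by (metis mult.assoc mult.commute of_real_mult)
    have "(LINT s|circle. ?i s) = deriv ?V (of_real \<rho>)"
      using Cauchy_circle[OF holomorphic_rotate_dilate(2)[OF F nR] holomorphic_rotate_dilate(1)[OF F nR], of "of_real \<rho>" 1] q by simp
    also have "\<dots> = (polar R \<theta>) * deriv F (polar r \<theta>)"
    proof (rule DERIV_imp_deriv)
      have "(F has_field_derivative deriv F (polar r \<theta>)) (at ((polar R \<theta>) * of_real \<rho>))"
        unfolding rr using r by (intro holomorphic_derivI[OF F]) (auto simp: norm_mult)
      then have "(?V has_field_derivative deriv F (polar r \<theta>) * (polar R \<theta>)) (at (of_real \<rho>))"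
        by (rule DERIV_chain2) (auto intro!: derivative_eq_intros)
      then show "(?V has_field_derivative (polar R \<theta>) * deriv F (polar r \<theta>)) (at (of_real \<rho>))"
        by (simp add: mult.commute)
    qed
    finally have eq: "norm (deriv F (polar r \<theta>)) = (1 / R) * norm (LINT s|circle. ?i s)" using R by (simp add: norm_mult)
    have "continuous_on UNIV ?i"
      using cis_ne[of "of_real \<rho>"] q
      by (intro continuous_intros continuous_on_circle_trace[OF holomorphic_rotate_dilate(2)[OF F nR]]) auto
    then have "ennreal (norm (LINT s|circle. ?i s)) \<le> (\<integral>\<^sup>+s. ennreal (norm (?i s)) \<partial>circle)"
      by (intro integral_norm_bound_ennreal integrable_circle)
    moreover have "ennreal (norm (deriv F (polar r \<theta>))) = ennreal (1 / R) * ennreal (norm (LINT s|circle. ?i s))"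
      unfolding eq by (rule ennreal_mult) (use R in auto)
    ultimately have "ennreal (norm (deriv F (polar r \<theta>))) \<le> ennreal (1 / R) * (\<integral>\<^sup>+s. ennreal (norm (?i s)) \<partial>circle)"
      by (simp only:) (rule mult_left_mono, auto)
    also have "\<dots> = (\<integral>\<^sup>+s. ennreal (1 / R) * ennreal (norm (?i s)) \<partial>circle)"
    proof (rule nn_integral_cmult[symmetric])
      have [measurable]: "?i \<in> borel_measurable borel" by (rule borel_measurable_continuous_onI) fact
      show "(\<lambda>s. ennreal (norm (?i s))) \<in> borel_measurable circle" by measurable
    qed
    also have "\<dots> = (\<integral>\<^sup>+s. norm (of_real (?c * poisson \<rho> s) * F (polar R (\<theta> + s))) \<partial>circle)"
    proof (intro nn_integral_cong)
      fix s
      have cF: "F (polar R (\<theta> + s)) = ?V (cis s)" by (simp add: mult.assoc cis_mult)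
      have "?c * poisson \<rho> s = (1 / R) / (norm (cis s - of_real \<rho>))\<^sup>2" using d by (simp add: poisson_def)
      then have "norm (of_real (?c * poisson \<rho> s) * F (polar R (\<theta> + s))) = (1 / R) * norm (?i s)"
        using R cF by (simp only: norm_mult norm_of_real) (simp add: norm_mult norm_divide norm_power power2_eq_square)
      then show "ennreal (1 / R) * ennreal (norm (?i s)) = ennreal (norm (of_real (?c * poisson \<rho> s) * F (polar R (\<theta> + s))))"
        using R by (simp only:) (rule ennreal_mult[symmetric], auto)
    qed
    finally show "ennreal (norm (deriv F (polar r \<theta>))) \<le> (\<integral>\<^sup>+s. norm (of_real (?c * poisson \<rho> s) * F (polar R (\<theta> + s))) \<partial>circle)" .
  qed (use W0 c in auto)
  then show ?thesis using cle p by (auto intro: Lp_le_mono)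
qed

text \<open>With parameter equal to the radius, the identity writes g' times
  \<open>(1 - a) powr (- (1 / p))\<close> as three terms. Each has mean at most a small number
  divided by \<open>1 - a\<close>: the derivative by the Cauchy estimate, the normalised one by its
  explicit denominator. Failure of the little-oh condition would contradict this along a sequence of
  radii.\<close>

lemma compact_imp_mean_Lipschitz:
  assumes p: "1 < p" and g: "g holomorphic_on ball 0 1" and T: "compact_on_Hardy p (gen_Hilbert g)"
  shows "g \<in> little_mean_Lipschitz p (1 / p)"
proof (rule little_mean_LipschitzI[OF g p], rule ccontr)
  fix \<epsilon> :: real assume \<epsilon>: "0 < \<epsilon>"
  let ?bad = "\<lambda>r. \<not> Lp_le p (\<lambda>\<theta>. deriv g (polar r \<theta>)) (\<epsilon> * (1 - r) powr (1 / p - 1))"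
  assume neg: "\<nexists>r0. 0 \<le> r0 \<and> r0 < 1 \<and> (\<forall>r\<ge>r0. r < 1 \<longrightarrow> Lp_le p (\<lambda>\<theta>. deriv g (polar r \<theta>)) (\<epsilon> * (1 - r) powr (1 / p - 1)))"
  have "\<exists>r. 1 - inverse (real (Suc n)) \<le> r \<and> r < 1 \<and> ?bad r" for n
  proof -
    have "0 \<le> 1 - inverse (real (Suc n))" "1 - inverse (real (Suc n)) < 1" by (auto simp: field_simps)
    then show ?thesis using neg by blast
  qed
  \<comment> \<open>The radii at which the estimate fails themselves serve as parameters of the test
    functions.\<close>
  then obtain a where a: "\<And>n. 1 - inverse (real (Suc n)) \<le> a n" "\<And>n. a n < 1" "\<And>n. ?bad (a n)" by metis
  have a0: "0 \<le> a n" for n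
  proof -
    have "inverse (real (Suc n)) \<le> 1" by (simp add: field_simps)
    then show ?thesis using a(1)[of n] by linarith
  qed
  have a1: "a \<longlonglongrightarrow> 1"
  proof (rule tendsto_sandwich[OF _ _ _ tendsto_const])
    show "(\<lambda>n. 1 - inverse (real (Suc n))) \<longlonglongrightarrow> 1"
      using tendsto_diff[OF tendsto_const LIMSEQ_inverse_real_of_nat, of 1] by simp
  qed (use a in \<open>auto intro: always_eventually less_imp_le\<close>)
  let ?T = "gen_Hilbert g"
  have TH: "?T (test_fun p (a n)) \<in> Hardy p" "?T (test_der p (a n)) \<in> Hardy p" for n
    using T test_fun_Hardy[OF p a0 a(2)] unfolding compact_on_Hardy_def by blast+
  obtain k where k: "strict_mono k" "(\<lambda>n. Hardy_norm p (?T (test_fun p (a (k n))))) \<longlonglongrightarrow> 0"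
    using compact_on_Hardy_null[OF p g T, where u="\<lambda>n. test_fun p (a n)" and C=1, OF _ _ test_fun_null[OF p a0 a(2) a1]]
      test_fun_Hardy[OF p a0 a(2)] by auto
  have ak: "(\<lambda>n. a (k n)) \<longlonglongrightarrow> 1" using LIMSEQ_subseq_LIMSEQ[OF a1 k(1)] by (simp add: o_def)
  \<comment> \<open>Extracted from the first subsequence, so that both families of images tend to 0
    along the same indices.\<close>
  obtain l where l: "strict_mono l" "(\<lambda>n. Hardy_norm p (?T (test_der p (a (k (l n)))))) \<longlonglongrightarrow> 0"
    using compact_on_Hardy_null[OF p g T, where u="\<lambda>n. test_der p (a (k n))" and C=2, OF _ _ test_fun_null[OF p a0 a(2) ak]]
      test_fun_Hardy[OF p a0 a(2)] norm_test_der_le[OF a0 a(2)] by auto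
  have kl: "(\<lambda>n. Hardy_norm p (?T (test_fun p (a (k (l n)))))) \<longlonglongrightarrow> 0"
    using LIMSEQ_subseq_LIMSEQ[OF k(2) l(1)] by (simp add: o_def)
  have "\<forall>\<^sub>F n in sequentially. Hardy_norm p (?T (test_fun p (a (k (l n))))) < \<epsilon> / 4 \<and> Hardy_norm p (?T (test_der p (a (k (l n))))) < \<epsilon> / 4"
    using order_tendstoD(2)[OF kl, of "\<epsilon> / 4"] order_tendstoD(2)[OF l(2), of "\<epsilon> / 4"] \<epsilon> by (auto intro: eventually_conj)
  then obtain n where "Hardy_norm p (?T (test_fun p (a n))) \<le> \<epsilon> / 4" "Hardy_norm p (?T (test_der p (a n))) \<le> \<epsilon> / 4"
    by (auto simp: eventually_sequentially intro: less_imp_le)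
  note small = this
  let ?F = "?T (test_fun p (a n))" and ?H = "?T (test_der p (a n))" and ?r = "a n"
  have r: "0 \<le> ?r" "?r < 1" using a0 a by auto
  note hol = Hardy_holomorphic[OF TH(1)] Hardy_holomorphic[OF TH(2)]
  have hol': "deriv ?F holomorphic_on ball 0 1" using hol by (intro holomorphic_intros) auto
  let ?d = "1 - ?r"
  have d: "0 < ?d" "?d \<le> 1" using r by auto
  have LF: "Lp_le p (\<lambda>\<theta>. ?F (polar s \<theta>)) (\<epsilon> / 4)" and LH: "Lp_le p (\<lambda>\<theta>. ?H (polar s \<theta>)) (\<epsilon> / 4)"
    if "0 \<le> s" "s < 1" for s
    using that p by (auto intro!: Lp_le_mono[OF Hardy_Lp_le[OF TH(1)] small(1)] Lp_le_mono[OF Hardy_Lp_le[OF TH(2)] small(2)])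
  \<comment> \<open>The derivative is estimated from the circle halfway to the boundary, which
    doubles the reciprocal distance.\<close>
  have "Lp_le p (\<lambda>\<theta>. deriv ?F (polar ?r \<theta>)) (\<epsilon> / 4 / ((1 + ?r) / 2 - ?r))"
    using p r by (intro Lp_le_deriv[OF _ hol(1)] LF) auto
  moreover have "\<epsilon> / 4 / ((1 + ?r) / 2 - ?r) = \<epsilon> / (2 * ?d)" using d by (simp add: field_simps)
  ultimately have LF': "Lp_le p (\<lambda>\<theta>. deriv ?F (polar ?r \<theta>)) (\<epsilon> / (2 * ?d))" by simp
  have LF'': "Lp_le p (\<lambda>\<theta>. (polar ?r \<theta>) * deriv ?F (polar ?r \<theta>)) (\<epsilon> / (2 * ?d))"
    by (rule Lp_le_dominated[OF LF']) (use r p in \<open>auto simp: norm_mult intro: mult_left_le_one_le\<close>)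
  note meas = trace_measurable(2)[OF hol(1) r] trace_measurable(2)[OF hol(2) r] trace_measurable(2)[OF hol' r]
  have mc: "(\<lambda>\<theta>. complex_of_real ?r * cis \<theta>) \<in> borel_measurable borel"
    by (intro borel_measurable_continuous_onI continuous_intros)
  have "Lp_le p (\<lambda>\<theta>. of_real (1 / ?d) * ?H (polar ?r \<theta>)) (norm (complex_of_real (1 / ?d)) * (\<epsilon> / 4))"
    using p r by (intro Lp_le_cmult LH meas) auto
  then have LH': "Lp_le p (\<lambda>\<theta>. of_real (1 / ?d) * ?H (polar ?r \<theta>)) (\<epsilon> / (4 * ?d))"
    using d by (simp add: norm_divide mult.commute flip: of_real_diff)
  have "Lp_le p (\<lambda>\<theta>. ?F (polar ?r \<theta>) + (polar ?r \<theta>) * deriv ?F (polar ?r \<theta>)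
      + of_real (1 / ?d) * ?H (polar ?r \<theta>)) (\<epsilon> / 4 + \<epsilon> / (2 * ?d) + \<epsilon> / (4 * ?d))"
    using p r by (intro Lp_le_add LF LF'' LH' borel_measurable_add borel_measurable_times borel_measurable_const meas mc) auto
  then have L: "Lp_le p (\<lambda>\<theta>. of_real (?d powr (- (1 / p))) * deriv g (polar ?r \<theta>)) (\<epsilon> / 4 + \<epsilon> / (2 * ?d) + \<epsilon> / (4 * ?d))"
    using test_fun_identity[OF p r g] r by (simp add: norm_mult)
  have dd: "?d powr (1 / p) * ?d powr (- (1 / p)) = 1" using d by (simp flip: powr_add)
  have "Lp_le p (\<lambda>\<theta>. of_real (?d powr (1 / p)) * (of_real (?d powr (- (1 / p))) * deriv g (polar ?r \<theta>)))
     (norm (complex_of_real (?d powr (1 / p))) * (\<epsilon> / 4 + \<epsilon> / (2 * ?d) + \<epsilon> / (4 * ?d)))"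
    using p r g by (intro Lp_le_cmult L borel_measurable_times borel_measurable_const trace_measurable holomorphic_intros) auto
  then have "Lp_le p (\<lambda>\<theta>. deriv g (polar ?r \<theta>)) (?d powr (1 / p) * (\<epsilon> / 4 + \<epsilon> / (2 * ?d) + \<epsilon> / (4 * ?d)))"
    using dd by (simp flip: mult.assoc of_real_mult)
  moreover have "?d powr (1 / p) * (\<epsilon> / 4 + \<epsilon> / (2 * ?d) + \<epsilon> / (4 * ?d)) \<le> \<epsilon> * ?d powr (1 / p - 1)"
  proof -
    \<comment> \<open>The shares 1/4, 1/2 and 1/4 add up to 1; the first term profits from a
      distance of at most 1.\<close>
    have "\<epsilon> / 4 + \<epsilon> / (2 * ?d) + \<epsilon> / (4 * ?d) \<le> \<epsilon> / ?d"
    proof -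
      have "\<epsilon> / 4 + \<epsilon> / (2 * y) + \<epsilon> / (4 * y) \<le> \<epsilon> / y" if y: "0 < y" "y \<le> 1" for y
      proof -
        have "\<epsilon> / 4 * 1 \<le> \<epsilon> / 4 * (1 / y)" using y \<epsilon> by (intro mult_left_mono) auto
        then show ?thesis by simp
      qed
      then show ?thesis using d .
    qed
    then have "?d powr (1 / p) * (\<epsilon> / 4 + \<epsilon> / (2 * ?d) + \<epsilon> / (4 * ?d)) \<le> ?d powr (1 / p) * (\<epsilon> / ?d)" by (rule mult_left_mono) simp
    also have "\<dots> = \<epsilon> * ?d powr (1 / p - 1)" using d by (simp add: powr_diff)
    finally show ?thesis .
  qed
  ultimately have "Lp_le p (\<lambda>\<theta>. deriv g (polar ?r \<theta>)) (\<epsilon> * ?d powr (1 / p - 1))" using p by (auto intro: Lp_le_mono)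
  with a(3)[of n] show False by simp
qed

theorem theorem8:
  fixes p :: real and g :: "complex \<Rightarrow> complex"
  assumes "1 < p" and "g holomorphic_on ball 0 1"
  shows "(compact_on_Hardy p (gen_Hilbert g) \<longrightarrow> g \<in> little_mean_Lipschitz p (1 / p)) \<and>
         (p \<le> 2 \<and> g \<in> little_mean_Lipschitz p (1 / p) \<longrightarrow> compact_on_Hardy p (gen_Hilbert g)) \<and>
         (2 < p \<and> (\<exists>q. 1 < q \<and> q < p \<and> g \<in> little_mean_Lipschitz q (1 / q)) \<longrightarrow>
            compact_on_Hardy p (gen_Hilbert g))"
  using assms compact_imp_mean_Lipschitz compact_on_HardyI gen_Hilbert_controlled_le_2 gen_Hilbert_controlled_less
  by blast

end
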